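(* Let $B=(B(u),\,0\le u\le1)$ be a standard Brownian motion started at $0$ and let $\overline{C}_{[0,1]}B$ be its least concave majorant on $[0,1]$. Let $U_1,U_2,\dots$ be a sequence of independent random variables uniform on $(0,1)$, independent of $B$. Let $L_1,L_2,\dots$ be the size-biased random permutation of lengths of segments of $\overline{C}_{[0,1]}B$ defined as follows: $L_1$ is the length of the interval (between consecutive vertex times of $\overline{C}_{[0,1]}B$) containing $U_1$; $L_2$ is the length of the interval containing the first point $U_i$ that is not in this first interval; $L_3$ is the length of the interval containing the next point $U_j$ that is not in either of the first two intervals; and so on. Then $$L_1,\quad \frac{L_2}{1-L_1},\quad \frac{L_3}{1-L_1-L_2},\ \dots$$ is a sequence of independent uniform $(0,1)$ random variables, and this sequence is independent of $B(1)$.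
   Context: The least concave majorant $\overline{C}_{[0,1]}f$ of a function $f$ on $[0,1]$ is the pointwise smallest concave function on $[0,1]$ that is $\ge f$. Almost surely, $\overline{C}_{[0,1]}B$ is piecewise linear on $(0,1)$: the times of its vertices (the times at which its slope changes) form a countable set accumulating at $0$ and at $1$ only, with finitely many vertices in $(\varepsilon,1-\varepsilon)$ for each $\varepsilon>0$. The vertex times partition $[0,1]$ into countably many intervals between consecutive vertex times; on each the majorant has a linear segment. The length of a segment means the length of the associated time interval. *)

theory Defs
  imports "HOL-Probability.Probability"
begin

text \<open>
  Brownian motion on the time interval $[0,1]$. Only the values \<open>B t\<close> with \<open>t \<in> {0..1}\<close> matter.
  All paths, not just almost all of them, are required to start at 0 and to be continuous.
\<close>

definition standard_brownian_motion :: "'a measure \<Rightarrow> (real \<Rightarrow> 'a \<Rightarrow> real) \<Rightarrow> bool"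
  where "standard_brownian_motion M B \<longleftrightarrow>
    (\<forall>t\<in>{0..1}. B t \<in> borel_measurable M) \<and>
    (\<forall>\<omega>\<in>space M. B 0 \<omega> = 0) \<and>
    (\<forall>\<omega>\<in>space M. continuous_on {0..1} (\<lambda>t. B t \<omega>)) \<and>
    (\<forall>s t. 0 \<le> s \<and> s < t \<and> t \<le> 1 \<longrightarrow>
      distributed M lborel (\<lambda>\<omega>. B t \<omega> - B s \<omega>) (normal_density 0 (sqrt (t - s)))) \<and>
    (\<forall>(n::nat) (t::nat \<Rightarrow> real). 0 \<le> t 0 \<and> (\<forall>i<n. t i \<le> t (Suc i)) \<and> t n \<le> 1 \<longrightarrow>
      prob_space.indep_vars M (\<lambda>_. borel) (\<lambda>i \<omega>. B (t (Suc i)) \<omega> - B (t i) \<omega>) {..<n})"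

text \<open>
  Independence of two random variables. Unlike \<open>prob_space.indep_var\<close>, the two may take values
  in spaces of different types.
\<close>

definition indep_rv ::
    "'a measure \<Rightarrow> 'b measure \<Rightarrow> ('a \<Rightarrow> 'b) \<Rightarrow> 'c measure \<Rightarrow> ('a \<Rightarrow> 'c) \<Rightarrow> bool"
  where "indep_rv M S X T Y \<longleftrightarrow>
    X \<in> measurable M S \<and> Y \<in> measurable M T \<and>
    prob_space.indep_set M
      {X -` A \<inter> space M | A. A \<in> sets S} {Y -` A \<inter> space M | A. A \<in> sets T}"

lemma indep_rv_iff_indep_var:
  assumes "prob_space M"
  shows "indep_rv M S X T Y \<longleftrightarrow> prob_space.indep_var M S X T Y"
proof -
  interpret prob_space M by fact
  show ?thesis
    unfolding indep_rv_def indep_var_def indep_vars_def2 indep_set_def UNIV_bool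
    by (auto split: bool.split cong: indep_sets_cong intro!: arg_cong2[where f=indep_sets]
        simp: fun_eq_iff elim!: back_subst[of "\<lambda>F. indep_sets F {False, True}"])
qed

definition least_concave_majorant :: "real set \<Rightarrow> (real \<Rightarrow> real) \<Rightarrow> real \<Rightarrow> real"
  where "least_concave_majorant S f x =
    Inf {g x | g. concave_on S g \<and> (\<forall>y\<in>S. f y \<le> g y)}"

text \<open>The pointwise infimum really is the least concave majorant as soon as \<open>f\<close> has any.\<close>

lemma least_concave_majorant_le:
  assumes "concave_on S g" "\<And>y. y \<in> S \<Longrightarrow> f y \<le> g y" "x \<in> S"
  shows "least_concave_majorant S f x \<le> g x"
  unfolding least_concave_majorant_def
  by (rule cInf_lower) (use assms in \<open>auto intro!: bdd_belowI[of _ "f x"]\<close>)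

lemma le_least_concave_majorant:
  assumes "concave_on S h" "\<And>y. y \<in> S \<Longrightarrow> f y \<le> h y" "x \<in> S"
  shows "f x \<le> least_concave_majorant S f x"
  unfolding least_concave_majorant_def
  by (rule cInf_greatest) (use assms in auto)

lemma concave_least_concave_majorant:
  assumes "concave_on S h" "\<And>y. y \<in> S \<Longrightarrow> f y \<le> h y"
  shows "concave_on S (least_concave_majorant S f)"
proof -
  let ?C = "least_concave_majorant S f"
  have S: "convex S" using assms(1) by (simp add: concave_on_iff)
  have "u * ?C x + v * ?C y \<le> ?C (u *\<^sub>R x + v *\<^sub>R y)"
    if xy: "x \<in> S" "y \<in> S" and uv: "0 \<le> u" "0 \<le> v" "u + v = 1" for x y u v
  proof -
    have "u * ?C x + v * ?C y \<le> g (u *\<^sub>R x + v *\<^sub>R y)"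
      if g: "concave_on S g" "\<forall>y\<in>S. f y \<le> g y" for g
    proof -
      have "?C x \<le> g x" "?C y \<le> g y"
        using least_concave_majorant_le[of S g f] g xy by auto
      then have "u * ?C x + v * ?C y \<le> u * g x + v * g y"
        using uv by (intro add_mono mult_left_mono) auto
      also have "\<dots> \<le> g (u *\<^sub>R x + v *\<^sub>R y)"
        using g(1) xy uv by (auto simp: concave_on_iff)
      finally show ?thesis .
    qed
    then show ?thesis
      unfolding least_concave_majorant_def[of S f "u *\<^sub>R x + v *\<^sub>R y"]
      by (intro cInf_greatest) (use assms in auto)
  qed
  then show ?thesis using S by (auto simp: concave_on_iff)
qed

text \<open>The slope of \<open>g\<close> changes at \<open>t\<close> if \<open>g\<close> is not affine on any neighbourhood of \<open>t\<close>.\<close>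

definition vertex_times :: "(real \<Rightarrow> real) \<Rightarrow> real set"
  where "vertex_times g =
    {t\<in>{0<..<1}. \<not> (\<exists>e>0. \<exists>a b. \<forall>s\<in>ball t e. g s = a + b * s)}"

definition consecutive :: "real set \<Rightarrow> real \<Rightarrow> real \<Rightarrow> bool"
  where "consecutive V a b \<longleftrightarrow> a \<in> V \<and> b \<in> V \<and> a < b \<and> V \<inter> {a<..<b} = {}"

text \<open>
  The open interval between consecutive points of \<open>V\<close> that contains \<open>x\<close>: there is at most one,
  and the value is empty if there is none.
\<close>

definition interval_containing :: "real set \<Rightarrow> real \<Rightarrow> real set"
  where "interval_containing V x = \<Union>{{a<..<b} | a b. consecutive V a b \<and> x \<in> {a<..<b}}"

lemma interval_containing_eq:
  assumes ab: "consecutive V a b" "x \<in> {a<..<b}"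
  shows "interval_containing V x = {a<..<b}"
proof -
  have "c = a \<and> d = b" if "consecutive V c d" "x \<in> {c<..<d}" for c d
  proof -
    have "\<not> a < c" "\<not> c < a" "\<not> b < d" "\<not> d < b"
      using ab that by (auto simp: consecutive_def disjoint_iff)
    then show ?thesis by simp
  qed
  then show ?thesis using ab unfolding interval_containing_def by blast
qed

text \<open>
  Given sample points \<open>u 0, u 1, \<dots>\<close>, the index of the sample point that discovers the \<open>n\<close>-th
  new interval (counted from 0).
\<close>

fun discovery_index :: "real set \<Rightarrow> (nat \<Rightarrow> real) \<Rightarrow> nat \<Rightarrow> nat"
  where
    "discovery_index V u 0 = 0"
  | "discovery_index V u (Suc n) =
      (LEAST i. discovery_index V u n < i \<and>
        (\<forall>j\<le>n. u i \<notin> interval_containing V (u (discovery_index V u j))))"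

definition size_biased_length :: "real set \<Rightarrow> (nat \<Rightarrow> real) \<Rightarrow> nat \<Rightarrow> real"
  where "size_biased_length V u n =
    measure lborel (interval_containing V (u (discovery_index V u n)))"

end

theory Submission
  imports Defs "HOL-Probability.Probability"
begin

text \<open>
  The theorem is proved by discretisation. Let \<open>B\<close> be sampled at the times \<open>k / n\<close>. If one of the
  segments of the majorant of the resulting random walk is picked with probability proportional
  to its length and is cut out, then, by exchangeability of the increments and the cycle lemma, its
  length is uniform on \<open>1, \<dots>, n\<close> and what remains is a walk of the remaining length, independent of
  the segment removed given that length. Iterating bounds the probability of every
  pattern of events \<open>L\<^sub>j / (1 - L\<^sub>1 - \<dots>) < a\<^sub>j\<close> or \<open>> a\<^sub>j\<close>, jointly with \<open>B(1) \<in> A\<close>, by the expected product.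

  By Borel-Cantelli, \<open>B\<close> almost surely lies below no line through its graph at a fixed time. Hence the segment
  over a fixed time is bounded by contact points of the path with a unique line, and the
  discrete segment over that time has at most its length in the limit. The expected lengths
  agree (both are \<open>1 / 2\<close> in the limit), because two different segments rarely have nearly equal slopes;
  so the discrete lengths converge in \<open>L\<^sup>1\<close>, and Fatou's lemma transfers the upper bounds to \<open>B\<close>. The
  \<open>2\<^sup>k\<close> patterns are disjoint and their bounds add up to \<open>P(B(1) \<in> A)\<close>, so all the bounds are equalities.
\<close>

section \<open>Faces of the majorant of a walk\<close>

text \<open>Fatou's lemma yields inequalities only, and the limits are arranged around this.
  Replacing a size-biased sample by finitely many uniform points costs weights of the form
  \<open>1 / (1 - c)\<close>, which are unbounded, so dominated convergence is not at hand. What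
  survives is lower semicontinuity: strict tests that hold for the limit hold for fine grids, and
  their weights converge. The partition into patterns recovers equality from the resulting upper
  bounds. The delicate point is that sampled segments might be shorter than the limiting one,
  several of them with merging slopes filling a single interval of the path. The one-step formula,
  applied twice, excludes this: given one face, the slope of another is distributed like the mean of
  fresh Gaussian increments, and such a mean comes within \<open>\<epsilon>\<close> of a given value
  with probability at most \<open>\<epsilon>\<close>. The number \<open>1 / 2\<close> is the mean of
  the uniform law, since a segment drawn by size from the sampled walk has a uniform length.\<close>

definition psum :: "(nat \<Rightarrow> real) \<Rightarrow> nat \<Rightarrow> real"
  where "psum x k = (\<Sum>i<k. x i)"

text \<open>
  A face is a segment of the majorant of the walk \<open>psum x\<close> on \<open>{0..n}\<close>, given by its left end point and
  its length. All other points lie strictly below its line, so that collinear faces do not occur: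
  degenerate walks have too few faces rather than too many.
\<close>

definition is_face :: "nat \<Rightarrow> (nat \<Rightarrow> real) \<Rightarrow> nat \<Rightarrow> nat \<Rightarrow> bool"
  where "is_face n x g l \<longleftrightarrow> 0 < l \<and> g + l \<le> n \<and>
    (\<forall>k\<le>n. k \<noteq> g \<longrightarrow> k \<noteq> g + l \<longrightarrow>
      (psum x k - psum x g) * real l < (psum x (g + l) - psum x g) * (real k - real g))"

definition faces :: "nat \<Rightarrow> (nat \<Rightarrow> real) \<Rightarrow> (nat \<times> nat) set"
  where "faces n x = {(g, l). is_face n x g l}"

definition excise :: "nat \<Rightarrow> nat \<Rightarrow> (nat \<Rightarrow> real) \<Rightarrow> nat \<Rightarrow> real"
  where "excise g l x = (\<lambda>i. if i < g then x i else x (i + l))"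

definition below_chord :: "nat \<Rightarrow> (nat \<Rightarrow> real) \<Rightarrow> bool"
  where "below_chord l x \<longleftrightarrow> (\<forall>k. 0 < k \<and> k < l \<longrightarrow> psum x k * real l < psum x l * real k)"

text \<open>
  A block is a face of a walk iff it stays below its chord and, once it is cut out, the
  rest of the walk tilted by the slope of the block has its strict maximum where the block was.
\<close>

definition peak :: "nat \<Rightarrow> (nat \<Rightarrow> real) \<Rightarrow> nat \<Rightarrow> real \<Rightarrow> bool"
  where "peak m w g s \<longleftrightarrow> g \<le> m \<and>
    (\<forall>k\<le>m. k \<noteq> g \<longrightarrow> psum w k - s * real k < psum w g - s * real g)"

lemma is_faceD: "is_face n x g l \<Longrightarrow> 0 < l \<and> g + l \<le> n"
  unfolding is_face_def by blast

lemma psum_0 [simp]: "psum x 0 = 0"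
  and psum_Suc: "psum x (Suc k) = psum x k + x k"
  by (simp_all add: psum_def)

lemma psum_shift: "psum (\<lambda>i. x (g + i)) k = psum x (g + k) - psum x g"
  by (induction k) (simp_all add: psum_Suc)

lemma psum_cong: "(\<And>i. i < k \<Longrightarrow> x i = y i) \<Longrightarrow> psum x k = psum y k"
  by (simp add: psum_def)

lemma psum_excise_le: "k \<le> g \<Longrightarrow> psum (excise g l x) k = psum x k"
  by (rule psum_cong) (simp add: excise_def)

lemma psum_excise_ge:
  "g \<le> k \<Longrightarrow> psum (excise g l x) k = psum x (k + l) - (psum x (g + l) - psum x g)"
proof (induction k rule: dec_induct)
  case base
  then show ?case by (simp add: psum_excise_le)
next
  case (step k)
  then show ?case by (simp add: psum_Suc excise_def)
qed

lemma below_chord_cong: "(\<And>i. i < l \<Longrightarrow> x i = y i) \<Longrightarrow> below_chord l x \<longleftrightarrow> below_chord l y"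
proof -
  assume "\<And>i. i < l \<Longrightarrow> x i = y i"
  then have "psum x k = psum y k" if "k \<le> l" for k
    using that by (intro psum_cong) auto
  then show ?thesis unfolding below_chord_def by auto
qed

lemma chord_less_iff:
  fixes L :: real
  assumes "0 < L"
  shows "a - \<sigma> / L * k < b - \<sigma> / L * g \<longleftrightarrow> (a - b) * L < \<sigma> * (k - g)"
proof -
  have "a - \<sigma> / L * k < b - \<sigma> / L * g \<longleftrightarrow> a - b < \<sigma> * (k - g) / L"
    by (simp add: right_diff_distrib diff_divide_distrib) linarith
  then show ?thesis using assms by (simp add: pos_less_divide_eq)
qed

lemma is_face_iff_below_peak:
  assumes l: "0 < l" and gl: "g + l \<le> n"
  shows "is_face n x g l \<longleftrightarrow> below_chord l (\<lambda>i. x (g + i)) \<and>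
    peak (n - l) (excise g l x) g ((psum x (g + l) - psum x g) / real l)"
    (is "?F \<longleftrightarrow> ?B \<and> ?P")
proof -
  let ?\<sigma> = "psum x (g + l) - psum x g"
  have pk: "psum x k - ?\<sigma> / real l * real k < psum x g - ?\<sigma> / real l * real g \<longleftrightarrow>
      (psum x k - psum x g) * real l < ?\<sigma> * (real k - real g)" for k
    using l by (intro chord_less_iff) simp
  \<comment> \<open>To the right of the block, time shifts by \<open>l\<close> and height by the
    increment over the block; the tilt by their quotient makes the two shifts cancel.\<close>
  have pk2: "psum (excise g l x) (k - l) - ?\<sigma> / real l * real (k - l) < psum x g - ?\<sigma> / real l * real g \<longleftrightarrow>
      (psum x k - psum x g) * real l < ?\<sigma> * (real k - real g)" if "g + l \<le> k" for k
  proof -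
    have e: "psum (excise g l x) (k - l) = psum x k - ?\<sigma>" "real (k - l) = real k - real l"
      using that by (simp_all add: psum_excise_ge)
    show ?thesis unfolding e using l by (subst chord_less_iff) (simp_all add: algebra_simps)
  qed
  show ?thesis
  proof
    assume F: ?F
    have ?B unfolding below_chord_def
    proof (intro allI impI)
      fix k assume "0 < k \<and> k < l"
      then show "psum (\<lambda>i. x (g + i)) k * real l < psum (\<lambda>i. x (g + i)) l * real k"
        using F gl unfolding is_face_def psum_shift by (auto dest!: spec[of _ "g + k"])
    qed
    moreover have ?P unfolding peak_def
    proof (intro conjI allI impI)
      show "g \<le> n - l" using gl by simp
      fix k assume k: "k \<le> n - l" "k \<noteq> g"
      show "psum (excise g l x) k - ?\<sigma> / real l * real k < psum (excise g l x) g - ?\<sigma> / real l * real g"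
      proof (cases "k < g")
        case True
        then have "psum (excise g l x) k = psum x k" "psum (excise g l x) g = psum x g"
          by (auto simp: psum_excise_le)
        then show ?thesis using F pk[of k] True gl unfolding is_face_def by auto
      next
        case False
        with k have "g + l \<le> k + l" "k + l \<le> n" "k + l \<noteq> g" "k + l \<noteq> g + l" using gl by auto
        then show ?thesis using F pk2[of "k + l"] unfolding is_face_def
          by (auto simp: psum_excise_le)
      qed
    qed
    ultimately show "?B \<and> ?P" ..
  next
    assume BP: "?B \<and> ?P"
    show ?F unfolding is_face_def
    proof (intro conjI l gl allI impI)
      fix k assume k: "k \<le> n" "k \<noteq> g" "k \<noteq> g + l"
      consider "k < g" | "g < k" "k < g + l" | "g + l < k" using k by linarith
      then show "(psum x k - psum x g) * real l < ?\<sigma> * (real k - real g)"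
      proof cases
        case 1
        then have "psum (excise g l x) k - ?\<sigma> / real l * real k < psum (excise g l x) g - ?\<sigma> / real l * real g"
          using BP gl unfolding peak_def by auto
        then show ?thesis using pk[of k] 1 by (simp add: psum_excise_le)
      next
        case 2
        then obtain j where j: "k = g + j" "0 < j" "j < l"
          by (metis add_less_cancel_left less_imp_add_positive)
        then show ?thesis using BP by (auto simp: below_chord_def psum_shift)
      next
        case 3
        then have "k - l \<le> n - l" "k - l \<noteq> g" using k by auto
        then have "psum (excise g l x) (k - l) - ?\<sigma> / real l * real (k - l) < psum (excise g l x) g - ?\<sigma> / real l * real g"
          using BP unfolding peak_def by blast
        then show ?thesis using pk2[of k] 3 by (simp add: psum_excise_le)
      qed
    qed
  qed
qed

section \<open>Rearranging increments, and the cycle lemma\<close>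

text \<open>An injective relabelling that puts the block in front and delays the first
  \<open>g\<close> increments by \<open>l\<close>; it preserves the law of i.i.d.
  increments.\<close>

definition move_block :: "nat \<Rightarrow> nat \<Rightarrow> nat \<Rightarrow> nat"
  where "move_block g l i = (if i < l then g + i else if i < g + l then i - l else i)"

lemma inj_move_block: "inj (move_block g l)"
  unfolding inj_def move_block_def by auto

text \<open>After the rearrangement the place \<open>g\<close> occurs in \<open>peak\<close> only,
  so for a fixed rearranged walk the sum over \<open>g\<close> counts strict maxima. The rest of the
  walk sees the block only through its length and its mean slope.\<close>

lemma is_face_move_block:
  fixes x :: "nat \<Rightarrow> real"
  assumes "0 < l" "g + l \<le> n"
  defines "y \<equiv> (\<lambda>i. x (move_block g l i))"
  shows "is_face n x g l \<longleftrightarrow> below_chord l y \<and> peak (n - l) (\<lambda>i. y (l + i)) g (psum y l / real l)"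
    and "psum x (g + l) - psum x g = psum y l"
    and "excise g l x = (\<lambda>i. y (l + i))"
proof -
  show e: "excise g l x = (\<lambda>i. y (l + i))"
    by (auto simp: y_def excise_def move_block_def fun_eq_iff add.commute)
  have "psum y l = psum (\<lambda>i. x (g + i)) l"
    by (rule psum_cong) (simp add: y_def move_block_def)
  then show s: "psum x (g + l) - psum x g = psum y l" by (simp add: psum_shift)
  have "below_chord l y \<longleftrightarrow> below_chord l (\<lambda>i. x (g + i))"
    by (rule below_chord_cong) (simp add: y_def move_block_def)
  then show "is_face n x g l \<longleftrightarrow> below_chord l y \<and> peak (n - l) (\<lambda>i. y (l + i)) g (psum y l / real l)"
    using is_face_iff_below_peak[OF assms(1,2), of x] e s by simp
qed

definition rotate_block :: "nat \<Rightarrow> nat \<Rightarrow> nat \<Rightarrow> nat"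
  where "rotate_block l r i = (if i < l then (if i + r < l then i + r else i + r - l) else i)"

lemma inj_rotate_block: "r < l \<Longrightarrow> inj (rotate_block l r)"
  unfolding inj_def rotate_block_def by (auto split: if_splits)

lemma psum_rotate_block:
  assumes "r < l" "k \<le> l"
  shows "psum (\<lambda>i. x (rotate_block l r i)) k =
    (if k + r \<le> l then psum x (k + r) - psum x r else psum x l - psum x r + psum x (k + r - l))"
  using assms(2)
proof (induction k)
  case (Suc k)
  consider "Suc k + r \<le> l" | "k + r = l" | "l < k + r" by linarith
  then show ?case
    using Suc by cases (simp_all add: psum_Suc rotate_block_def Suc_diff_le)
qed (use assms in simp)

text \<open>The cycle lemma. Tilted by its mean slope, the block returns to height 0 at time
  \<open>l\<close> and extends periodically. Rotating by \<open>r\<close> moves the origin to the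
  point \<open>r\<close> of this periodic walk, and staying below the chord means that this point is
  the strict maximum of a period.\<close>

lemma below_chord_rotate_block:
  assumes r: "r < l"
  shows "below_chord l (\<lambda>i. x (rotate_block l r i)) \<longleftrightarrow>
    (\<forall>j<l. j \<noteq> r \<longrightarrow> psum x j - psum x l / real l * real j < psum x r - psum x l / real l * real r)"
    (is "?L \<longleftrightarrow> ?R")
proof -
  have l: "real l > 0" using r by simp
  have tot: "psum (\<lambda>i. x (rotate_block l r i)) l = psum x l"
    using psum_rotate_block[OF r order_refl, of x] r by (cases "r = 0") auto
  have key: "psum (\<lambda>i. x (rotate_block l r i)) k * real l < psum x l * real k \<longleftrightarrow>
     psum x j - psum x l / real l * real j < psum x r - psum x l / real l * real r"
    if k: "0 < k" "k < l" and j: "j = (if k + r < l then k + r else k + r - l)" for k j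
  proof (cases "k + r < l")
    case True
    then have e: "psum (\<lambda>i. x (rotate_block l r i)) k = psum x j - psum x r" "real j = real k + real r"
      using psum_rotate_block[OF r, of k x] k j by simp_all
    show ?thesis unfolding e using l by (subst chord_less_iff) (simp_all add: algebra_simps)
  next
    case False
    then have e: "real j = real k + real r - real l" using j by (simp add: of_nat_diff)
    have e2: "psum (\<lambda>i. x (rotate_block l r i)) k = psum x l - psum x r + psum x j"
      using psum_rotate_block[OF r, of k x] k j False by (cases "k + r = l") auto
    show ?thesis unfolding e e2 using l by (subst chord_less_iff) (simp_all add: algebra_simps)
  qed
  show ?thesis
  proof
    assume L: ?L
    show ?R
    proof (intro allI impI)
      fix j assume j: "j < l" "j \<noteq> r"
      \<comment> \<open>The time at which the rotated block passes the original point
        \<open>j\<close>.\<close>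
      define k where "k = (if r < j then j - r else j + l - r)"
      have k: "0 < k" "k < l" "j = (if k + r < l then k + r else k + r - l)"
        using j r by (auto simp: k_def)
      show "psum x j - psum x l / real l * real j < psum x r - psum x l / real l * real r"
        using L k key[OF k] unfolding below_chord_def tot by blast
    qed
  next
    assume R: ?R
    show ?L unfolding below_chord_def tot
    proof (intro allI impI)
      fix k assume k: "0 < k \<and> k < l"
      define j where "j = (if k + r < l then k + r else k + r - l)"
      have "j < l" "j \<noteq> r" using k r by (auto simp: j_def)
      then show "psum (\<lambda>i. x (rotate_block l r i)) k * real l < psum x l * real k"
        using R key[of k j] k j_def by auto
    qed
  qed
qed

lemma sum_indicator_unique:
  assumes "finite A" "\<exists>!a. a \<in> A \<and> P a"
  shows "(\<Sum>a\<in>A. if P a then c else 0) = (c :: 'b :: comm_monoid_add)"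
proof -
  obtain a where a: "a \<in> A" "P a" "\<And>b. b \<in> A \<Longrightarrow> P b \<Longrightarrow> b = a" using assms(2) by auto
  have "P b \<longleftrightarrow> b = a" if "b \<in> A" for b using that a by blast
  then have "(\<Sum>b\<in>A. if P b then c else 0) = (\<Sum>b\<in>A. if b = a then c else 0)"
    by (intro sum.cong) simp_all
  then show ?thesis using a(1) assms(1) by simp
qed

lemma ex1_strict_max:
  fixes f :: "'b \<Rightarrow> real"
  assumes "finite A" "A \<noteq> {}" "inj_on f A"
  shows "\<exists>!a. a \<in> A \<and> (\<forall>b\<in>A. b \<noteq> a \<longrightarrow> f b < f a)"
proof -
  have "Max (f ` A) \<in> f ` A" using assms(1,2) by (intro Max_in) auto
  then obtain a where a: "a \<in> A" "f a = Max (f ` A)" unfolding image_iff by metis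
  have "f b < f a" if "b \<in> A" "b \<noteq> a" for b
  proof -
    have "f b \<le> f a" using that a(2) assms(1) by simp
    moreover have "f b \<noteq> f a" using inj_onD[OF assms(3), of b a] that a(1) by blast
    ultimately show ?thesis by simp
  qed
  then have m: "\<forall>b\<in>A. b \<noteq> a \<longrightarrow> f b < f a" by blast
  show ?thesis
  proof (rule ex1I[of _ a])
    show "a \<in> A \<and> (\<forall>b\<in>A. b \<noteq> a \<longrightarrow> f b < f a)" using a(1) m by blast
    fix c assume "c \<in> A \<and> (\<forall>b\<in>A. b \<noteq> c \<longrightarrow> f b < f c)"
    then show "c = a" using a(1) m by (metis less_asym)
  qed
qed

lemma finite_faces [simp]: "finite (faces n x)"
proof (rule finite_subset)
  show "faces n x \<subseteq> {..n} \<times> {..n}" by (auto simp: faces_def dest!: is_faceD)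
qed simp

text \<open>Trades the set of faces, which depends on \<open>x\<close>, for a fixed index set with
  conditional terms, so that integration and measurability can be handled termwise.\<close>

lemma sum_faces:
  "(\<Sum>(g, l)\<in>faces n x. \<phi> g l) =
    (\<Sum>l\<in>{1..n}. \<Sum>g\<le>n - l. if is_face n x g l then \<phi> g l else (0 :: 'b :: comm_monoid_add))"
proof -
  let ?A = "Sigma {1..n} (\<lambda>l. {..n - l})"
  have "(\<Sum>l\<in>{1..n}. \<Sum>g\<le>n - l. if is_face n x g l then \<phi> g l else 0) =
      (\<Sum>p\<in>?A. if is_face n x (snd p) (fst p) then \<phi> (snd p) (fst p) else 0)"
    by (subst sum.Sigma) (simp_all add: split_beta')
  also have "\<dots> = (\<Sum>p\<in>{p \<in> ?A. is_face n x (snd p) (fst p)}. \<phi> (snd p) (fst p))"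
    by (rule sum.inter_filter[symmetric]) simp
  also have "\<dots> = (\<Sum>p\<in>prod.swap ` faces n x. \<phi> (snd p) (fst p))"
  proof (rule sum.cong)
    show "{p \<in> ?A. is_face n x (snd p) (fst p)} = prod.swap ` faces n x"
      unfolding faces_def by (auto simp: image_iff dest: is_faceD)
  qed simp
  also have "\<dots> = (\<Sum>p\<in>faces n x. \<phi> (fst p) (snd p))"
    by (subst sum.reindex) (simp_all add: o_def)
  finally show ?thesis by (simp add: split_beta')
qed

section \<open>The one-step formula for walks with independent increments\<close>

text \<open>The absence of atoms rules out ties: the tilted values compared in
  \<open>below_chord\<close> and \<open>peak\<close> are almost surely distinct, so strict maxima
  exist.\<close>

locale iid_walk = sequence_space \<gamma> for \<gamma> :: "real measure" +
  assumes sets_step [measurable_cong]: "sets \<gamma> = sets borel"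
    and no_atoms: "emeasure \<gamma> {r} = 0"
begin

lemma prob_space_step: "prob_space \<gamma>" by unfold_locales

lemma space_step [simp]: "space \<gamma> = UNIV"
  using sets_eq_imp_space_eq[OF sets_step] by simp

lemma space_S [simp]: "space S = UNIV"
  by (auto simp: space_PiM PiE_def extensional_def)

lemma measurable_coord [measurable]: "(\<lambda>x. x i) \<in> borel_measurable S"
  using measurable_component_singleton[of i UNIV "\<lambda>_. \<gamma>"] by (simp cong: measurable_cong_sets add: sets_step)

lemma measurable_to_S: "(\<And>i. (\<lambda>z. f z i) \<in> borel_measurable N) \<Longrightarrow> f \<in> measurable N S"
  by (rule measurable_PiM_single') (auto simp: cong: measurable_cong_sets sets_step)

lemma measurable_psum [measurable]: "(\<lambda>x. psum x k) \<in> borel_measurable S"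
  unfolding psum_def by measurable

text \<open>Exchangeability, in the form used both for moving and for rotating a block: i.i.d.
  coordinates keep their joint law under an injective relabelling.\<close>

lemma nn_integral_reindex:
  assumes "inj \<pi>" and [measurable]: "F \<in> borel_measurable S"
  shows "(\<integral>\<^sup>+x. F (\<lambda>i. x (\<pi> i)) \<partial>S) = (\<integral>\<^sup>+x. F x \<partial>S)"
proof -
  have "distr S S (\<lambda>x i. x (\<pi> i)) = S"
    using distr_PiM_reindex[of UNIV "\<lambda>_. \<gamma>" \<pi> UNIV] prob_space_step assms(1) by (simp add: restrict_UNIV)
  then have "(\<integral>\<^sup>+x. F x \<partial>S) = (\<integral>\<^sup>+x. F x \<partial>distr S S (\<lambda>x i. x (\<pi> i)))" by simp
  also have "\<dots> = (\<integral>\<^sup>+x. F (\<lambda>i. x (\<pi> i)) \<partial>S)"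
    by (rule nn_integral_distr) (auto intro!: measurable_to_S)
  finally show ?thesis ..
qed

text \<open>Fubini with coordinate \<open>j\<close> singled out: given the others, the form vanishes
  for a single value of that coordinate, and single values have measure 0.\<close>

lemma AE_linear_form_nonzero:
  assumes j: "j < n" "c j \<noteq> 0"
  shows "AE x in S. (\<Sum>i<n. c i * x i) \<noteq> 0"
proof -
  let ?R = "Pi\<^sub>M (UNIV - {j}) (\<lambda>_. \<gamma>)"
  interpret R: prob_space ?R by (rule prob_space_PiM) (rule prob_space_step)
  interpret G: prob_space \<gamma> by (rule prob_space_step)
  interpret P: pair_sigma_finite \<gamma> ?R by unfold_locales
  have upd: "(\<lambda>(s, X). X(j := s)) \<in> measurable (\<gamma> \<Otimes>\<^sub>M ?R) S"
    using measurable_fun_upd[of UNIV "UNIV - {j}" j snd "\<gamma> \<Otimes>\<^sub>M ?R" "\<lambda>_. \<gamma>" fst]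
    by (simp add: split_beta' insert_absorb insert_Diff)
  have eq: "distr (\<gamma> \<Otimes>\<^sub>M ?R) S (\<lambda>(s, X). X(j := s)) = S"
    using distr_pair_PiM_eq_PiM[of "UNIV - {j}" "\<lambda>_. \<gamma>" j] prob_space_step
    by (simp add: insert_Diff)
  define Q where "Q s X \<longleftrightarrow> (\<Sum>i<n. c i * (X(j := s)) i) \<noteq> 0" for s X
  have m: "(\<lambda>z. (snd z)(j := fst z)) \<in> measurable (\<gamma> \<Otimes>\<^sub>M ?R) S"
    using upd by (simp add: split_beta')
  have [measurable]: "\<And>i. (\<lambda>z. ((snd z)(j := fst z)) i) \<in> borel_measurable (\<gamma> \<Otimes>\<^sub>M ?R)"
    by (rule measurable_compose[OF m measurable_coord])
  have *: "{z \<in> space (\<gamma> \<Otimes>\<^sub>M ?R). Q (fst z) (snd z)} \<in> sets (\<gamma> \<Otimes>\<^sub>M ?R)"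
    unfolding Q_def by measurable
  have "AE z in \<gamma> \<Otimes>\<^sub>M ?R. Q (fst z) (snd z)"
  proof (rule P.AE_pair_measure[OF *])
    have "AE X in ?R. AE s in \<gamma>. Q s X" unfolding Q_def
    proof (rule AE_I2)
      fix X :: "nat \<Rightarrow> real"
      define r where "r = - (\<Sum>i\<in>{..<n} - {j}. c i * X i) / c j"
      have "{r} \<in> null_sets \<gamma>" using no_atoms[of r] by (auto simp: sets_step null_sets_def)
      then have "AE s in \<gamma>. s \<notin> {r}" by (rule AE_not_in)
      then show "AE s in \<gamma>. (\<Sum>i<n. c i * (X(j := s)) i) \<noteq> 0"
      proof eventually_elim
        case (elim s)
        have "(\<Sum>i<n. c i * (X(j := s)) i) = c j * s + (\<Sum>i\<in>{..<n} - {j}. c i * X i)"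
          using j by (subst sum.remove[of _ j]) auto
        then show ?case using elim j by (auto simp: r_def field_simps)
      qed
    qed
    then show "AE s in \<gamma>. AE X in ?R. Q (fst (s, X)) (snd (s, X))"
      using P.AE_commute[OF *] by simp
  qed
  moreover have mS: "{x \<in> space S. (\<Sum>i<n. c i * x i) \<noteq> 0} \<in> sets S" by measurable
  ultimately have "AE x in distr (\<gamma> \<Otimes>\<^sub>M ?R) S (\<lambda>(s, X). X(j := s)). (\<Sum>i<n. c i * x i) \<noteq> 0"
    unfolding AE_distr_iff[OF upd mS] by (simp add: split_beta' Q_def)
  then show ?thesis by (simp only: eq)
qed

end

lemma psum_eq_sum_if: "k \<le> N \<Longrightarrow> psum x k = (\<Sum>i<N. (if i < k then 1 else 0) * x i)"
proof -
  assume "k \<le> N"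
  then have "{i. i < N \<and> i < k} = {..<k}" by auto
  then show ?thesis
    unfolding psum_def by (simp add: if_distrib[of "\<lambda>c. c * _"] sum.If_cases Int_def cong: if_cong)
qed

text \<open>Differences of tilted partial sums are linear forms in the increments; this gives their
  coefficients, as \<open>AE_linear_form_nonzero\<close> requires.\<close>

lemma psum_combination:
  assumes "k \<le> N" "k' \<le> N" "l \<le> N"
  shows "(\<Sum>i<N. ((if i < k then 1 else 0) - (if i < k' then 1 else 0) + r * (if i < l then 1 else 0)) * x i) =
    psum x k - psum x k' + r * psum x l"
  unfolding psum_eq_sum_if[OF assms(1), of x] psum_eq_sum_if[OF assms(2), of x] psum_eq_sum_if[OF assms(3), of x]
  by (simp only: sum_distrib_left sum_subtractf[symmetric] sum.distrib[symmetric])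
    (rule sum.cong, simp_all add: algebra_simps)

context iid_walk
begin

lemma measurable_shift: "(\<lambda>x i. x (l + i)) \<in> measurable S S"
  by (intro measurable_to_S measurable_coord)

lemma measurable_excise: "excise g l \<in> measurable S S"
  unfolding excise_def by (intro measurable_to_S) measurable

lemma measurable_below_chord [measurable]: "Measurable.pred S (below_chord l)"
  unfolding below_chord_def[abs_def] by measurable

lemma measurable_peak [measurable]:
  "Measurable.pred S (\<lambda>x. peak m (\<lambda>i. x (l + i)) g (psum x k / r))"
  unfolding peak_def psum_def by measurable

lemma measurable_is_face [measurable]: "Measurable.pred S (\<lambda>x. is_face n x g l)"
  unfolding is_face_def by measurable

lemma AE_inj_rotation: "AE x in S. inj_on (\<lambda>k. psum x k - psum x l / real l * real k) {..<l}"
proof -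
  have "AE x in S. k < k' \<longrightarrow> k' < l \<longrightarrow>
      psum x k - psum x l / real l * real k \<noteq> psum x k' - psum x l / real l * real k'" for k k'
  proof (cases "k < k' \<and> k' < l")
    case True
    \<comment> \<open>The coefficient at index \<open>k\<close> is \<open>(k' - k) / l - 1\<close>,
      nonzero because \<open>k' - k < l\<close>.\<close>
    define c where "c i = (if i < k then 1 else 0) - (if i < k' then 1 else 0) + (real k' - real k) / real l
      * (if i < l then 1 else 0)" for i
    have "AE x in S. (\<Sum>i<l. c i * x i) \<noteq> 0"
      by (rule AE_linear_form_nonzero[of k]) (use True in \<open>auto simp: c_def field_simps\<close>)
    then show ?thesis
    proof eventually_elim
      case (elim x)
      have "(\<Sum>i<l. c i * x i) = psum x k - psum x k' + (real k' - real k) / real l * psum x l"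
        unfolding c_def by (rule psum_combination) (use True in auto)
      then show ?case using elim by (auto simp: algebra_simps diff_divide_distrib)
    qed
  qed simp
  then have "AE x in S. \<forall>k k'. k < k' \<longrightarrow> k' < l \<longrightarrow>
      psum x k - psum x l / real l * real k \<noteq> psum x k' - psum x l / real l * real k'"
    by (simp add: AE_all_countable)
  then show ?thesis
    by eventually_elim (auto intro!: linorder_inj_onI)
qed

lemma AE_inj_peak:
  assumes l: "0 < l"
  shows "AE x in S. inj_on (\<lambda>k. psum (\<lambda>i. x (l + i)) k - psum x l / real l * real k) {..m}"
proof -
  have "AE x in S. k < k' \<longrightarrow>
      psum (\<lambda>i. x (l + i)) k - psum x l / real l * real k \<noteq> psum (\<lambda>i. x (l + i)) k' - psum x l / real l * real k'" for k k'
  proof (cases "k < k'")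
    case True
    \<comment> \<open>Here index 0 serves: the two indicators cancel there and
      \<open>(k' - k) / l\<close> remains.\<close>
    define c where "c i = (if i < l + k then 1 else 0) - (if i < l + k' then 1 else 0) + (real k' - real k) / real l
      * (if i < l then 1 else 0)" for i
    have "AE x in S. (\<Sum>i<l + k'. c i * x i) \<noteq> 0"
      by (rule AE_linear_form_nonzero[of 0]) (use True l in \<open>auto simp: c_def field_simps\<close>)
    then show ?thesis
    proof eventually_elim
      case (elim x)
      have "(\<Sum>i<l + k'. c i * x i) = psum x (l + k) - psum x (l + k') + (real k' - real k) / real l * psum x l"
        unfolding c_def by (rule psum_combination) (use True in auto)
      then show ?case using elim unfolding psum_shift by (auto simp: algebra_simps diff_divide_distrib)
    qed
  qed simp
  then have "AE x in S. \<forall>k k'. k < k' \<longrightarrow>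
      psum (\<lambda>i. x (l + i)) k - psum x l / real l * real k \<noteq> psum (\<lambda>i. x (l + i)) k' - psum x l / real l * real k'"
    by (simp add: AE_all_countable)
  then show ?thesis
    by eventually_elim (auto intro!: linorder_inj_onI)
qed

text \<open>Rotations preserve both the law and \<open>G\<close>, so the factor \<open>l\<close> can
  be spread over the \<open>l\<close> rotations of the block, of which almost surely exactly one
  stays below the chord.\<close>

lemma nn_integral_below_chord:
  assumes l: "0 < l" and [measurable]: "G \<in> borel_measurable S"
    and G: "\<And>x r. r < l \<Longrightarrow> G (\<lambda>i. x (rotate_block l r i)) = G x"
  shows "(\<integral>\<^sup>+x. (if below_chord l x then of_nat l * G x else 0) \<partial>S) = (\<integral>\<^sup>+x. G x \<partial>S)"
proof -
  have [measurable]: "Measurable.pred S (\<lambda>x. below_chord l (\<lambda>i. x (rotate_block l r i)))" for r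
    unfolding below_chord_def psum_def by measurable
  have "(\<integral>\<^sup>+x. (if below_chord l x then of_nat l * G x else 0) \<partial>S) =
      of_nat l * (\<integral>\<^sup>+x. (if below_chord l x then G x else 0) \<partial>S)"
    by (subst nn_integral_cmult[symmetric]) (auto intro!: nn_integral_cong)
  also have "\<dots> = (\<Sum>r<l. \<integral>\<^sup>+x. (if below_chord l x then G x else 0) \<partial>S)" by simp
  also have "\<dots> = (\<Sum>r<l. \<integral>\<^sup>+x. (if below_chord l (\<lambda>i. x (rotate_block l r i)) then G x else 0) \<partial>S)"
  proof (rule sum.cong[OF refl])
    fix r assume "r \<in> {..<l}"
    then have r: "r < l" by simp
    have "(\<integral>\<^sup>+x. (if below_chord l x then G x else 0) \<partial>S) =
        (\<integral>\<^sup>+x. (if below_chord l (\<lambda>i. x (rotate_block l r i)) then G (\<lambda>i. x (rotate_block l r i)) else 0) \<partial>S)"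
      by (subst nn_integral_reindex[OF inj_rotate_block[OF r], of "\<lambda>x. if below_chord l x then G x else 0"]) simp_all
    also have "\<dots> = (\<integral>\<^sup>+x. (if below_chord l (\<lambda>i. x (rotate_block l r i)) then G x else 0) \<partial>S)"
    proof (rule nn_integral_cong)
      fix x
      show "(if below_chord l (\<lambda>i. x (rotate_block l r i)) then G (\<lambda>i. x (rotate_block l r i)) else 0) =
          (if below_chord l (\<lambda>i. x (rotate_block l r i)) then G x else 0)"
        by (simp only: G[OF r, of x])
    qed
    finally show "(\<integral>\<^sup>+x. (if below_chord l x then G x else 0) \<partial>S) =
        (\<integral>\<^sup>+x. (if below_chord l (\<lambda>i. x (rotate_block l r i)) then G x else 0) \<partial>S)" .
  qed
  also have "\<dots> = (\<integral>\<^sup>+x. (\<Sum>r<l. if below_chord l (\<lambda>i. x (rotate_block l r i)) then G x else 0) \<partial>S)"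
    by (rule nn_integral_sum[symmetric]) measurable
  also have "\<dots> = (\<integral>\<^sup>+x. G x \<partial>S)"
  proof (rule nn_integral_cong_AE)
    show "AE x in S. (\<Sum>r<l. if below_chord l (\<lambda>i. x (rotate_block l r i)) then G x else 0) = G x"
      using AE_inj_rotation[of l]
    proof eventually_elim
      case (elim x)
      have "\<exists>!r. r \<in> {..<l} \<and> (\<forall>j\<in>{..<l}. j \<noteq> r \<longrightarrow>
          psum x j - psum x l / real l * real j < psum x r - psum x l / real l * real r)"
        by (rule ex1_strict_max) (use elim l in auto)
      then have "\<exists>!r. r \<in> {..<l} \<and> below_chord l (\<lambda>i. x (rotate_block l r i))"
        by (simp add: below_chord_rotate_block Ball_def cong: conj_cong)
      then show ?case by (intro sum_indicator_unique) simp_all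
    qed
  qed
  finally show ?thesis .
qed

text \<open>
  Move the block to the front. Exactly one place of reinsertion makes the rest peak there,
  and exactly one of the \<open>l\<close> rotations of the block stays below its chord: this cancels the factor \<open>l\<close>.
\<close>

theorem nn_integral_sum_faces:
  fixes H :: "nat \<Rightarrow> real \<Rightarrow> (nat \<Rightarrow> real) \<Rightarrow> ennreal"
  assumes meas: "\<And>l. (\<lambda>z. H l (fst z) (snd z)) \<in> borel_measurable (borel \<Otimes>\<^sub>M S)"
  shows "(\<integral>\<^sup>+x. (\<Sum>(g, l)\<in>faces n x. of_nat l * H l (psum x (g + l) - psum x g) (excise g l x)) \<partial>S) =
    (\<Sum>l\<in>{1..n}. \<integral>\<^sup>+x. H l (psum x l) (\<lambda>i. x (l + i)) \<partial>S)"
proof -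
  have H: "(\<lambda>x. H l (f x) (h x)) \<in> borel_measurable S"
    if "f \<in> borel_measurable S" "h \<in> measurable S S" for f h l
    using measurable_compose[OF measurable_Pair[OF that] meas] by simp
  define G where "G l x = H l (psum x l) (\<lambda>i. x (l + i))" for l x
  have G_meas [measurable]: "G l \<in> borel_measurable S" for l
    unfolding G_def by (rule H[OF measurable_psum measurable_shift])
  have [measurable]: "(\<lambda>x. H l (psum x (g + l) - psum x g) (excise g l x)) \<in> borel_measurable S" for g l
    by (rule H[OF _ measurable_excise]) measurable
  \<comment> \<open>The contribution of a block standing in front that is to be reinserted at
    \<open>g\<close>.\<close>
  define F where "F l g x = (if below_chord l x \<and> peak (n - l) (\<lambda>i. x (l + i)) g (psum x l / real l)
    then of_nat l * G l x else 0)" for l g x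
  have F_meas [measurable]: "F l g \<in> borel_measurable S" for l g
    unfolding F_def by measurable
  have "(\<integral>\<^sup>+x. (\<Sum>(g, l)\<in>faces n x. of_nat l * H l (psum x (g + l) - psum x g) (excise g l x)) \<partial>S) =
    (\<Sum>l\<in>{1..n}. \<Sum>g\<le>n - l. \<integral>\<^sup>+x. (if is_face n x g l then
      of_nat l * H l (psum x (g + l) - psum x g) (excise g l x) else 0) \<partial>S)"
    unfolding sum_faces by (subst nn_integral_sum, measurable)+
  also have "\<dots> = (\<Sum>l\<in>{1..n}. \<Sum>g\<le>n - l. \<integral>\<^sup>+x. F l g x \<partial>S)"
  proof (intro sum.cong refl)
    fix l g assume "l \<in> {1..n}" "g \<in> {..n - l}"
    then have lg: "0 < l" "g + l \<le> n" by auto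
    have "(\<integral>\<^sup>+x. F l g x \<partial>S) = (\<integral>\<^sup>+x. F l g (\<lambda>i. x (move_block g l i)) \<partial>S)"
      by (rule nn_integral_reindex[symmetric]) (auto intro: inj_move_block)
    also have "\<dots> = (\<integral>\<^sup>+x. (if is_face n x g l then
      of_nat l * H l (psum x (g + l) - psum x g) (excise g l x) else 0) \<partial>S)"
      using is_face_move_block[OF lg] by (intro nn_integral_cong) (simp add: F_def G_def)
    finally show "(\<integral>\<^sup>+x. (if is_face n x g l then
      of_nat l * H l (psum x (g + l) - psum x g) (excise g l x) else 0) \<partial>S) = (\<integral>\<^sup>+x. F l g x \<partial>S)" ..
  qed
  also have "\<dots> = (\<Sum>l\<in>{1..n}. \<integral>\<^sup>+x. G l x \<partial>S)"
  proof (rule sum.cong[OF refl])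
    fix l assume "l \<in> {1..n}"
    then have l: "0 < l" by simp
    have "(\<Sum>g\<le>n - l. \<integral>\<^sup>+x. F l g x \<partial>S) = (\<integral>\<^sup>+x. (\<Sum>g\<le>n - l. F l g x) \<partial>S)"
      by (rule nn_integral_sum[symmetric]) measurable
    also have "\<dots> = (\<integral>\<^sup>+x. (if below_chord l x then of_nat l * G l x else 0) \<partial>S)"
    proof (rule nn_integral_cong_AE)
      show "AE x in S. (\<Sum>g\<le>n - l. F l g x) = (if below_chord l x then of_nat l * G l x else 0)"
        using AE_inj_peak[OF l, of "n - l"]
      proof eventually_elim
        case (elim x)
        have "\<exists>!g. g \<in> {..n - l} \<and> (\<forall>k\<in>{..n - l}. k \<noteq> g \<longrightarrow>
          psum (\<lambda>i. x (l + i)) k - psum x l / real l * real k < psum (\<lambda>i. x (l + i)) g - psum x l / real l * real g)"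
          by (rule ex1_strict_max) (use elim in auto)
        then have *: "\<exists>!g. g \<in> {..n - l} \<and> peak (n - l) (\<lambda>i. x (l + i)) g (psum x l / real l)"
          by (simp add: peak_def Ball_def cong: conj_cong)
        have "(\<Sum>g\<le>n - l. F l g x) = (\<Sum>g\<le>n - l. if peak (n - l) (\<lambda>i. x (l + i)) g (psum x l / real l)
            then (if below_chord l x then of_nat l * G l x else 0) else 0)"
          by (rule sum.cong) (auto simp: F_def)
        also have "\<dots> = (if below_chord l x then of_nat l * G l x else 0)"
          by (rule sum_indicator_unique[OF _ *]) simp
        finally show ?case .
      qed
    qed
    also have "\<dots> = (\<integral>\<^sup>+x. G l x \<partial>S)"
    proof (rule nn_integral_below_chord[OF l])
      fix x r assume r: "r < l"
      have "psum (\<lambda>i. x (rotate_block l r i)) l = psum x l"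
        using psum_rotate_block[OF r order_refl, of x] r by (cases "r = 0") auto
      moreover have "(\<lambda>i. x (rotate_block l r (l + i))) = (\<lambda>i. x (l + i))"
        by (simp add: rotate_block_def)
      ultimately show "G l (\<lambda>i. x (rotate_block l r i)) = G l x" by (simp add: G_def)
    qed measurable
    finally show "(\<Sum>g\<le>n - l. \<integral>\<^sup>+x. F l g x \<partial>S) = (\<integral>\<^sup>+x. G l x \<partial>S)" .
  qed
  finally show ?thesis by (simp add: G_def)
qed

text \<open>The block, of which \<open>H\<close> sees only the total, is independent of what
  follows, and what follows is again a full i.i.d. sequence. This permits an induction over removed
  faces.\<close>

lemma nn_integral_split:
  assumes meas: "(\<lambda>z. H (fst z) (snd z)) \<in> borel_measurable (borel \<Otimes>\<^sub>M S)"
  shows "(\<integral>\<^sup>+x. H (psum x l) (\<lambda>i. x (l + i)) \<partial>S) = (\<integral>\<^sup>+u. (\<integral>\<^sup>+w. H (psum u l) w \<partial>S) \<partial>S)"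
proof -
  have [measurable]: "(\<lambda>x. H (psum x l) (\<lambda>i. x (l + i))) \<in> borel_measurable S"
    using measurable_compose[OF measurable_Pair[OF measurable_psum measurable_shift] meas] by simp
  have m: "(\<lambda>(u, w). comb_seq l u w) \<in> measurable (S \<Otimes>\<^sub>M S) S" by measurable
  have "(\<integral>\<^sup>+x. H (psum x l) (\<lambda>i. x (l + i)) \<partial>S) =
      (\<integral>\<^sup>+x. H (psum x l) (\<lambda>i. x (l + i)) \<partial>distr (S \<Otimes>\<^sub>M S) S (\<lambda>(u, w). comb_seq l u w))"
    by (simp add: PiM_comb_seq)
  also have "\<dots> = (\<integral>\<^sup>+z. H (psum (comb_seq l (fst z) (snd z)) l) (\<lambda>i. comb_seq l (fst z) (snd z) (l + i)) \<partial>(S \<Otimes>\<^sub>M S))"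
    by (subst nn_integral_distr[OF m]) (simp_all add: split_beta')
  also have "\<dots> = (\<integral>\<^sup>+z. H (psum (fst z) l) (snd z) \<partial>(S \<Otimes>\<^sub>M S))"
  proof (rule nn_integral_cong)
    fix z :: "(nat \<Rightarrow> real) \<times> (nat \<Rightarrow> real)"
    have "psum (comb_seq l (fst z) (snd z)) l = psum (fst z) l"
      by (rule psum_cong) (simp add: comb_seq_less)
    then show "H (psum (comb_seq l (fst z) (snd z)) l) (\<lambda>i. comb_seq l (fst z) (snd z) (l + i)) = H (psum (fst z) l) (snd z)"
      using comb_seq_add[of l "fst z" "snd z"] by (simp add: add.commute)
  qed
  also have "\<dots> = (\<integral>\<^sup>+u. (\<integral>\<^sup>+w. H (psum u l) w \<partial>S) \<partial>S)"
  proof -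
    have "(\<lambda>z. H (psum (fst z) l) (snd z)) \<in> borel_measurable (S \<Otimes>\<^sub>M S)"
      using measurable_compose[OF measurable_Pair[OF measurable_compose[OF measurable_fst measurable_psum] measurable_snd] meas] by simp
    then show ?thesis by (subst P.nn_integral_fst[symmetric]) simp_all
  qed
  finally show ?thesis .
qed

end

section \<open>Iterated removal of faces\<close>

text \<open>The slope form of the definition: the arguments below compare lines through different
  points by their slopes.\<close>

lemma is_face_iff_line:
  "is_face n x g l \<longleftrightarrow> 0 < l \<and> g + l \<le> n \<and> (\<exists>s. psum x (g + l) = psum x g + s * real l \<and>
    (\<forall>k\<le>n. k \<noteq> g \<longrightarrow> k \<noteq> g + l \<longrightarrow> psum x k < psum x g + s * (real k - real g)))"
proof -
  have "(psum x k - psum x g) * real l < (psum x (g + l) - psum x g) * (real k - real g) \<longleftrightarrow>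
      psum x k < psum x g + (psum x (g + l) - psum x g) / real l * (real k - real g)" if "0 < l" for k
    using that by (simp add: field_simps)
  moreover have "s = (psum x (g + l) - psum x g) / real l" if "psum x (g + l) = psum x g + s * real l" "0 < l" for s
    using that by simp
  moreover have "psum x (g + l) = psum x g + (psum x (g + l) - psum x g) / real l * real l" if "0 < l"
    using that by simp
  ultimately show ?thesis unfolding is_face_def by blast
qed

text \<open>A supporting line in the weak sense, ties allowed. Both ends of a face carry one with
  the slope of the face.\<close>

definition anchored :: "nat \<Rightarrow> (nat \<Rightarrow> real) \<Rightarrow> nat \<Rightarrow> real \<Rightarrow> bool"
  where "anchored n x a s \<longleftrightarrow> a \<le> n \<and> (\<forall>k\<le>n. psum x k \<le> psum x a + s * (real k - real a))"

text \<open>Strictly inside a face the walk is strictly below the line of the face. A supporting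
  line there would need a smaller slope than the face because of the left end and a larger one
  because of the right end.\<close>

lemma anchored_no_straddle:
  assumes a: "anchored n x a s" and f: "is_face n x g l"
  shows "a \<le> g \<or> g + l \<le> a"
proof (rule ccontr)
  assume "\<not> ?thesis"
  then have ga: "g < a" "a < g + l" by auto
  have gl: "g + l \<le> n" using is_faceD[OF f] by simp
  obtain t where t: "psum x (g + l) = psum x g + t * real l" "psum x a < psum x g + t * (real a - real g)"
    using f ga gl unfolding is_face_iff_line by auto
  have 1: "psum x g \<le> psum x a + s * (real g - real a)" "psum x (g + l) \<le> psum x a + s * (real (g + l) - real a)"
    using a gl unfolding anchored_def by auto
  have "s * (real a - real g) < t * (real a - real g)"
    using 1(1) t(2) by (simp add: algebra_simps)
  then have "s < t" using ga by (simp add: mult_less_cancel_right)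
  moreover have "t * (real (g + l) - real a) < s * (real (g + l) - real a)"
    using 1(2) t by (simp add: algebra_simps)
  then have "t < s" using ga by (simp add: mult_less_cancel_right)
  ultimately show False by simp
qed

lemma is_face_anchored:
  assumes "is_face n x g l"
  obtains s where "anchored n x g s" "anchored n x (g + l) s" "psum x (g + l) = psum x g + s * real l"
    "\<And>k. k \<le> n \<Longrightarrow> k \<noteq> g \<Longrightarrow> k \<noteq> g + l \<Longrightarrow> psum x k < psum x g + s * (real k - real g)"
proof -
  obtain s where s: "psum x (g + l) = psum x g + s * real l"
    "\<forall>k\<le>n. k \<noteq> g \<longrightarrow> k \<noteq> g + l \<longrightarrow> psum x k < psum x g + s * (real k - real g)"
    using assms unfolding is_face_iff_line by auto
  have *: "psum x k \<le> psum x g + s * (real k - real g)" if "k \<le> n" for k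
    using s that by (cases "k = g \<or> k = g + l") (auto intro: less_imp_le)
  then have "anchored n x g s" "anchored n x (g + l) s"
    using is_faceD[OF assms] unfolding anchored_def by (auto simp: s(1) algebra_simps)
  then show ?thesis using that s by blast
qed

text \<open>Both ends of each face are anchored, so neither face has an end strictly inside the
  other.\<close>

lemma faces_disjoint:
  assumes f: "is_face n x g l" and f': "is_face n x g' l'" and ne: "(g, l) \<noteq> (g', l')"
  shows "g' + l' \<le> g \<or> g + l \<le> g'"
proof -
  obtain s where s: "anchored n x g s" "anchored n x (g + l) s" using is_face_anchored[OF f] by blast
  obtain t where t: "anchored n x g' t" "anchored n x (g' + l') t" using is_face_anchored[OF f'] by blast
  show ?thesis
    using s[THEN anchored_no_straddle, OF f'] t[THEN anchored_no_straddle, OF f] ne is_faceD[OF f] is_faceD[OF f']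
    by auto
qed

text \<open>A face to the left of the anchor has a slope larger than \<open>s\<close>. To the right
  of the anchor its line therefore stays above the supporting line of slope \<open>s\<close>, under
  which both continuations of the walk lie.\<close>

lemma is_face_transfer_left:
  assumes x: "anchored n x a s" "\<And>k. k < a \<Longrightarrow> psum x k < psum x a + s * (real k - real a)"
    and y: "anchored m y a s" and eq: "\<And>k. k \<le> a \<Longrightarrow> psum y k = psum x k"
    and f: "is_face n x g l" and gl: "g + l \<le> a"
  shows "is_face m y g l"
proof -
  have l: "0 < l" using is_faceD[OF f] by simp
  obtain t where t: "psum x (g + l) = psum x g + t * real l"
    "\<And>k. k \<le> n \<Longrightarrow> k \<noteq> g \<Longrightarrow> k \<noteq> g + l \<Longrightarrow> psum x k < psum x g + t * (real k - real g)"
    using is_face_anchored[OF f] by metis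
  have an: "a \<le> n" "a \<le> m" using x y by (auto simp: anchored_def)
  have ta: "psum x a \<le> psum x g + t * (real a - real g)"
    using t(1) t(2)[of a] gl l an by (cases "a = g + l") auto
  have ga: "g < a" using gl l by simp
  have "s * (real a - real g) < t * (real a - real g)"
    using x(2)[OF ga] ta by (simp add: algebra_simps)
  then have st: "s < t" using ga by (simp add: mult_less_cancel_right)
  have "psum y k < psum y g + t * (real k - real g)" if k: "k \<le> m" "k \<noteq> g" "k \<noteq> g + l" for k
  proof (cases "k \<le> a")
    case True
    then show ?thesis using t(2)[of k] k eq[of k] eq[of g] ga an by auto
  next
    case False
    have "psum y k \<le> psum x a + s * (real k - real a)"
      using y k eq[of a] unfolding anchored_def by auto
    also have "\<dots> < psum x a + t * (real k - real a)" using st False by simp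
    also have "\<dots> \<le> psum y g + t * (real k - real g)"
      using ta eq[of g] ga by (simp add: algebra_simps)
    finally show ?thesis .
  qed
  then show ?thesis
    unfolding is_face_iff_line using l gl an t(1) eq[of g] eq[of "g + l"] by auto
qed

text \<open>The mirror image: faces to the right of the anchor have slopes smaller than
  \<open>s\<close>. The anchor may sit at different times and heights in the two walks, as it does
  before and after an excision.\<close>

lemma is_face_transfer_right:
  assumes x: "anchored n x a s" "\<And>k. a < k \<Longrightarrow> k \<le> n \<Longrightarrow> psum x k < psum x a + s * (real k - real a)"
    and y: "anchored m y b s" and mn: "n + b = m + a"
    and eq: "\<And>k. a + k \<le> n \<Longrightarrow> psum y (b + k) = psum x (a + k) - c"
    and f: "is_face n x (a + i) l"
  shows "is_face m y (b + i) l"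
proof -
  have l: "0 < l" and il: "a + i + l \<le> n" using is_faceD[OF f] by auto
  obtain t where t: "psum x (a + i + l) = psum x (a + i) + t * real l"
    "\<And>k. k \<le> n \<Longrightarrow> k \<noteq> a + i \<Longrightarrow> k \<noteq> a + i + l \<Longrightarrow> psum x k < psum x (a + i) + t * (real k - real (a + i))"
    using is_face_anchored[OF f] by metis
  have an: "a \<le> n" "b \<le> m" using x y by (auto simp: anchored_def)
  have ta: "psum x a \<le> psum x (a + i) + t * (real a - real (a + i))"
    using t(2)[of a] l an by (cases "i = 0") auto
  have "psum x (a + i + l) < psum x a + s * (real (a + i + l) - real a)"
    by (rule x(2)) (use l il in auto)
  then have "psum x (a + i) + t * real l < psum x (a + i) + t * (real a - real (a + i)) + t * real i + s * (real l + real i) - t * real i"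
    using t(1) ta by (simp add: algebra_simps)
  then have "t * (real l + real i) < s * (real l + real i)" by (simp add: algebra_simps)
  then have st: "t < s" using l by (simp add: mult_less_cancel_right)
  have "psum y k < psum y (b + i) + t * (real k - real (b + i))" if k: "k \<le> m" "k \<noteq> b + i" "k \<noteq> b + i + l" for k
  proof (cases "b \<le> k")
    case True
    then obtain j where j: "k = b + j" using le_Suc_ex by blast
    then show ?thesis using t(2)[of "a + j"] k eq[of j] eq[of i] mn il by auto
  next
    case False
    have "psum y k \<le> psum y b + s * (real k - real b)"
      using y k unfolding anchored_def by auto
    also have "\<dots> < psum y b + t * (real k - real b)" using st False by simp
    also have "\<dots> \<le> psum y (b + i) + t * (real k - real (b + i))"
      using ta eq[of 0] eq[of i] an il by (simp add: algebra_simps)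
    finally show ?thesis .
  qed
  then show ?thesis
    unfolding is_face_iff_line using l il mn t(1) eq[of i] eq[of "i + l"] by (auto simp: add.assoc intro!: exI[of _ t])
qed

definition insert_face :: "nat \<Rightarrow> nat \<Rightarrow> nat \<times> nat \<Rightarrow> nat \<times> nat"
  where "insert_face g l f = (if fst f + snd f \<le> g then f else (fst f + l, snd f))"

text \<open>The line of the removed face anchors the walk at both ends of the face and the excised
  walk at the seam, always with the same slope. Faces on either side can therefore be transferred in
  both directions.\<close>

lemma faces_excise:
  assumes f: "is_face n x g l"
  shows "bij_betw (insert_face g l) (faces (n - l) (excise g l x)) (faces n x - {(g, l)})"
    and "f' \<in> faces (n - l) (excise g l x) \<Longrightarrow>
      psum x (fst (insert_face g l f') + snd f') - psum x (fst (insert_face g l f')) =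
      psum (excise g l x) (fst f' + snd f') - psum (excise g l x) (fst f')"
proof -
  let ?w = "excise g l x"
  have l: "0 < l" "g + l \<le> n" using is_faceD[OF f] by auto
  obtain s where s: "anchored n x g s" "anchored n x (g + l) s" "psum x (g + l) = psum x g + s * real l"
    "\<And>k. k \<le> n \<Longrightarrow> k \<noteq> g \<Longrightarrow> k \<noteq> g + l \<Longrightarrow> psum x k < psum x g + s * (real k - real g)"
    by (rule is_face_anchored[OF f]) blast
  have wl: "psum ?w k = psum x k" if "k \<le> g" for k using that by (rule psum_excise_le)
  have wr: "psum ?w (g + k) = psum x (g + l + k) - s * real l" for k
    by (subst psum_excise_ge) (simp_all add: s(3) add_ac)
  have sl: "psum x k < psum x g + s * (real k - real g)" if "k < g" for k
    by (rule s(4)) (use that l in auto)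
  have sr: "psum x k < psum x (g + l) + s * (real k - real (g + l))" if "g + l < k" "k \<le> n" for k
    using s(4)[of k] that by (simp add: s(3) algebra_simps)
  have swr: "psum ?w k < psum ?w g + s * (real k - real g)" if k: "g < k" "k \<le> n - l" for k
  proof -
    obtain j where j: "k = g + j" using k less_imp_add_positive by blast
    show ?thesis using sr[of "g + l + j"] k l unfolding j wr wl[OF order_refl] by (simp add: s(3) algebra_simps)
  qed
  have sw: "anchored (n - l) ?w g s"
    unfolding anchored_def
  proof (intro conjI allI impI)
    show "g \<le> n - l" using l by simp
    fix k assume "k \<le> n - l"
    then show "psum ?w k \<le> psum ?w g + s * (real k - real g)"
      using swr[of k] sl[of k] by (cases k g rule: linorder_cases) (auto simp: wl)
  qed
  have left: "is_face (n - l) ?w h m \<longleftrightarrow> is_face n x h m" if "h + m \<le> g" for h m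
  proof
    assume A: "is_face (n - l) ?w h m"
    show "is_face n x h m"
    proof (rule is_face_transfer_left[OF sw _ s(1) _ A that])
      show "psum ?w k < psum ?w g + s * (real k - real g)" if "k < g" for k
        using sl[OF that] that by (simp add: wl)
      show "psum x k = psum ?w k" if "k \<le> g" for k using wl[OF that] by simp
    qed
  next
    assume A: "is_face n x h m"
    show "is_face (n - l) ?w h m"
      by (rule is_face_transfer_left[OF s(1) sl sw wl A that])
  qed
  have right: "is_face (n - l) ?w (g + i) m \<longleftrightarrow> is_face n x (g + l + i) m" for i m
  proof
    assume "is_face (n - l) ?w (g + i) m"
    then show "is_face n x (g + l + i) m"
      by (rule is_face_transfer_right[OF sw swr s(2), where c = "- s * real l", rotated -1])
        (use l in \<open>auto simp: wr\<close>)
  next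
    assume "is_face n x (g + l + i) m"
    then show "is_face (n - l) ?w (g + i) m"
      by (rule is_face_transfer_right[OF s(2) sr sw, where c = "s * real l", rotated -1])
        (use l in \<open>auto simp: wr\<close>)
  qed
  have dw: "g \<le> h \<or> h + m \<le> g" if "is_face (n - l) ?w h m" for h m
    by (rule anchored_no_straddle[OF sw that])
  have dx: "h + m \<le> g \<or> g + l \<le> h" if "is_face n x h m" "(h, m) \<noteq> (g, l)" for h m
    using faces_disjoint[OF f that(1)] that(2) by auto
  show "bij_betw (insert_face g l) (faces (n - l) ?w) (faces n x - {(g, l)})"
  proof (rule bij_betwI[where g = "\<lambda>f'. if fst f' + snd f' \<le> g then f' else (fst f' - l, snd f')"])
    show "insert_face g l \<in> faces (n - l) ?w \<rightarrow> faces n x - {(g, l)}"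
    proof (intro Pi_I)
      fix f' assume "f' \<in> faces (n - l) ?w"
      then obtain h m where hm: "f' = (h, m)" "is_face (n - l) ?w h m" by (auto simp: faces_def)
      have m: "0 < m" using is_faceD[OF hm(2)] by simp
      show "insert_face g l f' \<in> faces n x - {(g, l)}"
      proof (cases "h + m \<le> g")
        case True
        then show ?thesis using hm left[OF True] m by (auto simp: insert_face_def faces_def)
      next
        case False
        then obtain i where "h = g + i" using dw[OF hm(2)] le_Suc_ex by blast
        then show ?thesis using hm False right[of i m] l by (auto simp: insert_face_def faces_def add_ac)
      qed
    qed
    show "(\<lambda>f'. if fst f' + snd f' \<le> g then f' else (fst f' - l, snd f')) \<in> faces n x - {(g, l)} \<rightarrow> faces (n - l) ?w"
    proof (intro Pi_I)
      fix f' assume "f' \<in> faces n x - {(g, l)}"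
      then obtain h m where hm: "f' = (h, m)" "is_face n x h m" "(h, m) \<noteq> (g, l)" by (auto simp: faces_def)
      show "(if fst f' + snd f' \<le> g then f' else (fst f' - l, snd f')) \<in> faces (n - l) ?w"
      proof (cases "h + m \<le> g")
        case True
        then show ?thesis using hm left[OF True] by (auto simp: faces_def)
      next
        case False
        then obtain i where "h = g + l + i" using dx[OF hm(2,3)] le_Suc_ex by blast
        then show ?thesis using hm False right[of i m] by (auto simp: faces_def)
      qed
    qed
  next
    fix f' assume "f' \<in> faces (n - l) ?w"
    then obtain h m where hm: "f' = (h, m)" "is_face (n - l) ?w h m" by (auto simp: faces_def)
    then show "(if fst (insert_face g l f') + snd (insert_face g l f') \<le> g then insert_face g l f'
        else (fst (insert_face g l f') - l, snd (insert_face g l f'))) = f'"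
      by (auto simp: insert_face_def)
  next
    fix f' assume "f' \<in> faces n x - {(g, l)}"
    then obtain h m where hm: "f' = (h, m)" "is_face n x h m" "(h, m) \<noteq> (g, l)" by (auto simp: faces_def)
    then show "insert_face g l (if fst f' + snd f' \<le> g then f' else (fst f' - l, snd f')) = f'"
      using dx[OF hm(2,3)] is_faceD[OF hm(2)] by (auto simp: insert_face_def)
  qed
  show "psum x (fst (insert_face g l f') + snd f') - psum x (fst (insert_face g l f')) =
      psum ?w (fst f' + snd f') - psum ?w (fst f')" if mem: "f' \<in> faces (n - l) ?w"
  proof -
    obtain h m where hm: "f' = (h, m)" "is_face (n - l) ?w h m" using mem by (auto simp: faces_def)
    show ?thesis
    proof (cases "h + m \<le> g")
      case True
      then show ?thesis using hm by (simp add: insert_face_def wl)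
    next
      case False
      then obtain i where "h = g + i" using dw[OF hm(2)] le_Suc_ex by blast
      then show ?thesis using hm False wr[of i] wr[of "i + m"] by (simp add: insert_face_def add_ac)
    qed
  qed
qed

text \<open>
  Probability that the first \<open>k\<close> elements of a size-biased permutation of \<open>F\<close>, of total length \<open>m\<close>,
  pass the tests \<open>R j l m'\<close>, where \<open>l\<close> is the length drawn at step \<open>j\<close> and \<open>m'\<close> the length remaining before that step.
\<close>

fun size_biased_weight ::
    "nat \<Rightarrow> 'f set \<Rightarrow> ('f \<Rightarrow> nat) \<Rightarrow> nat \<Rightarrow> (nat \<Rightarrow> nat \<Rightarrow> nat \<Rightarrow> bool) \<Rightarrow> ennreal"
  where
    "size_biased_weight 0 F len m R = 1"
  | "size_biased_weight (Suc k) F len m R = (\<Sum>f\<in>F. if R 0 (len f) m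
      then of_nat (len f) / of_nat m * size_biased_weight k (F - {f}) len (m - len f) (\<lambda>j. R (Suc j)) else 0)"

lemma size_biased_weight_bij:
  assumes "bij_betw \<phi> F F'" "\<And>f. f \<in> F \<Longrightarrow> len' (\<phi> f) = len f"
  shows "size_biased_weight k F' len' m R = size_biased_weight k F len m R"
  using assms
proof (induction k arbitrary: F F' m R)
  case (Suc k)
  have inj: "inj_on \<phi> F" and img: "F' = \<phi> ` F" using Suc.prems(1) by (auto simp: bij_betw_def)
  have IH: "size_biased_weight k (F' - {\<phi> f}) len' m R = size_biased_weight k (F - {f}) len m R"
    if "f \<in> F" for f m R
  proof (rule Suc.IH)
    show "bij_betw \<phi> (F - {f}) (F' - {\<phi> f})"
      using inj img that by (auto simp: bij_betw_def inj_on_def)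
  qed (use Suc.prems(2) in auto)
  show ?case
    unfolding size_biased_weight.simps img sum.reindex[OF inj] o_def
    by (intro sum.cong refl) (simp add: Suc.prems(2) IH[unfolded img])
qed simp

section \<open>Consequences of repeated removal for the random walk\<close>

context iid_walk
begin

text \<open>The set of faces takes finitely many values, each on a measurable event, so every
  function of it is measurable.\<close>

lemma measurable_of_faces:
  fixes \<Phi> :: "(nat \<times> nat) set \<Rightarrow> ennreal"
  shows "(\<lambda>x. \<Phi> (faces n x)) \<in> borel_measurable S"
proof -
  let ?A = "Pow ({..n} \<times> {..n})"
  have c: "finite ?A" by simp
  have "faces n \<in> measurable S (count_space ?A)"
    unfolding measurable_count_space_eq2[OF c]
  proof (intro conjI ballI)
    show "faces n \<in> space S \<rightarrow> ?A" by (auto simp: faces_def dest!: is_faceD)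
    fix A assume A: "A \<in> ?A"
    have 1: "faces n x \<subseteq> {..n} \<times> {..n}" for x by (auto simp: faces_def dest!: is_faceD)
    have 2: "p \<in> faces n x \<longleftrightarrow> is_face n x (fst p) (snd p)" for p x by (simp add: faces_def split_beta')
    have "faces n x = A \<longleftrightarrow> (\<forall>p\<in>{..n} \<times> {..n}. is_face n x (fst p) (snd p) \<longleftrightarrow> p \<in> A)" for x
      using 1[of x] A unfolding 2[symmetric] by blast
    then have "faces n -` {A} \<inter> space S = {x \<in> space S. \<forall>p\<in>{..n} \<times> {..n}. is_face n x (fst p) (snd p) \<longleftrightarrow> p \<in> A}"
      by auto
    also have "\<dots> \<in> sets S"
    proof (rule sets.sets_Collect_finite_All)
      fix p :: "nat \<times> nat"
      have "{x \<in> space S. is_face n x (fst p) (snd p)} \<in> sets S"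
        using measurable_is_face[of n "fst p" "snd p"] by (simp only: pred_def)
      then show "{x \<in> space S. is_face n x (fst p) (snd p) \<longleftrightarrow> p \<in> A} \<in> sets S"
        by (cases "p \<in> A") (simp_all only: simp_thms sets.sets_Collect_neg)
    qed simp
    finally show "faces n -` {A} \<inter> space S \<in> sets S" .
  qed
  then show ?thesis by (rule measurable_compose) simp
qed

text \<open>Divided by \<open>n\<close>: a face drawn with probability proportional to its length
  has a length uniform on \<open>{1..n}\<close>.\<close>

lemma nn_integral_sum_length_faces:
  "(\<integral>\<^sup>+x. (\<Sum>(g, l)\<in>faces n x. of_nat l * h l) \<partial>S) = (\<Sum>l\<in>{1..n}. h l)"
  using nn_integral_sum_faces[of "\<lambda>l _ _. h l" n] by (simp add: P.emeasure_space_1[simplified])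

lemma sum_length_faces_le: "(\<Sum>(g, l)\<in>faces n x. l) \<le> n"
proof -
  have "(\<Sum>(g, l)\<in>faces n x. l) = (\<Sum>f\<in>faces n x. card {fst f..<fst f + snd f})"
    by (simp add: split_beta')
  also have "\<dots> = card (\<Union>f\<in>faces n x. {fst f..<fst f + snd f})"
  proof (rule card_UN_disjoint[symmetric])
    show "\<forall>f\<in>faces n x. \<forall>f'\<in>faces n x. f \<noteq> f' \<longrightarrow> {fst f..<fst f + snd f} \<inter> {fst f'..<fst f' + snd f'} = {}"
    proof (intro ballI impI)
      fix f f' assume "f \<in> faces n x" "f' \<in> faces n x" "f \<noteq> f'"
      then have "is_face n x (fst f) (snd f)" "is_face n x (fst f') (snd f')" "(fst f, snd f) \<noteq> (fst f', snd f')"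
        by (auto simp: faces_def)
      from faces_disjoint[OF this] show "{fst f..<fst f + snd f} \<inter> {fst f'..<fst f' + snd f'} = {}"
        by auto
    qed
  qed auto
  also have "\<dots> \<le> card {..<n}"
    by (rule card_mono) (auto simp: faces_def dest!: is_faceD)
  finally show ?thesis by simp
qed

text \<open>Disjointness bounds the total length by \<open>n\<close>, and
  \<open>nn_integral_sum_length_faces\<close> with \<open>h = 1\<close> gives it the mean
  \<open>n\<close>; hence it equals \<open>n\<close> almost surely.\<close>

lemma AE_sum_length_faces: "AE x in S. (\<Sum>(g, l)\<in>faces n x. l) = n"
proof -
  have m: "(\<lambda>x. of_nat (\<Sum>(g, l)\<in>faces n x. l) :: ennreal) \<in> borel_measurable S"
    by (rule measurable_of_faces)
  have m': "(\<lambda>x. of_nat (n - (\<Sum>(g, l)\<in>faces n x. l)) :: ennreal) \<in> borel_measurable S"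
    by (rule measurable_of_faces)
  have "(\<integral>\<^sup>+x. of_nat (\<Sum>(g, l)\<in>faces n x. l) \<partial>S) = (of_nat n :: ennreal)"
    using nn_integral_sum_length_faces[where h = "\<lambda>_. 1", of n] by (simp add: split_beta')
  moreover have "(\<integral>\<^sup>+x. of_nat n \<partial>S) = (of_nat n :: ennreal)"
    using P.emeasure_space_1 by simp
  moreover have eq: "of_nat (\<Sum>(g, l)\<in>faces n x. l) + of_nat (n - (\<Sum>(g, l)\<in>faces n x. l)) = (of_nat n :: ennreal)" for x
    by (metis of_nat_add le_add_diff_inverse sum_length_faces_le)
  moreover have "(\<integral>\<^sup>+x. of_nat n \<partial>S) = (\<integral>\<^sup>+x. of_nat (\<Sum>(g, l)\<in>faces n x. l) \<partial>S) +
      (\<integral>\<^sup>+x. of_nat (n - (\<Sum>(g, l)\<in>faces n x. l)) \<partial>S :: ennreal)"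
    unfolding nn_integral_add[symmetric, OF m m'] eq ..
  ultimately have "of_nat n + (\<integral>\<^sup>+x. of_nat (n - (\<Sum>(g, l)\<in>faces n x. l)) \<partial>S) = (of_nat n + 0 :: ennreal)"
    by (simp only: add_0_right)
  then have "(\<integral>\<^sup>+x. of_nat (n - (\<Sum>(g, l)\<in>faces n x. l)) \<partial>S) = (0 :: ennreal)"
    unfolding ennreal_add_left_cancel by simp
  then have "AE x in S. of_nat (n - (\<Sum>(g, l)\<in>faces n x. l)) = (0 :: ennreal)"
    by (subst (asm) nn_integral_0_iff_AE[OF m'])
  then show ?thesis
    by eventually_elim (use sum_length_faces_le[of n] in \<open>auto simp: le_antisym\<close>)
qed

text \<open>Induction on the number of faces drawn. Given the first face, the excised walk is a
  fresh walk of length \<open>n - l\<close>, and the final value is the sum of the two totals; so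
  the hypothesis applies with \<open>\<psi>\<close> translated by the total of the face. The factor
  \<open>q 0\<close> bounds the proportion of admissible lengths, all \<open>n\<close> lengths being
  equally likely.\<close>

lemma nn_integral_size_biased_weight_le:
  fixes q :: "nat \<Rightarrow> real"
  assumes R: "\<And>j m. real (card {l \<in> {1..m}. R j l m}) \<le> q j * real m"
    and q: "\<And>j. 0 \<le> q j" and [measurable]: "\<psi> \<in> borel_measurable borel"
  shows "(\<integral>\<^sup>+x. size_biased_weight k (faces n x) snd n R * \<psi> (psum x n) \<partial>S) \<le>
    ennreal (\<Prod>j<k. q j) * (\<integral>\<^sup>+x. \<psi> (psum x n) \<partial>S)"
  using assms
proof (induction k arbitrary: n R q \<psi>)
  case (Suc k)
  note [measurable] = Suc.prems(3)
  let ?R = "\<lambda>j. R (Suc j)" and ?Q = "\<Prod>j<k. q (Suc j)"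
  have Q: "0 \<le> ?Q" using Suc.prems(2) by (intro prod_nonneg) auto
  \<comment> \<open>The factor \<open>l\<close> of \<open>nn_integral_sum_faces\<close> and the
    \<open>1 / n\<close> placed here form the size-biased probability \<open>l / n\<close>. The
    final value of the whole walk is restored as \<open>s + psum w (n - l)\<close>.\<close>
  define H where "H l s w = (if R 0 l n then 1 / of_nat n *
    (size_biased_weight k (faces (n - l) w) snd (n - l) ?R * \<psi> (s + psum w (n - l))) else 0)" for l s w
  have [measurable]: "(\<lambda>w. size_biased_weight k (faces m w) snd m' ?R) \<in> borel_measurable S" for m m'
    by (rule measurable_of_faces)
  have H: "(\<lambda>z. H l (fst z) (snd z)) \<in> borel_measurable (borel \<Otimes>\<^sub>M S)" for l
    unfolding H_def by measurable
  have "size_biased_weight (Suc k) (faces n x) snd n R * \<psi> (psum x n) =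
      (\<Sum>(g, l)\<in>faces n x. of_nat l * H l (psum x (g + l) - psum x g) (excise g l x))" for x
    unfolding size_biased_weight.simps sum_distrib_right
  proof (rule sum.cong[OF refl])
    fix f assume "f \<in> faces n x"
    then obtain g l where f: "f = (g, l)" "is_face n x g l" by (auto simp: faces_def)
    have l: "0 < l" "g + l \<le> n" using is_faceD[OF f(2)] by auto
    have "size_biased_weight k (faces n x - {f}) snd (n - l) ?R =
        size_biased_weight k (faces (n - l) (excise g l x)) snd (n - l) ?R"
      unfolding f(1) by (rule size_biased_weight_bij[OF faces_excise(1)[OF f(2)]]) (simp add: insert_face_def)
    moreover have "psum (excise g l x) (n - l) = psum x n - (psum x (g + l) - psum x g)"
      using l by (subst psum_excise_ge) auto
    ultimately show "(if R 0 (snd f) n then of_nat (snd f) / of_nat n *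
          size_biased_weight k (faces n x - {f}) snd (n - snd f) ?R else 0) * \<psi> (psum x n) =
        (case f of (g, l) \<Rightarrow> of_nat l * H l (psum x (g + l) - psum x g) (excise g l x))"
      unfolding f(1) H_def by (simp add: divide_ennreal_def mult_ac)
  qed
  then have "(\<integral>\<^sup>+x. size_biased_weight (Suc k) (faces n x) snd n R * \<psi> (psum x n) \<partial>S) =
      (\<Sum>l\<in>{1..n}. \<integral>\<^sup>+x. H l (psum x l) (\<lambda>i. x (l + i)) \<partial>S)"
    using nn_integral_sum_faces[of H n] H by simp
  also have "\<dots> = (\<Sum>l\<in>{1..n}. \<integral>\<^sup>+u. (\<integral>\<^sup>+w. H l (psum u l) w \<partial>S) \<partial>S)"
    by (intro sum.cong refl nn_integral_split H)
  also have "\<dots> \<le> (\<Sum>l\<in>{1..n}. if R 0 l n then 1 / of_nat n * (ennreal ?Q * (\<integral>\<^sup>+x. \<psi> (psum x n) \<partial>S)) else 0)"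
  proof (rule sum_mono)
    fix l assume l: "l \<in> {1..n}"
    let ?\<Psi> = "\<lambda>s w. \<psi> (s + psum w (n - l))"
    have m: "(\<lambda>z. ?\<Psi> (fst z) (snd z)) \<in> borel_measurable (borel \<Otimes>\<^sub>M S)" by measurable
    have "(\<integral>\<^sup>+u. (\<integral>\<^sup>+w. size_biased_weight k (faces (n - l) w) snd (n - l) ?R * \<psi> (psum u l + psum w (n - l)) \<partial>S) \<partial>S)
        \<le> (\<integral>\<^sup>+u. ennreal ?Q * (\<integral>\<^sup>+w. ?\<Psi> (psum u l) w \<partial>S) \<partial>S)"
      by (intro nn_integral_mono Suc.IH) (use Suc.prems in auto)
    also have "\<dots> = ennreal ?Q * (\<integral>\<^sup>+u. (\<integral>\<^sup>+w. ?\<Psi> (psum u l) w \<partial>S) \<partial>S)"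
      by (rule nn_integral_cmult) measurable
    \<comment> \<open>Block and rest are joined again, so that \<open>\<psi>\<close> sees the final
      value of a walk of length \<open>n\<close>.\<close>
    also have "(\<integral>\<^sup>+u. (\<integral>\<^sup>+w. ?\<Psi> (psum u l) w \<partial>S) \<partial>S) = (\<integral>\<^sup>+x. ?\<Psi> (psum x l) (\<lambda>i. x (l + i)) \<partial>S)"
      by (rule nn_integral_split[OF m, symmetric])
    also have "\<dots> = (\<integral>\<^sup>+x. \<psi> (psum x n) \<partial>S)"
      using l by (simp add: psum_shift)
    finally have *: "(\<integral>\<^sup>+u. (\<integral>\<^sup>+w. size_biased_weight k (faces (n - l) w) snd (n - l) ?R * \<psi> (psum u l + psum w (n - l)) \<partial>S) \<partial>S)
        \<le> ennreal ?Q * (\<integral>\<^sup>+x. \<psi> (psum x n) \<partial>S)" .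
    show "(\<integral>\<^sup>+u. (\<integral>\<^sup>+w. H l (psum u l) w \<partial>S) \<partial>S) \<le>
        (if R 0 l n then 1 / of_nat n * (ennreal ?Q * (\<integral>\<^sup>+x. \<psi> (psum x n) \<partial>S)) else 0)"
    proof (cases "R 0 l n")
      case True
      have "(\<integral>\<^sup>+u. (\<integral>\<^sup>+w. H l (psum u l) w \<partial>S) \<partial>S) = 1 / of_nat n *
        (\<integral>\<^sup>+u. (\<integral>\<^sup>+w. size_biased_weight k (faces (n - l) w) snd (n - l) ?R * \<psi> (psum u l + psum w (n - l)) \<partial>S) \<partial>S)"
        using True by (simp add: H_def nn_integral_cmult)
      then show ?thesis using * True by (simp add: mult_left_mono)
    qed (simp add: H_def)
  qed
  also have "\<dots> = of_nat (card {l \<in> {1..n}. R 0 l n}) * (1 / of_nat n * (ennreal ?Q * (\<integral>\<^sup>+x. \<psi> (psum x n) \<partial>S)))"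
    by (subst sum.inter_filter[symmetric]) simp_all
  also have "\<dots> = (of_nat (card {l \<in> {1..n}. R 0 l n}) / of_nat n) * (ennreal ?Q * (\<integral>\<^sup>+x. \<psi> (psum x n) \<partial>S))"
    by (simp add: divide_ennreal_def mult_ac)
  also have "\<dots> \<le> ennreal (q 0) * (ennreal ?Q * (\<integral>\<^sup>+x. \<psi> (psum x n) \<partial>S))"
  proof (cases "n = 0")
    case False
    have "real (card {l \<in> {1..n}. R 0 l n}) / real n \<le> q 0"
      using Suc.prems(1)[of n 0] False by (simp add: divide_le_eq)
    then have "ennreal (real (card {l \<in> {1..n}. R 0 l n}) / real n) \<le> ennreal (q 0)"
      by (rule ennreal_leI)
    then have "(of_nat (card {l \<in> {1..n}. R 0 l n}) / of_nat n :: ennreal) \<le> ennreal (q 0)"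
      using False by (simp add: ennreal_of_nat_eq_real_of_nat divide_ennreal)
    then show ?thesis by (rule mult_right_mono) simp
  qed simp
  also have "\<dots> = ennreal (\<Prod>j<Suc k. q j) * (\<integral>\<^sup>+x. \<psi> (psum x n) \<partial>S)"
    unfolding prod.lessThan_Suc_shift using Suc.prems(2) Q by (simp add: ennreal_mult mult_ac)
  finally show ?case .
qed simp

text \<open>The one-step formula is used twice: removing one face fixes its slope and leaves an
  independent walk, and removing a face from that walk replaces its slope by the mean of
  \<open>l'\<close> increments. A bound on the concentration of such means is therefore
  enough.\<close>

lemma nn_integral_close_slopes_le:
  fixes \<epsilon> :: real and b :: ennreal
  assumes b: "\<And>l c. 0 < l \<Longrightarrow> l \<le> n \<Longrightarrow> emeasure S {w. \<bar>psum w l / real l - c\<bar> < \<epsilon>} \<le> b"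
  shows "(\<integral>\<^sup>+x. (\<Sum>(g, l)\<in>faces n x. \<Sum>(g', l')\<in>faces n x - {(g, l)}. of_nat l * (of_nat l' *
      (if \<bar>(psum x (g + l) - psum x g) / real l - (psum x (g' + l') - psum x g') / real l'\<bar> < \<epsilon> then 1 else 0))) \<partial>S)
    \<le> of_nat (n * n) * b"
proof -
  define clo where "clo l l' s s' = (if \<bar>s' / real l' - s / real l\<bar> < \<epsilon> then 1 else (0::ennreal))" for l l' :: nat and s s' :: real
  define H where "H l s w = (\<Sum>(g', l')\<in>faces (n - l) w. of_nat l' * clo l l' s (psum w (g' + l') - psum w g'))" for l s w
  have [measurable]: "(\<lambda>z. clo l l' (f z) (h z)) \<in> borel_measurable N"
    if [measurable]: "f \<in> borel_measurable N" "h \<in> borel_measurable N" for l l' f h and N :: "'z measure"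
    unfolding clo_def by measurable
  have H: "(\<lambda>z. H l (fst z) (snd z)) \<in> borel_measurable (borel \<Otimes>\<^sub>M S)" for l
    unfolding H_def sum_faces clo_def by measurable
  have "(\<Sum>(g, l)\<in>faces n x. \<Sum>(g', l')\<in>faces n x - {(g, l)}. of_nat l * (of_nat l' *
      (if \<bar>(psum x (g + l) - psum x g) / real l - (psum x (g' + l') - psum x g') / real l'\<bar> < \<epsilon> then 1 else 0))) =
      (\<Sum>(g, l)\<in>faces n x. of_nat l * H l (psum x (g + l) - psum x g) (excise g l x))" for x
  proof (rule sum.cong[OF refl])
    fix f assume "f \<in> faces n x"
    then obtain g l where f: "f = (g, l)" "is_face n x g l" by (auto simp: faces_def)
    \<comment> \<open>By \<open>faces_excise\<close> the other faces, with their lengths and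
      increments, are those of the excised walk.\<close>
    have "H l (psum x (g + l) - psum x g) (excise g l x) =
        (\<Sum>(g', l')\<in>faces n x - {(g, l)}. of_nat l' * clo l l' (psum x (g + l) - psum x g) (psum x (g' + l') - psum x g'))"
      unfolding H_def split_beta'
      by (subst sum.reindex_bij_betw[OF faces_excise(1)[OF f(2)], symmetric])
        (rule sum.cong, simp_all add: faces_excise(2)[OF f(2), symmetric] insert_face_def)
    then show "(case f of (g, l) \<Rightarrow> (\<Sum>(g', l')\<in>faces n x - {(g, l)}. of_nat l * (of_nat l' *
      (if \<bar>(psum x (g + l) - psum x g) / real l - (psum x (g' + l') - psum x g') / real l'\<bar> < \<epsilon> then 1 else 0)))) =
      (case f of (g, l) \<Rightarrow> of_nat l * H l (psum x (g + l) - psum x g) (excise g l x))"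
      unfolding f(1) by (simp add: sum_distrib_left clo_def abs_minus_commute split_beta')
  qed
  then have "(\<integral>\<^sup>+x. (\<Sum>(g, l)\<in>faces n x. \<Sum>(g', l')\<in>faces n x - {(g, l)}. of_nat l * (of_nat l' *
      (if \<bar>(psum x (g + l) - psum x g) / real l - (psum x (g' + l') - psum x g') / real l'\<bar> < \<epsilon> then 1 else 0))) \<partial>S)
      = (\<Sum>l\<in>{1..n}. \<integral>\<^sup>+x. H l (psum x l) (\<lambda>i. x (l + i)) \<partial>S)"
    using nn_integral_sum_faces[of H n] H by simp
  also have "\<dots> = (\<Sum>l\<in>{1..n}. \<integral>\<^sup>+u. (\<integral>\<^sup>+w. H l (psum u l) w \<partial>S) \<partial>S)"
    by (intro sum.cong refl nn_integral_split H)
  also have "\<dots> \<le> (\<Sum>l\<in>{1..n}. of_nat n * b)"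
  proof (rule sum_mono)
    fix l assume "l \<in> {1..n}"
    have "(\<integral>\<^sup>+w. H l s w \<partial>S) \<le> of_nat n * b" for s
    proof -
      have "(\<integral>\<^sup>+w. H l s w \<partial>S) = (\<Sum>l'\<in>{1..n - l}. \<integral>\<^sup>+w. clo l l' s (psum w l') \<partial>S)"
        unfolding H_def
        by (rule nn_integral_sum_faces[of "\<lambda>l' s' _. clo l l' s s'"]) measurable
      also have "\<dots> \<le> (\<Sum>l'\<in>{1..n - l}. b)"
      proof (rule sum_mono)
        fix l' assume "l' \<in> {1..n - l}"
        then have l': "0 < l'" "l' \<le> n" by auto
        have "(\<integral>\<^sup>+w. clo l l' s (psum w l') \<partial>S) = (\<integral>\<^sup>+w. indicator {w. \<bar>psum w l' / real l' - s / real l\<bar> < \<epsilon>} w \<partial>S)"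
          by (intro nn_integral_cong) (simp add: clo_def)
        also have "\<dots> = emeasure S {w. \<bar>psum w l' / real l' - s / real l\<bar> < \<epsilon>}"
        proof (rule nn_integral_indicator)
          have "{w \<in> space S. \<bar>psum w l' / real l' - s / real l\<bar> < \<epsilon>} \<in> sets S" by measurable
          then show "{w. \<bar>psum w l' / real l' - s / real l\<bar> < \<epsilon>} \<in> sets S" by simp
        qed
        also have "\<dots> \<le> b" by (rule b[OF l'])
        finally show "(\<integral>\<^sup>+w. clo l l' s (psum w l') \<partial>S) \<le> b" .
      qed
      also have "\<dots> = of_nat (n - l) * b" by simp
      also have "\<dots> \<le> of_nat n * b" by (intro mult_right_mono) auto
      finally show ?thesis .
    qed
    then have "(\<integral>\<^sup>+u. (\<integral>\<^sup>+w. H l (psum u l) w \<partial>S) \<partial>S) \<le> (\<integral>\<^sup>+u. of_nat n * b \<partial>S)"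
      by (intro nn_integral_mono) auto
    also have "\<dots> = of_nat n * b" using P.emeasure_space_1 by simp
    finally show "(\<integral>\<^sup>+u. (\<integral>\<^sup>+w. H l (psum u l) w \<partial>S) \<partial>S) \<le> of_nat n * b" .
  qed
  also have "\<dots> = of_nat (n * n) * b" by (simp add: mult.assoc)
  finally show ?thesis .
qed

end

section \<open>Rejection sampling\<close>

lemma interval_containing_cases:
  obtains "interval_containing V s = {}"
  | a b where "consecutive V a b" "a < s" "s < b" "interval_containing V s = {a<..<b}"
proof (cases "\<exists>a b. consecutive V a b \<and> s \<in> {a<..<b}")
  case True
  then show ?thesis using interval_containing_eq[of V _ _ s] that(2) by auto
next
  case False
  then have "interval_containing V s = {}" unfolding interval_containing_def by blast
  then show ?thesis by (rule that(1))
qed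

lemma interval_containing_self: "y \<in> interval_containing V s \<Longrightarrow> s \<in> interval_containing V s"
  by (rule interval_containing_cases[of V s]) auto

lemma interval_containing_same:
  "y \<in> interval_containing V s \<Longrightarrow> interval_containing V y = interval_containing V s"
  by (rule interval_containing_cases[of V s]) (auto simp: interval_containing_eq)

lemma interval_containing_disjoint:
  assumes "s \<notin> interval_containing V t"
  shows "interval_containing V s \<inter> interval_containing V t = {}"
proof (rule ccontr)
  assume "\<not> ?thesis"
  then obtain y where y: "y \<in> interval_containing V s" "y \<in> interval_containing V t" by auto
  then have "interval_containing V s = interval_containing V t"
    using interval_containing_same by metis
  then show False using interval_containing_self[OF y(1)] assms by simp
qed

lemma open_interval_containing: "open (interval_containing V s)"
  by (rule interval_containing_cases[of V s]) auto

lemma interval_containing_subset: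
  assumes "V \<subseteq> {0<..<1}"
  shows "interval_containing V s \<subseteq> {0<..<1}"
proof (rule interval_containing_cases[of V s])
  fix a b assume "consecutive V a b" "interval_containing V s = {a<..<b}"
  moreover from this have "a \<in> {0<..<1}" "b \<in> {0<..<1}" using assms unfolding consecutive_def by blast+
  ultimately show ?thesis by auto
qed simp

text \<open>A union of open squares, hence open; this settles measurability jointly in both
  points.\<close>

lemma open_interval_containing_rel: "open {z. snd z \<in> interval_containing V (fst z)}"
proof -
  have "{z. snd z \<in> interval_containing V (fst z)} =
      (\<Union>(a, b)\<in>{(a, b). consecutive V a b}. {a<..<b} \<times> {a<..<b})"
  proof (intro equalityI subsetI)
    fix z assume "z \<in> {z. snd z \<in> interval_containing V (fst z)}"
    then obtain a b where "consecutive V a b" "fst z \<in> {a<..<b}" "snd z \<in> {a<..<b}"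
      unfolding interval_containing_def by blast
    then show "z \<in> (\<Union>(a, b)\<in>{(a, b). consecutive V a b}. {a<..<b} \<times> {a<..<b})"
      by (intro UN_I[of "(a, b)"]) (simp_all add: mem_Times_iff)
  next
    fix z assume "z \<in> (\<Union>(a, b)\<in>{(a, b). consecutive V a b}. {a<..<b} \<times> {a<..<b})"
    then obtain a b where "consecutive V a b" "fst z \<in> {a<..<b}" "snd z \<in> {a<..<b}"
      by (auto simp: mem_Times_iff)
    then show "z \<in> {z. snd z \<in> interval_containing V (fst z)}"
      using interval_containing_eq[of V a b "fst z"] by simp
  qed
  also have "open \<dots>" by (auto intro!: open_UN open_Times)
  finally show ?thesis .
qed

lemma measurable_interval_containing_rel:
  assumes "f \<in> borel_measurable N" "g \<in> borel_measurable N"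
  shows "Measurable.pred N (\<lambda>z. g z \<in> interval_containing V (f z))"
proof -
  have "Measurable.pred (borel :: (real \<times> real) measure) (\<lambda>z. snd z \<in> interval_containing V (fst z))"
    using open_interval_containing_rel[of V] by (simp add: pred_def borel_open)
  from measurable_compose[OF borel_measurable_Pair[OF assms] this] show ?thesis by simp
qed

lemma measurable_length_interval_containing:
  "(\<lambda>s. measure lborel (interval_containing V s)) \<in> borel_measurable borel"
proof -
  let ?Q = "{z. snd z \<in> interval_containing V (fst z)}"
  have "?Q \<in> sets (borel \<Otimes>\<^sub>M lborel)"
    using borel_open[OF open_interval_containing_rel[of V]]
    by (simp add: borel_prod[symmetric] cong: sets_pair_measure_cong)
  then have "(\<lambda>s. emeasure lborel (Pair s -` ?Q)) \<in> borel_measurable borel"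
    by (rule lborel.measurable_emeasure_Pair)
  then show ?thesis unfolding measure_def by (simp add: vimage_def)
qed

text \<open>
  Discovery when the points of \<open>C\<close> count as already covered. Unlike \<open>discovery_index\<close>, it
  admits a recursion on the first sample point.
\<close>

fun discovery_index_from :: "real set \<Rightarrow> real set \<Rightarrow> (nat \<Rightarrow> real) \<Rightarrow> nat \<Rightarrow> nat"
  where
    "discovery_index_from V C u 0 = (LEAST i. u i \<notin> C)"
  | "discovery_index_from V C u (Suc n) =
      (LEAST i. discovery_index_from V C u n < i \<and> u i \<notin> C \<and>
        (\<forall>j\<le>n. u i \<notin> interval_containing V (u (discovery_index_from V C u j))))"

lemma discovery_index_from_empty: "discovery_index_from V {} u n = discovery_index V u n"
proof (induction n rule: less_induct)
  case (less n)
  show ?case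
  proof (cases n)
    case 0
    then show ?thesis by (simp add: Least_eq_0)
  next
    case (Suc m)
    then have "discovery_index_from V {} u j = discovery_index V u j" if "j \<le> m" for j
      using less that by simp
    then show ?thesis unfolding Suc by (simp cong: conj_cong)
  qed
qed

text \<open>\<open>V\<close> and \<open>C\<close> may vary with \<open>z\<close>, so that the lemma
  serves for a fixed vertex set as well as for the random one.\<close>

lemma measurable_discovery_index_from:
  assumes u [measurable]: "\<And>i. (\<lambda>z. u z i) \<in> borel_measurable N"
    and C [measurable]: "\<And>i. Measurable.pred N (\<lambda>z. u z i \<in> C z)"
    and J: "\<And>f g. f \<in> borel_measurable N \<Longrightarrow> g \<in> borel_measurable N \<Longrightarrow>
      Measurable.pred N (\<lambda>z. g z \<in> interval_containing (V z) (f z))"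
  shows "(\<lambda>z. discovery_index_from (V z) (C z) (u z) n) \<in> measurable N (count_space UNIV)"
proof (induction n rule: less_induct)
  case (less n)
  show ?case
  proof (cases n)
    case 0
    then show ?thesis by simp
  next
    case (Suc m)
    have d [measurable]: "(\<lambda>z. discovery_index_from (V z) (C z) (u z) j) \<in> measurable N (count_space UNIV)" if "j \<le> m" for j
      using less Suc that by simp
    have 1: "{z \<in> space N. discovery_index_from (V z) (C z) (u z) m < i} \<in> sets N" for i
      using d[of m] by measurable
    have 2: "{z \<in> space N. u z i \<notin> C z} \<in> sets N" for i
      by (rule sets.sets_Collect_neg[OF C[unfolded pred_def]])
    have 3: "{z \<in> space N. \<forall>j\<le>m. u z i \<notin> interval_containing (V z) (u z (discovery_index_from (V z) (C z) (u z) j))} \<in> sets N" for i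
    proof (rule sets.sets_Collect_countable_All)
      fix j
      show "{z \<in> space N. j \<le> m \<longrightarrow>
          u z i \<notin> interval_containing (V z) (u z (discovery_index_from (V z) (C z) (u z) j))} \<in> sets N"
      proof (cases "j \<le> m")
        case True
        have "(\<lambda>z. u z (discovery_index_from (V z) (C z) (u z) j)) \<in> borel_measurable N"
          by (rule measurable_compose_countable[OF u d[OF True]])
        from sets.sets_Collect_neg[OF J[OF this u, unfolded pred_def]] True show ?thesis by simp
      qed simp
    qed
    show ?thesis unfolding Suc discovery_index_from.simps
      by (rule measurable_Least) (simp only: pred_def sets.sets_Collect_conj 1 2 3)
  qed
qed

text \<open>
  If all intervals found stay away from \<open>0\<close> and the sample points come close to \<open>0\<close> again and again, then
  every \<open>LEAST\<close> in the definition of the discovery times is attained.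
\<close>

definition bounded_away_0 :: "real set \<Rightarrow> bool"
  where "bounded_away_0 C \<longleftrightarrow> (\<exists>e>0. C \<inter> {0<..<e} = {})"

definition recurrent_0 :: "(nat \<Rightarrow> real) \<Rightarrow> bool"
  where "recurrent_0 u \<longleftrightarrow> (\<forall>m N. \<exists>i\<ge>N. u i \<in> {0<..<1 / real (Suc m)})"

lemma bounded_away_0_Un: "bounded_away_0 C \<Longrightarrow> bounded_away_0 D \<Longrightarrow> bounded_away_0 (C \<union> D)"
proof -
  assume "bounded_away_0 C" "bounded_away_0 D"
  then obtain c d where "c > 0" "C \<inter> {0<..<c} = {}" "d > 0" "D \<inter> {0<..<d} = {}"
    unfolding bounded_away_0_def by blast
  then show ?thesis unfolding bounded_away_0_def
    by (intro exI[of _ "min c d"]) (auto simp: disjoint_iff)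
qed

lemma bounded_away_0_interval_containing: "V \<subseteq> {0<..<1} \<Longrightarrow> bounded_away_0 (interval_containing V s)"
proof (rule interval_containing_cases[of V s])
  assume "interval_containing V s = {}"
  then show ?thesis unfolding bounded_away_0_def by (intro exI[of _ 1]) simp
next
  fix a b assume "V \<subseteq> {0<..<1}" "consecutive V a b" "interval_containing V s = {a<..<b}"
  moreover from this have "a \<in> {0<..<1}" unfolding consecutive_def by blast
  ultimately show ?thesis unfolding bounded_away_0_def by (intro exI[of _ a]) auto
qed

lemma ex_outside:
  assumes "bounded_away_0 C" "recurrent_0 u"
  shows "\<exists>i\<ge>N. u i \<notin> C"
proof -
  obtain e where e: "e > 0" "C \<inter> {0<..<e} = {}" using assms(1) unfolding bounded_away_0_def by blast
  obtain m where m: "1 / real (Suc m) < e" using e(1) nat_approx_posE by blast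
  obtain i where "i \<ge> N" "u i \<in> {0<..<1 / real (Suc m)}" using assms(2) unfolding recurrent_0_def by blast
  then show ?thesis using e(2) m by (intro exI[of _ i]) (auto simp: disjoint_iff)
qed

lemma bounded_away_0_UN:
  "finite A \<Longrightarrow> (\<And>a. a \<in> A \<Longrightarrow> bounded_away_0 (D a)) \<Longrightarrow> bounded_away_0 (\<Union>a\<in>A. D a)"
proof (induction A rule: finite_induct)
  case empty
  show ?case unfolding bounded_away_0_def by (intro exI[of _ 1]) simp
qed (auto intro: bounded_away_0_Un)

context
  fixes V C :: "real set" and u :: "nat \<Rightarrow> real" and s :: real
  assumes V: "V \<subseteq> {0<..<1}" and C: "bounded_away_0 C" and u: "recurrent_0 u"
begin

text \<open>Finitely many intervals are excluded; together with \<open>C\<close> they stay away from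
  0, where sample points keep arriving.\<close>

lemma ex_new:
  fixes n N :: nat
  shows "\<exists>i. N < i \<and> u i \<notin> C \<and> (\<forall>j\<le>n. u i \<notin> interval_containing V (t j))"
proof -
  have "bounded_away_0 (C \<union> (\<Union>j\<in>{..n}. interval_containing V (t j)))"
    by (intro bounded_away_0_Un bounded_away_0_UN C bounded_away_0_interval_containing V) simp
  from ex_outside[OF this u, of "Suc N"] show ?thesis by (auto simp: Suc_le_eq)
qed

text \<open>\<open>Least_Suc\<close> shifts a \<open>LEAST\<close> only if some index satisfies its
  condition; \<open>ex_new\<close> supplies one at every stage.\<close>

lemma discovery_index_from_skip:
  assumes s: "s \<in> C"
  shows "discovery_index_from V C (case_nat s u) n = Suc (discovery_index_from V C u n)"
proof (induction n rule: less_induct)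
  case (less n)
  show ?case
  proof (cases n)
    case 0
    obtain i where "u i \<notin> C" using ex_new[of 0 0 "\<lambda>_. 0"] by auto
    then have "(LEAST i. case_nat s u i \<notin> C) = Suc (LEAST i. case_nat s u (Suc i) \<notin> C)"
      by (intro Least_Suc[of _ "Suc i"]) (use s in auto)
    then show ?thesis unfolding 0 by simp
  next
    case (Suc m)
    have IH: "discovery_index_from V C (case_nat s u) j = Suc (discovery_index_from V C u j)" if "j \<le> m" for j
      using less Suc that by simp
    let ?P = "\<lambda>i. discovery_index_from V C (case_nat s u) m < i \<and> case_nat s u i \<notin> C \<and>
        (\<forall>j\<le>m. case_nat s u i \<notin> interval_containing V (case_nat s u (discovery_index_from V C (case_nat s u) j)))"
    have P: "?P (Suc i) \<longleftrightarrow> discovery_index_from V C u m < i \<and> u i \<notin> C \<and>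
        (\<forall>j\<le>m. u i \<notin> interval_containing V (u (discovery_index_from V C u j)))" for i
      by (simp add: IH cong: conj_cong)
    obtain i where "?P (Suc i)"
      unfolding P using ex_new[of "discovery_index_from V C u m" m "\<lambda>j. u (discovery_index_from V C u j)"] by blast
    then have "(LEAST i. ?P i) = Suc (LEAST i. ?P (Suc i))"
      by (rule Least_Suc) simp
    then show ?thesis unfolding Suc P by simp
  qed
qed

text \<open>A first point outside \<open>C\<close> adds its interval to the covered set, and the
  remaining points are searched afresh with this larger set.\<close>

lemma discovery_index_from_hit:
  assumes s: "s \<notin> C"
  shows "discovery_index_from V C (case_nat s u) 0 = 0"
    and "discovery_index_from V C (case_nat s u) (Suc n) =
      Suc (discovery_index_from V (C \<union> interval_containing V s) u n)"
proof -
  show 0: "discovery_index_from V C (case_nat s u) 0 = 0"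
    using s by (simp add: Least_eq_0)
  show "discovery_index_from V C (case_nat s u) (Suc n) =
      Suc (discovery_index_from V (C \<union> interval_containing V s) u n)"
  proof (induction n rule: less_induct)
    case (less n)
    let ?d = "discovery_index_from V C (case_nat s u)"
    let ?d' = "discovery_index_from V (C \<union> interval_containing V s) u"
    let ?P = "\<lambda>i. ?d n < i \<and> case_nat s u i \<notin> C \<and>
        (\<forall>j\<le>n. case_nat s u i \<notin> interval_containing V (case_nat s u (?d j)))"
    have IH: "?d (Suc j) = Suc (?d' j)" if "j < n" for j using less that by simp
    obtain i where "?P (Suc i)"
      using ex_new[of "?d n" n "\<lambda>j. case_nat s u (?d j)"] by (auto intro: less_SucI)
    then have L: "?d (Suc n) = Suc (LEAST i. ?P (Suc i))"
      unfolding discovery_index_from.simps by (rule Least_Suc) simp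
    show "?d (Suc n) = Suc (?d' n)"
    proof (cases n)
      case 0
      then show ?thesis unfolding L using s by (simp add: Least_eq_0)
    next
      case (Suc m)
      have *: "(\<forall>j\<le>n. Q (?d j)) \<longleftrightarrow> Q 0 \<and> (\<forall>j\<le>m. Q (Suc (?d' j)))" for Q
      proof -
        have "(\<forall>j\<le>n. Q (?d j)) \<longleftrightarrow> Q (?d 0) \<and> (\<forall>j\<le>m. Q (?d (Suc j)))"
          unfolding Suc by (metis Suc_le_mono le0 not0_implies_Suc)
        then show ?thesis using IH Suc by (simp only: 0) auto
      qed
      have P: "?P (Suc i) \<longleftrightarrow> ?d' m < i \<and> u i \<notin> C \<union> interval_containing V s \<and>
          (\<forall>j\<le>m. u i \<notin> interval_containing V (u (?d' j)))" for i
        unfolding *[of "\<lambda>d. case_nat s u (Suc i) \<notin> interval_containing V (case_nat s u d)"]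
        using IH[of m] Suc by auto
      have "?d' n = (LEAST i. ?d' m < i \<and> u i \<notin> C \<union> interval_containing V s \<and>
          (\<forall>j\<le>m. u i \<notin> interval_containing V (u (?d' j))))"
        unfolding Suc by (rule discovery_index_from.simps(2))
      then show ?thesis by (simp only: L P)
    qed
  qed
qed

end

section \<open>Independent uniform points and the rejection identity\<close>

definition unif :: "real measure"
  where "unif = uniform_measure lborel {0<..<1}"

lemma prob_space_unif: "prob_space unif"
  unfolding unif_def by (rule prob_space_uniform_measure) simp_all

lemma sets_unif [simp, measurable_cong]: "sets unif = sets borel"
  by (simp add: unif_def)

lemma space_unif [simp]: "space unif = UNIV"
  by (simp add: unif_def)

lemma emeasure_unif: "A \<in> sets borel \<Longrightarrow> emeasure unif A = emeasure lborel ({0<..<1} \<inter> A)"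
  by (simp add: unif_def divide_ennreal_def)

lemma measure_unif: "A \<in> sets borel \<Longrightarrow> A \<subseteq> {0<..<1} \<Longrightarrow> measure unif A = measure lborel A"
  by (simp add: measure_def emeasure_unif Int_absorb1)

interpretation Unif: prob_space unif
  by (rule prob_space_unif)

interpretation U: sequence_space unif
  unfolding sequence_space_def product_prob_space_def product_prob_space_axioms_def product_sigma_finite_def
  using prob_space_unif by (simp add: prob_space_imp_sigma_finite)

lemma space_seq [simp]: "space U.S = UNIV"
  by (auto simp: space_PiM)

lemma measurable_seq_coord [measurable]: "(\<lambda>u. u i) \<in> borel_measurable U.S"
  using measurable_component_singleton[of i UNIV "\<lambda>_. unif"] by (simp cong: measurable_cong_sets)

lemma measurable_seqI: "(\<And>i. (\<lambda>z. f z i) \<in> borel_measurable N) \<Longrightarrow> f \<in> measurable N U.S"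
  by (rule measurable_PiM_single') (auto cong: measurable_cong_sets)

lemma nn_integral_seq:
  assumes [measurable]: "F \<in> borel_measurable U.S"
  shows "(\<integral>\<^sup>+u. F u \<partial>U.S) = (\<integral>\<^sup>+s. (\<integral>\<^sup>+u. F (case_nat s u) \<partial>U.S) \<partial>unif)"
proof -
  have m: "(\<lambda>(s, u). case_nat s u) \<in> measurable (unif \<Otimes>\<^sub>M U.S) U.S" by measurable
  have "(\<integral>\<^sup>+u. F u \<partial>U.S) = (\<integral>\<^sup>+u. F u \<partial>distr (unif \<Otimes>\<^sub>M U.S) U.S (\<lambda>(s, u). case_nat s u))"
    by (simp only: U.PiM_iter)
  also have "\<dots> = (\<integral>\<^sup>+z. F (case_nat (fst z) (snd z)) \<partial>(unif \<Otimes>\<^sub>M U.S))"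
    by (subst nn_integral_distr[OF m]) (simp_all add: split_beta')
  also have "\<dots> = (\<integral>\<^sup>+s. (\<integral>\<^sup>+u. F (case_nat s u) \<partial>U.S) \<partial>unif)"
    by (subst U.P.nn_integral_fst[symmetric]) simp_all
  finally show ?thesis .
qed

text \<open>\<open>K\<close> consecutive points all miss an interval of length \<open>p\<close> with
  probability \<open>(1 - p) ^ K\<close>, which tends to 0.\<close>

lemma AE_recurrent_0: "AE u in U.S. recurrent_0 u"
proof -
  have "AE u in U.S. \<exists>i\<ge>N. u i \<in> {0<..<1 / real (Suc m)}" for m N
  proof -
    let ?I = "{0<..<1 / real (Suc m)}"
    let ?p = "1 / real (Suc m)"
    have p: "0 < ?p" "?p \<le> 1" by auto
    have I: "measure unif (- ?I) = 1 - ?p"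
    proof -
      have "?I \<subseteq> {0<..<1}" using order_less_le_trans[OF _ p(2)] by (auto simp del: of_nat_Suc)
      then have "measure unif ?I = ?p"
        by (subst measure_unif) (use p in \<open>auto simp del: of_nat_Suc\<close>)
      then show ?thesis using prob_space.prob_compl[OF prob_space_unif, of ?I] by (simp add: Compl_eq_Diff_UNIV)
    qed
    let ?A = "{u \<in> space U.S. \<forall>i\<ge>N. u i \<notin> ?I}"
    have A: "?A \<in> sets U.S" by measurable
    have "measure U.S ?A \<le> (1 - ?p) ^ K" for K
    proof -
      have "measure U.S ?A \<le> measure U.S {u \<in> space U.S. \<forall>i\<in>{N..<N + K}. u i \<in> - ?I}"
      proof (rule U.P.finite_measure_mono)
        show "{u \<in> space U.S. \<forall>i\<in>{N..<N + K}. u i \<in> - ?I} \<in> sets U.S" by measurable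
      qed auto
      also have "\<dots> = (\<Prod>i\<in>{N..<N + K}. measure unif (- ?I))"
        using U.emeasure_PiM_Collect[of "{N..<N + K}" "\<lambda>_. - ?I"]
        by (simp add: U.P.emeasure_eq_measure Unif.emeasure_eq_measure prod_ennreal prod_nonneg ennreal_power)
      also have "\<dots> = (1 - ?p) ^ K" unfolding I by simp
      finally show ?thesis .
    qed
    moreover have "(\<lambda>K. (1 - ?p) ^ K) \<longlonglongrightarrow> 0"
      by (rule LIMSEQ_power_zero) (use p in auto)
    ultimately have "measure U.S ?A \<le> 0"
      by (intro LIMSEQ_le_const[of "\<lambda>K. (1 - ?p) ^ K"]) auto
    then have "measure U.S ?A = 0" using measure_nonneg[of U.S ?A] by linarith
    then have "?A \<in> null_sets U.S" using A by (simp add: null_sets_def U.P.emeasure_eq_measure)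
    then have "AE u in U.S. u \<notin> ?A" by (rule AE_not_in)
    then show ?thesis by eventually_elim auto
  qed
  then show ?thesis unfolding recurrent_0_def by (simp add: AE_all_countable)
qed

text \<open>
  Instead of waiting for a sample point outside the intervals found so far, one may use exactly the first \<open>k\<close>
  points, weighted by the inverse probabilities of the accepted regions.
\<close>

definition size_biased_density ::
    "(real \<Rightarrow> real set) \<Rightarrow> (real \<Rightarrow> real) \<Rightarrow> nat \<Rightarrow> real set \<Rightarrow> real \<Rightarrow> (nat \<Rightarrow> real \<Rightarrow> real \<Rightarrow> bool) \<Rightarrow> (nat \<Rightarrow> real) \<Rightarrow> ennreal"
  where "size_biased_density J len k C c R u = (\<Prod>j<k.
    if u j \<notin> C \<and> (\<forall>i<j. u j \<notin> J (u i)) \<and> R j (len (u j)) (1 - c - (\<Sum>i<j. len (u i)))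
    then ennreal (1 / (1 - c - (\<Sum>i<j. len (u i)))) else 0)"

lemma size_biased_density_0 [simp]: "size_biased_density J len 0 C c R u = 1"
  by (simp add: size_biased_density_def)

lemma size_biased_density_Suc:
  "size_biased_density J len (Suc k) C c R (case_nat s u) =
    (if s \<notin> C \<and> R 0 (len s) (1 - c)
     then ennreal (1 / (1 - c)) * size_biased_density J len k (C \<union> J s) (c + len s) (\<lambda>j. R (Suc j)) u else 0)"
proof -
  have *: "(\<forall>i<Suc j. u j \<notin> J (case_nat s u i)) \<longleftrightarrow> u j \<notin> J s \<and> (\<forall>i<j. u j \<notin> J (u i))" for j
    unfolding All_less_Suc2 by simp
  have **: "1 - c - (len s + x) = 1 - (c + len s) - x" for x by simp
  show ?thesis
    unfolding size_biased_density_def prod.lessThan_Suc_shift sum.lessThan_Suc_shift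
    by (simp add: * ** conj_assoc cong: if_cong)
qed

lemma measurable_size_biased_density:
  assumes u [measurable]: "\<And>i. (\<lambda>z. u z i) \<in> borel_measurable N"
    and C: "\<And>i. Measurable.pred N (\<lambda>z. u z i \<in> C z)"
    and J: "\<And>i j. Measurable.pred N (\<lambda>z. u z j \<in> J z (u z i))"
    and len [measurable]: "\<And>i. (\<lambda>z. len z (u z i)) \<in> borel_measurable N"
    and R: "\<And>j. Measurable.pred (borel \<Otimes>\<^sub>M borel) (\<lambda>p. R j (fst p) (snd p))"
  shows "(\<lambda>z. size_biased_density (J z) (len z) k (C z) c R (u z)) \<in> borel_measurable N"
proof -
  have 1: "{z \<in> space N. u z j \<notin> C z} \<in> sets N" for j
    by (rule sets.sets_Collect_neg[OF C[unfolded pred_def]])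
  have 2: "{z \<in> space N. \<forall>i<j. u z j \<notin> J z (u z i)} \<in> sets N" for j
  proof (rule sets.sets_Collect_countable_All)
    fix i show "{z \<in> space N. i < j \<longrightarrow> u z j \<notin> J z (u z i)} \<in> sets N"
      using sets.sets_Collect_neg[OF J[unfolded pred_def], of j i] by (cases "i < j") simp_all
  qed
  have 3: "{z \<in> space N. R j (len z (u z j)) (1 - c - (\<Sum>i<j. len z (u z i)))} \<in> sets N" for j
  proof -
    have "(\<lambda>z. (len z (u z j), 1 - c - (\<Sum>i<j. len z (u z i)))) \<in> measurable N (borel \<Otimes>\<^sub>M borel)"
      by measurable
    from measurable_compose[OF this R[of j]] show ?thesis by (simp add: pred_def)
  qed
  show ?thesis unfolding size_biased_density_def
    by (intro borel_measurable_prod_ennreal measurable_If sets.sets_Collect_conj 1 2 3) measurable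
qed

text \<open>Condition on the first sample point. With probability \<open>c\<close>, the measure of
  \<open>C\<close>, it is wasted and the search starts again; otherwise its interval may join
  \<open>C\<close>. The probability \<open>Q\<close> in question thus satisfies
  \<open>Q = Q * c + A\<close>, so \<open>Q = A / (1 - c)\<close>, and \<open>1 / (1 - c)\<close> is
  the weight in \<open>size_biased_density\<close>. The covered set is general for the sake of the
  induction, and the last condition on it makes the measures of new intervals add up.\<close>

theorem rejection_sampling:
  assumes V: "V \<subseteq> {0<..<1}"
    and C: "C \<in> sets borel" "C \<subseteq> {0<..<1}" "bounded_away_0 C"
      "\<And>s. s \<notin> C \<Longrightarrow> interval_containing V s \<inter> C = {}"
    and R: "\<And>j. Measurable.pred (borel \<Otimes>\<^sub>M borel) (\<lambda>p. R j (fst p) (snd p))"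
  defines "J \<equiv> interval_containing V" and "len \<equiv> \<lambda>s. measure lborel (interval_containing V s)"
  shows "(\<integral>\<^sup>+u. (if \<forall>j<k. R j (len (u (discovery_index_from V C u j)))
        (1 - measure unif C - (\<Sum>i<j. len (u (discovery_index_from V C u i)))) then 1 else 0) \<partial>U.S) =
    (\<integral>\<^sup>+u. size_biased_density J len k C (measure unif C) R u \<partial>U.S)"
  using C R
proof (induction k arbitrary: C R)
  case 0
  then show ?case by simp
next
  case (Suc k)
  note C = Suc.prems(1-4) and R = Suc.prems(5)
  define F where "F n C R u \<longleftrightarrow> (\<forall>j<n. R j (len (u (discovery_index_from V C u j)))
        (1 - measure unif C - (\<Sum>i<j. len (u (discovery_index_from V C u i)))))"
    for n C and R :: "nat \<Rightarrow> real \<Rightarrow> real \<Rightarrow> bool" and u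
  have len_meas [measurable]: "len \<in> borel_measurable borel"
    unfolding len_def by (rule measurable_length_interval_containing)
  have J_rel: "Measurable.pred N (\<lambda>z. g z \<in> J (f z))" if "f \<in> borel_measurable N" "g \<in> borel_measurable N"
    for f g and N :: "'z measure"
    unfolding J_def by (rule measurable_interval_containing_rel[OF that])
  have JC: "C \<union> J s \<in> sets borel" "C \<union> J s \<subseteq> {0<..<1}" "bounded_away_0 (C \<union> J s)"
      "\<And>t. t \<notin> C \<union> J s \<Longrightarrow> interval_containing V t \<inter> (C \<union> J s) = {}"
      "measure unif (C \<union> J s) = measure unif C + len s" if s: "s \<notin> C" for s
  proof -
    show 1: "C \<union> J s \<in> sets borel"
      using C(1) borel_open[OF open_interval_containing[of V s]] unfolding J_def by (rule sets.Un)
    show 2: "C \<union> J s \<subseteq> {0<..<1}"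
      using C(2) interval_containing_subset[OF V] unfolding J_def by blast
    show "bounded_away_0 (C \<union> J s)"
      unfolding J_def by (intro bounded_away_0_Un C(3) bounded_away_0_interval_containing V)
    show "interval_containing V t \<inter> (C \<union> J s) = {}" if "t \<notin> C \<union> J s" for t
      using C(4)[of t] interval_containing_disjoint[of t V s] that unfolding J_def by blast
    have "measure unif (C \<union> J s) = measure unif C + measure unif (J s)"
      by (rule Unif.finite_measure_Union)
        (use C(1) C(4)[OF s] borel_open[OF open_interval_containing[of V s]] in \<open>auto simp: J_def\<close>)
    also have "measure unif (J s) = len s"
      unfolding len_def J_def
      by (rule measure_unif[OF borel_open[OF open_interval_containing] interval_containing_subset[OF V]])
    finally show "measure unif (C \<union> J s) = measure unif C + len s" .
  qed
  \<comment> \<open>Being away from 0, \<open>C\<close> leaves out an interval of positive measure,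
    so dividing by \<open>1 - c\<close> is legitimate.\<close>
  have c1: "measure unif C < 1"
  proof -
    obtain e where e: "e > 0" "C \<inter> {0<..<e} = {}" using C(3) unfolding bounded_away_0_def by blast
    let ?e = "min e 1"
    have "measure unif C \<le> measure unif {?e..<1}"
      using e(2) C(2) by (intro Unif.finite_measure_mono) (force simp: not_less)+
    also have "\<dots> = 1 - ?e"
      by (subst measure_unif) (use e(1) in auto)
    also have "\<dots> < 1" using e(1) by simp
    finally show ?thesis .
  qed
  have d_meas: "(\<lambda>u. discovery_index_from V C u j) \<in> measurable U.S (count_space UNIV)" if "C \<in> sets borel" for C j
  proof (rule measurable_discovery_index_from)
    show "Measurable.pred U.S (\<lambda>u. u i \<in> C)" for i using that by measurable
  qed (auto intro: measurable_interval_containing_rel)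
  have F_meas [measurable]: "Measurable.pred U.S (F n C R)"
    if C: "C \<in> sets borel" and R: "\<And>j. Measurable.pred (borel \<Otimes>\<^sub>M borel) (\<lambda>p. R j (fst p) (snd p))" for n C R
  proof -
    have [measurable]: "(\<lambda>u. len (u (discovery_index_from V C u j))) \<in> borel_measurable U.S" for j
      by (rule measurable_compose[OF measurable_compose_countable[OF measurable_seq_coord d_meas[OF C]] len_meas])
    have 1: "Measurable.pred U.S (\<lambda>u. R j (len (u (discovery_index_from V C u j)))
        (1 - measure unif C - (\<Sum>i<j. len (u (discovery_index_from V C u i)))))" for j
    proof -
      have "(\<lambda>u. (len (u (discovery_index_from V C u j)),
          1 - measure unif C - (\<Sum>i<j. len (u (discovery_index_from V C u i))))) \<in> measurable U.S (borel \<Otimes>\<^sub>M borel)"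
        by measurable
      from measurable_compose[OF this R[of j]] show ?thesis by simp
    qed
    have "F n C R = (\<lambda>u. \<forall>j\<in>{..<n}. R j (len (u (discovery_index_from V C u j)))
        (1 - measure unif C - (\<Sum>i<j. len (u (discovery_index_from V C u i)))))"
      by (auto simp: F_def fun_eq_iff)
    also have "Measurable.pred U.S \<dots>"
      by (intro pred_intros_finite 1) simp
    finally show ?thesis .
  qed
  let ?c = "measure unif C" and ?R = "\<lambda>j. R (Suc j)"
  have skip: "F (Suc k) C R (case_nat s u) \<longleftrightarrow> F (Suc k) C R u" if "s \<in> C" "recurrent_0 u" for s u
    unfolding F_def by (simp add: discovery_index_from_skip[OF V C(3) that(2,1)])
  have hit: "F (Suc k) C R (case_nat s u) \<longleftrightarrow> R 0 (len s) (1 - ?c) \<and> F k (C \<union> J s) ?R u"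
    if "s \<notin> C" "recurrent_0 u" for s u
    unfolding F_def All_less_Suc2 JC(5)[OF that(1)] sum.lessThan_Suc_shift
    by (simp only: discovery_index_from_hit[OF V C(3) that(2,1)] nat.case J_def lessThan_0 sum.empty
        diff_diff_eq add.assoc add_0_right)
  define Q where "Q = (\<integral>\<^sup>+u. (if F (Suc k) C R u then 1 else 0) \<partial>U.S)"
  define q where "q s = (\<integral>\<^sup>+u. (if F k (C \<union> J s) ?R u then 1 else 0) \<partial>U.S)" for s
  define A where "A = (\<integral>\<^sup>+s. (if s \<notin> C \<and> R 0 (len s) (1 - ?c) then q s else 0) \<partial>unif)"
  have mF: "Measurable.pred U.S (F (Suc k) C R)" using F_meas[OF C(1) R] .
  have R0 [measurable]: "Measurable.pred borel (\<lambda>s. R 0 (len s) (1 - ?c))"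
  proof -
    have "(\<lambda>s. (len s, 1 - ?c)) \<in> measurable borel (borel \<Otimes>\<^sub>M borel)" by measurable
    from measurable_compose[OF this R[of 0]] show ?thesis by simp
  qed
  have inner: "(\<integral>\<^sup>+u. (if F (Suc k) C R (case_nat s u) then 1 else 0) \<partial>U.S) =
      Q * indicator C s + (if s \<notin> C \<and> R 0 (len s) (1 - ?c) then q s else 0)" for s
  proof (cases "s \<in> C")
    case True
    have "(\<integral>\<^sup>+u. (if F (Suc k) C R (case_nat s u) then 1 else 0) \<partial>U.S) = Q"
      unfolding Q_def using AE_recurrent_0 by (intro nn_integral_cong_AE) (auto elim!: eventually_mono simp: skip[OF True])
    then show ?thesis using True by simp
  next
    case False
    have "(\<integral>\<^sup>+u. (if F (Suc k) C R (case_nat s u) then 1 else 0) \<partial>U.S) =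
        (\<integral>\<^sup>+u. (if R 0 (len s) (1 - ?c) \<and> F k (C \<union> J s) ?R u then 1 else 0) \<partial>U.S)"
      using AE_recurrent_0 by (intro nn_integral_cong_AE) (auto elim!: eventually_mono simp: hit[OF False])
    then show ?thesis using False by (simp add: q_def)
  qed
  have dens: "(\<lambda>z. size_biased_density J len n C c R (f z)) \<in> borel_measurable N"
    if "f \<in> measurable N U.S" "C \<in> sets borel"
      "\<And>j. Measurable.pred (borel \<Otimes>\<^sub>M borel) (\<lambda>p. R j (fst p) (snd p))" for n C c R f and N :: "'z measure"
  proof (rule measurable_size_biased_density)
    show [measurable]: "(\<lambda>z. f z i) \<in> borel_measurable N" for i
      by (rule measurable_compose[OF that(1) measurable_seq_coord])
    show "Measurable.pred N (\<lambda>z. f z i \<in> C)" for i using that(2) by measurable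
    show "Measurable.pred N (\<lambda>z. f z j \<in> J (f z i))" for i j by (rule J_rel) measurable
    show "(\<lambda>z. len (f z i)) \<in> borel_measurable N" for i by measurable
  qed (rule that(3))
  have q_dens: "(\<integral>\<^sup>+u. size_biased_density J len k (C \<union> J s) (?c + len s) ?R u \<partial>U.S) = q s" if "s \<notin> C" for s
    using Suc.IH[of "C \<union> J s" ?R] JC[OF that] R unfolding q_def F_def by simp
  have dens_Suc: "(\<integral>\<^sup>+u. size_biased_density J len (Suc k) C ?c R (case_nat s u) \<partial>U.S) =
      ennreal (1 / (1 - ?c)) * (if s \<notin> C \<and> R 0 (len s) (1 - ?c) then q s else 0)" for s
  proof (cases "s \<notin> C \<and> R 0 (len s) (1 - ?c)")
    case True
    have "(\<integral>\<^sup>+u. size_biased_density J len (Suc k) C ?c R (case_nat s u) \<partial>U.S) =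
        ennreal (1 / (1 - ?c)) * (\<integral>\<^sup>+u. size_biased_density J len k (C \<union> J s) (?c + len s) ?R u \<partial>U.S)"
      unfolding size_biased_density_Suc using True JC(1) R
      by (simp add: nn_integral_cmult dens[OF measurable_ident_sets[OF refl]])
    then show ?thesis using True q_dens by simp
  next
    case False
    then show ?thesis by (cases "s \<in> C") (simp_all add: size_biased_density_Suc)
  qed
  have mD: "(\<lambda>u. size_biased_density J len (Suc k) C ?c R u) \<in> borel_measurable U.S"
    by (rule dens[OF measurable_ident_sets[OF refl] C(1) R])
  \<comment> \<open>Measurability of the hit term is read off from \<open>inner\<close>: outside
    \<open>C\<close> it equals an integral with parameter, and the indicator of the complement
    removes the other term.\<close>
  have mA: "(\<lambda>s. if s \<notin> C \<and> R 0 (len s) (1 - ?c) then q s else 0) \<in> borel_measurable unif"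
  proof -
    have "(\<lambda>(s, u). case_nat s u) \<in> measurable (unif \<Otimes>\<^sub>M U.S) U.S" by measurable
    from measurable_compose[OF this mF]
    have "(\<lambda>z. if F (Suc k) C R (case_nat (fst z) (snd z)) then 1 else 0 :: ennreal) \<in> borel_measurable (unif \<Otimes>\<^sub>M U.S)"
      by (intro measurable_If) (simp_all add: pred_def split_beta')
    then have "(\<lambda>s. \<integral>\<^sup>+u. (if F (Suc k) C R (case_nat s u) then 1 else 0) \<partial>U.S) \<in> borel_measurable unif"
      by (intro U.P.borel_measurable_nn_integral[of "\<lambda>s u. if F (Suc k) C R (case_nat s u) then 1 else 0"]) (simp only: split_beta')
    then have "(\<lambda>s. (Q * indicator C s + (if s \<notin> C \<and> R 0 (len s) (1 - ?c) then q s else 0)) * indicator (- C) s)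
        \<in> borel_measurable unif"
      unfolding inner by (rule borel_measurable_times_ennreal) (rule borel_measurable_indicator, use C(1) in \<open>simp add: borel_comp\<close>)
    also have "(\<lambda>s. (Q * indicator C s + (if s \<notin> C \<and> R 0 (len s) (1 - ?c) then q s else 0)) * indicator (- C) s) =
        (\<lambda>s. if s \<notin> C \<and> R 0 (len s) (1 - ?c) then q s else 0)"
      by (auto simp: fun_eq_iff indicator_def)
    finally show ?thesis .
  qed
  have "Q = (\<integral>\<^sup>+s. (\<integral>\<^sup>+u. (if F (Suc k) C R (case_nat s u) then 1 else 0) \<partial>U.S) \<partial>unif)"
    unfolding Q_def by (rule nn_integral_seq) (use mF in measurable)
  also have "\<dots> = Q * emeasure unif C + A"
  proof -
    have "(\<lambda>s. Q * indicator C s) \<in> borel_measurable unif"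
      by (intro borel_measurable_times_ennreal borel_measurable_const borel_measurable_indicator) (simp add: C(1))
    from nn_integral_add[OF this mA] show ?thesis
      unfolding inner A_def using C(1) by (simp only: nn_integral_cmult_indicator sets_unif)
  qed
  finally have QA: "Q = Q * ennreal ?c + A" by (simp add: Unif.emeasure_eq_measure)
  have Q1: "Q \<le> 1"
  proof -
    have "Q \<le> (\<integral>\<^sup>+u. 1 \<partial>U.S)" unfolding Q_def by (intro nn_integral_mono) auto
    then show ?thesis using U.P.emeasure_space_1 by simp
  qed
  \<comment> \<open>The equation for \<open>Q\<close> cannot be solved by subtraction in
    \<open>ennreal\<close>; both quantities are finite, so it is solved in the reals.\<close>
  obtain qr where qr: "Q = ennreal qr" "0 \<le> qr" using Q1 by (cases Q) (auto simp: top_unique)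
  have "A \<le> Q" by (subst QA) simp
  then obtain ar where ar: "A = ennreal ar" "0 \<le> ar" using Q1 by (cases A) (auto simp: top_unique)
  have "ennreal qr = ennreal (qr * ?c + ar)"
    using QA unfolding qr(1) ar(1) using qr(2) ar(2) by (simp add: ennreal_mult ennreal_plus)
  then have "qr = qr * ?c + ar" using qr(2) ar(2) by (subst (asm) ennreal_inj) auto
  then have "qr = 1 / (1 - ?c) * ar" using c1 by (simp add: field_simps)
  then have "Q = ennreal (1 / (1 - ?c)) * A"
    unfolding qr(1) ar(1) using c1 ar(2) by (simp add: ennreal_mult[symmetric])
  also have "\<dots> = (\<integral>\<^sup>+s. (\<integral>\<^sup>+u. size_biased_density J len (Suc k) C ?c R (case_nat s u) \<partial>U.S) \<partial>unif)"
    unfolding dens_Suc A_def by (rule nn_integral_cmult[OF mA, symmetric])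
  also have "\<dots> = (\<integral>\<^sup>+u. size_biased_density J len (Suc k) C ?c R u \<partial>U.S)"
    by (rule nn_integral_seq[OF mD, symmetric])
  finally show ?case unfolding Q_def F_def .
qed

section \<open>Brownian motion has no supporting line at a fixed time\<close>

context prob_space
begin

lemma prob_std_normal_ge_1_pos: "0 < (\<integral>\<^sup>+x. ennreal (std_normal_density x) * indicator {1..} x \<partial>lborel)"
proof (rule ccontr)
  assume "\<not> ?thesis"
  then have "(\<integral>\<^sup>+x. ennreal (std_normal_density x) * indicator {1..} x \<partial>lborel) = 0" by (simp add: zero_less_iff_neq_zero)
  then have "AE x in lborel. ennreal (std_normal_density x) * indicator {1..} x = 0"
    by (subst (asm) nn_integral_0_iff_AE) auto
  then have "AE x in lborel. x \<notin> {1..2::real}"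
  proof eventually_elim
    case (elim x)
    then show ?case using normal_density_pos[of 1 0 x] by (auto simp: indicator_def split: if_splits)
  qed
  then have "{1..2::real} \<in> null_sets lborel" by (simp add: AE_iff_null_sets)
  then show False by (simp add: null_sets_def)
qed

text \<open>
  The variances \<open>c / (fact j)\<^sup>2\<close> decay so fast that \<open>Y j\<close> is dominated by its independent part \<open>Y j - Y (j + 1)\<close>
  while its square root scale beats every linear bound.
\<close>

lemma AE_exceeds_linear:
  fixes Y :: "nat \<Rightarrow> 'a \<Rightarrow> real"
  assumes c: "0 < c" and s_def: "\<And>j. s j = sqrt c / fact j"
  defines "X \<equiv> \<lambda>j \<omega>. Y j \<omega> - Y (Suc j) \<omega>"
  assumes Y: "\<And>j. distributed M lborel (Y j) (normal_density 0 (s j))"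
    and X: "\<And>j. 0 < j \<Longrightarrow> distributed M lborel (X j) (normal_density 0 (sqrt ((s j)\<^sup>2 - (s (Suc j))\<^sup>2)))"
    and ind: "\<And>J a. finite J \<Longrightarrow> J \<noteq> {} \<Longrightarrow>
      prob {\<omega> \<in> space M. \<forall>j\<in>J. X j \<omega> < a j} = (\<Prod>j\<in>J. prob {\<omega> \<in> space M. X j \<omega> < a j})"
  shows "AE \<omega> in M. \<forall>b. \<exists>j. b * (s j)\<^sup>2 < Y j \<omega>"
proof -
  have s0: "0 < s j" for j unfolding s_def using c by simp
  have sS: "s (Suc j) = s j / real (Suc j)" for j by (simp add: s_def field_simps)
  \<comment> \<open>The index 0 is exceptional: \<open>fact 0 = fact 1\<close> gives
    \<open>s 0 = s 1\<close>, and the variance of \<open>X 0\<close> would be 0.\<close>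
  have sle: "s (Suc j) \<le> s j / 2" if "0 < j" for j
    unfolding sS using s0[of j] that by (intro divide_left_mono) auto
  define r where "r j = sqrt ((s j)\<^sup>2 - (s (Suc j))\<^sup>2)" for j
  \<comment> \<open>At least the fraction \<open>3 / 4\<close> of the variance remains, and the
    square root of \<open>3 / 4\<close> exceeds \<open>3 / 4\<close>.\<close>
  have r: "3 / 4 * s j \<le> r j" if "0 < j" for j
  proof -
    have "(s (Suc j))\<^sup>2 \<le> (s j / 2)\<^sup>2" using sle[OF that] s0[of "Suc j"] by (intro power_mono) auto
    then have "(s (Suc j))\<^sup>2 \<le> (s j)\<^sup>2 / 4" by (simp add: power_divide)
    moreover have "(3 / 4 * s j)\<^sup>2 = 9 / 16 * (s j)\<^sup>2" by (simp add: power2_eq_square)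
    ultimately have "(3 / 4 * s j)\<^sup>2 \<le> (s j)\<^sup>2 - (s (Suc j))\<^sup>2"
      using zero_le_power2[of "s j"] by linarith
    then show ?thesis unfolding r_def by (rule real_le_rsqrt)
  qed
  have r0: "0 < r j" if "0 < j" for j using r[OF that] s0[of j] by simp
  have [measurable]: "Y j \<in> borel_measurable M" for j using distributed_measurable[OF Y[of j]] by simp
  have [measurable]: "X j \<in> borel_measurable M" for j unfolding X_def by measurable
  define p where "p = enn2real (\<integral>\<^sup>+x. ennreal (std_normal_density x) * indicator {1..} x \<partial>lborel)"
  have pX: "prob {\<omega> \<in> space M. r j \<le> X j \<omega>} = p" if "0 < j" for j
  proof -
    have "distributed M lborel (\<lambda>\<omega>. (X j \<omega> - 0) / r j) std_normal_density"
      using X[OF that] normal_standard_normal_convert[OF r0[OF that], of "X j" 0] by (simp add: r_def)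
    from distributed_emeasure[OF this, of "{1..}"]
    have "emeasure M ((\<lambda>\<omega>. (X j \<omega> - 0) / r j) -` {1..} \<inter> space M) =
      (\<integral>\<^sup>+x. ennreal (std_normal_density x) * indicator {1..} x \<partial>lborel)" by simp
    also have "(\<lambda>\<omega>. (X j \<omega> - 0) / r j) -` {1..} \<inter> space M = {\<omega> \<in> space M. r j \<le> X j \<omega>}"
      using r0[OF that] by (auto simp: field_simps)
    finally show ?thesis by (simp add: measure_def p_def)
  qed
  have p0: "0 < p"
  proof -
    have "emeasure M {\<omega> \<in> space M. r 1 \<le> X 1 \<omega>} = (\<integral>\<^sup>+x. ennreal (std_normal_density x) * indicator {1..} x \<partial>lborel)"
    proof -
      have "distributed M lborel (\<lambda>\<omega>. (X 1 \<omega> - 0) / r 1) std_normal_density"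
        using X[of 1] normal_standard_normal_convert[OF r0[of 1], of "X 1" 0] by (simp add: r_def)
      from distributed_emeasure[OF this, of "{1..}"]
      have "emeasure M ((\<lambda>\<omega>. (X 1 \<omega> - 0) / r 1) -` {1..} \<inter> space M) =
        (\<integral>\<^sup>+x. ennreal (std_normal_density x) * indicator {1..} x \<partial>lborel)" by simp
      also have "(\<lambda>\<omega>. (X 1 \<omega> - 0) / r 1) -` {1..} \<inter> space M = {\<omega> \<in> space M. r 1 \<le> X 1 \<omega>}"
        using r0[of 1] by (auto simp: field_simps)
      finally show ?thesis .
    qed
    then have "0 < emeasure M {\<omega> \<in> space M. r 1 \<le> X 1 \<omega>}" using prob_std_normal_ge_1_pos by simp
    then have "0 < prob {\<omega> \<in> space M. r 1 \<le> X 1 \<omega>}" by (simp add: emeasure_eq_measure)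
    then show ?thesis by (simp add: pX)
  qed
  have p1: "p \<le> 1" using pX[of 1] prob_le_1 by (metis zero_less_one)
  \<comment> \<open>The events that \<open>X j\<close> exceeds its standard deviation are
    independent and have the same probability \<open>p > 0\<close>, so almost surely they occur
    arbitrarily late.\<close>
  have io: "AE \<omega> in M. \<exists>j\<ge>N. r j \<le> X j \<omega>" if N: "0 < N" for N
  proof -
    let ?A = "{\<omega> \<in> space M. \<forall>j\<ge>N. X j \<omega> < r j}"
    have A: "?A \<in> sets M" by measurable
    have "prob ?A \<le> (1 - p) ^ Suc K" for K
    proof -
      have "prob ?A \<le> prob {\<omega> \<in> space M. \<forall>j\<in>{N..<N + Suc K}. X j \<omega> < r j}"
        by (rule finite_measure_mono) auto
      also have "\<dots> = (\<Prod>j\<in>{N..<N + Suc K}. prob {\<omega> \<in> space M. X j \<omega> < r j})"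
        by (rule ind) auto
      also have "\<dots> = (\<Prod>j\<in>{N..<N + Suc K}. 1 - p)"
      proof (rule prod.cong[OF refl])
        fix j assume "j \<in> {N..<N + Suc K}"
        then have "0 < j" using N by simp
        have "prob {\<omega> \<in> space M. X j \<omega> < r j} = prob (space M - {\<omega> \<in> space M. r j \<le> X j \<omega>})"
          by (rule arg_cong[where f = prob]) auto
        also have "\<dots> = 1 - p" using pX[OF \<open>0 < j\<close>] by (subst prob_compl) auto
        finally show "prob {\<omega> \<in> space M. X j \<omega> < r j} = 1 - p" .
      qed
      also have "\<dots> = (1 - p) ^ Suc K" by simp
      finally show ?thesis .
    qed
    moreover have "(\<lambda>K. (1 - p) ^ Suc K) \<longlonglongrightarrow> 0"
      by (rule LIMSEQ_Suc, rule LIMSEQ_power_zero) (use p0 p1 in auto)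
    ultimately have "prob ?A \<le> 0"
      by (intro LIMSEQ_le_const[of "\<lambda>K. (1 - p) ^ Suc K"]) auto
    then have "prob ?A = 0" using measure_nonneg[of M ?A] by linarith
    then have "?A \<in> null_sets M" using A by (simp add: null_sets_def emeasure_eq_measure)
    then have "AE \<omega> in M. \<omega> \<notin> ?A" by (rule AE_not_in)
    then show ?thesis using AE_space by eventually_elim (auto simp: not_less)
  qed
  \<comment> \<open>Chebyshev's inequality bounds the exceptional probabilities by
    \<open>4 / (j + 1)^2\<close>, a summable sequence: consecutive standard deviations have the
    quotient \<open>j + 1\<close>, which is what the factorial is for.\<close>
  have ev: "AE \<omega> in M. eventually (\<lambda>j. \<bar>Y (Suc j) \<omega>\<bar> < s j / 2) sequentially"
  proof -
    let ?E = "\<lambda>j. {\<omega> \<in> space M. s j / 2 \<le> \<bar>Y (Suc j) \<omega>\<bar>}"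
    have le: "prob (?E j) \<le> 4 / (real (Suc j))\<^sup>2" for j
    proof -
      have e: "expectation (Y (Suc j)) = 0" by (rule normal_distributed_expectation[OF s0 Y])
      have v: "variance (Y (Suc j)) = (s (Suc j))\<^sup>2" by (rule normal_distributed_variance[OF s0 Y])
      have "integrable M (\<lambda>\<omega>. (Y (Suc j) \<omega>)\<^sup>2)"
        using distributed_integrable[OF Y[of "Suc j"], of "\<lambda>x. x\<^sup>2"] integrable_normal_moment[OF s0[of "Suc j"], of 0 2] by simp
      from Chebyshev_inequality[OF _ this, of "s j / 2"]
      have "prob (?E j) \<le> (s (Suc j))\<^sup>2 / (s j / 2)\<^sup>2" using s0[of j] v unfolding e by simp
      also have "\<dots> = 4 / (real (Suc j))\<^sup>2" using s0[of j] unfolding sS power_divide by (simp del: of_nat_Suc)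
      finally show ?thesis .
    qed
    have "summable (\<lambda>j. 4 * inverse ((real (Suc j))\<^sup>2))"
      by (intro summable_mult) (use inverse_power_summable[of 2, where 'a = real] in \<open>subst summable_Suc_iff, simp\<close>)
    then have "summable (\<lambda>j. prob (?E j))"
    proof (rule summable_comparison_test'[where N = 0])
      show "norm (prob (?E j)) \<le> 4 * inverse ((real (Suc j))\<^sup>2)" for j
        using le[of j] by (simp only: real_norm_def abs_of_nonneg measure_nonneg divide_inverse)
    qed
    then have "AE \<omega> in M. eventually (\<lambda>j. \<omega> \<in> space M - ?E j) sequentially"
      by (intro borel_cantelli_AE1) (auto simp: emeasure_eq_measure)
    then show ?thesis
      by eventually_elim (auto elim!: eventually_mono simp: not_le)
  qed
  have "AE \<omega> in M. \<forall>N. 0 < N \<longrightarrow> (\<exists>j\<ge>N. r j \<le> X j \<omega>)"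
    using io by (auto simp: AE_all_countable)
  then show ?thesis using ev
  proof eventually_elim
    case (elim \<omega>)
    show ?case
    proof
      fix b
      have "(\<lambda>j. b * (sqrt c * (1 / fact j))) \<longlonglongrightarrow> b * (sqrt c * 0)"
        by (intro tendsto_intros) (use summable_LIMSEQ_zero[OF summable_exp[of 1]] in \<open>simp add: inverse_eq_divide\<close>)
      then have "(\<lambda>j. b * s j) \<longlonglongrightarrow> 0" by (simp add: s_def)
      then have "eventually (\<lambda>j. b * s j < 1 / 4) sequentially" by (rule order_tendstoD) simp
      with elim(2) have "eventually (\<lambda>j. b * s j < 1 / 4 \<and> \<bar>Y (Suc j) \<omega>\<bar> < s j / 2) sequentially"
        by eventually_elim simp
      then obtain N where N: "\<And>j. N \<le> j \<Longrightarrow> b * s j < 1 / 4 \<and> \<bar>Y (Suc j) \<omega>\<bar> < s j / 2"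
        unfolding eventually_sequentially by blast
      obtain j where j: "Suc N \<le> j" "r j \<le> X j \<omega>" using elim(1) by blast
      \<comment> \<open>In units of \<open>s j\<close>: \<open>X j\<close> contributes at least
        \<open>3 / 4\<close>, \<open>Y (Suc j)\<close> takes away less than \<open>1 / 2\<close>,
        and \<open>b * (s j)\<^sup>2\<close> is at most \<open>1 / 4\<close>.\<close>
      then have "b * s j < 1 / 4" "\<bar>Y (Suc j) \<omega>\<bar> < s j / 2" "3 / 4 * s j \<le> X j \<omega>"
        using N[of j] r[of j] by auto
      moreover have "b * (s j)\<^sup>2 \<le> 1 / 4 * s j"
        using \<open>b * s j < 1 / 4\<close> mult_right_mono[of "b * s j" "1 / 4" "s j"] s0[of j] by (simp add: power2_eq_square)
      ultimately show "\<exists>j. b * (s j)\<^sup>2 < Y j \<omega>"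
        unfolding X_def by (intro exI[of _ j]) linarith
    qed
  qed
qed

end

text \<open>For a continuous path and an interior time this is contact of the path with its
  majorant; at 0 and at 1 it says that the growth away from the end point is at most linear.\<close>

definition touches :: "(real \<Rightarrow> real) \<Rightarrow> real \<Rightarrow> bool"
  where "touches f t \<longleftrightarrow> (\<exists>b. \<forall>y\<in>{0..1}. f y \<le> f t + b * (y - t))"

lemma indep_prod_increments:
  assumes "prob_space M" and B: "standard_brownian_motion M B"
    and t: "\<And>i. 0 \<le> t i" "\<And>i. t i \<le> (1 :: real)" "\<And>i. t i \<le> t (Suc i)"
    and J: "finite J" "J \<noteq> {}" and A: "\<And>j. A j \<in> sets borel"
  shows "measure M {\<omega> \<in> space M. \<forall>j\<in>J. B (t (Suc j)) \<omega> - B (t j) \<omega> \<in> A j} =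
    (\<Prod>j\<in>J. measure M {\<omega> \<in> space M. B (t (Suc j)) \<omega> - B (t j) \<omega> \<in> A j})"
proof -
  interpret prob_space M by fact
  obtain n where n: "J \<subseteq> {..<n}" using finite_nat_iff_bounded[of J] J(1) by auto
  have "indep_vars (\<lambda>_. borel) (\<lambda>i \<omega>. B (t (Suc i)) \<omega> - B (t i) \<omega>) {..<n}"
    using B t unfolding standard_brownian_motion_def by blast
  from indep_varsD[OF this J(2,1) n, of A] A
  have "prob (\<Inter>j\<in>J. (\<lambda>\<omega>. B (t (Suc j)) \<omega> - B (t j) \<omega>) -` A j \<inter> space M) =
      (\<Prod>j\<in>J. prob ((\<lambda>\<omega>. B (t (Suc j)) \<omega> - B (t j) \<omega>) -` A j \<inter> space M))" by blast
  moreover have "(\<Inter>j\<in>J. (\<lambda>\<omega>. B (t (Suc j)) \<omega> - B (t j) \<omega>) -` A j \<inter> space M) =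
      {\<omega> \<in> space M. \<forall>j\<in>J. B (t (Suc j)) \<omega> - B (t j) \<omega> \<in> A j}"
    using J(2) by auto
  moreover have "(\<lambda>\<omega>. B (t (Suc j)) \<omega> - B (t j) \<omega>) -` A j \<inter> space M =
      {\<omega> \<in> space M. B (t (Suc j)) \<omega> - B (t j) \<omega> \<in> A j}" for j by auto
  ultimately show ?thesis by simp
qed

text \<open>The times \<open>t + (s j)\<^sup>2\<close> approach \<open>t\<close> from the right, and
  the increment up to them has standard deviation \<open>s j\<close>. So
  \<open>AE_exceeds_linear\<close> says that the path beats every multiple of the elapsed
  time.\<close>

lemma AE_not_touches_left:
  assumes M: "prob_space M" and B: "standard_brownian_motion M B" and t: "0 \<le> t" "t < 1"
  shows "AE \<omega> in M. \<not> touches (\<lambda>y. B y \<omega>) t"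
proof -
  interpret prob_space M by fact
  define s where "s j = sqrt (1 - t) / fact j" for j :: nat
  have s: "0 < s j" "s (Suc j) \<le> s j" "(s j)\<^sup>2 \<le> 1 - t" for j
  proof -
    show "0 < s j" "s (Suc j) \<le> s j" for j using t by (auto simp: s_def intro!: divide_left_mono fact_mono)
    have "s j \<le> sqrt (1 - t)" using t by (auto simp: s_def divide_le_eq fact_ge_1 mult_left_le)
    then have "(s j)\<^sup>2 \<le> (sqrt (1 - t))\<^sup>2" using \<open>0 < s j\<close> by (intro power_mono) auto
    then show "(s j)\<^sup>2 \<le> 1 - t" using t by simp
  qed
  have sq: "(s (Suc j))\<^sup>2 \<le> (s j)\<^sup>2" for j using s[of "Suc j"] s[of j] by (intro power_mono) auto
  have sq_anti: "(s j)\<^sup>2 \<le> (s i)\<^sup>2" if "i \<le> j" for i j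
    using lift_Suc_antimono_le[of "\<lambda>j. (s j)\<^sup>2"] sq that by blast
  have sq_less: "(s (Suc j))\<^sup>2 < (s j)\<^sup>2" if "0 < j" for j
  proof -
    have "s (Suc j) < s j" using t that by (auto simp: s_def divide_simps)
    then show ?thesis using s[of "Suc j"] by (intro power_strict_mono) auto
  qed
  let ?Y = "\<lambda>j \<omega>. B (t + (s j)\<^sup>2) \<omega> - B t \<omega>"
  have normal: "distributed M lborel (\<lambda>\<omega>. B b \<omega> - B a \<omega>) (normal_density 0 (sqrt (b - a)))"
    if "0 \<le> a" "a < b" "b \<le> 1" for a b
    using B that unfolding standard_brownian_motion_def by blast
  have "AE \<omega> in M. \<forall>b. \<exists>j. b * (s j)\<^sup>2 < ?Y j \<omega>"
  proof (rule AE_exceeds_linear[of "1 - t" s ?Y])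
    show "s j = sqrt (1 - t) / fact j" for j by (rule s_def)
    fix j
    show "distributed M lborel (?Y j) (normal_density 0 (s j))"
      using normal[of t "t + (s j)\<^sup>2"] t s[of j] by simp
    show "distributed M lborel (\<lambda>\<omega>. ?Y j \<omega> - ?Y (Suc j) \<omega>) (normal_density 0 (sqrt ((s j)\<^sup>2 - (s (Suc j))\<^sup>2)))"
      if "0 < j"
      using normal[of "t + (s (Suc j))\<^sup>2" "t + (s j)\<^sup>2"] t s[of j] s(1)[of "Suc j"] sq_less[OF that] by simp
  next
    fix J :: "nat set" and a assume J: "finite J" "J \<noteq> {}"
    obtain n where n: "\<And>j. j \<in> J \<Longrightarrow> j < n" using finite_nat_iff_bounded[of J] J(1) by auto
    \<comment> \<open>Independence is stated for increasing times while \<open>s j\<close>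
      decreases, hence the index \<open>n - i\<close>; from \<open>n\<close> on the sequence is
      constant so as to remain monotone.\<close>
    define u where "u i = t + (if i \<le> n then (s (n - i))\<^sup>2 else (s 0)\<^sup>2)" for i
    have u: "0 \<le> u i" "u i \<le> 1" "u i \<le> u (Suc i)" for i
      using t s(3)[of "n - i"] s(3)[of 0] sq_anti[of "n - Suc i" "n - i"] sq_anti[of 0 "n - i"] by (auto simp: u_def)
    define J' where "J' = (\<lambda>j. n - Suc j) ` J"
    have inj: "inj_on (\<lambda>j. n - Suc j) J" using n by (auto simp: inj_on_def) (metis Suc_diff_Suc diff_diff_cancel less_imp_le nat.inject)
    have uj: "B (u (Suc (n - Suc j))) \<omega> - B (u (n - Suc j)) \<omega> = ?Y j \<omega> - ?Y (Suc j) \<omega>" if "j \<in> J" for j \<omega>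
    proof -
      have "Suc (n - Suc j) = n - j" "n - (n - j) = j" "n - (n - Suc j) = Suc j" using n[OF that] by auto
      then show ?thesis unfolding u_def by simp
    qed
    have "prob {\<omega> \<in> space M. \<forall>i\<in>J'. B (u (Suc i)) \<omega> - B (u i) \<omega> \<in> {..<a (n - Suc i)}} =
        (\<Prod>i\<in>J'. prob {\<omega> \<in> space M. B (u (Suc i)) \<omega> - B (u i) \<omega> \<in> {..<a (n - Suc i)}})"
      by (rule indep_prod_increments[where t = u and J = J' and A = "\<lambda>i. {..<a (n - Suc i)}", OF M B u]) (use J in \<open>auto simp: J'_def\<close>)
    moreover have q: "B (u (Suc (n - Suc j))) \<omega> - B (u (n - Suc j)) \<omega> \<in> {..<a (n - Suc (n - Suc j))} \<longleftrightarrow>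
        ?Y j \<omega> - ?Y (Suc j) \<omega> < a j" if "j \<in> J" for j \<omega>
    proof -
      have "n - Suc (n - Suc j) = j" using n[OF that] by auto
      then show ?thesis by (simp only: uj[OF that] lessThan_iff)
    qed
    moreover have bi: "(\<forall>i\<in>J'. P i) \<longleftrightarrow> (\<forall>j\<in>J. P (n - Suc j))" for P by (simp add: J'_def)
    moreover have "{\<omega> \<in> space M. \<forall>i\<in>J'. B (u (Suc i)) \<omega> - B (u i) \<omega> \<in> {..<a (n - Suc i)}} =
        {\<omega> \<in> space M. \<forall>j\<in>J. ?Y j \<omega> - ?Y (Suc j) \<omega> < a j}"
      unfolding bi by (intro Collect_cong conj_cong refl ball_cong q)
    moreover have "(\<Prod>i\<in>J'. prob {\<omega> \<in> space M. B (u (Suc i)) \<omega> - B (u i) \<omega> \<in> {..<a (n - Suc i)}}) =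
        (\<Prod>j\<in>J. prob {\<omega> \<in> space M. ?Y j \<omega> - ?Y (Suc j) \<omega> < a j})"
      unfolding J'_def prod.reindex[OF inj] o_def by (intro prod.cong refl arg_cong[where f = prob] Collect_cong conj_cong q)
    ultimately show "prob {\<omega> \<in> space M. \<forall>j\<in>J. ?Y j \<omega> - ?Y (Suc j) \<omega> < a j} =
        (\<Prod>j\<in>J. prob {\<omega> \<in> space M. ?Y j \<omega> - ?Y (Suc j) \<omega> < a j})"
      by (simp only:)
  qed (use t in simp)
  then show ?thesis
  proof eventually_elim
    case (elim \<omega>)
    show ?case
    proof
      assume "touches (\<lambda>y. B y \<omega>) t"
      then obtain b where b: "\<And>y. y \<in> {0..1} \<Longrightarrow> B y \<omega> \<le> B t \<omega> + b * (y - t)" unfolding touches_def by blast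
      obtain j where "b * (s j)\<^sup>2 < ?Y j \<omega>" using elim by blast
      then show False using b[of "t + (s j)\<^sup>2"] t s(3)[of j] by auto
    qed
  qed
qed

text \<open>The same argument backwards from time 1. The times \<open>1 - (s j)\<^sup>2\<close>
  already increase with \<open>j\<close>, and the symmetry of the normal law takes care of the
  sign.\<close>

lemma AE_not_touches_1:
  assumes M: "prob_space M" and B: "standard_brownian_motion M B"
  shows "AE \<omega> in M. \<not> touches (\<lambda>y. B y \<omega>) 1"
proof -
  interpret prob_space M by fact
  define s where "s j = sqrt 1 / fact j" for j :: nat
  have s: "0 < s j" "s (Suc j) \<le> s j" "(s j)\<^sup>2 \<le> 1" for j
    by (auto simp: s_def divide_simps abs_square_le_1 fact_ge_1)
  have sq: "(s (Suc j))\<^sup>2 \<le> (s j)\<^sup>2" for j using s[of "Suc j"] s[of j] by (intro power_mono) auto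
  have sq_less: "(s (Suc j))\<^sup>2 < (s j)\<^sup>2" if "0 < j" for j
  proof -
    have "s (Suc j) < s j" using that by (auto simp: s_def divide_simps)
    then show ?thesis using s[of "Suc j"] by (intro power_strict_mono) auto
  qed
  let ?Y = "\<lambda>j \<omega>. B (1 - (s j)\<^sup>2) \<omega> - B 1 \<omega>"
  have normal: "distributed M lborel (\<lambda>\<omega>. B a \<omega> - B b \<omega>) (normal_density 0 (sqrt (b - a)))"
    if "0 \<le> a" "a < b" "b \<le> 1" for a b
  proof -
    have "distributed M lborel (\<lambda>\<omega>. B b \<omega> - B a \<omega>) (normal_density 0 (sqrt (b - a)))"
      using B that unfolding standard_brownian_motion_def by blast
    from normal_density_affine[OF this, of "-1" 0] that show ?thesis by simp
  qed
  have "AE \<omega> in M. \<forall>b. \<exists>j. b * (s j)\<^sup>2 < ?Y j \<omega>"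
  proof (rule AE_exceeds_linear[of 1 s ?Y])
    show "s j = sqrt 1 / fact j" for j by (rule s_def)
    fix j
    show "distributed M lborel (?Y j) (normal_density 0 (s j))"
      using normal[of "1 - (s j)\<^sup>2" 1] s[of j] by simp
    show "distributed M lborel (\<lambda>\<omega>. ?Y j \<omega> - ?Y (Suc j) \<omega>) (normal_density 0 (sqrt ((s j)\<^sup>2 - (s (Suc j))\<^sup>2)))"
      if "0 < j"
      using normal[of "1 - (s j)\<^sup>2" "1 - (s (Suc j))\<^sup>2"] s[of j] s(1)[of "Suc j"] sq_less[OF that] by simp
  next
    fix J :: "nat set" and a assume J: "finite J" "J \<noteq> {}"
    have "prob {\<omega> \<in> space M. \<forall>j\<in>J. B (1 - (s (Suc j))\<^sup>2) \<omega> - B (1 - (s j)\<^sup>2) \<omega> \<in> {- a j<..}} =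
        (\<Prod>j\<in>J. prob {\<omega> \<in> space M. B (1 - (s (Suc j))\<^sup>2) \<omega> - B (1 - (s j)\<^sup>2) \<omega> \<in> {- a j<..}})"
      by (rule indep_prod_increments[OF M B, where t = "\<lambda>j. 1 - (s j)\<^sup>2"]) (use J s sq in auto)
    moreover have "B (1 - (s (Suc j))\<^sup>2) \<omega> - B (1 - (s j)\<^sup>2) \<omega> \<in> {- a j<..} \<longleftrightarrow> ?Y j \<omega> - ?Y (Suc j) \<omega> < a j" for j \<omega>
      by auto
    ultimately show "prob {\<omega> \<in> space M. \<forall>j\<in>J. ?Y j \<omega> - ?Y (Suc j) \<omega> < a j} =
        (\<Prod>j\<in>J. prob {\<omega> \<in> space M. ?Y j \<omega> - ?Y (Suc j) \<omega> < a j})"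
      by simp
  qed simp
  then show ?thesis
  proof eventually_elim
    case (elim \<omega>)
    show ?case
    proof
      assume "touches (\<lambda>y. B y \<omega>) 1"
      then obtain b where b: "\<And>y. y \<in> {0..1} \<Longrightarrow> B y \<omega> \<le> B 1 \<omega> + b * (y - 1)" unfolding touches_def by blast
      obtain j where "- b * (s j)\<^sup>2 < ?Y j \<omega>" using elim by blast
      then show False using b[of "1 - (s j)\<^sup>2"] s(3)[of j] by auto
    qed
  qed
qed

section \<open>Segments of the majorant of a continuous path\<close>

lemma concave_on_affine: "convex S \<Longrightarrow> concave_on S (\<lambda>y::real. a + b * y)"
  by (auto simp: concave_on_iff algebra_simps) (simp add: distrib_left[symmetric] flip: distrib_right)

lemma lcm_le_affine:
  assumes "\<And>y. y \<in> {0..1} \<Longrightarrow> f y \<le> a + b * y" "x \<in> {0..1::real}"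
  shows "least_concave_majorant {0..1} f x \<le> a + b * x"
  by (rule least_concave_majorant_le) (use assms concave_on_affine[of "{0..1}" a b] in auto)

locale unit_path =
  fixes f :: "real \<Rightarrow> real"
  assumes cont: "continuous_on {0..1} f"
begin

abbreviation "C \<equiv> least_concave_majorant {0..1} f"

lemma ex_upper_bound: "\<exists>a. \<forall>y\<in>{0..1}. f y \<le> a + 0 * y"
proof -
  obtain m where "\<forall>y\<in>{0..1}. f y \<le> f m" using continuous_attains_sup[OF _ _ cont] by fastforce
  then show ?thesis by auto
qed

lemma concave_C: "concave_on {0..1} C" and f_le_C: "x \<in> {0..1} \<Longrightarrow> f x \<le> C x"
proof -
  obtain a where a: "\<forall>y\<in>{0..1}. f y \<le> a + 0 * y" using ex_upper_bound by blast
  have c: "concave_on {0..1} (\<lambda>y::real. a + 0 * y)" by (rule concave_on_affine) simp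
  show "concave_on {0..1} C" using concave_least_concave_majorant[OF c] a by blast
  show "f x \<le> C x" if "x \<in> {0..1}" using le_least_concave_majorant[OF c _ that] a by blast
qed

lemma supporting_line:
  assumes "x \<in> {0<..<1}"
  shows "\<exists>\<beta>. \<forall>y\<in>{0..1}. C y \<le> C x + \<beta> * (y - x)"
proof -
  have "convex_on {0..1} (\<lambda>y. - C y)" using concave_C by (simp add: concave_on_def)
  from convex_le_Inf_differential[OF this, of x] assms
  obtain \<beta> where "\<And>y. y \<in> {0..1} \<Longrightarrow> - C x + \<beta> * (y - x) \<le> - C y" by fastforce
  then have "\<forall>y\<in>{0..1}. C y \<le> C x + (- \<beta>) * (y - x)" by fastforce
  then show ?thesis by blast
qed

lemma gap:
  assumes "S \<subseteq> {0..1}" "closed S" "\<And>y. y \<in> S \<Longrightarrow> f y < a + b * y"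
  shows "\<exists>\<eta>>0. \<forall>y\<in>S. f y + \<eta> \<le> a + b * y"
proof (cases "S = {}")
  case False
  have "compact S" using assms(1,2) by (metis compact_Icc compact_Int_closed inf.absorb2)
  moreover have "continuous_on S (\<lambda>y. a + b * y - f y)"
    by (intro continuous_intros continuous_on_subset[OF cont assms(1)])
  ultimately obtain m where m: "m \<in> S" "\<forall>y\<in>S. a + b * m - f m \<le> a + b * y - f y"
    using continuous_attains_inf[of S "\<lambda>y. a + b * y - f y"] False by blast
  then show ?thesis using assms(3)[OF m(1)] by (intro exI[of _ "a + b * m - f m"]) fastforce
qed (auto intro: exI[of _ 1])

text \<open>On \<open>{0..c}\<close> there is a uniform gap below the line, so the line may be
  turned about its point over \<open>c\<close>, becoming lower on the left and higher on the right,
  and still dominates \<open>f\<close>.\<close>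

lemma tilt_left:
  assumes le: "\<And>y. y \<in> {0..1} \<Longrightarrow> f y \<le> a + b * y" and c: "c \<le> 1"
    and less: "\<And>y. y \<in> {0..c} \<Longrightarrow> f y < a + b * y"
  shows "\<exists>\<epsilon>>0. \<forall>y\<in>{0..1}. f y \<le> a + b * y + \<epsilon> * (y - c)"
proof -
  obtain \<eta> where \<eta>: "\<eta> > 0" "\<forall>y\<in>{0..c}. f y + \<eta> \<le> a + b * y" using gap[of "{0..c}" a b] less c by auto
  have "f y \<le> a + b * y + \<eta> * (y - c)" if y: "y \<in> {0..1}" for y
  proof (cases "y \<le> c")
    case True
    \<comment> \<open>All times lie in the unit interval, so the gap itself serves as the change of
      slope.\<close>
    then have "\<eta> * (c - y) \<le> \<eta> * 1" using c y \<eta>(1) by (intro mult_left_mono) auto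
    moreover have "f y + \<eta> \<le> a + b * y" using \<eta>(2) True y by auto
    ultimately show ?thesis by (simp add: algebra_simps)
  next
    case False
    then have "0 \<le> \<eta> * (y - c)" using \<eta>(1) by simp
    then show ?thesis using le[OF y] by simp
  qed
  then show ?thesis using \<eta>(1) by blast
qed

lemma tilt_right:
  assumes le: "\<And>y. y \<in> {0..1} \<Longrightarrow> f y \<le> a + b * y" and c: "0 \<le> c"
    and less: "\<And>y. y \<in> {c..1} \<Longrightarrow> f y < a + b * y"
  shows "\<exists>\<epsilon>>0. \<forall>y\<in>{0..1}. f y \<le> a + b * y + \<epsilon> * (c - y)"
proof -
  obtain \<eta> where \<eta>: "\<eta> > 0" "\<forall>y\<in>{c..1}. f y + \<eta> \<le> a + b * y" using gap[of "{c..1}" a b] less c by auto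
  have "f y \<le> a + b * y + \<eta> * (c - y)" if y: "y \<in> {0..1}" for y
  proof (cases "c \<le> y")
    case True
    then have "\<eta> * (y - c) \<le> \<eta> * 1" using c y \<eta>(1) by (intro mult_left_mono) auto
    moreover have "f y + \<eta> \<le> a + b * y" using \<eta>(2) True y by auto
    ultimately show ?thesis by (simp add: algebra_simps)
  next
    case False
    then have "0 \<le> \<eta> * (c - y)" using \<eta>(1) by simp
    then show ?thesis using le[OF y] by simp
  qed
  then show ?thesis using \<eta>(1) by blast
qed

text \<open>\<open>p\<close> and \<open>q\<close> are the first and the last contact of
  \<open>f\<close> with a supporting line of slope \<open>\<beta>\<close>; further contacts between
  them are allowed. Both lie strictly between 0 and 1, as \<open>vertex_times\<close> demands of its
  elements.\<close>

definition face_line :: "real \<Rightarrow> real \<Rightarrow> real \<Rightarrow> bool"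
  where "face_line p q \<beta> \<longleftrightarrow> 0 < p \<and> p < q \<and> q < 1 \<and> f q = f p + \<beta> * (q - p) \<and>
    (\<forall>y\<in>{0..1}. f y \<le> f p + \<beta> * (y - p)) \<and>
    (\<forall>y\<in>{0..1}. f y = f p + \<beta> * (y - p) \<longrightarrow> p \<le> y \<and> y \<le> q)"

text \<open>Parallel supporting lines with contact coincide, hence so do their extreme contact
  points. Different intervals thus have different slopes, which is how sampled faces over them are
  told apart.\<close>

lemma face_line_unique:
  assumes "face_line p q \<beta>" "face_line p' q' \<beta>"
  shows "p = p' \<and> q = q'"
proof -
  have p: "p \<in> {0..1}" "p' \<in> {0..1}" "q \<in> {0..1}" "q' \<in> {0..1}" using assms by (auto simp: face_line_def)
  have "f p \<le> f p' + \<beta> * (p - p')" "f p' \<le> f p + \<beta> * (p' - p)"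
    using assms p by (auto simp: face_line_def)
  then have e: "f p = f p' + \<beta> * (p - p')" by (simp add: algebra_simps)
  then have e': "f p' = f p + \<beta> * (p' - p)" by (simp add: algebra_simps)
  have "f q = f p' + \<beta> * (q - p')" "f q' = f p + \<beta> * (q' - p)"
    using assms e by (auto simp: face_line_def algebra_simps)
  then have "p' \<le> p" "p \<le> p'" "q \<le> q'" "q' \<le> q"
    using assms p e e' unfolding face_line_def by blast+
  then show ?thesis by simp
qed

text \<open>Take a supporting line of the majorant at \<open>u\<close> and its contact set
  \<open>K\<close> with \<open>f\<close>, which does not contain \<open>u\<close>. Without contact
  on one side of \<open>u\<close>, a tilted line would undercut the majorant at \<open>u\<close>. So
  the extreme points of \<open>K\<close> enclose \<open>u\<close>; between them the majorant is the
  line, and outside it is strictly lower, again by tilting.\<close>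

lemma ex_face_line:
  assumes u: "u \<in> {0<..<1}" and nt: "\<not> touches f u" "\<not> touches f 0" "\<not> touches f 1"
  obtains p q \<beta> where "face_line p q \<beta>" "p < u" "u < q" "interval_containing (vertex_times C) u = {p<..<q}"
proof -
  obtain \<beta> where \<beta>: "\<And>y. y \<in> {0..1} \<Longrightarrow> C y \<le> C u + \<beta> * (y - u)" using supporting_line[OF u] by blast
  define a where "a = C u - \<beta> * u"
  have Cl: "C y \<le> a + \<beta> * y" if "y \<in> {0..1}" for y using \<beta>[OF that] by (simp add: a_def algebra_simps)
  have Cu: "C u = a + \<beta> * u" by (simp add: a_def)
  have fl: "f y \<le> a + \<beta> * y" if "y \<in> {0..1}" for y using f_le_C[OF that] Cl[OF that] by simp
  have no_touch: "t \<notin> {0..1} \<or> f t < a + \<beta> * t" if "\<not> touches f t" for t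
  proof (rule ccontr)
    assume "\<not> ?thesis"
    then have "t \<in> {0..1}" "f t = a + \<beta> * t" using fl[of t] by auto
    then have "\<forall>y\<in>{0..1}. f y \<le> f t + \<beta> * (y - t)" using fl by (auto simp: algebra_simps)
    then show False using that by (auto simp: touches_def)
  qed
  have fu: "f u < a + \<beta> * u" using no_touch[OF nt(1)] u by auto
  define K where "K = {y \<in> {0..1}. f y = a + \<beta> * y}"
  have K_iff: "f y < a + \<beta> * y" if "y \<in> {0..1}" "y \<notin> K" for y using fl[OF that(1)] that by (auto simp: K_def)
  have "K = {0..1} \<inter> (\<lambda>y. f y - (a + \<beta> * y)) -` {0}" by (auto simp: K_def)
  moreover have "closed ({0..1} \<inter> (\<lambda>y. f y - (a + \<beta> * y)) -` {0})"
    by (intro continuous_closed_preimage continuous_intros cont)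
  ultimately have "closed K" by simp
  moreover have "{0..1} \<inter> K = K" by (auto simp: K_def)
  ultimately have compK: "compact K" using compact_Int_closed[OF compact_Icc, of K 0 1] by simp
  have left: "\<exists>y\<in>K. y \<le> u"
  proof (rule ccontr)
    assume no: "\<not> ?thesis"
    \<comment> \<open>Inserting 1 yields a minimum also if \<open>K\<close> is empty; the pivot
      \<open>c\<close> of the tilt is placed between \<open>u\<close> and this minimum.\<close>
    have "compact (insert 1 K)" using compK by (rule compact_insert)
    then obtain m where m: "m \<in> insert 1 K" "\<forall>y\<in>insert 1 K. m \<le> y"
      using compact_attains_inf[of "insert 1 K"] by blast
    have mu: "u < m" "m \<le> 1" using m no u by (auto simp: K_def not_le)
    define c where "c = (u + m) / 2"
    have c: "u < c" "c < m" "c \<le> 1" using mu by (auto simp: c_def)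
    have "f y < a + \<beta> * y" if "y \<in> {0..c}" for y using K_iff[of y] m(2) that c by force
    from tilt_left[OF fl c(3) this] obtain \<epsilon> where \<epsilon>: "\<epsilon> > 0" "\<forall>y\<in>{0..1}. f y \<le> a + \<beta> * y + \<epsilon> * (y - c)" by blast
    have "C u \<le> (a - \<epsilon> * c) + (\<beta> + \<epsilon>) * u"
      by (rule lcm_le_affine) (use \<epsilon>(2) u in \<open>auto simp: algebra_simps\<close>)
    then have "\<epsilon> * c \<le> \<epsilon> * u" unfolding Cu by (simp add: algebra_simps)
    then show False using c(1) \<epsilon>(1) by simp
  qed
  have right: "\<exists>y\<in>K. u \<le> y"
  proof (rule ccontr)
    assume no: "\<not> ?thesis"
    have "compact (insert 0 K)" using compK by (rule compact_insert)
    then obtain m where m: "m \<in> insert 0 K" "\<forall>y\<in>insert 0 K. y \<le> m"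
      using compact_attains_sup[of "insert 0 K"] by blast
    have mu: "m < u" "0 \<le> m" using m no u by (auto simp: K_def not_le)
    define c where "c = (u + m) / 2"
    have c: "c < u" "m < c" "0 \<le> c" using mu by (auto simp: c_def)
    have "f y < a + \<beta> * y" if "y \<in> {c..1}" for y using K_iff[of y] m(2) that c by force
    from tilt_right[OF fl c(3) this] obtain \<epsilon> where \<epsilon>: "\<epsilon> > 0" "\<forall>y\<in>{0..1}. f y \<le> a + \<beta> * y + \<epsilon> * (c - y)" by blast
    have "C u \<le> (a + \<epsilon> * c) + (\<beta> - \<epsilon>) * u"
      by (rule lcm_le_affine) (use \<epsilon>(2) u in \<open>auto simp: algebra_simps\<close>)
    then have "\<epsilon> * u \<le> \<epsilon> * c" unfolding Cu by (simp add: algebra_simps)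
    then show False using c(1) \<epsilon>(1) by simp
  qed
  have "K \<noteq> {}" using left by blast
  obtain p where p: "p \<in> K" "\<And>y. y \<in> K \<Longrightarrow> p \<le> y" using compact_attains_inf[OF compK \<open>K \<noteq> {}\<close>] by blast
  obtain q where q: "q \<in> K" "\<And>y. y \<in> K \<Longrightarrow> y \<le> q" using compact_attains_sup[OF compK \<open>K \<noteq> {}\<close>] by blast
  have uK: "u \<notin> K" using fu by (auto simp: K_def)
  have pu: "p < u" using left p uK by (metis order_trans le_less)
  have uq: "u < q" using right q uK by (metis order_trans le_less)
  have p01: "p \<in> {0..1}" "f p = a + \<beta> * p" and q01: "q \<in> {0..1}" "f q = a + \<beta> * q" using p(1) q(1) by (auto simp: K_def)
  have "p \<noteq> 0" using no_touch[OF nt(2)] p01 by auto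
  then have p0: "0 < p" using p01 by auto
  have "q \<noteq> 1" using no_touch[OF nt(3)] q01 by auto
  then have q1: "q < 1" using q01 by auto
  have fline: "face_line p q \<beta>"
    unfolding face_line_def
  proof (intro conjI ballI impI p0 q1)
    show "p < q" using pu uq by simp
    show "f q = f p + \<beta> * (q - p)" using p01 q01 by (simp add: algebra_simps)
    show "f y \<le> f p + \<beta> * (y - p)" if "y \<in> {0..1}" for y using fl[OF that] p01 by (simp add: algebra_simps)
    show "p \<le> y" "y \<le> q" if "y \<in> {0..1}" "f y = f p + \<beta> * (y - p)" for y
      using p(2)[of y] q(2)[of y] that p01 by (auto simp: K_def algebra_simps)
  qed
  have inside: "C y = a + \<beta> * y" if y: "p \<le> y" "y \<le> q" for y
  proof (rule antisym)
    show "C y \<le> a + \<beta> * y" using Cl y p01 q01 by auto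
    define v where "v = (y - p) / (q - p)"
    have v: "0 \<le> v" "v \<le> 1" "(1 - v) * p + v * q = y" 
    proof -
      have "v * (q - p) = y - p" using pu uq by (simp add: v_def)
      then show "(1 - v) * p + v * q = y" by (simp add: algebra_simps)
      show "0 \<le> v" "v \<le> 1" using y pu uq by (auto simp: v_def divide_le_eq)
    qed
    have "(1 - v) * C p + v * C q \<le> C ((1 - v) *\<^sub>R p + v *\<^sub>R q)"
      using concave_C v p01 q01 unfolding concave_on_iff by auto
    moreover have "(1 - v) * (a + \<beta> * p) + v * (a + \<beta> * q) \<le> (1 - v) * C p + v * C q"
      using f_le_C[OF p01(1)] f_le_C[OF q01(1)] p01 q01 v by (intro add_mono mult_left_mono) auto
    moreover have "(1 - v) * (a + \<beta> * p) + v * (a + \<beta> * q) = a + \<beta> * ((1 - v) * p + v * q)"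
      by (simp add: algebra_simps)
    ultimately show "a + \<beta> * y \<le> C y" unfolding real_scaleR_def v(3) by linarith
  qed
  have outside_right: "C z < a + \<beta> * z" if z: "q < z" "z \<le> 1" for z
  proof -
    define c where "c = (q + z) / 2"
    have c: "q < c" "c < z" "0 \<le> c" using z q01 by (auto simp: c_def)
    have "f y < a + \<beta> * y" if "y \<in> {c..1}" for y using K_iff[of y] q(2)[of y] that c by force
    from tilt_right[OF fl c(3) this] obtain \<epsilon> where \<epsilon>: "\<epsilon> > 0" "\<forall>y\<in>{0..1}. f y \<le> a + \<beta> * y + \<epsilon> * (c - y)" by blast
    have "C z \<le> (a + \<epsilon> * c) + (\<beta> - \<epsilon>) * z"
      by (rule lcm_le_affine) (use \<epsilon>(2) z q01 in \<open>auto simp: algebra_simps\<close>)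
    also have "\<dots> < a + \<beta> * z" using \<epsilon>(1) c(2) by (simp add: algebra_simps)
    finally show ?thesis .
  qed
  have outside_left: "C z < a + \<beta> * z" if z: "z < p" "0 \<le> z" for z
  proof -
    define c where "c = (p + z) / 2"
    have c: "c < p" "z < c" "c \<le> 1" using z p01 by (auto simp: c_def)
    have "f y < a + \<beta> * y" if "y \<in> {0..c}" for y using K_iff[of y] p(2)[of y] that c by force
    from tilt_left[OF fl c(3) this] obtain \<epsilon> where \<epsilon>: "\<epsilon> > 0" "\<forall>y\<in>{0..1}. f y \<le> a + \<beta> * y + \<epsilon> * (y - c)" by blast
    have "C z \<le> (a - \<epsilon> * c) + (\<beta> + \<epsilon>) * z"
      by (rule lcm_le_affine) (use \<epsilon>(2) z p01 in \<open>auto simp: algebra_simps\<close>)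
    also have "\<dots> < a + \<beta> * z" using \<epsilon>(1) c(2) by (simp add: algebra_simps)
    finally show ?thesis .
  qed
  have two_points: "\<alpha> + \<gamma> * s = a + \<beta> * s"
    if "\<alpha> + \<gamma> * x = a + \<beta> * x" "\<alpha> + \<gamma> * y = a + \<beta> * y" "x \<noteq> y" for \<alpha> \<gamma> x y s :: real
  proof -
    have "(\<gamma> - \<beta>) * (x - y) = 0" using that(1,2) by (simp add: algebra_simps)
    then have "\<gamma> = \<beta>" using that(3) by simp
    then show ?thesis using that(1) by simp
  qed
  have pV: "p \<in> vertex_times C"
    unfolding vertex_times_def
  proof (intro CollectI conjI notI)
    show "p \<in> {0<..<1}" using p0 pu u by auto
    \<comment> \<open>An affine piece around \<open>p\<close> agrees with the line on part of the
      segment, hence also to the left of \<open>p\<close>, where the majorant is strictly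
      lower.\<close>
    assume "\<exists>e>0. \<exists>\<alpha> \<gamma>. \<forall>s\<in>ball p e. C s = \<alpha> + \<gamma> * s"
    then obtain e \<alpha> \<gamma> where e: "e > 0" "\<And>s. s \<in> ball p e \<Longrightarrow> C s = \<alpha> + \<gamma> * s" by blast
    define r where "r = p + min (e / 2) (q - p)"
    have r: "p < r" "r \<le> q" "r \<in> ball p e" using e(1) pu uq by (auto simp: r_def dist_real_def)
    have "\<alpha> + \<gamma> * p = a + \<beta> * p" "\<alpha> + \<gamma> * r = a + \<beta> * r"
      using e(1) e(2)[of p] e(2)[OF r(3)] inside[of p] inside[of r] r pu uq by auto
    from two_points[OF this] r have *: "\<alpha> + \<gamma> * s = a + \<beta> * s" for s by auto
    define z where "z = p - min (e / 2) p"
    have z: "z < p" "0 \<le> z" "z \<in> ball p e" using e(1) p0 by (auto simp: z_def dist_real_def)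
    show False using outside_left[OF z(1,2)] e(2)[OF z(3)] * by simp
  qed
  have qV: "q \<in> vertex_times C"
    unfolding vertex_times_def
  proof (intro CollectI conjI notI)
    show "q \<in> {0<..<1}" using q1 uq u by auto
    assume "\<exists>e>0. \<exists>\<alpha> \<gamma>. \<forall>s\<in>ball q e. C s = \<alpha> + \<gamma> * s"
    then obtain e \<alpha> \<gamma> where e: "e > 0" "\<And>s. s \<in> ball q e \<Longrightarrow> C s = \<alpha> + \<gamma> * s" by blast
    define r where "r = q - min (e / 2) (q - p)"
    have r: "r < q" "p \<le> r" "r \<in> ball q e" using e(1) pu uq by (auto simp: r_def dist_real_def)
    have "\<alpha> + \<gamma> * q = a + \<beta> * q" "\<alpha> + \<gamma> * r = a + \<beta> * r"
      using e(1) e(2)[of q] e(2)[OF r(3)] inside[of q] inside[of r] r pu uq by auto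
    from two_points[OF this] r have *: "\<alpha> + \<gamma> * s = a + \<beta> * s" for s by auto
    define z where "z = q + min (e / 2) (1 - q)"
    have z: "q < z" "z \<le> 1" "z \<in> ball q e" using e(1) q1 by (auto simp: z_def dist_real_def)
    show False using outside_right[OF z(1,2)] e(2)[OF z(3)] * by simp
  qed
  have none: "vertex_times C \<inter> {p<..<q} = {}"
  proof -
    have "s \<notin> vertex_times C" if s: "p < s" "s < q" for s
    proof -
      have "\<exists>e>0. \<exists>\<alpha> \<gamma>. \<forall>t\<in>ball s e. C t = \<alpha> + \<gamma> * t"
        by (intro exI[of _ "min (s - p) (q - s)"] conjI exI[of _ a] exI[of _ \<beta>])
          (use s inside in \<open>auto simp: dist_real_def abs_less_iff\<close>)
      then show ?thesis by (auto simp: vertex_times_def)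
    qed
    then show ?thesis by auto
  qed
  have "interval_containing (vertex_times C) u = {p<..<q}"
    by (rule interval_containing_eq) (use pV qV none pu uq in \<open>auto simp: consecutive_def\<close>)
  then show ?thesis using fline pu uq that by blast
qed

end

section \<open>Sampling a path on a grid\<close>

text \<open>Padded with zeros to an infinite sequence, the format of the walks above.\<close>

definition grid_increment :: "(real \<Rightarrow> real) \<Rightarrow> nat \<Rightarrow> nat \<Rightarrow> real"
  where "grid_increment f n i = (if i < n then f (real (Suc i) / real n) - f (real i / real n) else 0)"

lemma psum_grid_increment: "k \<le> n \<Longrightarrow> psum (grid_increment f n) k = f (real k / real n) - f 0"
proof (induction k)
  case (Suc k)
  then show ?case by (simp add: psum_Suc grid_increment_def)
qed simp

definition grid_slope :: "(real \<Rightarrow> real) \<Rightarrow> nat \<Rightarrow> nat \<Rightarrow> nat \<Rightarrow> real"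
  where "grid_slope f n g l =
    real n * ((psum (grid_increment f n) (g + l) - psum (grid_increment f n) g) / real l)"

lemma grid_face:
  assumes n: "0 < n" and face: "is_face n (grid_increment f n) g l"
  defines "a \<equiv> real g / real n" and "h \<equiv> real (g + l) / real n" and "c \<equiv> grid_slope f n g l"
  shows "0 \<le> a" "a < h" "h \<le> 1" "f h = f a + c * (h - a)"
    "\<And>k. k \<le> n \<Longrightarrow> f (real k / real n) \<le> f a + c * (real k / real n - a)"
proof -
  let ?x = "grid_increment f n"
  have l: "0 < l" "g + l \<le> n" using is_faceD[OF face] by auto
  obtain s where s: "anchored n ?x g s" "psum ?x (g + l) = psum ?x g + s * real l"
    using is_face_anchored[OF face] by metis
  have c: "c = real n * s" using s(2) l by (simp add: c_def grid_slope_def)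
  show "0 \<le> a" "a < h" using n l by (auto simp: a_def h_def divide_strict_right_mono)
  show "h \<le> 1" using n l by (simp add: h_def divide_le_eq_1)
  have cs: "c * (real k / real n - a) = s * (real k - real g)" for k
    using n unfolding c a_def by (simp add: field_simps)
  show "f h = f a + c * (h - a)"
    using s(2) l unfolding h_def cs by (simp add: psum_grid_increment a_def)
  show "f (real k / real n) \<le> f a + c * (real k / real n - a)" if "k \<le> n" for k
    using s(1) that l unfolding cs anchored_def by (auto simp: psum_grid_increment a_def)
qed

context unit_path
begin

text \<open>The bound is uniform in the line, however steep: of the two grid points around
  \<open>y\<close>, one is used at which the line is not higher than at \<open>y\<close>, and there
  \<open>f\<close> differs from \<open>f y\<close> by less than \<open>\<epsilon>\<close>.\<close>

lemma grid_majorant: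
  assumes \<epsilon>: "0 < \<epsilon>"
  shows "\<exists>N>0. \<forall>n\<ge>N. \<forall>\<alpha> c. (\<forall>k\<le>n. f (real k / real n) \<le> \<alpha> + c * (real k / real n)) \<longrightarrow>
    (\<forall>y\<in>{0..1}. f y \<le> \<alpha> + c * y + \<epsilon>)"
proof -
  have "uniformly_continuous_on {0..1} f" by (rule compact_uniformly_continuous[OF cont compact_Icc])
  then obtain d where d: "d > 0" "\<And>x y. x \<in> {0..1} \<Longrightarrow> y \<in> {0..1} \<Longrightarrow> dist y x < d \<Longrightarrow> dist (f y) (f x) < \<epsilon>"
    using \<epsilon> unfolding uniformly_continuous_on_def by metis
  obtain N where N: "1 / real (Suc N) < d" using d(1) nat_approx_posE by blast
  show ?thesis
  proof (intro exI[of _ "Suc N + 1"] conjI allI impI ballI)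
    fix n \<alpha> c y
    assume n: "n \<ge> Suc N + 1" and le: "\<forall>k\<le>n. f (real k / real n) \<le> \<alpha> + c * (real k / real n)" and y: "y \<in> {0..1::real}"
    have n0: "0 < real n" using n by simp
    have "1 / real n \<le> 1 / real (Suc N)" using n by (intro divide_left_mono) auto
    then have nd: "1 / real n < d" using N by simp
    show "f y \<le> \<alpha> + c * y + \<epsilon>"
    proof (cases "y = 1")
      case True
      then show ?thesis using le[rule_format, of n] n0 \<epsilon> by simp
    next
      case False
      define k where "k = nat \<lfloor>real n * y\<rfloor>"
      have k: "real k \<le> real n * y" "real n * y < real k + 1"
        using y n0 by (auto simp: k_def of_nat_nat)
      have "real n * y < real n" using False y n0 by simp
      then have kn: "k < n" using k by linarith
      define z0 where "z0 = real k / real n"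
      define z1 where "z1 = real (Suc k) / real n"
      have z: "z0 \<le> y" "y \<le> z1" "y - z0 < d" "z1 - y < d \<or> z1 - y = 1 / real n" "z0 \<in> {0..1}" "z1 \<in> {0..1}"
        using k kn n0 nd by (auto simp: z0_def z1_def field_simps)
      have z01: "z1 - z0 = 1 / real n" using n0 by (simp add: z0_def z1_def field_simps)
      have "f y < f z0 + \<epsilon>" using d(2)[of y z0] z y by (auto simp: dist_real_def)
      moreover have "f y < f z1 + \<epsilon>" using d(2)[of y z1] z z01 nd y by (auto simp: dist_real_def)
      moreover have "f z0 \<le> \<alpha> + c * z0" "f z1 \<le> \<alpha> + c * z1"
        using le[rule_format, of k] le[rule_format, of "Suc k"] kn by (auto simp: z0_def z1_def)
      moreover have "c * z0 \<le> c * y \<or> c * z1 \<le> c * y"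
        using z(1,2) by (cases "0 \<le> c") (auto intro: mult_left_mono mult_left_mono_neg)
      ultimately show ?thesis by linarith
    qed
  qed simp
qed

text \<open>The path is below the limit line and, up to \<open>\<epsilon>\<close>, below the line of
  the sampled face. Comparing the lines at a contact point of each, on opposite sides of
  \<open>u\<close>, bounds the difference of slopes; the gap \<open>\<eta>\<close> away from the
  interval confines the ends of the face. The length is bounded from above only, since several
  sampled faces may share the interval.\<close>

lemma grid_face_limit:
  assumes F: "face_line p q \<beta>" and u: "p < u" "u < q" and \<delta>: "0 < \<delta>"
  shows "\<exists>N>0. \<forall>n\<ge>N. \<forall>g l. is_face n (grid_increment f n) g l \<longrightarrow> g \<le> nat \<lfloor>real n * u\<rfloor> \<longrightarrow>
    nat \<lfloor>real n * u\<rfloor> < g + l \<longrightarrow>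
    \<bar>grid_slope f n g l - \<beta>\<bar> < \<delta> \<and> real l / real n < q - p + \<delta>"
proof -
  have pq: "0 < p" "q < 1" "f q = f p + \<beta> * (q - p)"
    and maj: "\<And>y. y \<in> {0..1} \<Longrightarrow> f y \<le> f p + \<beta> * (y - p)"
    and con: "\<And>y. y \<in> {0..1} \<Longrightarrow> f y = f p + \<beta> * (y - p) \<Longrightarrow> p \<le> y \<and> y \<le> q"
    using F by (auto simp: face_line_def)
  let ?S = "{0..p - \<delta> / 2} \<union> {q + \<delta> / 2..1}"
  have "\<exists>\<eta>>0. \<forall>y\<in>?S. f y + \<eta> \<le> (f p - \<beta> * p) + \<beta> * y"
  proof (rule gap)
    show "?S \<subseteq> {0..1}" using pq u \<delta> by auto
    show "f y < (f p - \<beta> * p) + \<beta> * y" if "y \<in> ?S" for y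
    proof -
      have y: "y \<in> {0..1}" "\<not> (p \<le> y \<and> y \<le> q)" using that pq u \<delta> by auto
      then have "f y \<noteq> f p + \<beta> * (y - p)" using con by blast
      then show ?thesis using maj[OF y(1)] by (simp add: algebra_simps)
    qed
  qed (intro closed_Un closed_atLeastAtMost)
  then obtain \<eta> where \<eta>: "\<eta> > 0" "\<And>y. y \<in> ?S \<Longrightarrow> f y + \<eta> \<le> f p + \<beta> * (y - p)"
    by (force simp: algebra_simps)
  define m where "m = min (u - p) (q - u)"
  have m: "0 < m" "m \<le> u - p" "m \<le> q - u" using u by (auto simp: m_def)
  \<comment> \<open>\<open>m\<close> is the distance of \<open>u\<close> from the ends. The bound
    \<open>\<epsilon> / m\<close> on the slope difference must be below both \<open>\<delta>\<close>
    and \<open>\<eta> / 2\<close>, and the slope error over the unit interval plus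
    \<open>\<epsilon>\<close> must stay below \<open>\<eta>\<close>.\<close>
  define \<epsilon> where "\<epsilon> = min (\<eta> / 2) (min (\<delta> / 2) (\<eta> / 2) * m) / 2"
  have \<epsilon>: "0 < \<epsilon>" "\<epsilon> < \<eta> / 2" "\<epsilon> < \<delta> * m" "\<epsilon> < \<eta> / 2 * m"
  proof -
    have a: "0 < min (\<delta> / 2) (\<eta> / 2) * m" using \<delta> \<eta>(1) m by simp
    then show "0 < \<epsilon>" "\<epsilon> < \<eta> / 2" using \<eta>(1) by (auto simp: \<epsilon>_def)
    have "\<epsilon> < min (\<delta> / 2) (\<eta> / 2) * m" using a \<eta>(1) unfolding \<epsilon>_def by linarith
    moreover have "min (\<delta> / 2) (\<eta> / 2) * m \<le> \<delta> * m" "min (\<delta> / 2) (\<eta> / 2) * m \<le> \<eta> / 2 * m"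
      using m \<delta> by (auto intro!: mult_right_mono)
    ultimately show "\<epsilon> < \<delta> * m" "\<epsilon> < \<eta> / 2 * m" by auto
  qed
  obtain N where N: "N > 0" "\<And>n \<alpha> c. n \<ge> N \<Longrightarrow> (\<forall>k\<le>n. f (real k / real n) \<le> \<alpha> + c * (real k / real n)) \<Longrightarrow>
    (\<forall>y\<in>{0..1}. f y \<le> \<alpha> + c * y + \<epsilon>)" using grid_majorant[OF \<epsilon>(1)] by blast
  show ?thesis
  proof (intro exI[of _ N] conjI N(1) allI impI)
    fix n g l
    assume n: "n \<ge> N" and face: "is_face n (grid_increment f n) g l"
      and g: "g \<le> nat \<lfloor>real n * u\<rfloor>" and gl: "nat \<lfloor>real n * u\<rfloor> < g + l"
    have n0: "0 < n" using n N(1) by simp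
    define a where "a = real g / real n"
    define h where "h = real (g + l) / real n"
    define c where "c = grid_slope f n g l"
    note G = grid_face[OF n0 face, folded a_def h_def c_def]
    have u0: "0 \<le> u" using pq u by simp
    have "real g \<le> real n * u" using g u0 by (simp add: le_nat_iff le_floor_iff)
    then have au: "a \<le> u" using n0 by (simp add: a_def field_simps)
    have "real n * u < real (g + l)" using gl u0 by (metis floor_less_iff nat_less_iff of_int_of_nat_eq zero_le_floor zero_le_mult_iff of_nat_0_le_iff)
    then have uh: "u < h" using n0 by (simp add: h_def field_simps)
    have "\<forall>k\<le>n. f (real k / real n) \<le> (f a - c * a) + c * (real k / real n)"
      using G(5) by (auto simp: algebra_simps)
    from N(2)[OF n this] have L: "f y \<le> f a + c * (y - a) + \<epsilon>" if "y \<in> {0..1}" for y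
      using that by (auto simp: algebra_simps)
    have a01: "a \<in> {0..1}" "h \<in> {0..1}" using G(1-3) by auto
    have "f p + \<beta> * (q - p) \<le> f a + c * (q - a) + \<epsilon>" using L[of q] pq u by auto
    moreover have "f a \<le> f p + \<beta> * (a - p)" by (rule maj[OF a01(1)])
    ultimately have 1: "(\<beta> - c) * (q - a) \<le> \<epsilon>" by (simp add: algebra_simps)
    have "f p \<le> f a + c * (p - a) + \<epsilon>" using L[of p] pq u by auto
    moreover have "f h \<le> f p + \<beta> * (h - p)" by (rule maj[OF a01(2)])
    ultimately have 2: "(c - \<beta>) * (h - p) \<le> \<epsilon>" using G(4) by (simp add: algebra_simps)
    have key: "\<bar>c - \<beta>\<bar> * m \<le> \<epsilon>"
    proof (cases "c \<le> \<beta>")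
      case True
      have "(\<beta> - c) * m \<le> (\<beta> - c) * (q - a)" using True m au by (intro mult_left_mono) auto
      then have "(\<beta> - c) * m \<le> \<epsilon>" using 1 by linarith
      then show ?thesis using True \<epsilon>(1) by (simp add: abs_if)
    next
      case False
      have "(c - \<beta>) * m \<le> (c - \<beta>) * (h - p)" using False m uh by (intro mult_left_mono) auto
      then have "(c - \<beta>) * m \<le> \<epsilon>" using 2 by linarith
      then show ?thesis using False by (simp add: abs_if)
    qed
    have "\<bar>c - \<beta>\<bar> * m < \<delta> * m" using key \<epsilon>(3) by simp
    then have c\<delta>: "\<bar>c - \<beta>\<bar> < \<delta>" using m(1) by simp
    then show "\<bar>grid_slope f n g l - \<beta>\<bar> < \<delta>" by (simp add: c_def)
    have "\<bar>c - \<beta>\<bar> * m < \<eta> / 2 * m" using key \<epsilon>(4) by simp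
    then have c\<eta>: "\<bar>c - \<beta>\<bar> < \<eta> / 2" using m(1) by (simp only: mult_less_cancel_right_pos)
    have c\<eta>2: "c - \<beta> \<le> \<eta> / 2" "\<beta> - c \<le> \<eta> / 2" using c\<eta> by linarith+
    \<comment> \<open>At \<open>h\<close> the path is on the sampled line, and in the case to be
      refuted this puts it less than \<open>\<eta>\<close> below the limit line; beyond
      \<open>q + \<delta> / 2\<close> the gap is at least \<open>\<eta>\<close>.\<close>
    have hq: "h < q + \<delta> / 2"
    proof (rule ccontr)
      assume "\<not> ?thesis"
      then have hS: "h \<in> ?S" "q \<le> h" using a01 \<delta> by auto
      have "f p + \<beta> * (q - p) \<le> f a + c * (q - a) + \<epsilon>" using L[of q] pq u by auto
      then have "f h \<ge> f p + \<beta> * (q - p) + c * (h - q) - \<epsilon>" using G(4) by (simp add: algebra_simps)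
      moreover have "(\<beta> - c) * (h - q) \<le> \<eta> / 2 * 1" 
        by (rule mult_mono) (use c\<eta>2 \<eta>(1) hS(2) a01 pq u in auto)
      ultimately have "f p + \<beta> * (h - p) - \<eta> / 2 - \<epsilon> \<le> f h" by (simp add: algebra_simps)
      then show False using \<eta>(2)[OF hS(1)] \<epsilon>(2) by simp
    qed
    have pa: "p - \<delta> / 2 < a"
    proof (rule ccontr)
      assume "\<not> ?thesis"
      then have hS: "a \<in> ?S" "a \<le> p" using a01 \<delta> by auto
      have "f p \<le> f a + c * (p - a) + \<epsilon>" using L[of p] pq u by auto
      moreover have "(c - \<beta>) * (p - a) \<le> \<eta> / 2 * 1" 
        by (rule mult_mono) (use c\<eta>2 \<eta>(1) hS(2) a01 pq u in auto)
      ultimately have "f p + \<beta> * (a - p) - \<eta> / 2 - \<epsilon> \<le> f a" by (simp add: algebra_simps)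
      then show False using \<eta>(2)[OF hS(1)] \<epsilon>(2) by simp
    qed
    have "real l / real n = h - a" using n0 by (simp add: h_def a_def field_simps)
    then show "real l / real n < q - p + \<delta>" using hq pa by simp
  qed
qed

end

section \<open>Countable descriptions of the majorant and of its intervals\<close>

context unit_path
begin

text \<open>Lines with rational coefficients are tested at rational points, which makes the event on
  the left a countable combination of conditions on values of \<open>f\<close>.\<close>

lemma C_less_iff:
  assumes s: "s \<in> {0<..<1}"
  shows "C s < r \<longleftrightarrow> (\<exists>\<alpha>\<in>\<rat>. \<exists>\<beta>\<in>\<rat>. \<alpha> + \<beta> * s < r \<and> (\<forall>y\<in>\<rat> \<inter> {0..1}. f y \<le> \<alpha> + \<beta> * y))"
proof
  assume "C s < r"
  obtain b where b: "\<And>y. y \<in> {0..1} \<Longrightarrow> C y \<le> C s + b * (y - s)" using supporting_line[OF s] by blast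
  \<comment> \<open>Perturbing slope and intercept costs at most \<open>e\<close> each, for which
    \<open>r - C s = 4 * e\<close> leaves room.\<close>
  define e where "e = (r - C s) / 4"
  have e: "e > 0" using \<open>C s < r\<close> by (simp add: e_def)
  obtain \<beta> where \<beta>: "\<beta> \<in> \<rat>" "b < \<beta>" "\<beta> < b + e" using Rats_dense_in_real[of b "b + e"] e by auto
  obtain \<alpha> where \<alpha>: "\<alpha> \<in> \<rat>" "C s - b * s < \<alpha>" "\<alpha> < C s - b * s + e"
    using Rats_dense_in_real[of "C s - b * s" "C s - b * s + e"] e by auto
  have "\<alpha> + \<beta> * s < r"
  proof -
    have "(\<beta> - b) * s \<le> e * 1" using \<beta> s e by (intro mult_mono) auto
    then have "\<beta> * s \<le> b * s + e" by (simp add: algebra_simps)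
    then show ?thesis using \<alpha>(3) e unfolding e_def by argo
  qed
  moreover have "f y \<le> \<alpha> + \<beta> * y" if "y \<in> \<rat> \<inter> {0..1}" for y
  proof -
    have y: "y \<in> {0..1}" using that by simp
    have "b * y \<le> \<beta> * y" using \<beta> y by (intro mult_right_mono) auto
    moreover have "f y \<le> C s - b * s + b * y" using f_le_C[OF y] b[OF y] by (simp add: algebra_simps)
    ultimately show ?thesis using \<alpha>(2) by linarith
  qed
  ultimately show "\<exists>\<alpha>\<in>\<rat>. \<exists>\<beta>\<in>\<rat>. \<alpha> + \<beta> * s < r \<and> (\<forall>y\<in>\<rat> \<inter> {0..1}. f y \<le> \<alpha> + \<beta> * y)"
    using \<alpha>(1) \<beta>(1) by blast
next
  assume "\<exists>\<alpha>\<in>\<rat>. \<exists>\<beta>\<in>\<rat>. \<alpha> + \<beta> * s < r \<and> (\<forall>y\<in>\<rat> \<inter> {0..1}. f y \<le> \<alpha> + \<beta> * y)"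
  then obtain \<alpha> \<beta> where ab: "\<alpha> + \<beta> * s < r" "\<And>y. y \<in> \<rat> \<Longrightarrow> y \<in> {0..1} \<Longrightarrow> f y \<le> \<alpha> + \<beta> * y" by blast
  have "f y \<le> \<alpha> + \<beta> * y" if y: "y \<in> {0..1}" for y
  proof (rule ccontr)
    assume "\<not> ?thesis"
    then have gt: "\<alpha> + \<beta> * y < f y" by simp
    have "continuous_on {0..1} (\<lambda>y. f y - (\<alpha> + \<beta> * y))" by (intro continuous_intros cont)
    then obtain d where d: "d > 0" "\<And>x. x \<in> {0..1} \<Longrightarrow> dist x y < d \<Longrightarrow>
        dist (f x - (\<alpha> + \<beta> * x)) (f y - (\<alpha> + \<beta> * y)) < f y - (\<alpha> + \<beta> * y)"
      using y gt unfolding continuous_on_iff by (metis diff_gt_0_iff_gt)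
    have "max 0 (y - d) < min 1 (y + d)" using y d(1) by auto
    then obtain x where x: "x \<in> \<rat>" "max 0 (y - d) < x" "x < min 1 (y + d)" using Rats_dense_in_real by blast
    then have "x \<in> {0..1}" "dist x y < d" by (auto simp: dist_real_def)
    from d(2)[OF this] ab(2)[OF x(1) this(1)] show False by (simp add: dist_real_def)
  qed
  then have "C s \<le> \<alpha> + \<beta> * s" by (rule lcm_le_affine) (use s in auto)
  then show "C s < r" using ab(1) by simp
qed

text \<open>Makes the vertex set closed in the open unit interval, so that a nearest vertex exists
  on each side as soon as there is any.\<close>

lemma open_affine_near: "open {t. \<exists>e>0. \<exists>a b. \<forall>s\<in>ball t e. g s = a + b * (s::real)}"
unfolding open_contains_ball
proof
  fix t assume "t \<in> {t. \<exists>e>0. \<exists>a b. \<forall>s\<in>ball t e. g s = a + b * s}"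
  then obtain e a b where e: "e > 0" "\<forall>s\<in>ball t e. g s = a + b * s" by blast
  show "\<exists>T>0. ball t T \<subseteq> {t. \<exists>e>0. \<exists>a b. \<forall>s\<in>ball t e. g s = a + b * s}"
  proof (intro exI[of _ "e / 2"] conjI subsetI)
    fix x assume "x \<in> ball t (e / 2)"
    have "ball x (e / 2) \<subseteq> ball t e"
    proof (rule subsetI)
      fix y assume "y \<in> ball x (e / 2)"
      then show "y \<in> ball t e" using \<open>x \<in> ball t (e / 2)\<close> dist_triangle[of t y x] by simp
    qed
    moreover have "e / 2 > 0" using e by simp
    ultimately have "\<exists>e>0. \<exists>a b. \<forall>s\<in>ball x e. g s = a + b * s" using e(2) by blast
    then show "x \<in> {t. \<exists>e>0. \<exists>a b. \<forall>s\<in>ball t e. g s = a + b * s}" by simp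
  qed (use e in simp)
qed

lemma compact_vertex_times: "0 < c \<Longrightarrow> d < 1 \<Longrightarrow> compact (vertex_times C \<inter> {c..d})"
proof -
  assume "0 < c" "d < 1"
  then have "vertex_times C \<inter> {c..d} = {c..d} - {t. \<exists>e>0. \<exists>a b. \<forall>s\<in>ball t e. C s = a + b * s}"
    unfolding vertex_times_def by force
  then show ?thesis using compact_diff[OF compact_Icc open_affine_near[of C]] by simp
qed

text \<open>A supporting line at the midpoint dominates both end values and attains their mean; so
  it passes through both, and concavity keeps the majorant on it in between.\<close>

lemma affine_if_midpoint:
  assumes ab: "0 \<le> a" "a < b" "b \<le> 1" and mid: "C ((a + b) / 2) = (C a + C b) / 2"
  shows "\<exists>\<alpha> \<beta>. \<forall>y\<in>{a..b}. C y = \<alpha> + \<beta> * y"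
proof -
  let ?m = "(a + b) / 2"
  have m: "?m \<in> {0<..<1}" using ab by auto
  obtain \<beta> where \<beta>: "\<And>y. y \<in> {0..1} \<Longrightarrow> C y \<le> C ?m + \<beta> * (y - ?m)" using supporting_line[OF m] by blast
  define \<alpha> where "\<alpha> = C ?m - \<beta> * ?m"
  have le: "C y \<le> \<alpha> + \<beta> * y" if "y \<in> {0..1}" for y using \<beta>[OF that] by (simp add: \<alpha>_def algebra_simps)
  have "C a + C b = 2 * \<alpha> + \<beta> * (a + b)" using mid by (simp add: \<alpha>_def algebra_simps)
  then have "C a + C b = (\<alpha> + \<beta> * a) + (\<alpha> + \<beta> * b)" by (simp add: algebra_simps)
  then have eq: "C a = \<alpha> + \<beta> * a" "C b = \<alpha> + \<beta> * b" using le[of a] le[of b] ab by auto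
  have "C y = \<alpha> + \<beta> * y" if y: "y \<in> {a..b}" for y
  proof (rule antisym)
    show "C y \<le> \<alpha> + \<beta> * y" using le y ab by auto
    define v where "v = (y - a) / (b - a)"
    have "v * (b - a) = y - a" using ab by (simp add: v_def)
    then have v3: "(1 - v) * a + v * b = y" by (simp add: algebra_simps)
    have v: "0 \<le> v" "v \<le> 1" using y ab by (auto simp: v_def divide_le_eq)
    have "(1 - v) * C a + v * C b \<le> C ((1 - v) *\<^sub>R a + v *\<^sub>R b)"
      using concave_C v ab unfolding concave_on_iff by auto
    moreover have "(1 - v) * C a + v * C b = \<alpha> + \<beta> * ((1 - v) * a + v * b)"
      unfolding eq by (simp add: algebra_simps)
    ultimately show "\<alpha> + \<beta> * y \<le> C y" unfolding real_scaleR_def v3 by linarith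
  qed
  then show ?thesis by blast
qed

text \<open>From local to global affinity. The distance \<open>D\<close> of the majorant from a
  supporting line is nonnegative and locally affine, so it vanishes near each of its zeros. Its
  zeros and its nonzeros both form open sets, and the interval is connected.\<close>

lemma affine_if_no_vertices:
  assumes rs: "0 \<le> r" "s \<le> 1" and V: "vertex_times C \<inter> {r<..<s} = {}" and x: "x \<in> {r<..<s}"
  shows "\<exists>\<alpha> \<beta>. \<forall>y\<in>{r<..<s}. C y = \<alpha> + \<beta> * y"
proof -
  have near: "\<exists>e>0. \<exists>a b. \<forall>s\<in>ball t e. C s = a + b * s" if "t \<in> {r<..<s}" for t
  proof -
    have "t \<notin> vertex_times C" "t \<in> {0<..<1}" using V that rs by auto
    then show ?thesis unfolding vertex_times_def mem_Collect_eq by blast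
  qed
  have x01: "x \<in> {0<..<1}" using x rs by auto
  obtain \<beta> where \<beta>: "\<And>y. y \<in> {0..1} \<Longrightarrow> C y \<le> C x + \<beta> * (y - x)" using supporting_line[OF x01] by blast
  define D where "D y = C x + \<beta> * (y - x) - C y" for y
  have D0: "0 \<le> D y" if "y \<in> {r<..<s}" for y using \<beta>[of y] that rs by (auto simp: D_def)
  have Dnear: "\<exists>e>0. ball t e \<subseteq> {r<..<s} \<and> (\<exists>a b. \<forall>y\<in>ball t e. D y = a + b * (y - t))" if t: "t \<in> {r<..<s}" for t
  proof -
    obtain e a b where e: "e > 0" "\<And>y. y \<in> ball t e \<Longrightarrow> C y = a + b * y" using near[OF t] by blast
    have "open {r<..<s}" by simp
    then obtain e' where e': "e' > 0" "ball t e' \<subseteq> {r<..<s}" using t openE by blast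
    have 1: "D y = C x + \<beta> * (t - x) - (a + b * t) + (\<beta> - b) * (y - t)" if "y \<in> ball t (min e e')" for y
    proof -
      have "C y = a + b * y" using that e(2)[of y] by simp
      then show ?thesis by (simp add: D_def algebra_simps)
    qed
    have 2: "0 < min e e'" "ball t (min e e') \<subseteq> {r<..<s}" using e(1) e' by auto
    show ?thesis using 1 2 by blast
  qed
  define A where "A = {t \<in> {r<..<s}. D t = 0}"
  define B where "B = {t \<in> {r<..<s}. D t \<noteq> 0}"
  have "open A"
  unfolding open_contains_ball
proof
    fix t assume t: "t \<in> A"
    then obtain e a b where e: "e > 0" "ball t e \<subseteq> {r<..<s}" "\<And>y. y \<in> ball t e \<Longrightarrow> D y = a + b * (y - t)"
      using Dnear[of t] unfolding A_def by blast
    have "a = 0" using e(3)[of t] t e(1) by (auto simp: A_def)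
    have "0 \<le> D (t + e / 2)" "0 \<le> D (t - e / 2)"
      using e(1,2) by (auto intro!: D0 subsetD[OF e(2)] simp: dist_real_def simp del: greaterThanLessThan_iff)
    then have "0 \<le> b * (e / 2)" "0 \<le> - (b * (e / 2))"
      using e(1) e(3)[of "t + e / 2"] e(3)[of "t - e / 2"] \<open>a = 0\<close> by (auto simp: dist_real_def)
    then have "b = 0" using e(1) by (auto simp: zero_le_mult_iff mult_le_0_iff)
    then have "ball t e \<subseteq> A" using e \<open>a = 0\<close> by (auto simp: A_def)
    then show "\<exists>T>0. ball t T \<subseteq> A" using e(1) by blast
  qed
  moreover have "open B"
  unfolding open_contains_ball
proof
    fix t assume t: "t \<in> B"
    then obtain e a b where e: "e > 0" "ball t e \<subseteq> {r<..<s}" "\<And>y. y \<in> ball t e \<Longrightarrow> D y = a + b * (y - t)"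
      using Dnear[of t] unfolding B_def by blast
    have "a \<noteq> 0" using e(3)[of t] t e(1) by (auto simp: B_def)
    have "open ((\<lambda>y. a + b * (y - t)) -` (- {0}))"
      by (intro open_vimage continuous_intros)
    moreover have "t \<in> (\<lambda>y. a + b * (y - t)) -` (- {0})" using \<open>a \<noteq> 0\<close> by simp
    ultimately obtain e' where e': "e' > 0" "ball t e' \<subseteq> (\<lambda>y. a + b * (y - t)) -` (- {0})" using openE by blast
    show "\<exists>T>0. ball t T \<subseteq> B"
    proof (intro exI[of _ "min e e'"] conjI subsetI)
      fix y assume y: "y \<in> ball t (min e e')"
      then have "y \<in> ball t e" "y \<in> ball t e'" by auto
      then show "y \<in> B" using e(2,3) e'(2) unfolding B_def by auto
    qed (use e(1) e'(1) in simp)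
  qed
  moreover have "connected {r<..<s}" by (rule connected_Ioo)
  ultimately have "A \<inter> {r<..<s} = {} \<or> B \<inter> {r<..<s} = {}"
    by (intro connectedD) (auto simp: A_def B_def)
  moreover have "x \<in> A" using x by (simp add: A_def D_def)
  ultimately have "D y = 0" if "y \<in> {r<..<s}" for y using x that by (auto simp: A_def B_def)
  then have "\<forall>y\<in>{r<..<s}. C y = (C x - \<beta> * x) + \<beta> * y" by (auto simp: D_def algebra_simps)
  then show ?thesis by blast
qed

text \<open>Reduces the absence of vertices to countably many equations between values of the
  majorant, hence to a measurable condition.\<close>

lemma no_vertices_iff:
  assumes rs: "0 \<le> r" "s \<le> 1"
  shows "vertex_times C \<inter> {r<..<s} = {} \<longleftrightarrow>
    (\<forall>a\<in>\<rat>. \<forall>b\<in>\<rat>. r < a \<longrightarrow> a < b \<longrightarrow> b < s \<longrightarrow> C ((a + b) / 2) = (C a + C b) / 2)"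
proof
  assume V: "vertex_times C \<inter> {r<..<s} = {}"
  show "\<forall>a\<in>\<rat>. \<forall>b\<in>\<rat>. r < a \<longrightarrow> a < b \<longrightarrow> b < s \<longrightarrow> C ((a + b) / 2) = (C a + C b) / 2"
  proof (intro ballI impI)
    fix a b assume ab: "r < a" "a < b" "b < s"
    then obtain \<alpha> \<beta> where "\<And>y. y \<in> {r<..<s} \<Longrightarrow> C y = \<alpha> + \<beta> * y"
      using affine_if_no_vertices[OF rs V, of a] by auto
    then have "C a = \<alpha> + \<beta> * a" "C b = \<alpha> + \<beta> * b" "C ((a + b) / 2) = \<alpha> + \<beta> * ((a + b) / 2)"
      using ab by auto
    then show "C ((a + b) / 2) = (C a + C b) / 2" by (simp add: field_simps)
  qed
next
  assume mid: "\<forall>a\<in>\<rat>. \<forall>b\<in>\<rat>. r < a \<longrightarrow> a < b \<longrightarrow> b < s \<longrightarrow> C ((a + b) / 2) = (C a + C b) / 2"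
  have "t \<notin> vertex_times C" if t: "r < t" "t < s" for t
  proof -
    obtain a where a: "a \<in> \<rat>" "r < a" "a < t" using Rats_dense_in_real[OF t(1)] by blast
    obtain b where b: "b \<in> \<rat>" "t < b" "b < s" using Rats_dense_in_real[OF t(2)] by blast
    have "C ((a + b) / 2) = (C a + C b) / 2" using mid a b by auto
    then obtain \<alpha> \<beta> where ab: "\<And>y. y \<in> {a..b} \<Longrightarrow> C y = \<alpha> + \<beta> * y"
      using affine_if_midpoint[of a b] a b rs by auto
    have "C y = \<alpha> + \<beta> * y" if "y \<in> ball t (min (t - a) (b - t))" for y
      using that by (intro ab) (auto simp: dist_real_def abs_less_iff)
    moreover have "0 < min (t - a) (b - t)" using a b by simp
    ultimately have "\<exists>e>0. \<exists>\<alpha> \<gamma>. \<forall>y\<in>ball t e. C y = \<alpha> + \<gamma> * y" by blast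
    then show ?thesis by (auto simp: vertex_times_def)
  qed
  then show "vertex_times C \<inter> {r<..<s} = {}" by auto
qed

text \<open>Rational \<open>r\<close> and \<open>s\<close> fit between the two points and the
  vertices around them. Conversely, compactness gives a last vertex up to \<open>r\<close> and a
  first one from \<open>s\<close> on, and these are consecutive.\<close>

lemma interval_containing_iff:
  "y \<in> interval_containing (vertex_times C) x \<longleftrightarrow>
    (\<exists>r\<in>\<rat>. \<exists>s\<in>\<rat>. 0 < r \<and> s < 1 \<and> r < x \<and> r < y \<and> x < s \<and> y < s \<and> vertex_times C \<inter> {r<..<s} = {} \<and>
      vertex_times C \<inter> {0<..<r} \<noteq> {} \<and> vertex_times C \<inter> {s<..<1} \<noteq> {})" (is "?L \<longleftrightarrow> ?R")
proof
  assume ?L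
  then obtain a b where ab: "consecutive (vertex_times C) a b" "x \<in> {a<..<b}" "y \<in> {a<..<b}"
    unfolding interval_containing_def by blast
  have aV: "a \<in> vertex_times C" "b \<in> vertex_times C" "vertex_times C \<inter> {a<..<b} = {}"
    using ab(1) by (auto simp: consecutive_def)
  then have a01: "0 < a" "b < 1" by (auto simp: vertex_times_def)
  have "a < min x y" "max x y < b" using ab by auto
  then obtain r s where r: "r \<in> \<rat>" "a < r" "r < min x y" and s: "s \<in> \<rat>" "max x y < s" "s < b"
    using Rats_dense_in_real by metis
  have "a \<in> vertex_times C \<inter> {0<..<r}" "b \<in> vertex_times C \<inter> {s<..<1}" using aV a01 r s by auto
  moreover have "vertex_times C \<inter> {r<..<s} = {}" using aV(3) r s by auto
  ultimately show ?R using r s a01 by (intro bexI[of _ r] bexI[of _ s]) auto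
next
  assume ?R
  then obtain r s where rs: "0 < r" "s < 1" "r < x" "r < y" "x < s" "y < s"
    and V: "vertex_times C \<inter> {r<..<s} = {}" "vertex_times C \<inter> {0<..<r} \<noteq> {}" "vertex_times C \<inter> {s<..<1} \<noteq> {}"
    by blast
  obtain v where v: "v \<in> vertex_times C" "0 < v" "v < r" using V(2) by auto
  obtain w where w: "w \<in> vertex_times C" "s < w" "w < 1" using V(3) by auto
  have "compact (vertex_times C \<inter> {v..r})" "vertex_times C \<inter> {v..r} \<noteq> {}"
    using compact_vertex_times[of v r] v rs by auto
  then obtain a where a: "a \<in> vertex_times C \<inter> {v..r}" "\<And>t. t \<in> vertex_times C \<inter> {v..r} \<Longrightarrow> t \<le> a"
    using compact_attains_sup[of "vertex_times C \<inter> {v..r}"] by blast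
  have "compact (vertex_times C \<inter> {s..w})" "vertex_times C \<inter> {s..w} \<noteq> {}"
    using compact_vertex_times[of s w] w rs by auto
  then obtain b where b: "b \<in> vertex_times C \<inter> {s..w}" "\<And>t. t \<in> vertex_times C \<inter> {s..w} \<Longrightarrow> b \<le> t"
    using compact_attains_inf[of "vertex_times C \<inter> {s..w}"] by blast
  have "t \<notin> {a<..<b}" if t: "t \<in> vertex_times C" for t
  proof
    assume "t \<in> {a<..<b}"
    moreover have "\<not> (r < t \<and> t < s)" using V(1) t by auto
    ultimately show False using a(1) b(1) a(2)[of t] b(2)[of t] t by fastforce
  qed
  then have "consecutive (vertex_times C) a b" using a(1) b(1) rs by (auto simp: consecutive_def)
  moreover have "x \<in> {a<..<b}" "y \<in> {a<..<b}" using a(1) b(1) rs by auto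
  ultimately show ?L using interval_containing_eq[of "vertex_times C" a b x] by simp
qed

end

section \<open>Measurability\<close>

text \<open>The space is arbitrary because the path is also used as a function on products with
  sample points and over the coarser sigma-algebra that it generates.\<close>

locale random_path =
  fixes N :: "'z measure" and F :: "'z \<Rightarrow> real \<Rightarrow> real"
  assumes F_cont: "\<And>z. z \<in> space N \<Longrightarrow> continuous_on {0..1} (F z)"
    and F_meas: "\<And>t. t \<in> {0..1} \<Longrightarrow> (\<lambda>z. F z t) \<in> borel_measurable N"
begin

lemma unit_path: "z \<in> space N \<Longrightarrow> unit_path (F z)"
  by (simp add: unit_path_def F_cont)

lemma measurable_C:
  assumes s: "s \<in> {0<..<1}"
  shows "(\<lambda>z. least_concave_majorant {0..1} (F z) s) \<in> borel_measurable N"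
  unfolding borel_measurable_iff_less
proof
  fix r
  have "{z \<in> space N. least_concave_majorant {0..1} (F z) s < r} =
    {z \<in> space N. \<exists>\<alpha>\<in>\<rat>. \<exists>\<beta>\<in>\<rat>. \<alpha> + \<beta> * s < r \<and> (\<forall>y\<in>\<rat> \<inter> {0..1}. F z y \<le> \<alpha> + \<beta> * y)}"
    using unit_path.C_less_iff[OF unit_path s] by blast
  also have "\<dots> \<in> sets N"
  proof (intro sets.sets_Collect_countable_Ex' sets.sets_Collect_conj sets.sets_Collect_countable_All'
      sets.sets_Collect_const countable_rat countable_Int1)
    fix \<alpha> \<beta> y :: real assume "y \<in> \<rat> \<inter> {0..1}"
    then have "(\<lambda>z. F z y) \<in> borel_measurable N" using F_meas by simp
    then show "{z \<in> space N. F z y \<le> \<alpha> + \<beta> * y} \<in> sets N" by measurable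
  qed
  finally show "{z \<in> space N. least_concave_majorant {0..1} (F z) s < r} \<in> sets N" .
qed

abbreviation "V z \<equiv> vertex_times (least_concave_majorant {0..1} (F z))"

lemma sets_no_vertices:
  assumes rs: "0 \<le> r" "s \<le> 1"
  shows "{z \<in> space N. V z \<inter> {r<..<s} = {}} \<in> sets N"
proof -
  let ?C = "\<lambda>z. least_concave_majorant {0..1} (F z)"
  have "{z \<in> space N. V z \<inter> {r<..<s} = {}} =
    {z \<in> space N. \<forall>a\<in>\<rat>. \<forall>b\<in>\<rat>. r < a \<longrightarrow> a < b \<longrightarrow> b < s \<longrightarrow> ?C z ((a + b) / 2) = (?C z a + ?C z b) / 2}"
    using unit_path.no_vertices_iff[OF unit_path rs] by blast
  also have "\<dots> \<in> sets N"
  proof (intro sets.sets_Collect_countable_All' countable_rat)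
    fix a b :: real
    show "{z \<in> space N. r < a \<longrightarrow> a < b \<longrightarrow> b < s \<longrightarrow> ?C z ((a + b) / 2) = (?C z a + ?C z b) / 2} \<in> sets N"
    proof (cases "r < a \<and> a < b \<and> b < s")
      case True
      have [measurable]: "(\<lambda>z. ?C z a) \<in> borel_measurable N" "(\<lambda>z. ?C z b) \<in> borel_measurable N"
        "(\<lambda>z. ?C z ((a + b) / 2)) \<in> borel_measurable N"
        using True rs by (auto intro!: measurable_C)
      have "{z \<in> space N. ?C z ((a + b) / 2) = (?C z a + ?C z b) / 2} \<in> sets N" by measurable
      then show ?thesis using True by simp
    qed auto
  qed
  finally show ?thesis .
qed

lemma measurable_interval_containing:
  assumes [measurable]: "g \<in> borel_measurable N" "h \<in> borel_measurable N"
  shows "Measurable.pred N (\<lambda>z. h z \<in> interval_containing (V z) (g z))"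
proof -
  have "{z \<in> space N. h z \<in> interval_containing (V z) (g z)} =
    {z \<in> space N. \<exists>r\<in>\<rat>. \<exists>s\<in>\<rat>. (0 < r \<and> s < 1 \<and> r < g z \<and> r < h z \<and> g z < s \<and> h z < s) \<and> V z \<inter> {r<..<s} = {} \<and>
      \<not> V z \<inter> {0<..<r} = {} \<and> \<not> V z \<inter> {s<..<1} = {}}"
    by (intro Collect_cong conj_cong refl) (simp only: unit_path.interval_containing_iff[OF unit_path] conj_assoc)
  also have "\<dots> \<in> sets N"
  proof (intro sets.sets_Collect_countable_Ex' countable_rat)
    fix r s :: real
    show "{z \<in> space N. (0 < r \<and> s < 1 \<and> r < g z \<and> r < h z \<and> g z < s \<and> h z < s) \<and> V z \<inter> {r<..<s} = {} \<and>
      \<not> V z \<inter> {0<..<r} = {} \<and> \<not> V z \<inter> {s<..<1} = {}} \<in> sets N"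
    proof (cases "0 < r \<and> r < s \<and> s < 1")
      case True
      have "{z \<in> space N. (0 < r \<and> s < 1 \<and> r < g z \<and> r < h z \<and> g z < s \<and> h z < s)} \<in> sets N" by measurable
      then show ?thesis
        using True by (intro sets.sets_Collect_conj sets.sets_Collect_neg sets_no_vertices) auto
    next
      case False
      have "{z \<in> space N. (0 < r \<and> s < 1 \<and> r < g z \<and> r < h z \<and> g z < s \<and> h z < s) \<and> V z \<inter> {r<..<s} = {} \<and>
        \<not> V z \<inter> {0<..<r} = {} \<and> \<not> V z \<inter> {s<..<1} = {}} = {}"
        using False by force
      then show ?thesis by (simp only: sets.empty_sets)
    qed
  qed
  finally show ?thesis by (simp add: pred_def)
qed

lemma random_path_compose: "\<phi> \<in> measurable N' N \<Longrightarrow> random_path N' (\<lambda>z. F (\<phi> z))"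
proof
  assume \<phi>: "\<phi> \<in> measurable N' N"
  show "continuous_on {0..1} (F (\<phi> z))" if "z \<in> space N'" for z
    using F_cont measurable_space[OF \<phi> that] by simp
  show "(\<lambda>z. F (\<phi> z) t) \<in> borel_measurable N'" if "t \<in> {0..1}" for t
    by (rule measurable_compose[OF \<phi> F_meas[OF that]])
qed

end

text \<open>The length is the measure of a section of a measurable set in the product with the time
  axis.\<close>

lemma (in random_path) measurable_length_interval:
  assumes [measurable]: "g \<in> borel_measurable N"
  shows "(\<lambda>z. measure lborel (interval_containing (V z) (g z))) \<in> borel_measurable N"
proof -
  interpret P: random_path "N \<Otimes>\<^sub>M lborel" "\<lambda>z. F (fst z)" by (rule random_path_compose) simp
  have "Measurable.pred (N \<Otimes>\<^sub>M lborel) (\<lambda>z. snd z \<in> interval_containing (V (fst z)) (g (fst z)))"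
    by (rule P.measurable_interval_containing) measurable
  then have "{z \<in> space (N \<Otimes>\<^sub>M lborel). snd z \<in> interval_containing (V (fst z)) (g (fst z))} \<in> sets (N \<Otimes>\<^sub>M lborel)"
    by (simp add: pred_def)
  from lborel.measurable_emeasure_Pair[OF this]
  have "(\<lambda>z. emeasure lborel (interval_containing (V z) (g z))) \<in> borel_measurable N"
    by (rule measurable_cong[THEN iffD1, rotated]) (auto simp: space_pair_measure intro!: arg_cong[where f = "emeasure lborel"])
  then show ?thesis unfolding measure_def by measurable
qed

section \<open>Sampled Brownian motion\<close>

definition gauss_step :: "nat \<Rightarrow> real measure"
  where "gauss_step n = density lborel (\<lambda>x. ennreal (normal_density 0 (sqrt (1 / real n)) x))"

lemma faces_cong: "(\<And>i. i < n \<Longrightarrow> x i = y i) \<Longrightarrow> faces n x = faces n y"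
proof -
  assume "\<And>i. i < n \<Longrightarrow> x i = y i"
  then have eq: "psum x k = psum y k" if "k \<le> n" for k using that by (intro psum_cong) auto
  have "is_face n x g l \<longleftrightarrow> is_face n y g l" for g l
  proof (cases "g + l \<le> n")
    case True
    then have "psum x g = psum y g" "psum x (g + l) = psum y (g + l)" using eq by auto
    then show ?thesis unfolding is_face_def using eq by (intro conj_cong refl all_cong imp_cong) auto
  qed (auto dest: is_faceD)
  then show ?thesis unfolding faces_def by auto
qed

lemma iid_walk_gauss_step: "0 < n \<Longrightarrow> iid_walk (gauss_step n)"
proof -
  assume n: "0 < n"
  have "prob_space (gauss_step n)"
    unfolding gauss_step_def by (rule prob_space_normal_density) (use n in simp)
  then have "sequence_space (gauss_step n)"
    unfolding sequence_space_def product_prob_space_def product_prob_space_axioms_def product_sigma_finite_def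
    by (simp add: prob_space_imp_sigma_finite)
  moreover have "emeasure (gauss_step n) {r} = 0" for r
  proof -
    have "{r} \<in> null_sets lborel" by (simp add: null_sets_def)
    then show ?thesis unfolding gauss_step_def
      by (subst emeasure_density) (auto intro!: nn_integral_null_set simp: null_sets_def)
  qed
  ultimately show ?thesis
    unfolding iid_walk_def iid_walk_axioms_def by (simp add: gauss_step_def)
qed

locale brownian = prob_space M for M :: "'a measure" +
  fixes B :: "real \<Rightarrow> 'a \<Rightarrow> real"
  assumes brownian: "standard_brownian_motion M B"
begin

abbreviation "bpath \<omega> \<equiv> (\<lambda>t. B t \<omega>)"
abbreviation "incr n \<omega> \<equiv> grid_increment (bpath \<omega>) n"

lemma B_meas [measurable]: "t \<in> {0..1} \<Longrightarrow> B t \<in> borel_measurable M"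
  using brownian unfolding standard_brownian_motion_def by blast

lemma B_0: "\<omega> \<in> space M \<Longrightarrow> B 0 \<omega> = 0"
  using brownian unfolding standard_brownian_motion_def by blast

lemma B_cont: "\<omega> \<in> space M \<Longrightarrow> continuous_on {0..1} (bpath \<omega>)"
  using brownian unfolding standard_brownian_motion_def by blast

lemma B_normal: "0 \<le> s \<Longrightarrow> s < t \<Longrightarrow> t \<le> 1 \<Longrightarrow>
    distributed M lborel (\<lambda>\<omega>. B t \<omega> - B s \<omega>) (normal_density 0 (sqrt (t - s)))"
  using brownian unfolding standard_brownian_motion_def by blast

lemma B_increments_indep:
  fixes t :: "nat \<Rightarrow> real"
  assumes "0 \<le> t 0" "\<forall>i<n. t i \<le> t (Suc i)" "t n \<le> 1"
  shows "indep_vars (\<lambda>_. borel) (\<lambda>i \<omega>. B (t (Suc i)) \<omega> - B (t i) \<omega>) {..<n}"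
  using brownian assms unfolding standard_brownian_motion_def by blast

lemma measurable_incr [measurable]: "(\<lambda>\<omega>. incr n \<omega> i) \<in> borel_measurable M"
proof (cases "i < n")
  case True
  have [measurable]: "B (real (Suc i) / real n) \<in> borel_measurable M" "B (real i / real n) \<in> borel_measurable M"
    using True by (auto intro!: B_meas simp: field_simps)
  show ?thesis using True unfolding grid_increment_def by simp
qed (simp add: grid_increment_def)

lemma psum_incr_total: "0 < n \<Longrightarrow> \<omega> \<in> space M \<Longrightarrow> psum (incr n \<omega>) n = B 1 \<omega>"
  by (simp add: psum_grid_increment B_0)

lemma indep_vars_incr: "indep_vars (\<lambda>_. borel) (\<lambda>i \<omega>. incr n \<omega> i) {..<n}"
proof (cases "n = 0")
  case False
  have "0 \<le> real 0 / real n \<and> (\<forall>i<n. real i / real n \<le> real (Suc i) / real n) \<and> real n / real n \<le> 1"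
    using False by (auto simp: divide_right_mono)
  then have "indep_vars (\<lambda>_. borel) (\<lambda>i \<omega>. B (real (Suc i) / real n) \<omega> - B (real i / real n) \<omega>) {..<n}"
    by (intro B_increments_indep[where t = "\<lambda>i. real i / real n"]) auto
  then show ?thesis
    by (rule indep_vars_cong[THEN iffD1, rotated -1]) (auto simp: grid_increment_def fun_eq_iff)
qed (simp add: indep_vars_def indep_sets_def)

lemma distr_incr:
  assumes i: "i < n"
  shows "distr M (gauss_step n) (\<lambda>\<omega>. incr n \<omega> i) = gauss_step n"
proof -
  have "distributed M lborel (\<lambda>\<omega>. B (real (Suc i) / real n) \<omega> - B (real i / real n) \<omega>)
      (normal_density 0 (sqrt (real (Suc i) / real n - real i / real n)))"
    by (rule B_normal) (use i in \<open>auto simp: divide_strict_right_mono\<close>)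
  moreover have "real (Suc i) / real n - real i / real n = 1 / real n"
    by (simp add: diff_divide_distrib[symmetric])
  ultimately have "distributed M lborel (\<lambda>\<omega>. incr n \<omega> i) (normal_density 0 (sqrt (1 / real n)))"
    using i by (simp add: grid_increment_def)
  from distributed_distr_eq_density[OF this] show ?thesis
    unfolding gauss_step_def by (simp cong: distr_cong)
qed

text \<open>Transfer between the grid increments of the path and the abstract walk, for functionals
  of the first \<open>n\<close> increments: their joint law is a finite product, and zeros fill the
  other coordinates.\<close>

lemma nn_integral_incr:
  assumes n: "0 < n" and F [measurable]: "F \<in> borel_measurable (PiM UNIV (\<lambda>_. gauss_step n))"
    and cong: "\<And>x y. (\<And>i. i < n \<Longrightarrow> x i = y i) \<Longrightarrow> F x = (F y :: ennreal)"
  shows "(\<integral>\<^sup>+\<omega>. F (incr n \<omega>) \<partial>M) = (\<integral>\<^sup>+x. F x \<partial>PiM UNIV (\<lambda>_. gauss_step n))"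
proof -
  interpret W: iid_walk "gauss_step n" by (rule iid_walk_gauss_step[OF n])
  let ?J = "PiM {..<n} (\<lambda>_. gauss_step n)"
  define ext where "ext y i = (if i < n then y i else 0)" for y :: "nat \<Rightarrow> real" and i
  have ext_meas: "ext \<in> measurable ?J W.S"
  proof (rule W.measurable_to_S)
    fix i
    show "(\<lambda>z. ext z i) \<in> borel_measurable ?J"
    proof (cases "i < n")
      case True
      then have "(\<lambda>z. z i) \<in> measurable ?J (gauss_step n)" by (intro measurable_component_singleton) simp
      then show ?thesis using True by (simp add: ext_def cong: measurable_cong_sets W.sets_step)
    qed (simp add: ext_def)
  qed
  have Fe: "(\<lambda>y. F (ext y)) \<in> borel_measurable ?J" by (rule measurable_compose[OF ext_meas F])
  have incr_meas: "(\<lambda>\<omega>. incr n \<omega> i) \<in> measurable M (gauss_step n)" for i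
    using measurable_incr[of n i] by (simp cong: measurable_cong_sets add: W.sets_step)
  have "indep_vars (\<lambda>_. gauss_step n) (\<lambda>i \<omega>. incr n \<omega> i) {..<n}"
    using indep_vars_incr[of n] unfolding indep_vars_def by (simp add: W.sets_step cong: measurable_cong_sets)
  then have "distr M ?J (\<lambda>\<omega>. \<lambda>i\<in>{..<n}. incr n \<omega> i) = PiM {..<n} (\<lambda>i. distr M (gauss_step n) (\<lambda>\<omega>. incr n \<omega> i))"
    using n by (subst (asm) indep_vars_iff_distr_eq_PiM) (auto intro: incr_meas)
  also have "\<dots> = ?J" by (rule PiM_cong) (auto simp: distr_incr)
  finally have law: "distr M ?J (\<lambda>\<omega>. \<lambda>i\<in>{..<n}. incr n \<omega> i) = ?J" .
  have m1: "(\<lambda>\<omega>. \<lambda>i\<in>{..<n}. incr n \<omega> i) \<in> measurable M ?J"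
    by (intro measurable_restrict incr_meas)
  have m2: "(\<lambda>x. restrict x {..<n}) \<in> measurable W.S ?J"
    by (intro measurable_restrict_subset) simp
  have "(\<integral>\<^sup>+\<omega>. F (incr n \<omega>) \<partial>M) = (\<integral>\<^sup>+\<omega>. F (ext (\<lambda>i\<in>{..<n}. incr n \<omega> i)) \<partial>M)"
    by (intro nn_integral_cong cong) (simp add: ext_def)
  also have "\<dots> = (\<integral>\<^sup>+y. F (ext y) \<partial>?J)"
    by (subst law[symmetric], subst nn_integral_distr[OF m1]) (use Fe in \<open>simp_all add: law\<close>)
  also have "\<dots> = (\<integral>\<^sup>+y. F (ext y) \<partial>distr W.S ?J (\<lambda>x. restrict x {..<n}))"
    by (subst W.distr_PiM_restrict_finite) auto
  also have "\<dots> = (\<integral>\<^sup>+x. F (ext (restrict x {..<n})) \<partial>W.S)"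
    by (rule nn_integral_distr[OF m2]) (simp add: Fe)
  also have "\<dots> = (\<integral>\<^sup>+x. F x \<partial>W.S)"
    by (intro nn_integral_cong cong) (simp add: ext_def)
  finally show ?thesis .
qed

lemma measurable_faces_incr:
  fixes \<Phi> :: "(nat \<times> nat) set \<Rightarrow> ennreal"
  assumes n: "0 < n"
  shows "(\<lambda>\<omega>. \<Phi> (faces n (incr n \<omega>))) \<in> borel_measurable M"
proof -
  interpret W: iid_walk "gauss_step n" by (rule iid_walk_gauss_step[OF n])
  have "(\<lambda>\<omega>. incr n \<omega>) \<in> measurable M W.S" by (rule W.measurable_to_S) (rule measurable_incr)
  from measurable_compose[OF this W.measurable_of_faces] show ?thesis .
qed

lemma nn_integral_faces_incr:
  fixes \<Phi> :: "(nat \<times> nat) set \<Rightarrow> ennreal"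
  assumes n: "0 < n"
  shows "(\<integral>\<^sup>+\<omega>. \<Phi> (faces n (incr n \<omega>)) \<partial>M) = (\<integral>\<^sup>+x. \<Phi> (faces n x) \<partial>PiM UNIV (\<lambda>_. gauss_step n))"
proof -
  interpret W: iid_walk "gauss_step n" by (rule iid_walk_gauss_step[OF n])
  show ?thesis
    by (rule nn_integral_incr[OF n W.measurable_of_faces]) (simp cong: faces_cong)
qed

lemma AE_faces_cover:
  assumes n: "0 < n"
  shows "AE \<omega> in M. (\<Sum>(g, l)\<in>faces n (incr n \<omega>). l) = n"
proof -
  interpret W: iid_walk "gauss_step n" by (rule iid_walk_gauss_step[OF n])
  let ?\<Phi> = "\<lambda>A :: (nat \<times> nat) set. (if (\<Sum>(g, l)\<in>A. l) = n then 0 else 1 :: ennreal)"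
  have "(\<integral>\<^sup>+x. ?\<Phi> (faces n x) \<partial>W.S) = 0"
    using W.AE_sum_length_faces[of n] by (subst nn_integral_0_iff_AE) (auto intro: W.measurable_of_faces)
  then have "(\<integral>\<^sup>+\<omega>. ?\<Phi> (faces n (incr n \<omega>)) \<partial>M) = 0" by (simp only: nn_integral_faces_incr[OF n, of ?\<Phi>])
  then have "AE \<omega> in M. ?\<Phi> (faces n (incr n \<omega>)) = 0"
    by (subst (asm) nn_integral_0_iff_AE) (rule measurable_faces_incr[OF n, of ?\<Phi>])
  then show ?thesis by eventually_elim (auto split: if_splits)
qed

lemma nn_integral_sum_length_incr:
  assumes n: "0 < n"
  shows "(\<integral>\<^sup>+\<omega>. (\<Sum>(g, l)\<in>faces n (incr n \<omega>). of_nat l * h l) \<partial>M) = (\<Sum>l\<in>{1..n}. h l)"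
proof -
  interpret W: iid_walk "gauss_step n" by (rule iid_walk_gauss_step[OF n])
  show ?thesis
    using nn_integral_faces_incr[OF n, of "\<lambda>A. \<Sum>(g, l)\<in>A. of_nat l * h l"] W.nn_integral_sum_length_faces[where n = n and h = h] by simp
qed

lemma nn_integral_size_biased_weight_incr:
  fixes q :: "nat \<Rightarrow> real"
  assumes n: "0 < n"
    and R: "\<And>j m. real (card {l \<in> {1..m}. R j l m}) \<le> q j * real m"
    and q: "\<And>j. 0 \<le> q j" and \<psi> [measurable]: "\<psi> \<in> borel_measurable borel"
  shows "(\<integral>\<^sup>+\<omega>. size_biased_weight k (faces n (incr n \<omega>)) snd n R * \<psi> (B 1 \<omega>) \<partial>M) \<le>
    ennreal (\<Prod>j<k. q j) * (\<integral>\<^sup>+\<omega>. \<psi> (B 1 \<omega>) \<partial>M)"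
proof -
  interpret W: iid_walk "gauss_step n" by (rule iid_walk_gauss_step[OF n])
  have [measurable]: "(\<lambda>x. size_biased_weight k (faces n x) snd n R) \<in> borel_measurable W.S"
    by (rule W.measurable_of_faces)
  have "(\<integral>\<^sup>+\<omega>. size_biased_weight k (faces n (incr n \<omega>)) snd n R * \<psi> (B 1 \<omega>) \<partial>M) =
      (\<integral>\<^sup>+\<omega>. size_biased_weight k (faces n (incr n \<omega>)) snd n R * \<psi> (psum (incr n \<omega>) n) \<partial>M)"
    by (intro nn_integral_cong) (simp add: psum_incr_total n)
  also have "\<dots> = (\<integral>\<^sup>+x. size_biased_weight k (faces n x) snd n R * \<psi> (psum x n) \<partial>W.S)"
    by (rule nn_integral_incr[OF n]) (simp_all cong: faces_cong psum_cong)
  also have "\<dots> \<le> ennreal (\<Prod>j<k. q j) * (\<integral>\<^sup>+x. \<psi> (psum x n) \<partial>W.S)"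
    by (rule W.nn_integral_size_biased_weight_le[OF R q \<psi>])
  also have "(\<integral>\<^sup>+x. \<psi> (psum x n) \<partial>W.S) = (\<integral>\<^sup>+\<omega>. \<psi> (psum (incr n \<omega>) n) \<partial>M)"
    by (rule nn_integral_incr[OF n, symmetric]) (simp_all cong: psum_cong)
  also have "\<dots> = (\<integral>\<^sup>+\<omega>. \<psi> (B 1 \<omega>) \<partial>M)"
    by (intro nn_integral_cong) (simp add: psum_incr_total n)
  finally show ?thesis .
qed

text \<open>The sum of \<open>l\<close> steps has standard deviation \<open>s\<close> with
  \<open>s\<^sup>2 = l / n\<close>, hence a density at most \<open>1 / (2 * s)\<close>, and the
  interval has length \<open>2 * s\<^sup>2 * \<epsilon>\<close>. The product is
  \<open>s * \<epsilon>\<close>, and \<open>s \<le> 1\<close>.\<close>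

lemma prob_increment_near_le:
  assumes n: "0 < n" and l: "0 < l" "l \<le> n" and \<epsilon>: "0 < \<epsilon>"
  shows "emeasure (PiM UNIV (\<lambda>_. gauss_step n)) {x. \<bar>psum x l / real l - c\<bar> < \<epsilon> / real n} \<le> ennreal \<epsilon>"
proof -
  interpret W: iid_walk "gauss_step n" by (rule iid_walk_gauss_step[OF n])
  define s where "s = sqrt (real l / real n)"
  have s: "0 < s" using n l by (simp add: s_def)
  let ?I = "{real l * (c - \<epsilon> / real n)<..<real l * (c + \<epsilon> / real n)}"
  have iff: "\<bar>y / real l - c\<bar> < \<epsilon> / real n \<longleftrightarrow> y \<in> ?I" for y
  proof -
    have "y / real l - c = (y - real l * c) / real l" using l by (simp add: field_simps)
    then have "\<bar>y / real l - c\<bar> < \<epsilon> / real n \<longleftrightarrow> \<bar>y - real l * c\<bar> < \<epsilon> / real n * real l"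
      using l by (simp add: abs_divide pos_divide_less_eq)
    also have "\<dots> \<longleftrightarrow> y \<in> ?I" by (simp only: abs_less_iff greaterThanLessThan_iff right_diff_distrib distrib_left mult.commute[of "real l"]) linarith
    finally show ?thesis .
  qed
  have "emeasure W.S {x. \<bar>psum x l / real l - c\<bar> < \<epsilon> / real n} = (\<integral>\<^sup>+x. indicator ?I (psum x l) \<partial>W.S)"
  proof -
    have "{x \<in> space W.S. psum x l \<in> ?I} \<in> sets W.S" by measurable
    then have "{x. \<bar>psum x l / real l - c\<bar> < \<epsilon> / real n} \<in> sets W.S" unfolding iff by simp
    then have "emeasure W.S {x. \<bar>psum x l / real l - c\<bar> < \<epsilon> / real n} =
        (\<integral>\<^sup>+x. indicator {x. \<bar>psum x l / real l - c\<bar> < \<epsilon> / real n} x \<partial>W.S)" by simp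
    then show ?thesis unfolding iff by (simp add: indicator_def)
  qed
  also have "\<dots> = (\<integral>\<^sup>+\<omega>. indicator ?I (psum (incr n \<omega>) l) \<partial>M)"
    by (rule nn_integral_incr[OF n, symmetric]) (use l in \<open>auto intro!: arg_cong[where f = "indicator _"] psum_cong\<close>)
  also have "\<dots> = (\<integral>\<^sup>+\<omega>. indicator ?I (B (real l / real n) \<omega> - B 0 \<omega>) \<partial>M)"
    using l by (simp add: psum_grid_increment)
  also have "\<dots> = (\<integral>\<^sup>+x. ennreal (normal_density 0 s x) * indicator ?I x \<partial>lborel)"
  proof -
    have "distributed M lborel (\<lambda>\<omega>. B (real l / real n) \<omega> - B 0 \<omega>) (normal_density 0 (sqrt (real l / real n - 0)))"
      by (rule B_normal) (use n l in auto)
    then show ?thesis by (intro distributed_nn_integral[symmetric]) (simp_all add: s_def)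
  qed
  also have "\<dots> \<le> (\<integral>\<^sup>+x. ennreal (1 / (2 * s)) * indicator ?I x \<partial>lborel)"
  proof (intro nn_integral_mono mult_right_mono ennreal_leI)
    fix x
    have "4 \<le> 2 * pi" using pi_ge_two by simp
    then have "2 \<le> sqrt (2 * pi)" by (intro real_le_rsqrt) simp
    then have "2 * s \<le> sqrt (2 * pi) * s" using s by (intro mult_right_mono) auto
    also have "\<dots> = sqrt (2 * pi * s\<^sup>2)"
      unfolding real_sqrt_mult[of "2 * pi" "s\<^sup>2"] real_sqrt_abs using s by simp
    finally have le: "2 * s \<le> sqrt (2 * pi * s\<^sup>2)" .
    have "normal_density 0 s x \<le> 1 / sqrt (2 * pi * s\<^sup>2) * 1"
      unfolding normal_density_def by (intro mult_left_mono) auto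
    also have "\<dots> \<le> 1 / (2 * s)" using le s by (simp add: frac_le)
    finally show "normal_density 0 s x \<le> 1 / (2 * s)" .
  qed simp
  also have "\<dots> = ennreal (1 / (2 * s)) * ennreal (2 * real l * (\<epsilon> / real n))"
    using l \<epsilon> n by (simp add: nn_integral_cmult_indicator algebra_simps)
  also have "\<dots> = ennreal (s * \<epsilon>)"
  proof -
    have ln: "real l / real n = s\<^sup>2" using n l by (simp add: s_def)
    have "1 / (2 * s) * (2 * real l * (\<epsilon> / real n)) = (real l / real n) * \<epsilon> / s" by simp
    also have "\<dots> = s * \<epsilon>" unfolding ln using s by (simp add: power2_eq_square)
    finally show ?thesis using s \<epsilon> by (subst ennreal_mult[symmetric]) auto
  qed
  also have "\<dots> \<le> ennreal \<epsilon>"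
  proof (rule ennreal_leI)
    have "s \<le> 1" using n l by (simp add: s_def)
    then show "s * \<epsilon> \<le> \<epsilon>" using \<epsilon> by (simp add: mult_le_cancel_right1)
  qed
  finally show ?thesis .
qed

lemma nn_integral_close_slopes_incr:
  assumes n: "0 < n" and \<epsilon>: "0 < \<epsilon>"
  shows "(\<integral>\<^sup>+\<omega>. (\<Sum>(g, l)\<in>faces n (incr n \<omega>). \<Sum>(g', l')\<in>faces n (incr n \<omega>) - {(g, l)}. of_nat l * (of_nat l' *
      (if \<bar>grid_slope (bpath \<omega>) n g l - grid_slope (bpath \<omega>) n g' l'\<bar> < \<epsilon> then 1 else 0))) \<partial>M)
    \<le> of_nat (n * n) * ennreal \<epsilon>"
proof -
  interpret W: iid_walk "gauss_step n" by (rule iid_walk_gauss_step[OF n])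
  define F :: "(nat \<Rightarrow> real) \<Rightarrow> ennreal" where "F x = (\<Sum>(g, l)\<in>faces n x. \<Sum>(g', l')\<in>faces n x - {(g, l)}. of_nat l * (of_nat l' *
      (if \<bar>(psum x (g + l) - psum x g) / real l - (psum x (g' + l') - psum x g') / real l'\<bar> < \<epsilon> / real n then 1 else 0)))" for x
  \<comment> \<open>The same sum over fixed index sets, the removal of a face becoming a case
    distinction; measurability is read off this form.\<close>
  have F_alt: "F x = (\<Sum>l\<in>{1..n}. \<Sum>g\<le>n - l. if is_face n x g l then
      (\<Sum>l'\<in>{1..n}. \<Sum>g'\<le>n - l'. if is_face n x g' l' then (if (g', l') = (g, l) then 0 else of_nat l * (of_nat l' *
      (if \<bar>(psum x (g + l) - psum x g) / real l - (psum x (g' + l') - psum x g') / real l'\<bar> < \<epsilon> / real n then 1 else 0))) else 0) else 0)" for x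
  proof -
    have rem: "(\<Sum>p\<in>A - {p0}. h p) = (\<Sum>p\<in>A. if p = p0 then 0 else h p)" if "finite A"
      for A and p0 :: "nat \<times> nat" and h :: "nat \<times> nat \<Rightarrow> ennreal"
      by (rule sum.mono_neutral_cong_left) (use that in auto)
    have "F x = (\<Sum>(g, l)\<in>faces n x. \<Sum>(g', l')\<in>faces n x. if (g', l') = (g, l) then 0 else of_nat l * (of_nat l' *
      (if \<bar>(psum x (g + l) - psum x g) / real l - (psum x (g' + l') - psum x g') / real l'\<bar> < \<epsilon> / real n then 1 else 0)))"
      unfolding F_def rem[OF finite_faces] by (simp only: split_beta' prod.collapse)
    then show ?thesis by (simp only: sum_faces)
  qed
  have F_meas: "F \<in> borel_measurable W.S"
    unfolding F_alt by measurable
  have F_cong: "F x = F y" if "\<And>i. i < n \<Longrightarrow> x i = y i" for x y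
  proof -
    have "faces n x = faces n y" using that by (rule faces_cong)
    moreover have "psum x k = psum y k" if "k \<le> n" for k
      using \<open>\<And>i. i < n \<Longrightarrow> x i = y i\<close> that by (intro psum_cong) auto
    moreover have "fst f \<le> n \<and> fst f + snd f \<le> n" if "f \<in> faces n y" for f
      using that by (auto simp: faces_def dest!: is_faceD)
    ultimately show ?thesis unfolding F_def split_beta'
      by (intro sum.cong) simp_all
  qed
  \<comment> \<open>Slopes in real time are \<open>n\<close> times the slopes per step, hence the
    tolerance \<open>\<epsilon> / n\<close>.\<close>
  have "\<bar>grid_slope (bpath \<omega>) n g l - grid_slope (bpath \<omega>) n g' l'\<bar> < \<epsilon> \<longleftrightarrow>
    \<bar>(psum (incr n \<omega>) (g + l) - psum (incr n \<omega>) g) / real l - (psum (incr n \<omega>) (g' + l') - psum (incr n \<omega>) g') / real l'\<bar> < \<epsilon> / real n"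
    for \<omega> g l g' l'
    unfolding grid_slope_def right_diff_distrib[symmetric] abs_mult using n by (simp add: field_simps)
  then have "(\<integral>\<^sup>+\<omega>. (\<Sum>(g, l)\<in>faces n (incr n \<omega>). \<Sum>(g', l')\<in>faces n (incr n \<omega>) - {(g, l)}. of_nat l * (of_nat l' *
      (if \<bar>grid_slope (bpath \<omega>) n g l - grid_slope (bpath \<omega>) n g' l'\<bar> < \<epsilon> then 1 else 0))) \<partial>M) = (\<integral>\<^sup>+\<omega>. F (incr n \<omega>) \<partial>M)"
    by (simp add: F_def)
  also have "\<dots> = (\<integral>\<^sup>+x. F x \<partial>W.S)" by (rule nn_integral_incr[OF n F_meas F_cong])
  also have "\<dots> \<le> of_nat (n * n) * ennreal \<epsilon>"
    unfolding F_def by (rule W.nn_integral_close_slopes_le) (rule prob_increment_near_le[OF n _ _ \<epsilon>])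
  finally show ?thesis .
qed

end

section \<open>Convergence of the sampled lengths\<close>

text \<open>For nonnegative \<open>s\<close> this is the grid interval from \<open>fst f / n\<close>
  to \<open>(fst f + snd f) / n\<close>, closed on the left. As \<open>nat\<close> maps negative
  integers to 0, a nonempty cell starting at 0 also contains all negative numbers, on which
  \<open>unif\<close> has no mass.\<close>

definition cell :: "nat \<Rightarrow> nat \<times> nat \<Rightarrow> real set"
  where "cell n f = {s. fst f \<le> nat \<lfloor>real n * s\<rfloor> \<and> nat \<lfloor>real n * s\<rfloor> < fst f + snd f}"

definition grid_interval :: "nat \<Rightarrow> (nat \<Rightarrow> real) \<Rightarrow> real \<Rightarrow> real set"
  where "grid_interval n x s = {y. \<exists>f\<in>faces n x. s \<in> cell n f \<and> y \<in> cell n f}"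

text \<open>At most one term differs from 0; the sum avoids choosing a face and gives 0 where none
  covers \<open>s\<close>.\<close>

definition grid_length :: "nat \<Rightarrow> (nat \<Rightarrow> real) \<Rightarrow> real \<Rightarrow> real"
  where "grid_length n x s = (\<Sum>f\<in>faces n x. if s \<in> cell n f then real (snd f) / real n else 0)"

lemma sets_cell [measurable]: "cell n f \<in> sets borel"
proof -
  have "{s \<in> space borel. fst f \<le> nat \<lfloor>real n * s\<rfloor> \<and> nat \<lfloor>real n * s\<rfloor> < fst f + snd f} \<in> sets borel"
    by measurable
  then show ?thesis by (simp add: cell_def)
qed

lemma cell_disjoint:
  assumes "f \<in> faces n x" "f' \<in> faces n x" "s \<in> cell n f" "s \<in> cell n f'"
  shows "f = f'"
proof (rule ccontr)
  assume "f \<noteq> f'"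
  then have "is_face n x (fst f) (snd f)" "is_face n x (fst f') (snd f')" "(fst f, snd f) \<noteq> (fst f', snd f')"
    using assms(1,2) by (auto simp: faces_def prod_eq_iff)
  from faces_disjoint[OF this] show False using assms(3,4) by (auto simp: cell_def)
qed

lemma grid_interval_eq: "f \<in> faces n x \<Longrightarrow> s \<in> cell n f \<Longrightarrow> grid_interval n x s = cell n f"
  unfolding grid_interval_def using cell_disjoint[of f n x _ s] by blast

lemma grid_length_eq:
  assumes f: "f \<in> faces n x" "s \<in> cell n f"
  shows "grid_length n x s = real (snd f) / real n"
proof -
  have "s \<in> cell n f' \<longleftrightarrow> f' = f" if "f' \<in> faces n x" for f' using cell_disjoint[OF that f(1) _ f(2)] f(2) by blast
  then have "grid_length n x s = (\<Sum>f'\<in>faces n x. if f' = f then real (snd f') / real n else 0)"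
    unfolding grid_length_def by (intro sum.cong refl) simp
  then show ?thesis using f(1) by simp
qed

lemma emeasure_cell:
  assumes n: "0 < n" and f: "f \<in> faces n x"
  shows "emeasure unif (cell n f) = ennreal (real (snd f) / real n)"
proof -
  define a where "a = real (fst f) / real n"
  define b where "b = real (fst f + snd f) / real n"
  have l: "0 < snd f" "fst f + snd f \<le> n" using f by (auto simp: faces_def dest!: is_faceD)
  have ab: "0 \<le> a" "a < b" "b \<le> 1"
    using n l by (auto simp: a_def b_def divide_strict_right_mono divide_le_eq_1)
  have iff: "s \<in> cell n f \<longleftrightarrow> a \<le> s \<and> s < b" if "0 < s" for s
  proof -
    have "0 \<le> real n * s" using that by simp
    then have "fst f \<le> nat \<lfloor>real n * s\<rfloor> \<longleftrightarrow> real (fst f) \<le> real n * s"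
      "nat \<lfloor>real n * s\<rfloor> < fst f + snd f \<longleftrightarrow> real n * s < real (fst f + snd f)"
      by (auto simp: le_nat_iff le_floor_iff nat_less_iff floor_less_iff)
    then show ?thesis using n by (simp add: cell_def a_def b_def field_simps)
  qed
  have "emeasure unif (cell n f) = emeasure lborel ({0<..<1} \<inter> cell n f)"
    by (rule emeasure_unif) simp
  also have "\<dots> = ennreal (b - a)"
  proof (rule antisym)
    have "emeasure lborel ({0<..<1} \<inter> cell n f) \<le> emeasure lborel {a..b}"
      by (rule emeasure_mono) (auto simp: iff)
    then show "emeasure lborel ({0<..<1} \<inter> cell n f) \<le> ennreal (b - a)" using ab by simp
    have "emeasure lborel {a<..<b} \<le> emeasure lborel ({0<..<1} \<inter> cell n f)"
      by (rule emeasure_mono) (use ab in \<open>auto simp: iff\<close>)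
    then show "ennreal (b - a) \<le> emeasure lborel ({0<..<1} \<inter> cell n f)" using ab by simp
  qed
  also have "b - a = real (snd f) / real n" by (simp add: a_def b_def diff_divide_distrib[symmetric])
  finally show ?thesis .
qed

lemma AE_unif: "AE s in unif. s \<in> {0<..<1}"
  unfolding unif_def by (rule AE_uniform_measureI) auto

text \<open>Disjoint faces of total length \<open>n\<close> leave no grid step uncovered.\<close>

lemma ex_cell:
  assumes n: "0 < n" and cover: "(\<Sum>(g, l)\<in>faces n x. l) = n" and s: "s \<in> {0<..<1}"
  shows "\<exists>f\<in>faces n x. s \<in> cell n f"
proof -
  let ?U = "\<Union>f\<in>faces n x. {fst f..<fst f + snd f}"
  have "card ?U = (\<Sum>f\<in>faces n x. card {fst f..<fst f + snd f})"
  proof (rule card_UN_disjoint)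
    show "\<forall>f\<in>faces n x. \<forall>f'\<in>faces n x. f \<noteq> f' \<longrightarrow> {fst f..<fst f + snd f} \<inter> {fst f'..<fst f' + snd f'} = {}"
    proof (intro ballI impI)
      fix f f' assume "f \<in> faces n x" "f' \<in> faces n x" "f \<noteq> f'"
      then have "is_face n x (fst f) (snd f)" "is_face n x (fst f') (snd f')" "(fst f, snd f) \<noteq> (fst f', snd f')"
        by (auto simp: faces_def)
      from faces_disjoint[OF this] show "{fst f..<fst f + snd f} \<inter> {fst f'..<fst f' + snd f'} = {}"
        by auto
    qed
  qed auto
  also have "\<dots> = n" using cover by (simp add: split_beta')
  finally have "card ?U = card {..<n}" by simp
  moreover have "?U \<subseteq> {..<n}" by (auto simp: faces_def dest!: is_faceD)
  ultimately have U: "?U = {..<n}" by (intro card_subset_eq) auto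
  have "real n * s < real n" "0 \<le> real n * s" using s n by auto
  then have "nat \<lfloor>real n * s\<rfloor> < n" by (simp add: nat_less_iff floor_less_iff)
  then have "nat \<lfloor>real n * s\<rfloor> \<in> ?U" using U by simp
  then show ?thesis by (auto simp: cell_def)
qed

lemma sum_length_subset_le:
  assumes "(\<Sum>(g, l)\<in>faces n x. l) = n" "D \<subseteq> faces n x"
  shows "(\<Sum>f\<in>D. snd f) \<le> n"
proof -
  have "(\<Sum>f\<in>D. snd f) \<le> (\<Sum>f\<in>faces n x. snd f)" by (rule sum_mono2) (use assms in auto)
  then show ?thesis using assms(1) by (simp add: split_beta')
qed

lemma measurable_grid_density:
  assumes R: "\<And>j. Measurable.pred (borel \<Otimes>\<^sub>M borel) (\<lambda>p. R j (fst p) (snd p))" and C [measurable]: "C \<in> sets borel"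
  shows "(\<lambda>u. size_biased_density (grid_interval n x) (grid_length n x) k C c R u) \<in> borel_measurable U.S"
proof (rule measurable_size_biased_density)
  have cm: "Measurable.pred U.S (\<lambda>u. u i \<in> cell n f)" for i f by measurable
  show "Measurable.pred U.S (\<lambda>u. u i \<in> C)" for i by measurable
  show "Measurable.pred U.S (\<lambda>u. u j \<in> grid_interval n x (u i))" for i j
    unfolding grid_interval_def mem_Collect_eq by (intro pred_intros_finite pred_intros_logic cm finite_faces)
  show "(\<lambda>u. grid_length n x (u i)) \<in> borel_measurable U.S" for i
    unfolding grid_length_def using cm by (intro borel_measurable_sum measurable_If) (auto simp: pred_def)
qed (use R in auto)

text \<open>A uniform point falls into the cell of a face with probability \<open>l / n\<close>, and
  the weight is the inverse of the remaining proportion \<open>m / n\<close>; the product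
  \<open>l / m\<close> is the size-biased probability. Sampled walk and path are thus described by
  the same kind of density in the same sample points, in which the limit can be taken.
  \<open>D\<close> collects the faces already drawn.\<close>

theorem nn_integral_grid_density:
  assumes n: "0 < n" and cover: "(\<Sum>(g, l)\<in>faces n x. l) = n"
    and D: "D \<subseteq> faces n x"
    and R: "\<And>j. Measurable.pred (borel \<Otimes>\<^sub>M borel) (\<lambda>p. R j (fst p) (snd p))"
  shows "(\<integral>\<^sup>+u. size_biased_density (grid_interval n x) (grid_length n x) k (\<Union>f\<in>D. cell n f)
      (real (\<Sum>f\<in>D. snd f) / real n) R u \<partial>U.S) =
    size_biased_weight k (faces n x - D) snd (n - (\<Sum>f\<in>D. snd f)) (\<lambda>j l m. R j (real l / real n) (real m / real n))"
  using D R
proof (induction k arbitrary: D R)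
  case 0
  then show ?case using U.P.emeasure_space_1 by simp
next
  case (Suc k)
  let ?J = "grid_interval n x" and ?L = "grid_length n x" and ?C = "\<Union>f\<in>D. cell n f"
  let ?c = "real (\<Sum>f\<in>D. snd f) / real n" and ?m = "n - (\<Sum>f\<in>D. snd f)"
  let ?R = "\<lambda>j. R (Suc j)"
  have finD: "finite D" using Suc.prems(1) finite_faces finite_subset by blast
  have mc: "real ?m / real n = 1 - ?c"
    using sum_length_subset_le[OF cover Suc.prems(1)] n by (simp add: of_nat_diff field_simps)
  define W where "W f = size_biased_weight k (faces n x - D - {f}) snd (?m - snd f) (\<lambda>j l m. ?R j (real l / real n) (real m / real n))" for f
  define H where "H f = (if R 0 (real (snd f) / real n) (1 - ?c) then ennreal (1 / (1 - ?c)) * W f else 0)" for f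
  have C_sets: "(\<Union>f\<in>D'. cell n f) \<in> sets borel" if "finite D'" for D'
    using that by (intro sets.finite_UN) auto
  have IH: "(\<integral>\<^sup>+u. size_biased_density ?J ?L k (?C \<union> cell n f) (?c + real (snd f) / real n) ?R u \<partial>U.S) = W f"
    if f: "f \<in> faces n x - D" for f
  proof -
    have *: "(\<Sum>f\<in>insert f D. snd f) = (\<Sum>f\<in>D. snd f) + snd f" using f finD by simp
    have "(\<integral>\<^sup>+u. size_biased_density ?J ?L k (\<Union>f\<in>insert f D. cell n f) (real (\<Sum>f\<in>insert f D. snd f) / real n) ?R u \<partial>U.S) =
      size_biased_weight k (faces n x - insert f D) snd (n - (\<Sum>f\<in>insert f D. snd f)) (\<lambda>j l m. ?R j (real l / real n) (real m / real n))"
      by (rule Suc.IH) (use f Suc.prems in auto)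
    moreover have "(\<Union>f\<in>insert f D. cell n f) = ?C \<union> cell n f" by auto
    moreover have "real (\<Sum>f\<in>insert f D. snd f) / real n = ?c + real (snd f) / real n"
      unfolding * by (simp add: add_divide_distrib)
    moreover have "faces n x - insert f D = faces n x - D - {f}" by auto
    moreover have "n - (\<Sum>f\<in>insert f D. snd f) = ?m - snd f" unfolding * by simp
    ultimately show ?thesis by (simp only: W_def)
  qed
  have dm: "size_biased_density ?J ?L k (?C \<union> cell n f) c ?R \<in> borel_measurable U.S" for c f
    by (rule measurable_grid_density) (use Suc.prems(2) C_sets[OF finD] in auto)
  have inner: "(\<integral>\<^sup>+u. size_biased_density ?J ?L (Suc k) ?C ?c R (case_nat s u) \<partial>U.S) =
      (\<Sum>f\<in>faces n x - D. H f * indicator (cell n f) s)" if s: "s \<in> {0<..<1}" for s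
  proof -
    obtain f where f: "f \<in> faces n x" "s \<in> cell n f" using ex_cell[OF n cover s] by blast
    have J: "?J s = cell n f" and L: "?L s = real (snd f) / real n"
      using grid_interval_eq[OF f] grid_length_eq[OF f] by auto
    have ind: "indicator (cell n f') s = (if f' = f then 1 else 0 :: ennreal)" if "f' \<in> faces n x" for f'
    proof -
      have "s \<in> cell n f' \<longleftrightarrow> f' = f" using cell_disjoint[OF that f(1) _ f(2)] f(2) by blast
      then show ?thesis by (simp add: indicator_def)
    qed
    have "(\<Sum>f'\<in>faces n x - D. H f' * indicator (cell n f') s) = (\<Sum>f'\<in>faces n x - D. if f' = f then H f' else 0)"
      by (intro sum.cong refl) (simp add: ind)
    also have "\<dots> = (if f \<in> faces n x - D then H f else 0)" by simp
    finally have rhs: "(\<Sum>f'\<in>faces n x - D. H f' * indicator (cell n f') s) = (if f \<in> faces n x - D then H f else 0)" .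
    show ?thesis
    proof (cases "f \<in> D")
      case True
      then have "s \<in> ?C" using f(2) by auto
      then show ?thesis unfolding rhs using True by (simp add: size_biased_density_Suc)
    next
      case False
      have "s \<notin> ?C"
      proof
        assume "s \<in> ?C"
        then obtain f' where f': "f' \<in> D" "s \<in> cell n f'" by auto
        then have "f' = f" using cell_disjoint[OF _ f(1) _ f(2)] Suc.prems(1) by blast
        then show False using f'(1) False by simp
      qed
      then have "(\<integral>\<^sup>+u. size_biased_density ?J ?L (Suc k) ?C ?c R (case_nat s u) \<partial>U.S) =
          (if R 0 (real (snd f) / real n) (1 - ?c) then ennreal (1 / (1 - ?c)) *
            (\<integral>\<^sup>+u. size_biased_density ?J ?L k (?C \<union> cell n f) (?c + real (snd f) / real n) ?R u \<partial>U.S) else 0)"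
        unfolding size_biased_density_Suc J L by (simp add: nn_integral_cmult dm)
      then show ?thesis unfolding rhs using IH[of f] f(1) False by (simp add: H_def)
    qed
  qed
  have "(\<integral>\<^sup>+u. size_biased_density ?J ?L (Suc k) ?C ?c R u \<partial>U.S) =
      (\<integral>\<^sup>+s. (\<integral>\<^sup>+u. size_biased_density ?J ?L (Suc k) ?C ?c R (case_nat s u) \<partial>U.S) \<partial>unif)"
    by (rule nn_integral_seq[OF measurable_grid_density[OF Suc.prems(2) C_sets[OF finD]]])
  also have "\<dots> = (\<integral>\<^sup>+s. (\<Sum>f\<in>faces n x - D. H f * indicator (cell n f) s) \<partial>unif)"
    by (rule nn_integral_cong_AE, rule eventually_mono[OF AE_unif], rule inner)
  also have "\<dots> = (\<Sum>f\<in>faces n x - D. \<integral>\<^sup>+s. H f * indicator (cell n f) s \<partial>unif)"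
    by (rule nn_integral_sum) (intro borel_measurable_times_ennreal borel_measurable_const borel_measurable_indicator, simp)
  also have "\<dots> = (\<Sum>f\<in>faces n x - D. H f * ennreal (real (snd f) / real n))"
    by (intro sum.cong refl) (simp add: nn_integral_cmult_indicator emeasure_cell[OF n, of _ x])
  also have "\<dots> = size_biased_weight (Suc k) (faces n x - D) snd ?m (\<lambda>j l m. R j (real l / real n) (real m / real n))"
    unfolding size_biased_weight.simps
  proof (rule sum.cong[OF refl])
    fix f assume f: "f \<in> faces n x - D"
    have l: "0 < snd f" using f by (auto simp: faces_def dest!: is_faceD)
    have "(\<Sum>f\<in>insert f D. snd f) \<le> n" using sum_length_subset_le[OF cover, of "insert f D"] f Suc.prems(1) by auto
    then have m0: "0 < ?m" using l f finD by simp
    have aux: "ennreal (1 / (real m / real n)) * ennreal (real l / real n) = ennreal (real l / real m)"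
      "ennreal (real l / real m) = of_nat l / of_nat m" if "0 < m" for m l :: nat
      using n that by (auto simp: ennreal_mult[symmetric] ennreal_of_nat_eq_real_of_nat divide_ennreal)
    have "ennreal (1 / (1 - ?c)) * ennreal (real (snd f) / real n) = ennreal (real (snd f) / real ?m)"
      unfolding mc[symmetric] by (rule aux(1)[OF m0])
    also have "\<dots> = of_nat (snd f) / of_nat ?m" by (rule aux(2)[OF m0])
    finally have *: "ennreal (1 / (1 - ?c)) * ennreal (real (snd f) / real n) = of_nat (snd f) / of_nat ?m" .
    show "H f * ennreal (real (snd f) / real n) = (if R 0 (real (snd f) / real n) (real ?m / real n)
        then of_nat (snd f) / of_nat ?m * size_biased_weight k (faces n x - D - {f}) snd (?m - snd f)
          (\<lambda>j l m. R (Suc j) (real l / real n) (real m / real n)) else 0)"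
      unfolding mc H_def W_def[symmetric] *[symmetric] by (simp add: mult_ac)
  qed
  finally show ?case .
qed

section \<open>Regular paths, and the mean length of the interval around a uniform point\<close>

context brownian
begin

sublocale random_path M "\<lambda>\<omega> t. B t \<omega>"
  by unfold_locales (auto intro: B_cont B_meas)

abbreviation "J \<omega> s \<equiv> interval_containing (V \<omega>) s"
abbreviation "len \<omega> s \<equiv> measure lborel (interval_containing (V \<omega>) s)"

text \<open>Countably many almost sure conditions. They reach every interval, because each contains
  a rational time from which its line can be found.\<close>

definition regular :: "'a \<Rightarrow> bool"
  where "regular \<omega> \<longleftrightarrow> \<not> touches (bpath \<omega>) 0 \<and> \<not> touches (bpath \<omega>) 1 \<and>
    (\<forall>r\<in>\<rat> \<inter> {0<..<1}. \<not> touches (bpath \<omega>) r) \<and> (\<forall>n>0. (\<Sum>(g, l)\<in>faces n (incr n \<omega>). l) = n)"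

lemma prob_space_M: "prob_space M" by unfold_locales

lemma AE_regular: "AE \<omega> in M. regular \<omega>"
proof -
  have "AE \<omega> in M. \<forall>r\<in>\<rat> \<inter> {0<..<1}. \<not> touches (bpath \<omega>) r"
    by (subst AE_ball_countable) (auto intro!: countable_Int1 countable_rat AE_not_touches_left[OF prob_space_M brownian])
  moreover have "AE \<omega> in M. \<forall>n>0. (\<Sum>(g, l)\<in>faces n (incr n \<omega>). l) = n"
    using AE_faces_cover by (simp add: AE_all_countable)
  ultimately show ?thesis
    using AE_not_touches_left[OF prob_space_M brownian, of 0] AE_not_touches_1[OF prob_space_M brownian]
    unfolding regular_def by auto
qed

lemma V_subset: "V \<omega> \<subseteq> {0<..<1}"
  by (auto simp: vertex_times_def)

text \<open>\<open>ex_face_line\<close> is applied at a rational time of the same interval, since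
  regularity says nothing about contact at \<open>s\<close> itself.\<close>

lemma regular_face_line:
  assumes \<omega>: "\<omega> \<in> space M" "regular \<omega>" and s: "s \<in> J \<omega> s"
  obtains p q \<beta> where "unit_path.face_line (bpath \<omega>) p q \<beta>" "p < s" "s < q" "J \<omega> s = {p<..<q}"
proof -
  interpret P: unit_path "bpath \<omega>" by (rule unit_path[OF \<omega>(1)])
  obtain a b where ab: "a < s" "s < b" "J \<omega> s = {a<..<b}"
    using s by (rule_tac interval_containing_cases[of "V \<omega>" s]) auto
  obtain r where r: "r \<in> \<rat>" "a < r" "r < b" using Rats_dense_in_real[of a b] ab by auto
  have "r \<in> J \<omega> s" using ab r by simp
  moreover from this have "r \<in> {0<..<1}" using interval_containing_subset[OF V_subset] by blast
  ultimately have Jr: "J \<omega> r = J \<omega> s" and nt: "\<not> touches (bpath \<omega>) r"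
    using interval_containing_same[of r "V \<omega>" s] \<omega>(2) r by (auto simp: regular_def)
  obtain p q \<beta> where "P.face_line p q \<beta>" "J \<omega> r = {p<..<q}"
    using P.ex_face_line[OF \<open>r \<in> {0<..<1}\<close> nt] \<omega>(2) unfolding regular_def by metis
  then show ?thesis using that[of p q \<beta>] s unfolding Jr by auto
qed

text \<open>At a fixed time the path almost surely touches no supporting line, so the time lies
  inside an interval; Fubini makes the time random.\<close>

lemma AE_in_interval: "AE z in unif \<Otimes>\<^sub>M M. fst z \<in> J (snd z) (fst z)"
proof -
  interpret Q: pair_sigma_finite unif M ..
  interpret R: random_path "unif \<Otimes>\<^sub>M M" "\<lambda>z t. B t (snd z)" by (rule random_path_compose) simp
  have "Measurable.pred (unif \<Otimes>\<^sub>M M) (\<lambda>z. fst z \<in> J (snd z) (fst z))"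
    by (rule R.measurable_interval_containing) measurable
  moreover have "AE s in unif. AE \<omega> in M. s \<in> J \<omega> s"
    using AE_unif
  proof (rule eventually_mono)
    fix s :: real assume s: "s \<in> {0<..<1}"
    have "AE \<omega> in M. \<not> touches (bpath \<omega>) s"
      by (rule AE_not_touches_left[OF prob_space_M brownian]) (use s in auto)
    with AE_regular AE_space show "AE \<omega> in M. s \<in> J \<omega> s"
    proof eventually_elim
      case (elim \<omega>)
      interpret P: unit_path "bpath \<omega>" by (rule unit_path) fact
      obtain p q \<beta> where "P.face_line p q \<beta>" "p < s" "s < q" "J \<omega> s = {p<..<q}"
        using P.ex_face_line[OF s] elim unfolding regular_def by metis
      then show ?case by simp
    qed
  qed
  ultimately show ?thesis by (intro Q.AE_pair_measure) (auto simp: pred_def)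
qed

text \<open>Combines \<open>grid_face_limit\<close> with the existence of a sampled face over
  \<open>s\<close>, which the covering condition in \<open>regular\<close> provides.\<close>

lemma regular_limit:
  assumes \<omega>: "\<omega> \<in> space M" "regular \<omega>" and s: "s \<in> J \<omega> s" and \<delta>: "0 < \<delta>"
    and F: "unit_path.face_line (bpath \<omega>) p q \<beta>" "J \<omega> s = {p<..<q}"
  shows "eventually (\<lambda>n. 0 < n \<and> (\<exists>f\<in>faces n (incr n \<omega>). s \<in> cell n f \<and>
    \<bar>grid_slope (bpath \<omega>) n (fst f) (snd f) - \<beta>\<bar> < \<delta> \<and>
    grid_length n (incr n \<omega>) s < len \<omega> s + \<delta>)) sequentially"
proof -
  interpret P: unit_path "bpath \<omega>" by (rule unit_path[OF \<omega>(1)])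
  have pq: "p < s" "s < q" using s F(2) by auto
  have s01: "s \<in> {0<..<1}" using interval_containing_subset[OF V_subset] s by blast
  obtain N where N: "N > 0" "\<forall>n\<ge>N. \<forall>g l. is_face n (incr n \<omega>) g l \<longrightarrow> g \<le> nat \<lfloor>real n * s\<rfloor> \<longrightarrow>
      nat \<lfloor>real n * s\<rfloor> < g + l \<longrightarrow>
      \<bar>grid_slope (bpath \<omega>) n g l - \<beta>\<bar> < \<delta> \<and> real l / real n < q - p + \<delta>"
    using P.grid_face_limit[OF F(1) pq \<delta>] by blast
  have len: "len \<omega> s = q - p" unfolding F(2) using pq by simp
  show ?thesis
    unfolding eventually_sequentially
  proof (intro exI[of _ N] allI impI conjI)
    fix n assume n: "N \<le> n"
    then show n0: "0 < n" using N(1) by simp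
    have "(\<Sum>(g, l)\<in>faces n (incr n \<omega>). l) = n" using \<omega>(2) n0 by (simp add: regular_def)
    from ex_cell[OF n0 this s01] obtain f where f: "f \<in> faces n (incr n \<omega>)" "s \<in> cell n f" by blast
    have "is_face n (incr n \<omega>) (fst f) (snd f)" using f(1) by (auto simp: faces_def)
    then have "\<bar>grid_slope (bpath \<omega>) n (fst f) (snd f) - \<beta>\<bar> < \<delta>" "real (snd f) / real n < q - p + \<delta>"
      using N(2) n f(2) by (auto simp: cell_def)
    then show "\<exists>f\<in>faces n (incr n \<omega>). s \<in> cell n f \<and> \<bar>grid_slope (bpath \<omega>) n (fst f) (snd f) - \<beta>\<bar> < \<delta> \<and>
        grid_length n (incr n \<omega>) s < len \<omega> s + \<delta>"
      using f grid_length_eq[OF f] unfolding len by auto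
  qed
qed

lemma pred_is_face_incr [measurable]: "Measurable.pred M (\<lambda>\<omega>. is_face n (incr n \<omega>) g l)"
proof -
  have "(\<lambda>\<omega>. psum (incr n \<omega>) k) \<in> borel_measurable M" for k
    unfolding psum_def by measurable
  then show ?thesis unfolding is_face_def by measurable
qed

lemma measurable_grid_slope [measurable]: "(\<lambda>\<omega>. grid_slope (bpath \<omega>) n g l) \<in> borel_measurable M"
  unfolding grid_slope_def psum_def by measurable

text \<open>For faces that cover the grid: the probability that two independent uniform points fall
  into faces whose slopes differ by less than \<open>\<epsilon>\<close>, the case of a common face
  included.\<close>

definition close_sum :: "real \<Rightarrow> nat \<Rightarrow> 'a \<Rightarrow> ennreal"
  where "close_sum \<epsilon> n \<omega> = (\<Sum>(g, l)\<in>faces n (incr n \<omega>). \<Sum>(g', l')\<in>faces n (incr n \<omega>).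
    ennreal (real l / real n) * (ennreal (real l' / real n) *
      (if \<bar>grid_slope (bpath \<omega>) n g l - grid_slope (bpath \<omega>) n g' l'\<bar> < \<epsilon> then 1 else 0)))"

lemma measurable_close_sum: "close_sum \<epsilon> n \<in> borel_measurable M"
  unfolding close_sum_def[abs_def] sum_faces by measurable

text \<open>Equal faces contribute the mean of the squared lengths, which is
  \<open>1 + ... + n\<close> over \<open>n\<^sup>2\<close>, and different ones at most
  \<open>\<epsilon>\<close> by \<open>nn_integral_close_slopes_incr\<close>.\<close>

lemma nn_integral_close_sum_le:
  assumes n: "0 < n" and \<epsilon>: "0 < \<epsilon>"
  shows "(\<integral>\<^sup>+\<omega>. close_sum \<epsilon> n \<omega> \<partial>M) \<le> ennreal (1 / 2 + 1 / (2 * real n) + \<epsilon>)"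
proof -
  let ?off = "\<lambda>\<omega>. (\<Sum>(g, l)\<in>faces n (incr n \<omega>). \<Sum>(g', l')\<in>faces n (incr n \<omega>) - {(g, l)}. of_nat l * (of_nat l' *
      (if \<bar>grid_slope (bpath \<omega>) n g l - grid_slope (bpath \<omega>) n g' l'\<bar> < \<epsilon> then 1 else 0))) :: ennreal"
  let ?diag = "\<lambda>\<omega>. (\<Sum>(g, l)\<in>faces n (incr n \<omega>). of_nat l * of_nat l) :: ennreal"
  have ln: "ennreal (real l / real n) = ennreal (1 / real n) * of_nat l" for l
    by (simp add: ennreal_of_nat_eq_real_of_nat ennreal_mult[symmetric])
  have split: "of_nat (n * n) * close_sum \<epsilon> n \<omega> = ?diag \<omega> + ?off \<omega>" for \<omega>
  proof -
    have nn: "of_nat (n * n) * (ennreal (1 / real n) * of_nat l * (ennreal (1 / real n) * of_nat l' * c)) = of_nat l * (of_nat l' * c)"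
      for l l' and c :: ennreal
    proof -
      have "of_nat n * ennreal (1 / real n) = 1"
        using n by (simp add: ennreal_of_nat_eq_real_of_nat ennreal_mult[symmetric])
      then have "(of_nat n * ennreal (1 / real n)) * (of_nat n * ennreal (1 / real n)) * (of_nat l * (of_nat l' * c)) = of_nat l * (of_nat l' * c)"
        by simp
      then show ?thesis by (simp only: of_nat_mult mult_ac)
    qed
    have "of_nat (n * n) * close_sum \<epsilon> n \<omega> = (\<Sum>(g, l)\<in>faces n (incr n \<omega>). \<Sum>(g', l')\<in>faces n (incr n \<omega>).
      of_nat l * (of_nat l' * (if \<bar>grid_slope (bpath \<omega>) n g l - grid_slope (bpath \<omega>) n g' l'\<bar> < \<epsilon> then 1 else 0)))"
      unfolding close_sum_def sum_distrib_left split_beta' ln nn ..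
    also have "\<dots> = (\<Sum>f\<in>faces n (incr n \<omega>). of_nat (snd f) * of_nat (snd f) +
        (\<Sum>(g', l')\<in>faces n (incr n \<omega>) - {f}. of_nat (snd f) * (of_nat l' *
      (if \<bar>grid_slope (bpath \<omega>) n (fst f) (snd f) - grid_slope (bpath \<omega>) n g' l'\<bar> < \<epsilon> then 1 else 0))))"
      unfolding split_beta' by (intro sum.cong refl, subst sum.remove[OF finite_faces]) (use \<epsilon> in auto)
    finally show ?thesis by (simp add: sum.distrib split_beta')
  qed
  have "of_nat (n * n) * (\<integral>\<^sup>+\<omega>. close_sum \<epsilon> n \<omega> \<partial>M) = (\<integral>\<^sup>+\<omega>. ?diag \<omega> + ?off \<omega> \<partial>M)"
    unfolding split[symmetric] by (rule nn_integral_cmult[symmetric]) (rule measurable_close_sum)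
  also have "\<dots> = (\<integral>\<^sup>+\<omega>. ?diag \<omega> \<partial>M) + (\<integral>\<^sup>+\<omega>. ?off \<omega> \<partial>M)"
  proof (rule nn_integral_add)
    show "?diag \<in> borel_measurable M" by (rule measurable_faces_incr[OF n])
    have "?off = (\<lambda>\<omega>. \<Sum>(g, l)\<in>faces n (incr n \<omega>). \<Sum>(g', l')\<in>faces n (incr n \<omega>). if (g', l') = (g, l) then 0 else of_nat l * (of_nat l' *
      (if \<bar>grid_slope (bpath \<omega>) n g l - grid_slope (bpath \<omega>) n g' l'\<bar> < \<epsilon> then 1 else 0)))"
    proof -
      have rem: "(\<Sum>p\<in>A - {p0}. h p) = (\<Sum>p\<in>A. if p = p0 then 0 else h p)" if "finite A"
        for A and p0 :: "nat \<times> nat" and h :: "nat \<times> nat \<Rightarrow> ennreal"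
        by (rule sum.mono_neutral_cong_left) (use that in auto)
      show ?thesis unfolding rem[OF finite_faces] by (simp only: split_beta' prod.collapse)
    qed
    also have "\<dots> \<in> borel_measurable M" unfolding sum_faces by measurable
    finally show "?off \<in> borel_measurable M" .
  qed
  also have "\<dots> \<le> (\<Sum>l\<in>{1..n}. of_nat l) + of_nat (n * n) * ennreal \<epsilon>"
    by (intro add_mono nn_integral_close_slopes_incr n \<epsilon>) (simp add: nn_integral_sum_length_incr[OF n])
  also have "\<dots> = of_nat (n * n) * ennreal (1 / 2 + 1 / (2 * real n) + \<epsilon>)"
  proof -
    have "(\<Sum>l\<in>{1..n}. of_nat l :: real) = real n * (real n + 1) / 2"
      by (induction n) (auto simp: field_simps)
    then have "ennreal (\<Sum>l\<in>{1..n}. of_nat l) = ennreal (real n * (real n + 1) / 2)" by (simp only:)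
    moreover have "(\<Sum>l\<in>{1..n}. of_nat l :: ennreal) = ennreal (\<Sum>l\<in>{1..n}. of_nat l)"
      by (simp add: ennreal_of_nat_eq_real_of_nat sum_ennreal)
    ultimately have "(\<Sum>l\<in>{1..n}. of_nat l :: ennreal) = ennreal (real n * (real n + 1) / 2)" by simp
    moreover have "real n * (real n + 1) / 2 + real (n * n) * \<epsilon> = real (n * n) * (1 / 2 + 1 / (2 * real n) + \<epsilon>)"
      using n by (simp add: field_simps)
    ultimately show ?thesis
      using \<epsilon> by (simp add: ennreal_of_nat_eq_real_of_nat ennreal_mult[symmetric] ennreal_plus[symmetric] del: ennreal_plus of_nat_mult)
  qed
  finally have le: "of_nat (n * n) * (\<integral>\<^sup>+\<omega>. close_sum \<epsilon> n \<omega> \<partial>M) \<le> of_nat (n * n) * ennreal (1 / 2 + 1 / (2 * real n) + \<epsilon>)" .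
  have "of_nat (n * n) \<noteq> (0 :: ennreal)" using n by simp
  moreover have "of_nat (n * n) \<noteq> (\<top> :: ennreal)" by (rule ennreal_of_nat_neq_top)
  ultimately show ?thesis using le ennreal_mult_le_mult_iff by blast
qed

lemma len_eq: "ennreal (len \<omega> s) = (\<integral>\<^sup>+t. indicator (J \<omega> s) t \<partial>unif)"
proof -
  have "J \<omega> s \<in> sets borel" "J \<omega> s \<subseteq> {0<..<1}"
    using borel_open[OF open_interval_containing] interval_containing_subset[OF V_subset] by auto
  then show ?thesis
    using measure_unif[of "J \<omega> s"] by (simp add: Unif.emeasure_eq_measure)
qed

lemma len_le_1: "len \<omega> s \<le> 1"
proof -
  have "J \<omega> s \<in> sets borel" "J \<omega> s \<subseteq> {0<..<1}"
    using borel_open[OF open_interval_containing] interval_containing_subset[OF V_subset] by auto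
  then show ?thesis using measure_unif[of "J \<omega> s"] Unif.prob_le_1[of "J \<omega> s"] by simp
qed

text \<open>\<open>len \<omega> s\<close> is the probability that a second uniform point lies in the
  interval of \<open>s\<close>. In that case the sampled faces over both points have slopes tending
  to the slope of that interval, so they are eventually close. Fatou's lemma is applied once for
  each point.\<close>

lemma nn_integral_len_le_close_sum:
  assumes \<omega>: "\<omega> \<in> space M" "regular \<omega>" and \<epsilon>: "0 < \<epsilon>"
  shows "(\<integral>\<^sup>+s. ennreal (len \<omega> s) \<partial>unif) \<le> liminf (\<lambda>n. close_sum \<epsilon> (Suc n) \<omega>)"
proof -
  interpret P: unit_path "bpath \<omega>" by (rule unit_path[OF \<omega>(1)])
  define G :: "nat \<Rightarrow> real \<Rightarrow> real \<Rightarrow> ennreal" where "G n s t = (\<Sum>f\<in>faces n (incr n \<omega>). \<Sum>f'\<in>faces n (incr n \<omega>).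
    (if \<bar>grid_slope (bpath \<omega>) n (fst f) (snd f) - grid_slope (bpath \<omega>) n (fst f') (snd f')\<bar> < \<epsilon> then 1 else 0) *
      indicator (cell n f) s * indicator (cell n f') t)" for n s t
  have Gm1: "(\<lambda>t. G n s t) \<in> borel_measurable unif" for n s
    unfolding G_def
    by (intro borel_measurable_sum borel_measurable_times_ennreal borel_measurable_const borel_measurable_indicator) simp
  have G1: "(\<integral>\<^sup>+t. G n s t \<partial>unif) = (\<Sum>f\<in>faces n (incr n \<omega>). \<Sum>f'\<in>faces n (incr n \<omega>).
    (if \<bar>grid_slope (bpath \<omega>) n (fst f) (snd f) - grid_slope (bpath \<omega>) n (fst f') (snd f')\<bar> < \<epsilon> then 1 else 0) *
      indicator (cell n f) s * ennreal (real (snd f') / real n))" if n: "0 < n" for n s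
  proof -
    have m: "(\<lambda>t. c * indicator (cell n f') t) \<in> borel_measurable unif" for c :: ennreal and f'
      by (intro borel_measurable_times_ennreal borel_measurable_const borel_measurable_indicator) simp
    show ?thesis unfolding G_def
      by (subst nn_integral_sum, intro borel_measurable_sum m, intro sum.cong refl,
          subst nn_integral_sum, intro m, intro sum.cong refl)
        (simp add: nn_integral_cmult_indicator emeasure_cell[OF n, of _ "incr n \<omega>"])
  qed
  have Gm2: "(\<lambda>s. \<integral>\<^sup>+t. G n s t \<partial>unif) \<in> borel_measurable unif" if n: "0 < n" for n
    unfolding G1[OF n]
    by (intro borel_measurable_sum borel_measurable_times_ennreal borel_measurable_const borel_measurable_indicator) simp
  have G2: "(\<integral>\<^sup>+s. (\<integral>\<^sup>+t. G n s t \<partial>unif) \<partial>unif) = close_sum \<epsilon> n \<omega>" if n: "0 < n" for n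
  proof -
    have m: "(\<lambda>t. c * indicator (cell n f') t * d) \<in> borel_measurable unif" for c d :: ennreal and f'
      by (intro borel_measurable_times_ennreal borel_measurable_const borel_measurable_indicator) simp
    have i: "(\<integral>\<^sup>+s. c * indicator (cell n f) s * d \<partial>unif) = ennreal (real (snd f) / real n) * (d * c)"
      if "f \<in> faces n (incr n \<omega>)" for c d f
    proof -
      have "(\<integral>\<^sup>+s. c * indicator (cell n f) s * d \<partial>unif) = (\<integral>\<^sup>+s. (c * d) * indicator (cell n f) s \<partial>unif)"
        by (intro nn_integral_cong) (simp add: mult_ac)
      also have "\<dots> = (c * d) * ennreal (real (snd f) / real n)"
        by (subst nn_integral_cmult_indicator) (simp_all add: emeasure_cell[OF n that])
      finally show ?thesis by (simp only: mult_ac)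
    qed
    show ?thesis unfolding G1[OF n] close_sum_def split_beta'
      by (subst nn_integral_sum, intro borel_measurable_sum m, intro sum.cong refl,
          subst nn_integral_sum, intro m, intro sum.cong refl, rule i)
  qed
  have ev: "indicator (J \<omega> s) t \<le> liminf (\<lambda>n. G (Suc n) s t)" for s t
  proof (cases "t \<in> J \<omega> s")
    case True
    have s: "s \<in> J \<omega> s" by (rule interval_containing_self[OF True])
    have Jt: "J \<omega> t = J \<omega> s" by (rule interval_containing_same[OF True])
    then have t: "t \<in> J \<omega> t" using True by simp
    obtain p q \<beta> where F: "P.face_line p q \<beta>" "J \<omega> s = {p<..<q}" using regular_face_line[OF \<omega> s] by metis
    have Ft: "J \<omega> t = {p<..<q}" using F(2) Jt by simp
    have h: "0 < \<epsilon> / 2" using \<epsilon> by simp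
    have "eventually (\<lambda>n. 1 \<le> G n s t) sequentially"
      using regular_limit[OF \<omega> s h F] regular_limit[OF \<omega> t h F(1) Ft]
    proof eventually_elim
      case (elim n)
      then obtain f f' where f: "f \<in> faces n (incr n \<omega>)" "s \<in> cell n f" "\<bar>grid_slope (bpath \<omega>) n (fst f) (snd f) - \<beta>\<bar> < \<epsilon> / 2"
        and f': "f' \<in> faces n (incr n \<omega>)" "t \<in> cell n f'" "\<bar>grid_slope (bpath \<omega>) n (fst f') (snd f') - \<beta>\<bar> < \<epsilon> / 2"
        by blast
      have "\<bar>grid_slope (bpath \<omega>) n (fst f) (snd f) - grid_slope (bpath \<omega>) n (fst f') (snd f')\<bar> < \<epsilon>"
        using f(3) f'(3) by linarith
      then have "1 = (if \<bar>grid_slope (bpath \<omega>) n (fst f) (snd f) - grid_slope (bpath \<omega>) n (fst f') (snd f')\<bar> < \<epsilon> then 1 else 0) *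
          indicator (cell n f) s * (indicator (cell n f') t :: ennreal)"
        using f(2) f'(2) by simp
      also have "\<dots> \<le> (\<Sum>f'\<in>faces n (incr n \<omega>).
        (if \<bar>grid_slope (bpath \<omega>) n (fst f) (snd f) - grid_slope (bpath \<omega>) n (fst f') (snd f')\<bar> < \<epsilon> then 1 else 0) *
          indicator (cell n f) s * indicator (cell n f') t)"
        by (rule member_le_sum[OF f'(1), where f = "\<lambda>f'. (if \<bar>grid_slope (bpath \<omega>) n (fst f) (snd f) - grid_slope (bpath \<omega>) n (fst f') (snd f')\<bar> < \<epsilon> then 1 else 0) *
          indicator (cell n f) s * indicator (cell n f') t"]) auto
      also have "\<dots> \<le> G n s t" unfolding G_def
        by (rule member_le_sum[OF f(1), where f = "\<lambda>f. \<Sum>f'\<in>faces n (incr n \<omega>).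
          (if \<bar>grid_slope (bpath \<omega>) n (fst f) (snd f) - grid_slope (bpath \<omega>) n (fst f') (snd f')\<bar> < \<epsilon> then 1 else 0) *
          indicator (cell n f) s * indicator (cell n f') t"]) auto
      finally show ?case .
    qed
    then have "eventually (\<lambda>n. 1 \<le> G (Suc n) s t) sequentially"
      by (rule eventually_compose_filterlim) (rule filterlim_Suc)
    then have "1 \<le> liminf (\<lambda>n. G (Suc n) s t)" by (rule Liminf_bounded)
    then show ?thesis using True by simp
  qed simp
  have "(\<integral>\<^sup>+s. ennreal (len \<omega> s) \<partial>unif) = (\<integral>\<^sup>+s. (\<integral>\<^sup>+t. indicator (J \<omega> s) t \<partial>unif) \<partial>unif)"
    by (simp only: len_eq)
  also have "\<dots> \<le> (\<integral>\<^sup>+s. (\<integral>\<^sup>+t. liminf (\<lambda>n. G (Suc n) s t) \<partial>unif) \<partial>unif)"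
    by (intro nn_integral_mono ev)
  also have "\<dots> \<le> (\<integral>\<^sup>+s. liminf (\<lambda>n. \<integral>\<^sup>+t. G (Suc n) s t \<partial>unif) \<partial>unif)"
    by (intro nn_integral_mono nn_integral_liminf Gm1)
  also have "\<dots> \<le> liminf (\<lambda>n. \<integral>\<^sup>+s. (\<integral>\<^sup>+t. G (Suc n) s t \<partial>unif) \<partial>unif)"
    by (intro nn_integral_liminf Gm2) simp
  also have "\<dots> = liminf (\<lambda>n. close_sum \<epsilon> (Suc n) \<omega>)" by (simp only: G2 zero_less_Suc)
  finally show ?thesis .
qed

text \<open>
  The diagonal of \<open>close_sum\<close> is the expected squared length of the faces, about \<open>1 / 2\<close>, and its off-diagonal part is
  at most \<open>\<epsilon>\<close>. Together with the upper bound on the sampled lengths this forces their convergence in \<open>L\<^sup>1\<close>.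
\<close>

lemma nn_integral_len_le: "(\<integral>\<^sup>+\<omega>. (\<integral>\<^sup>+s. ennreal (len \<omega> s) \<partial>unif) \<partial>M) \<le> ennreal (1 / 2)"
proof (rule ennreal_le_epsilon)
  fix \<epsilon> :: real assume \<epsilon>: "0 < \<epsilon>"
  have "(\<integral>\<^sup>+\<omega>. (\<integral>\<^sup>+s. ennreal (len \<omega> s) \<partial>unif) \<partial>M) \<le> (\<integral>\<^sup>+\<omega>. liminf (\<lambda>n. close_sum \<epsilon> (Suc n) \<omega>) \<partial>M)"
  proof (rule nn_integral_mono_AE)
    show "AE \<omega> in M. (\<integral>\<^sup>+s. ennreal (len \<omega> s) \<partial>unif) \<le> liminf (\<lambda>n. close_sum \<epsilon> (Suc n) \<omega>)"
      using AE_regular AE_space by eventually_elim (rule nn_integral_len_le_close_sum[OF _ _ \<epsilon>])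
  qed
  also have "\<dots> \<le> liminf (\<lambda>n. \<integral>\<^sup>+\<omega>. close_sum \<epsilon> (Suc n) \<omega> \<partial>M)"
    by (rule nn_integral_liminf) (rule measurable_close_sum)
  also have "\<dots> \<le> liminf (\<lambda>n. ennreal (1 / 2 + 1 / (2 * real (Suc n)) + \<epsilon>))"
    by (intro Liminf_mono always_eventually allI nn_integral_close_sum_le \<epsilon>) simp
  also have "\<dots> = ennreal (1 / 2 + \<epsilon>)"
  proof (rule lim_imp_Liminf)
    have "(\<lambda>n. 1 / 2 + (1 / 2) * inverse (real (Suc n)) + \<epsilon>) \<longlonglongrightarrow> 1 / 2 + (1 / 2) * 0 + \<epsilon>"
      by (intro tendsto_intros LIMSEQ_inverse_real_of_nat)
    then have "(\<lambda>n. 1 / 2 + 1 / (2 * real (Suc n)) + \<epsilon>) \<longlonglongrightarrow> 1 / 2 + \<epsilon>" by (simp add: inverse_eq_divide)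
    then show "(\<lambda>n. ennreal (1 / 2 + 1 / (2 * real (Suc n)) + \<epsilon>)) \<longlonglongrightarrow> ennreal (1 / 2 + \<epsilon>)" by (rule tendsto_ennrealI)
  qed simp
  also have "\<dots> = ennreal (1 / 2) + ennreal \<epsilon>" using \<epsilon> by (subst ennreal_plus[symmetric]) auto
  finally show "(\<integral>\<^sup>+\<omega>. (\<integral>\<^sup>+s. ennreal (len \<omega> s) \<partial>unif) \<partial>M) \<le> ennreal (1 / 2) + ennreal \<epsilon>" .
qed

end

lemma nn_integral_grid_length:
  assumes n: "0 < n"
  shows "(\<integral>\<^sup>+s. ennreal (grid_length n x s) \<partial>unif) = (\<Sum>(g, l)\<in>faces n x. of_nat l * (ennreal (1 / real n) * ennreal (real l / real n)))"
proof -
  have "ennreal (grid_length n x s) = (\<Sum>f\<in>faces n x. ennreal (real (snd f) / real n) * indicator (cell n f) s)" for s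
  proof -
    have "(\<Sum>f\<in>faces n x. ennreal (if s \<in> cell n f then real (snd f) / real n else 0)) = ennreal (grid_length n x s)"
      unfolding grid_length_def by (rule sum_ennreal) auto
    moreover have "(\<Sum>f\<in>faces n x. ennreal (if s \<in> cell n f then real (snd f) / real n else 0)) =
        (\<Sum>f\<in>faces n x. ennreal (real (snd f) / real n) * indicator (cell n f) s)"
      by (intro sum.cong refl) (auto simp: indicator_def)
    ultimately show ?thesis by simp
  qed
  then have "(\<integral>\<^sup>+s. ennreal (grid_length n x s) \<partial>unif) =
      (\<integral>\<^sup>+s. (\<Sum>f\<in>faces n x. ennreal (real (snd f) / real n) * indicator (cell n f) s) \<partial>unif)" by simp
  also have "\<dots> = (\<Sum>f\<in>faces n x. \<integral>\<^sup>+s. ennreal (real (snd f) / real n) * indicator (cell n f) s \<partial>unif)"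
    by (rule nn_integral_sum) (intro borel_measurable_times_ennreal borel_measurable_const borel_measurable_indicator, simp)
  also have "\<dots> = (\<Sum>(g, l)\<in>faces n x. of_nat l * (ennreal (1 / real n) * ennreal (real l / real n)))"
    unfolding split_beta'
  proof (rule sum.cong[OF refl])
    fix f assume f: "f \<in> faces n x"
    have "(\<integral>\<^sup>+s. ennreal (real (snd f) / real n) * indicator (cell n f) s \<partial>unif) =
        ennreal (real (snd f) / real n) * ennreal (real (snd f) / real n)"
      by (subst nn_integral_cmult_indicator) (simp_all add: emeasure_cell[OF n f])
    also have "ennreal (real (snd f) / real n) * ennreal (real (snd f) / real n) =
        of_nat (snd f) * (ennreal (1 / real n) * ennreal (real (snd f) / real n))"
      by (simp add: ennreal_of_nat_eq_real_of_nat ennreal_mult[symmetric])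
    finally show "(\<integral>\<^sup>+s. ennreal (real (snd f) / real n) * indicator (cell n f) s \<partial>unif) =
        of_nat (snd f) * (ennreal (1 / real n) * ennreal (real (snd f) / real n))" .
  qed
  finally show ?thesis .
qed

lemma grid_length_nonneg: "0 \<le> grid_length n x s"
  unfolding grid_length_def by (intro sum_nonneg) auto

lemma grid_length_le_1: "grid_length n x s \<le> 1"
proof (cases "\<exists>f\<in>faces n x. s \<in> cell n f")
  case True
  then obtain f where f: "f \<in> faces n x" "s \<in> cell n f" by blast
  have "snd f \<le> n" using f(1) by (auto simp: faces_def dest!: is_faceD)
  then show ?thesis unfolding grid_length_eq[OF f] by (cases "n = 0") (auto simp: divide_le_eq_1)
next
  case False
  then have "grid_length n x s = 0" unfolding grid_length_def by (intro sum.neutral) auto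
  then show ?thesis by simp
qed

text \<open>Lower semicontinuity. Where the limit density is positive, the tests hold, the remaining
  lengths are positive and the points are separated; all this persists for large \<open>m\<close>,
  and the weights converge. Elsewhere the left side is 0.\<close>

lemma size_biased_density_liminf:
  assumes len: "\<And>i. (\<lambda>m. L m (u i)) \<longlonglongrightarrow> l (u i)"
    and J: "\<And>i j. u j \<notin> J (u i) \<Longrightarrow> eventually (\<lambda>m. u j \<notin> Jn m (u i)) sequentially"
    and R: "\<And>j a b an bn. R j a b \<Longrightarrow> 0 < b \<Longrightarrow> an \<longlonglongrightarrow> a \<Longrightarrow> bn \<longlonglongrightarrow> b \<Longrightarrow> eventually (\<lambda>m. Rn m j (an m) (bn m)) sequentially"
  shows "size_biased_density J l k {} 0 R u \<le> liminf (\<lambda>m. size_biased_density (Jn m) (L m) k {} 0 (Rn m) u)"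
proof (cases "size_biased_density J l k {} 0 R u = 0")
  case False
  define b where "b j = 1 - (\<Sum>i<j. l (u i))" for j
  define bn where "bn m j = 1 - (\<Sum>i<j. L m (u i))" for m j
  have nz: "(\<forall>i<j. u j \<notin> J (u i)) \<and> R j (l (u j)) (b j) \<and> 0 < b j" if "j < k" for j
  proof -
    have "(if u j \<notin> {} \<and> (\<forall>i<j. u j \<notin> J (u i)) \<and> R j (l (u j)) (1 - 0 - (\<Sum>i<j. l (u i)))
      then ennreal (1 / (1 - 0 - (\<Sum>i<j. l (u i)))) else 0) \<noteq> 0"
    proof
      assume "(if u j \<notin> {} \<and> (\<forall>i<j. u j \<notin> J (u i)) \<and> R j (l (u j)) (1 - 0 - (\<Sum>i<j. l (u i)))
        then ennreal (1 / (1 - 0 - (\<Sum>i<j. l (u i)))) else 0) = 0"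
      then have "size_biased_density J l k {} 0 R u = 0"
        unfolding size_biased_density_def by (intro prod_zero finite_lessThan bexI[of _ j]) (use that in auto)
      then show False using False by simp
    qed
    then have *: "(\<forall>i<j. u j \<notin> J (u i)) \<and> R j (l (u j)) (b j)" and "ennreal (1 / b j) \<noteq> 0"
      by (auto simp: b_def split: if_splits)
    \<comment> \<open>\<open>ennreal\<close> truncates negative numbers to 0 and division by 0 gives
      0, so a nonzero factor already forces a positive remaining length.\<close>
    then have "0 < 1 / b j" by (simp only: ennreal_eq_0_iff not_le)
    then show ?thesis using * by (simp add: zero_less_divide_1_iff)
  qed
  have bnb: "(\<lambda>m. bn m j) \<longlonglongrightarrow> b j" for j
    unfolding bn_def b_def by (intro tendsto_intros len)
  have val: "size_biased_density J l k {} 0 R u = ennreal (\<Prod>j<k. 1 / b j)"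
  proof -
    have "size_biased_density J l k {} 0 R u = (\<Prod>j<k. ennreal (1 / b j))"
      unfolding size_biased_density_def by (rule prod.cong[OF refl]) (use nz in \<open>auto simp: b_def\<close>)
    also have "\<dots> = ennreal (\<Prod>j<k. 1 / b j)"
      by (rule prod_ennreal) (use nz in \<open>auto intro: less_imp_le\<close>)
    finally show ?thesis .
  qed
  have ev: "eventually (\<lambda>m. \<forall>j\<in>{..<k}. (\<forall>i\<in>{..<j}. u j \<notin> Jn m (u i)) \<and> Rn m j (L m (u j)) (bn m j) \<and> 0 < bn m j) sequentially"
  proof (intro eventually_ball_finite ballI eventually_conj)
    fix j assume "j \<in> {..<k}"
    then have j: "j < k" by simp
    show "eventually (\<lambda>m. u j \<notin> Jn m (u i)) sequentially" if "i \<in> {..<j}" for i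
      using nz[OF j] that J by simp
    show "eventually (\<lambda>m. Rn m j (L m (u j)) (bn m j)) sequentially"
      using R[OF _ _ len bnb] nz[OF j] by blast
    show "eventually (\<lambda>m. 0 < bn m j) sequentially"
      using order_tendstoD(1)[OF bnb] nz[OF j] by blast
  qed auto
  have "(\<lambda>m. ennreal (\<Prod>j<k. 1 / bn m j)) \<longlonglongrightarrow> ennreal (\<Prod>j<k. 1 / b j)"
  proof (intro tendsto_ennrealI tendsto_prod tendsto_divide tendsto_const bnb)
    fix j assume "j \<in> {..<k}" then show "b j \<noteq> 0" using nz[of j] by auto
  qed
  moreover have "eventually (\<lambda>m. ennreal (\<Prod>j<k. 1 / bn m j) = size_biased_density (Jn m) (L m) k {} 0 (Rn m) u) sequentially"
    using ev
  proof eventually_elim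
    case (elim m)
    have "size_biased_density (Jn m) (L m) k {} 0 (Rn m) u = (\<Prod>j<k. ennreal (1 / bn m j))"
      unfolding size_biased_density_def by (rule prod.cong[OF refl]) (use elim in \<open>auto simp: bn_def\<close>)
    also have "\<dots> = ennreal (\<Prod>j<k. 1 / bn m j)"
      by (rule prod_ennreal) (use elim in \<open>auto intro: less_imp_le\<close>)
    finally show ?case ..
  qed
  ultimately have "(\<lambda>m. size_biased_density (Jn m) (L m) k {} 0 (Rn m) u) \<longlonglongrightarrow> ennreal (\<Prod>j<k. 1 / b j)"
    by (rule Lim_transform_eventually)
  then have "liminf (\<lambda>m. size_biased_density (Jn m) (L m) k {} 0 (Rn m) u) = ennreal (\<Prod>j<k. 1 / b j)"
    by (intro lim_imp_Liminf) auto
  then show ?thesis by (simp only: val order_refl)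
qed simp

context brownian
begin

lemma measurable_grid_length_joint:
  assumes s: "s \<in> borel_measurable N" and w: "w \<in> measurable N M"
  shows "(\<lambda>z. grid_length n (incr n (w z)) (s z)) \<in> borel_measurable N"
proof -
  have "grid_length n (incr n (w z)) (s z) = (\<Sum>l\<in>{1..n}. \<Sum>g\<le>n - l. if is_face n (incr n (w z)) g l
      then (if s z \<in> cell n (g, l) then real l / real n else 0) else 0)" for z
    unfolding grid_length_def sum_faces[symmetric] split_beta' by simp
  moreover have "{z \<in> space N. is_face n (incr n (w z)) g l} \<in> sets N" for g l
    using measurable_compose[OF w pred_is_face_incr] by (simp add: pred_def)
  moreover have "{z \<in> space N. s z \<in> cell n f} \<in> sets N" for f
    using measurable_sets[OF s sets_cell[of n f]] by (simp add: vimage_def Int_def conj_commute)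
  ultimately show ?thesis
    by (simp only:) (intro borel_measurable_sum measurable_If borel_measurable_const)
qed

definition close_length :: "(nat \<Rightarrow> nat) \<Rightarrow> 'a \<Rightarrow> real \<Rightarrow> bool"
  where "close_length r \<omega> s \<longleftrightarrow> (\<lambda>m. grid_length (r m) (incr (r m) \<omega>) s) \<longlonglongrightarrow> len \<omega> s"

lemma AE_AE_in_interval: "AE \<omega> in M. AE s in unif. s \<in> J \<omega> s"
proof -
  interpret Q: pair_sigma_finite unif M ..
  interpret R: random_path "unif \<Otimes>\<^sub>M M" "\<lambda>z t. B t (snd z)" by (rule random_path_compose) simp
  have "Measurable.pred (unif \<Otimes>\<^sub>M M) (\<lambda>z. fst z \<in> J (snd z) (fst z))"
    by (rule R.measurable_interval_containing) measurable
  then have "{z \<in> space (unif \<Otimes>\<^sub>M M). fst z \<in> J (snd z) (fst z)} \<in> sets (unif \<Otimes>\<^sub>M M)" by (simp add: pred_def)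
  from Q.AE_commute[OF this] show ?thesis using Q.AE_pair[OF AE_in_interval] by simp
qed

text \<open>For almost every path and point the excess \<open>max 0 (\<Lambda> m z - lam z)\<close>
  tends to 0, and by domination so does its mean. The means of \<open>\<Lambda> m\<close> are at
  least \<open>1 / 2\<close> and that of \<open>lam\<close> is at most \<open>1 / 2\<close>, so the
  mean deficit does not exceed the mean excess. This gives convergence in mean, hence almost
  everywhere along a subsequence.\<close>

lemma ex_subsequence:
  obtains r where "strict_mono r" "\<And>m. 0 < r m" "AE \<omega> in M. AE s in unif. close_length r \<omega> s"
proof -
  interpret Q: pair_prob_space M unif ..
  interpret R: random_path "M \<Otimes>\<^sub>M unif" "\<lambda>z t. B t (fst z)" by (rule random_path_compose) simp
  let ?N = "M \<Otimes>\<^sub>M unif"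
  define \<Lambda> where "\<Lambda> m z = grid_length (Suc m) (incr (Suc m) (fst z)) (snd z)" for m z
  define lam where "lam z = len (fst z) (snd z)" for z
  have sm: "snd \<in> borel_measurable ?N" by measurable
  have \<Lambda>_meas [measurable]: "\<Lambda> m \<in> borel_measurable ?N" for m
    unfolding \<Lambda>_def[abs_def] by (rule measurable_grid_length_joint[OF sm]) measurable
  have lam_meas [measurable]: "lam \<in> borel_measurable ?N"
    unfolding lam_def[abs_def] by (rule R.measurable_length_interval[OF sm])
  have b: "0 \<le> \<Lambda> m z" "\<Lambda> m z \<le> 1" "0 \<le> lam z" "lam z \<le> 1" for m z
    unfolding \<Lambda>_def lam_def by (auto intro: grid_length_nonneg grid_length_le_1 len_le_1)
  have int: "integrable ?N (\<Lambda> m)" "integrable ?N lam" for m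
    by (rule Q.integrable_const_bound[where B = 1], use b in auto)+
  have Ilam: "integral\<^sup>L ?N lam \<le> 1 / 2"
  proof -
    have "ennreal (integral\<^sup>L ?N lam) = (\<integral>\<^sup>+z. ennreal (lam z) \<partial>?N)"
      by (rule nn_integral_eq_integral[symmetric, OF int(2)]) (simp add: b)
    also have "\<dots> = (\<integral>\<^sup>+\<omega>. (\<integral>\<^sup>+s. ennreal (lam (\<omega>, s)) \<partial>unif) \<partial>M)"
      by (rule Unif.nn_integral_fst[symmetric]) measurable
    also have "\<dots> = (\<integral>\<^sup>+\<omega>. (\<integral>\<^sup>+s. ennreal (len \<omega> s) \<partial>unif) \<partial>M)" by (simp add: lam_def)
    also have "\<dots> \<le> ennreal (1 / 2)" by (rule nn_integral_len_le)
    finally show ?thesis by (subst (asm) ennreal_le_iff) auto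
  qed
  have I\<Lambda>: "1 / 2 \<le> integral\<^sup>L ?N (\<Lambda> m)" for m
  proof -
    let ?n = "Suc m"
    have "ennreal (integral\<^sup>L ?N (\<Lambda> m)) = (\<integral>\<^sup>+z. ennreal (\<Lambda> m z) \<partial>?N)"
      by (rule nn_integral_eq_integral[symmetric, OF int(1)]) (simp add: b)
    also have "\<dots> = (\<integral>\<^sup>+\<omega>. (\<integral>\<^sup>+s. ennreal (grid_length ?n (incr ?n \<omega>) s) \<partial>unif) \<partial>M)"
    proof -
      have "(\<integral>\<^sup>+z. ennreal (\<Lambda> m z) \<partial>?N) = (\<integral>\<^sup>+\<omega>. (\<integral>\<^sup>+s. ennreal (\<Lambda> m (\<omega>, s)) \<partial>unif) \<partial>M)"
        by (rule Unif.nn_integral_fst[symmetric]) measurable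
      then show ?thesis by (simp add: \<Lambda>_def)
    qed
    also have "\<dots> = (\<Sum>l\<in>{1..?n}. ennreal (1 / real ?n) * ennreal (real l / real ?n))"
      by (simp only: nn_integral_grid_length zero_less_Suc nn_integral_sum_length_incr)
    also have "\<dots> = ennreal (\<Sum>l\<in>{1..?n}. 1 / real ?n * (real l / real ?n))"
      by (subst sum_ennreal[symmetric]) (auto simp: ennreal_mult[symmetric] simp del: of_nat_Suc)
    also have "(\<Sum>l\<in>{1..?n}. 1 / real ?n * (real l / real ?n)) = 1 / 2 + 1 / (2 * real ?n)"
    proof -
      have "(\<Sum>l\<in>{1..k}. real l) = real k * (real k + 1) / 2" for k
        by (induction k) (auto simp: field_simps)
      then have "(\<Sum>l\<in>{1..?n}. 1 / real ?n * (real l / real ?n)) = 1 / real ?n * ((real ?n * (real ?n + 1) / 2) / real ?n)"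
        by (simp only: sum_distrib_left[symmetric] sum_divide_distrib[symmetric])
      also have "\<dots> = 1 / 2 + 1 / (2 * real ?n)" by (simp add: field_simps del: of_nat_Suc)
      finally show ?thesis .
    qed
    finally have "integral\<^sup>L ?N (\<Lambda> m) = 1 / 2 + 1 / (2 * real ?n)"
      by (subst (asm) ennreal_inj) (auto intro!: integral_nonneg_AE simp: b)
    then show ?thesis by simp
  qed
  have AElim: "AE z in ?N. (\<lambda>m. max 0 (\<Lambda> m z - lam z)) \<longlonglongrightarrow> 0"
  proof (rule Q.AE_pair_measure)
    show "{z \<in> space ?N. (\<lambda>m. max 0 (\<Lambda> m z - lam z)) \<longlonglongrightarrow> 0} \<in> sets ?N" by measurable
    show "AE \<omega> in M. AE s in unif. (\<lambda>m. max 0 (\<Lambda> m (\<omega>, s) - lam (\<omega>, s))) \<longlonglongrightarrow> 0"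
      using AE_regular AE_space AE_AE_in_interval
    proof eventually_elim
      case (elim \<omega>)
      from elim(3) show ?case
      proof (rule eventually_mono)
        fix s assume s: "s \<in> J \<omega> s"
        obtain p q \<beta> where F: "unit_path.face_line (bpath \<omega>) p q \<beta>" "J \<omega> s = {p<..<q}"
          using regular_face_line[OF elim(2,1) s] by metis
        show "(\<lambda>m. max 0 (\<Lambda> m (\<omega>, s) - lam (\<omega>, s))) \<longlonglongrightarrow> 0"
        proof (rule LIMSEQ_I)
          fix \<delta> :: real assume \<delta>: "0 < \<delta>"
          from regular_limit[OF elim(2,1) s \<delta> F]
          have "eventually (\<lambda>n. grid_length n (incr n \<omega>) s < len \<omega> s + \<delta>) sequentially"
            by eventually_elim blast
          then obtain N where N: "\<And>n. N \<le> n \<Longrightarrow> grid_length n (incr n \<omega>) s < len \<omega> s + \<delta>"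
            unfolding eventually_sequentially by blast
          show "\<exists>N. \<forall>m\<ge>N. norm (max 0 (\<Lambda> m (\<omega>, s) - lam (\<omega>, s)) - 0) < \<delta>"
            using N[of "Suc m" for m] \<delta> by (intro exI[of _ N]) (auto simp: \<Lambda>_def lam_def less_diff_eq algebra_simps)
        qed
      qed
    qed
  qed
  have "(\<lambda>m. \<integral>z. max 0 (\<Lambda> m z - lam z) \<partial>?N) \<longlonglongrightarrow> (\<integral>z. 0 \<partial>?N)"
  proof (rule integral_dominated_convergence[where w = "\<lambda>_. 1"])
    show "AE z in ?N. norm (max 0 (\<Lambda> m z - lam z)) \<le> 1" for m
    proof (rule AE_I2)
      fix z show "norm (max 0 (\<Lambda> m z - lam z)) \<le> 1" using b(1,2)[of m z] b(3,4)[of z] by simp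
    qed
  qed (use AElim in auto)
  then have lim: "(\<lambda>m. 2 * (\<integral>z. max 0 (\<Lambda> m z - lam z) \<partial>?N)) \<longlonglongrightarrow> 0"
    using tendsto_mult_right_zero[of _ sequentially 2] by simp
  have "(\<lambda>m. \<integral>z. norm (\<Lambda> m z - lam z) \<partial>?N) \<longlonglongrightarrow> 0"
  proof (rule tendsto_sandwich[OF _ _ tendsto_const lim])
    show "eventually (\<lambda>m. 0 \<le> (\<integral>z. norm (\<Lambda> m z - lam z) \<partial>?N)) sequentially"
      by (intro always_eventually allI integral_nonneg_AE) auto
    have imax: "integrable ?N (\<lambda>z. max 0 (\<Lambda> m z - lam z))" for m using int by auto
    have "(\<integral>z. norm (\<Lambda> m z - lam z) \<partial>?N) \<le> 2 * (\<integral>z. max 0 (\<Lambda> m z - lam z) \<partial>?N)" for m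
    proof -
      have "(\<integral>z. norm (\<Lambda> m z - lam z) \<partial>?N) = (\<integral>z. 2 * max 0 (\<Lambda> m z - lam z) - (\<Lambda> m z - lam z) \<partial>?N)"
        by (intro Bochner_Integration.integral_cong refl) (auto simp: max_def)
      also have "\<dots> = 2 * (\<integral>z. max 0 (\<Lambda> m z - lam z) \<partial>?N) - (integral\<^sup>L ?N (\<Lambda> m) - integral\<^sup>L ?N lam)"
        using imax int by simp
      finally show ?thesis using Ilam I\<Lambda>[of m] by simp
    qed
    then show "eventually (\<lambda>m. (\<integral>z. norm (\<Lambda> m z - lam z) \<partial>?N) \<le> 2 * (\<integral>z. max 0 (\<Lambda> m z - lam z) \<partial>?N)) sequentially"
      by (intro always_eventually allI)
  qed
  then obtain r0 where r0: "strict_mono r0" "AE z in ?N. (\<lambda>m. \<Lambda> (r0 m) z - lam z) \<longlonglongrightarrow> 0"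
    using tendsto_L1_AE_subseq[of ?N "\<lambda>m z. \<Lambda> m z - lam z"] int by auto
  define r where "r m = Suc (r0 m)" for m
  have "AE z in ?N. close_length r (fst z) (snd z)"
    using r0(2)
  proof (rule eventually_mono)
    fix z assume "(\<lambda>m. \<Lambda> (r0 m) z - lam z) \<longlonglongrightarrow> 0"
    then have "(\<lambda>m. \<Lambda> (r0 m) z) \<longlonglongrightarrow> lam z" by (rule LIM_zero_cancel)
    then show "close_length r (fst z) (snd z)" by (simp add: close_length_def \<Lambda>_def lam_def r_def)
  qed
  from Q.AE_pair[OF this] have "AE \<omega> in M. AE s in unif. close_length r \<omega> s" by simp
  then show ?thesis using r0(1) by (intro that[of r]) (auto simp: r_def strict_mono_def)
qed

end

section \<open>The law of the ratios for Brownian motion with independent uniform points\<close>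

lemma card_lower_le:
  assumes "0 \<le> a"
  shows "real (card {l \<in> {1..m}. real l / real m < a}) \<le> a * real m"
proof (cases "m = 0")
  case False
  have "{l \<in> {1..m}. real l / real m < a} \<subseteq> {1..<nat \<lceil>a * real m\<rceil>}"
    using False by (auto simp: field_simps zless_nat_eq_int_zless less_ceiling_iff)
  then have "card {l \<in> {1..m}. real l / real m < a} \<le> card {1..<nat \<lceil>a * real m\<rceil>}" by (intro card_mono) auto
  then have "real (card {l \<in> {1..m}. real l / real m < a}) \<le> real (nat \<lceil>a * real m\<rceil> - 1)" by simp
  also have "\<dots> \<le> a * real m"
    using assms by (cases "nat \<lceil>a * real m\<rceil>") (auto, linarith)
  finally show ?thesis .
qed simp

lemma card_upper_le:
  assumes "0 \<le> a" "a \<le> 1"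
  shows "real (card {l \<in> {1..m}. a < (real l - 1) / real m}) \<le> (1 - a) * real m"
proof (cases "m = 0")
  case False
  let ?k = "nat \<lfloor>a * real m\<rfloor>"
  \<comment> \<open>From \<open>l - 1 > a * m\<close> follows
    \<open>l \<ge> \<lfloor>a * m\<rfloor> + 2\<close>; the extra unit compensates for rounding
    down.\<close>
  have "{l \<in> {1..m}. a < (real l - 1) / real m} \<subseteq> {?k + 2..m}"
  proof
    fix l assume "l \<in> {l \<in> {1..m}. a < (real l - 1) / real m}"
    then have l: "1 \<le> l" "l \<le> m" "a * real m < real l - 1" using False by (auto simp: field_simps)
    have "0 \<le> a * real m" using assms by simp
    then have "real ?k \<le> a * real m" by linarith
    then have "real ?k < real l - 1" using l by linarith
    then have "?k + 2 \<le> l" by linarith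
    then show "l \<in> {?k + 2..m}" using l by simp
  qed
  then have "card {l \<in> {1..m}. a < (real l - 1) / real m} \<le> card {?k + 2..m}" by (intro card_mono) auto
  then have "real (card {l \<in> {1..m}. a < (real l - 1) / real m}) \<le> real (m - Suc ?k)" by simp
  also have "\<dots> \<le> (1 - a) * real m"
  proof (cases "Suc ?k \<le> m")
    case True
    have "a * real m < real ?k + 1" using assms by (simp add: of_nat_nat)
    then show ?thesis using True by (simp add: of_nat_diff algebra_simps)
  next
    case False
    then show ?thesis using assms by simp
  qed
  finally show ?thesis .
qed simp

text \<open>Both alternatives are strict and hence stable under small changes, as the limit
  requires; the boundary case is recovered in \<open>prob_event_le\<close>.\<close>

definition ratio_test :: "(nat \<Rightarrow> bool) \<Rightarrow> (nat \<Rightarrow> real) \<Rightarrow> nat \<Rightarrow> real \<Rightarrow> real \<Rightarrow> bool"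
  where "ratio_test \<theta> a j x y \<longleftrightarrow> (if \<theta> j then a j < x / y else x / y < a j)"

text \<open>
  The shift by one grid step in the lower bound makes the number of admissible lengths at most
  \<open>(1 - a j) * m\<close>, without rounding errors; it disappears in the limit.
\<close>

definition grid_ratio_test :: "nat \<Rightarrow> (nat \<Rightarrow> bool) \<Rightarrow> (nat \<Rightarrow> real) \<Rightarrow> nat \<Rightarrow> real \<Rightarrow> real \<Rightarrow> bool"
  where "grid_ratio_test n \<theta> a j x y \<longleftrightarrow> (if \<theta> j then a j < (x - 1 / real n) / y else x / y < a j)"

lemma pred_ratio_test: "Measurable.pred (borel \<Otimes>\<^sub>M borel) (\<lambda>p. ratio_test \<theta> a j (fst p) (snd p))"
  unfolding ratio_test_def by (cases "\<theta> j") (simp_all, measurable)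

lemma pred_grid_ratio_test: "Measurable.pred (borel \<Otimes>\<^sub>M borel) (\<lambda>p. grid_ratio_test n \<theta> a j (fst p) (snd p))"
  unfolding grid_ratio_test_def by (cases "\<theta> j") (simp_all, measurable)

lemma card_grid_ratio_test:
  assumes n: "0 < n" and a: "0 \<le> a j" "\<theta> j \<Longrightarrow> a j \<le> 1"
  shows "real (card {l \<in> {1..m}. grid_ratio_test n \<theta> a j (real l / real n) (real m / real n)}) \<le>
    (if \<theta> j then 1 - a j else a j) * real m"
proof -
  have *: "(real l / real n - 1 / real n) / (real m / real n) = (real l - 1) / real m" for l
    using n by (simp add: diff_divide_distrib[symmetric])
  have **: "(real l / real n) / (real m / real n) = real l / real m" for l using n by simp
  show ?thesis
  proof (cases "\<theta> j")
    case True
    show ?thesis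
      using card_upper_le[OF a(1) a(2)[OF True], of m] by (simp only: grid_ratio_test_def True if_True *)
  next
    case False
    show ?thesis
      using card_lower_le[OF a(1), of m] by (simp only: grid_ratio_test_def False if_False **)
  qed
qed

lemma grid_ratio_test_eventually:
  assumes "ratio_test \<theta> a j x y" "0 < y" "xn \<longlonglongrightarrow> x" "yn \<longlonglongrightarrow> y" and r: "strict_mono r" "\<And>m. 0 < r m"
  shows "eventually (\<lambda>m. grid_ratio_test (r m) \<theta> a j (xn m) (yn m)) sequentially"
proof (cases "\<theta> j")
  case True
  have "(\<lambda>n. 1 / real n) \<longlonglongrightarrow> 0" by (rule lim_1_over_n)
  then have "(\<lambda>m. 1 / real (r m)) \<longlonglongrightarrow> 0" using LIMSEQ_subseq_LIMSEQ[OF _ r(1)] by (simp add: o_def)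
  then have "(\<lambda>m. (xn m - 1 / real (r m)) / yn m) \<longlonglongrightarrow> (x - 0) / y"
    using assms by (intro tendsto_intros) auto
  then have "(\<lambda>m. (xn m - 1 / real (r m)) / yn m) \<longlonglongrightarrow> x / y" by simp
  from order_tendstoD(1)[OF this] show ?thesis
    using assms(1) True by (simp add: ratio_test_def grid_ratio_test_def)
next
  case False
  have "(\<lambda>m. xn m / yn m) \<longlonglongrightarrow> x / y" using assms by (intro tendsto_intros) auto
  from order_tendstoD(2)[OF this] show ?thesis
    using assms(1) False by (simp add: ratio_test_def grid_ratio_test_def)
qed

definition stick_ratio :: "real set \<Rightarrow> (nat \<Rightarrow> real) \<Rightarrow> nat \<Rightarrow> real"
  where "stick_ratio V u n = size_biased_length V u n / (1 - (\<Sum>k<n. size_biased_length V u k))"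

lemma (in random_path) measurable_stick_ratio:
  assumes u: "\<And>i. (\<lambda>z. u z i) \<in> borel_measurable N"
  shows "(\<lambda>z. stick_ratio (V z) (u z) n) \<in> borel_measurable N"
proof -
  have d: "(\<lambda>z. discovery_index (V z) (u z) n) \<in> measurable N (count_space UNIV)" for n
    using measurable_discovery_index_from[of u N "\<lambda>_. {}" V n] u measurable_interval_containing
    by (simp add: discovery_index_from_empty)
  have [measurable]: "(\<lambda>z. size_biased_length (V z) (u z) n) \<in> borel_measurable N" for n
    unfolding size_biased_length_def
    by (rule measurable_length_interval) (rule measurable_compose_countable[OF u d])
  show ?thesis unfolding stick_ratio_def by measurable
qed

context brownian
begin

text \<open>Different intervals have different slopes, and the slopes of the sampled faces over the
  two points tend to them. Within half the difference of the two limits, a common face is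
  impossible.\<close>

lemma eventually_separated:
  assumes \<omega>: "\<omega> \<in> space M" "regular \<omega>" and s: "s \<in> J \<omega> s" and t: "t \<in> J \<omega> t" and ts: "t \<notin> J \<omega> s"
  shows "eventually (\<lambda>n. t \<notin> grid_interval n (incr n \<omega>) s) sequentially"
proof -
  interpret P: unit_path "bpath \<omega>" by (rule unit_path[OF \<omega>(1)])
  obtain p q \<beta> where F: "P.face_line p q \<beta>" "J \<omega> s = {p<..<q}" using regular_face_line[OF \<omega> s] by metis
  obtain p' q' \<beta>' where F': "P.face_line p' q' \<beta>'" "J \<omega> t = {p'<..<q'}" using regular_face_line[OF \<omega> t] by metis
  have ne: "\<beta> \<noteq> \<beta>'"
  proof
    assume "\<beta> = \<beta>'"
    then have "p = p' \<and> q = q'" using P.face_line_unique F(1) F'(1) by blast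
    then show False using F(2) F'(2) t ts by simp
  qed
  define \<delta> where "\<delta> = \<bar>\<beta> - \<beta>'\<bar> / 2"
  have \<delta>: "0 < \<delta>" using ne by (simp add: \<delta>_def)
  show ?thesis
    using regular_limit[OF \<omega> s \<delta> F] regular_limit[OF \<omega> t \<delta> F']
  proof eventually_elim
    case (elim n)
    then obtain f f' where f: "f \<in> faces n (incr n \<omega>)" "s \<in> cell n f" "\<bar>grid_slope (bpath \<omega>) n (fst f) (snd f) - \<beta>\<bar> < \<delta>"
      and f': "f' \<in> faces n (incr n \<omega>)" "t \<in> cell n f'" "\<bar>grid_slope (bpath \<omega>) n (fst f') (snd f') - \<beta>'\<bar> < \<delta>"
      by blast
    show ?case
    proof
      assume "t \<in> grid_interval n (incr n \<omega>) s"
      then obtain f0 where f0: "f0 \<in> faces n (incr n \<omega>)" "s \<in> cell n f0" "t \<in> cell n f0"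
        unfolding grid_interval_def by blast
      have "f0 = f" by (rule cell_disjoint[OF f0(1) f(1) f0(2) f(2)])
      moreover have "f0 = f'" by (rule cell_disjoint[OF f0(1) f'(1) f0(3) f'(2)])
      ultimately show False using f(3) f'(3) unfolding \<delta>_def by (simp add: abs_if split: if_splits)
    qed
  qed
qed

abbreviation "weight \<theta> a k n \<omega> \<equiv> size_biased_weight k (faces n (incr n \<omega>)) snd n
  (\<lambda>j l m. grid_ratio_test n \<theta> a j (real l / real n) (real m / real n))"

text \<open>Fatou's lemma over the sample points, for a fixed path;
  \<open>nn_integral_grid_density\<close> turns the integrals on the right into size-biased weights
  of the sampled walk.\<close>

lemma density_le_liminf:
  assumes \<omega>: "\<omega> \<in> space M" "regular \<omega>" and r: "strict_mono r" "\<And>m. 0 < r m"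
    and in_J: "AE s in unif. s \<in> J \<omega> s" and cl: "AE s in unif. close_length r \<omega> s"
  shows "(\<integral>\<^sup>+u. size_biased_density (J \<omega>) (len \<omega>) k {} 0 (ratio_test \<theta> a) u \<partial>U.S) \<le>
    liminf (\<lambda>m. weight \<theta> a k (r m) \<omega>)"
proof -
  let ?D = "\<lambda>m u. size_biased_density (grid_interval (r m) (incr (r m) \<omega>)) (grid_length (r m) (incr (r m) \<omega>)) k {} 0
    (grid_ratio_test (r m) \<theta> a) u"
  have "AE u in U.S. \<forall>i. u i \<in> J \<omega> (u i)"
    using U.AE_component[OF UNIV_I in_J] by (simp add: AE_all_countable)
  moreover have "AE u in U.S. \<forall>i. close_length r \<omega> (u i)"
    using U.AE_component[OF UNIV_I cl] by (simp add: AE_all_countable)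
  ultimately have "AE u in U.S. size_biased_density (J \<omega>) (len \<omega>) k {} 0 (ratio_test \<theta> a) u \<le> liminf (\<lambda>m. ?D m u)"
  proof eventually_elim
    case (elim u)
    show ?case
    proof (rule size_biased_density_liminf)
      show "(\<lambda>m. grid_length (r m) (incr (r m) \<omega>) (u i)) \<longlonglongrightarrow> len \<omega> (u i)" for i
        using elim(2) by (simp add: close_length_def)
      show "eventually (\<lambda>m. u j \<notin> grid_interval (r m) (incr (r m) \<omega>) (u i)) sequentially" if "u j \<notin> J \<omega> (u i)" for i j
        using eventually_subseq[OF r(1) eventually_separated[OF \<omega> _ _ that]] elim(1) by blast
      show "eventually (\<lambda>m. grid_ratio_test (r m) \<theta> a j (an m) (bn m)) sequentially"
        if "ratio_test \<theta> a j x y" "0 < y" "an \<longlonglongrightarrow> x" "bn \<longlonglongrightarrow> y" for j x y an bn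
        by (rule grid_ratio_test_eventually[OF that r])
    qed
  qed
  then have "(\<integral>\<^sup>+u. size_biased_density (J \<omega>) (len \<omega>) k {} 0 (ratio_test \<theta> a) u \<partial>U.S) \<le> (\<integral>\<^sup>+u. liminf (\<lambda>m. ?D m u) \<partial>U.S)"
    by (rule nn_integral_mono_AE)
  also have "\<dots> \<le> liminf (\<lambda>m. \<integral>\<^sup>+u. ?D m u \<partial>U.S)"
    by (rule nn_integral_liminf) (rule measurable_grid_density[OF pred_grid_ratio_test], simp)
  also have "(\<lambda>m. \<integral>\<^sup>+u. ?D m u \<partial>U.S) = (\<lambda>m. weight \<theta> a k (r m) \<omega>)"
  proof
    fix m
    have "(\<Sum>(g, l)\<in>faces (r m) (incr (r m) \<omega>). l) = r m" using \<omega>(2) r(2) by (simp add: regular_def)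
    from nn_integral_grid_density[OF r(2) this, of "{}" "grid_ratio_test (r m) \<theta> a" k]
    show "(\<integral>\<^sup>+u. ?D m u \<partial>U.S) = weight \<theta> a k (r m) \<omega>"
      using pred_grid_ratio_test by simp
  qed
  finally show ?thesis .
qed

abbreviation "ratio \<omega> u j \<equiv> stick_ratio (V \<omega>) u j"

lemma nn_integral_pattern:
  "(\<integral>\<^sup>+u. (if \<forall>j<k. if \<theta> j then a j < ratio \<omega> u j else ratio \<omega> u j < a j then 1 else 0) \<partial>U.S) =
    (\<integral>\<^sup>+u. size_biased_density (J \<omega>) (len \<omega>) k {} 0 (ratio_test \<theta> a) u \<partial>U.S)"
proof -
  have "bounded_away_0 {}" unfolding bounded_away_0_def by (intro exI[of _ 1]) simp
  from rejection_sampling[OF V_subset _ _ this _ pred_ratio_test, where k = k]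
  have "(\<integral>\<^sup>+u. (if \<forall>j<k. ratio_test \<theta> a j (size_biased_length (V \<omega>) u j) (1 - 0 - (\<Sum>i<j. size_biased_length (V \<omega>) u i))
      then 1 else 0) \<partial>U.S) = (\<integral>\<^sup>+u. size_biased_density (J \<omega>) (len \<omega>) k {} 0 (ratio_test \<theta> a) u \<partial>U.S)"
    by (simp add: discovery_index_from_empty size_biased_length_def)
  then show ?thesis by (simp only: ratio_test_def stick_ratio_def diff_0_right)
qed

text \<open>Fatou's lemma over the paths, combined with the bound for walks. The condition
  \<open>a j \<le> 1\<close> is tied to \<open>\<theta> j\<close> because
  \<open>prob_event_le\<close> raises the other thresholds, possibly above 1.\<close>

lemma pattern_le:
  assumes a: "\<And>j. 0 \<le> a j" "\<And>j. \<theta> j \<Longrightarrow> a j \<le> 1" and A: "A \<in> sets borel"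
  shows "(\<integral>\<^sup>+\<omega>. (\<integral>\<^sup>+u. (if \<forall>j<k. if \<theta> j then a j < ratio \<omega> u j else ratio \<omega> u j < a j then 1 else 0) \<partial>U.S) *
      indicator A (B 1 \<omega>) \<partial>M) \<le>
    ennreal (\<Prod>j<k. if \<theta> j then 1 - a j else a j) * (\<integral>\<^sup>+\<omega>. indicator A (B 1 \<omega>) \<partial>M)"
proof -
  obtain r where r: "strict_mono r" "\<And>m. 0 < r m" "AE \<omega> in M. AE s in unif. close_length r \<omega> s"
    by (rule ex_subsequence) blast
  have [measurable]: "(indicator A :: real \<Rightarrow> ennreal) \<in> borel_measurable borel" using A by simp
  have B1: "B 1 \<in> borel_measurable M" by (rule B_meas) simp
  have "(\<integral>\<^sup>+\<omega>. (\<integral>\<^sup>+u. (if \<forall>j<k. if \<theta> j then a j < ratio \<omega> u j else ratio \<omega> u j < a j then 1 else 0) \<partial>U.S) *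
      indicator A (B 1 \<omega>) \<partial>M) \<le> (\<integral>\<^sup>+\<omega>. liminf (\<lambda>m. weight \<theta> a k (r m) \<omega> * indicator A (B 1 \<omega>)) \<partial>M)"
  proof (rule nn_integral_mono_AE)
    show "AE \<omega> in M. (\<integral>\<^sup>+u. (if \<forall>j<k. if \<theta> j then a j < ratio \<omega> u j else ratio \<omega> u j < a j then 1 else 0) \<partial>U.S) *
      indicator A (B 1 \<omega>) \<le> liminf (\<lambda>m. weight \<theta> a k (r m) \<omega> * indicator A (B 1 \<omega>))"
      using AE_regular AE_space AE_AE_in_interval r(3)
    proof eventually_elim
      case (elim \<omega>)
      from density_le_liminf[OF elim(2,1) r(1,2) elim(3,4), of k \<theta> a]
      show ?case unfolding nn_integral_pattern by (cases "B 1 \<omega> \<in> A") simp_all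
    qed
  qed
  also have "\<dots> \<le> liminf (\<lambda>m. \<integral>\<^sup>+\<omega>. weight \<theta> a k (r m) \<omega> * indicator A (B 1 \<omega>) \<partial>M)"
  proof (rule nn_integral_liminf)
    fix m
    show "(\<lambda>\<omega>. weight \<theta> a k (r m) \<omega> * indicator A (B 1 \<omega>)) \<in> borel_measurable M"
      by (intro borel_measurable_times_ennreal measurable_faces_incr[OF r(2)] measurable_compose[OF B1]) simp
  qed
  also have "\<dots> \<le> liminf (\<lambda>m :: nat. ennreal (\<Prod>j<k. if \<theta> j then 1 - a j else a j) * (\<integral>\<^sup>+\<omega>. indicator A (B 1 \<omega>) \<partial>M))"
  proof (intro Liminf_mono always_eventually allI nn_integral_size_biased_weight_incr r(2))
    fix m j n
    show "real (card {l \<in> {1..n}. grid_ratio_test (r m) \<theta> a j (real l / real (r m)) (real n / real (r m))}) \<le>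
        (if \<theta> j then 1 - a j else a j) * real n"
      by (rule card_grid_ratio_test[OF r(2)]) (use a in auto)
  qed (use a in auto)
  also have "\<dots> = ennreal (\<Prod>j<k. if \<theta> j then 1 - a j else a j) * (\<integral>\<^sup>+\<omega>. indicator A (B 1 \<omega>) \<partial>M)"
    by (rule Liminf_const) simp
  finally show ?thesis .
qed

sublocale MU: pair_prob_space M "PiM UNIV (\<lambda>_ :: nat. unif)" ..

text \<open>The alternative to \<open><\<close> is now its exact complement, so that for given
  \<open>k\<close> the patterns partition the event that \<open>B 1\<close> lies in
  \<open>A\<close>.\<close>

definition event :: "nat \<Rightarrow> (nat \<Rightarrow> bool) \<Rightarrow> (nat \<Rightarrow> real) \<Rightarrow> real set \<Rightarrow> ('a \<times> (nat \<Rightarrow> real)) set"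
  where "event k \<theta> a A = {z \<in> space (M \<Otimes>\<^sub>M U.S).
    (\<forall>j<k. if \<theta> j then a j < ratio (fst z) (snd z) j else ratio (fst z) (snd z) j \<le> a j) \<and> B 1 (fst z) \<in> A}"

lemma measurable_ratio: "(\<lambda>z. ratio (fst z) (snd z) j) \<in> borel_measurable (M \<Otimes>\<^sub>M U.S)"
proof -
  interpret R: random_path "M \<Otimes>\<^sub>M U.S" "\<lambda>z t. B t (fst z)" by (rule random_path_compose) simp
  show ?thesis
    by (rule R.measurable_stick_ratio) (rule measurable_compose[OF measurable_snd measurable_seq_coord])
qed

lemma sets_event:
  assumes A: "A \<in> sets borel"
  shows "event k \<theta> a A \<in> sets (M \<Otimes>\<^sub>M U.S)"
proof -
  have B1: "(\<lambda>z. B 1 (fst z)) \<in> borel_measurable (M \<Otimes>\<^sub>M U.S)"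
    by (rule measurable_compose[OF measurable_fst B_meas]) simp
  have 1: "{z \<in> space (M \<Otimes>\<^sub>M U.S). B 1 (fst z) \<in> A} \<in> sets (M \<Otimes>\<^sub>M U.S)"
    using measurable_sets[OF B1 A] by (simp add: vimage_def Int_def conj_commute)
  have 2: "{z \<in> space (M \<Otimes>\<^sub>M U.S). \<forall>j<k. if \<theta> j then a j < ratio (fst z) (snd z) j else ratio (fst z) (snd z) j \<le> a j} \<in> sets (M \<Otimes>\<^sub>M U.S)"
  proof (rule sets.sets_Collect_countable_All)
    fix j
    note [measurable] = measurable_ratio[of j]
    have "{z \<in> space (M \<Otimes>\<^sub>M U.S). a j < ratio (fst z) (snd z) j} \<in> sets (M \<Otimes>\<^sub>M U.S)"
      "{z \<in> space (M \<Otimes>\<^sub>M U.S). ratio (fst z) (snd z) j \<le> a j} \<in> sets (M \<Otimes>\<^sub>M U.S)"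
      using borel_measurable_less[OF borel_measurable_const measurable_ratio[of j]]
        borel_measurable_le[OF measurable_ratio[of j] borel_measurable_const] by (auto simp: pred_def)
    then show "{z \<in> space (M \<Otimes>\<^sub>M U.S). j < k \<longrightarrow> (if \<theta> j then a j < ratio (fst z) (snd z) j else ratio (fst z) (snd z) j \<le> a j)} \<in> sets (M \<Otimes>\<^sub>M U.S)"
      by (cases "j < k"; cases "\<theta> j") simp_all
  qed
  show ?thesis unfolding event_def by (intro sets.sets_Collect_conj 1 2)
qed

text \<open>\<open>pattern_le\<close> treats strict inequalities. A closed condition is contained in
  the strict one with the threshold raised by \<open>1 / (i + 1)\<close>, and \<open>i\<close> tends
  to infinity.\<close>

lemma prob_event_le:
  assumes a: "\<And>j. 0 \<le> a j" "\<And>j. a j \<le> 1" and A: "A \<in> sets borel"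
  shows "measure (M \<Otimes>\<^sub>M U.S) (event k \<theta> a A) \<le> (\<Prod>j<k. if \<theta> j then 1 - a j else a j) * prob {\<omega> \<in> space M. B 1 \<omega> \<in> A}"
proof -
  have B1: "B 1 \<in> borel_measurable M" by (rule B_meas) simp
  have SA: "{\<omega> \<in> space M. B 1 \<omega> \<in> A} \<in> sets M"
    using measurable_sets[OF B1 A] by (simp add: vimage_def Int_def conj_commute)
  have PA: "(\<integral>\<^sup>+\<omega>. indicator A (B 1 \<omega>) \<partial>M) = ennreal (prob {\<omega> \<in> space M. B 1 \<omega> \<in> A})"
  proof -
    have "(\<integral>\<^sup>+\<omega>. indicator A (B 1 \<omega>) \<partial>M) = (\<integral>\<^sup>+\<omega>. indicator {\<omega> \<in> space M. B 1 \<omega> \<in> A} \<omega> \<partial>M)"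
      by (intro nn_integral_cong) (simp add: indicator_def)
    then show ?thesis using SA by (simp add: emeasure_eq_measure)
  qed
  define b where "b i j = (if \<theta> j then a j else a j + 1 / real (Suc i))" for i j
  have le: "measure (M \<Otimes>\<^sub>M U.S) (event k \<theta> a A) \<le>
      (\<Prod>j<k. if \<theta> j then 1 - a j else a j + 1 / real (Suc i)) * prob {\<omega> \<in> space M. B 1 \<omega> \<in> A}" for i
  proof -
    have "ennreal (measure (M \<Otimes>\<^sub>M U.S) (event k \<theta> a A)) = (\<integral>\<^sup>+z. indicator (event k \<theta> a A) z \<partial>(M \<Otimes>\<^sub>M U.S))"
      using sets_event[OF A] by (simp add: MU.emeasure_eq_measure)
    also have "\<dots> = (\<integral>\<^sup>+\<omega>. (\<integral>\<^sup>+u. indicator (event k \<theta> a A) (\<omega>, u) \<partial>U.S) \<partial>M)"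
      by (rule U.P.nn_integral_fst[symmetric]) (intro borel_measurable_indicator sets_event A)
    also have "\<dots> \<le> (\<integral>\<^sup>+\<omega>. (\<integral>\<^sup>+u. (if \<forall>j<k. if \<theta> j then b i j < ratio \<omega> u j else ratio \<omega> u j < b i j then 1 else 0) \<partial>U.S) *
      indicator A (B 1 \<omega>) \<partial>M)"
    proof (intro nn_integral_mono)
      fix \<omega>
      have le: "indicator (event k \<theta> a A) (\<omega>, u) \<le>
        (if \<forall>j<k. if \<theta> j then b i j < ratio \<omega> u j else ratio \<omega> u j < b i j then 1 else 0 :: ennreal)" for u
      proof (cases "(\<omega>, u) \<in> event k \<theta> a A")
        case True
        have p: "0 < 1 / real (Suc i)" by simp
        have "if \<theta> j then b i j < ratio \<omega> u j else ratio \<omega> u j < b i j" if "j < k" for j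
        proof (cases "\<theta> j")
          case False
          then have "ratio \<omega> u j \<le> a j" using True that unfolding event_def by auto
          then have "ratio \<omega> u j < a j + 1 / real (Suc i)" using p by linarith
          then show ?thesis using False by (simp only: b_def if_False)
        qed (use True that in \<open>auto simp: event_def b_def\<close>)
        then have "\<forall>j<k. if \<theta> j then b i j < ratio \<omega> u j else ratio \<omega> u j < b i j" by blast
        then have "(if \<forall>j<k. if \<theta> j then b i j < ratio \<omega> u j else ratio \<omega> u j < b i j then 1 else 0) = (1 :: ennreal)"
          by (rule if_P)
        moreover have "indicator (event k \<theta> a A) (\<omega>, u) \<le> (1 :: ennreal)" by (simp add: indicator_def)
        ultimately show ?thesis by (rule back_subst[of "\<lambda>y. _ \<le> y", OF _ sym, rotated])
      next
        case False
        then have "indicator (event k \<theta> a A) (\<omega>, u) = (0 :: ennreal)" by (simp add: indicator_def)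
        then show ?thesis by (rule ord_eq_le_trans) (rule zero_le)
      qed
      show "(\<integral>\<^sup>+u. indicator (event k \<theta> a A) (\<omega>, u) \<partial>U.S) \<le>
        (\<integral>\<^sup>+u. (if \<forall>j<k. if \<theta> j then b i j < ratio \<omega> u j else ratio \<omega> u j < b i j then 1 else 0) \<partial>U.S) * indicator A (B 1 \<omega>)"
      proof (cases "B 1 \<omega> \<in> A")
        case True
        then have 1: "indicator A (B 1 \<omega>) = (1 :: ennreal)" by simp
        show ?thesis unfolding 1 mult_1_right by (rule nn_integral_mono) (rule le)
      next
        case False
        then have "indicator (event k \<theta> a A) (\<omega>, u) = (0 :: ennreal)" for u
          by (simp add: event_def indicator_def)
        then have 0: "(\<integral>\<^sup>+u. indicator (event k \<theta> a A) (\<omega>, u) \<partial>U.S) = 0" by simp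
        show ?thesis unfolding 0 by (rule zero_le)
      qed
    qed
    also have "\<dots> \<le> ennreal (\<Prod>j<k. if \<theta> j then 1 - b i j else b i j) * (\<integral>\<^sup>+\<omega>. indicator A (B 1 \<omega>) \<partial>M)"
      by (rule pattern_le) (use a A in \<open>auto simp: b_def\<close>)
    also have "(\<Prod>j<k. if \<theta> j then 1 - b i j else b i j) = (\<Prod>j<k. if \<theta> j then 1 - a j else a j + 1 / real (Suc i))"
      by (intro prod.cong refl) (simp add: b_def)
    also have "ennreal (\<Prod>j<k. if \<theta> j then 1 - a j else a j + 1 / real (Suc i)) * (\<integral>\<^sup>+\<omega>. indicator A (B 1 \<omega>) \<partial>M) =
        ennreal ((\<Prod>j<k. if \<theta> j then 1 - a j else a j + 1 / real (Suc i)) * prob {\<omega> \<in> space M. B 1 \<omega> \<in> A})"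
      unfolding PA by (rule ennreal_mult[symmetric]) (use a in \<open>auto intro!: prod_nonneg\<close>)
    finally show ?thesis
      by (subst (asm) ennreal_le_iff) (use a in \<open>auto intro!: mult_nonneg_nonneg prod_nonneg\<close>)
  qed
  have "(\<lambda>i. (\<Prod>j<k. if \<theta> j then 1 - a j else a j + 1 / real (Suc i)) * prob {\<omega> \<in> space M. B 1 \<omega> \<in> A}) \<longlonglongrightarrow>
      (\<Prod>j<k. if \<theta> j then 1 - a j else a j) * prob {\<omega> \<in> space M. B 1 \<omega> \<in> A}"
  proof (intro tendsto_mult tendsto_prod tendsto_const)
    fix j
    have "(\<lambda>i. a j + inverse (real (Suc i))) \<longlonglongrightarrow> a j + 0"
      by (intro tendsto_intros LIMSEQ_inverse_real_of_nat)
    then show "(\<lambda>i. if \<theta> j then 1 - a j else a j + 1 / real (Suc i)) \<longlonglongrightarrow> (if \<theta> j then 1 - a j else a j)"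
      by (simp add: inverse_eq_divide)
  qed
  then show ?thesis by (rule LIMSEQ_le_const) (use le in auto)
qed

text \<open>
  Splitting according to one more ratio preserves both sides, so the upper bounds cannot be strict.
\<close>

theorem prob_event:
  assumes a: "\<And>j. 0 \<le> a j" "\<And>j. a j \<le> 1" and A: "A \<in> sets borel"
  shows "measure (M \<Otimes>\<^sub>M U.S) (event k \<theta> a A) = (\<Prod>j<k. if \<theta> j then 1 - a j else a j) * prob {\<omega> \<in> space M. B 1 \<omega> \<in> A}"
proof (induction k arbitrary: \<theta>)
  case 0
  have B1: "B 1 \<in> borel_measurable M" by (rule B_meas) simp
  have SA: "{\<omega> \<in> space M. B 1 \<omega> \<in> A} \<in> sets M"
    using measurable_sets[OF B1 A] by (simp add: vimage_def Int_def conj_commute)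
  have "event 0 \<theta> a A = {\<omega> \<in> space M. B 1 \<omega> \<in> A} \<times> space U.S"
    by (auto simp: event_def space_pair_measure)
  then have "emeasure (M \<Otimes>\<^sub>M U.S) (event 0 \<theta> a A) = emeasure M {\<omega> \<in> space M. B 1 \<omega> \<in> A} * emeasure U.S (space U.S)"
    by (simp only:) (rule U.P.emeasure_pair_measure_Times[OF SA sets.top])
  then show ?case by (simp add: U.P.emeasure_space_1[simplified] emeasure_eq_measure MU.emeasure_eq_measure)
next
  case (Suc k)
  let ?t = "\<theta>(k := True)" and ?f = "\<theta>(k := False)"
  let ?q = "\<Prod>j<k. if \<theta> j then 1 - a j else a j" and ?p = "prob {\<omega> \<in> space M. B 1 \<omega> \<in> A}"
  have cg: "(\<forall>j<k. if (\<theta>(k := c)) j then P j else Q j) \<longleftrightarrow> (\<forall>j<k. if \<theta> j then P j else Q j)" for P Q c by auto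
  have "event k \<theta> a A = event (Suc k) ?t a A \<union> event (Suc k) ?f a A"
    unfolding event_def All_less_Suc cg by (auto simp: not_less)
  moreover have "event (Suc k) ?t a A \<inter> event (Suc k) ?f a A = {}"
    unfolding event_def All_less_Suc cg by auto
  ultimately have sum: "measure (M \<Otimes>\<^sub>M U.S) (event k \<theta> a A) =
      measure (M \<Otimes>\<^sub>M U.S) (event (Suc k) ?t a A) + measure (M \<Otimes>\<^sub>M U.S) (event (Suc k) ?f a A)"
    using MU.finite_measure_Union[OF sets_event[OF A] sets_event[OF A]] by simp
  have qc: "(\<Prod>j<k. if (\<theta>(k := c)) j then 1 - a j else a j) = ?q" for c
    by (intro prod.cong refl) auto
  have t: "measure (M \<Otimes>\<^sub>M U.S) (event (Suc k) ?t a A) \<le> ?q * (1 - a k) * ?p"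
    using prob_event_le[OF a A, where k = "Suc k" and \<theta> = ?t] unfolding prod.lessThan_Suc qc by simp
  have f: "measure (M \<Otimes>\<^sub>M U.S) (event (Suc k) ?f a A) \<le> ?q * a k * ?p"
    using prob_event_le[OF a A, where k = "Suc k" and \<theta> = ?f] unfolding prod.lessThan_Suc qc by simp
  have tot: "?q * ?p = ?q * (1 - a k) * ?p + ?q * a k * ?p" by (simp add: algebra_simps)
  have "measure (M \<Otimes>\<^sub>M U.S) (event (Suc k) ?t a A) = ?q * (1 - a k) * ?p"
    "measure (M \<Otimes>\<^sub>M U.S) (event (Suc k) ?f a A) = ?q * a k * ?p"
    using sum t f tot unfolding Suc.IH by linarith+
  then show ?case
    using fun_upd_triv[of \<theta> k] by (cases "\<theta> k") (simp_all add: fun_upd_idem)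
qed

end

section \<open>Transfer to the given sample points\<close>

lemma restrict_UNIV_eq: "restrict f UNIV = f"
  by (simp add: restrict_def)

lemma emeasure_seq_atMost:
  assumes "finite K"
  shows "emeasure U.S {u. \<forall>j\<in>K. u j \<le> a j} = ennreal (\<Prod>j\<in>K. max 0 (min 1 (a j)))"
proof -
  have at: "emeasure unif {..x} = ennreal (max 0 (min 1 x))" for x
  proof -
    have "{0<..<1} \<inter> {..x} = (if x < 1 then {0<..x} else {0<..<1})" by auto
    then show ?thesis by (simp add: emeasure_unif max_def min_def)
  qed
  have "{u. \<forall>j\<in>K. u j \<le> a j} = prod_emb UNIV (\<lambda>_. unif) K (Pi\<^sub>E K (\<lambda>j. {..a j}))"
    by (auto simp: prod_emb_def PiE_iff)
  then have "emeasure U.S {u. \<forall>j\<in>K. u j \<le> a j} = (\<Prod>j\<in>K. emeasure unif {..a j})"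
    using assms by (simp only:) (rule U.emeasure_PiM_emb, auto)
  also have "\<dots> = ennreal (\<Prod>j\<in>K. max 0 (min 1 (a j)))"
    unfolding at by (rule prod_ennreal) simp
  finally show ?thesis .
qed

lemma sets_seq_atMost:
  "sets U.S = sigma_sets UNIV {{u. \<forall>j\<in>K. u j \<le> a j} | K a. finite (K :: nat set)}"
proof -
  let ?E = "range (\<lambda>x :: real. {..x})"
  have b: "sets unif = sets (sigma UNIV ?E)" unfolding sets_unif by (subst borel_eq_atMost) (rule refl)
  have cover: "\<exists>S\<subseteq>?E. countable S \<and> UNIV = \<Union>S"
  proof (intro exI conjI)
    show "range (\<lambda>n :: nat. {..real n}) \<subseteq> ?E" by auto
    show "(UNIV :: real set) = \<Union>(range (\<lambda>n :: nat. {..real n}))"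
      by (auto intro: real_arch_simple)
  qed simp
  have "sets U.S = sets (PiM UNIV (\<lambda>_ :: nat. sigma UNIV ?E))"
    by (rule sets_PiM_cong[OF refl b])
  also have "\<dots> = sets (sigma (\<Pi>\<^sub>E i\<in>(UNIV :: nat set). UNIV)
      {{f \<in> (\<Pi>\<^sub>E i\<in>(UNIV :: nat set). UNIV). \<forall>i\<in>j. f i \<in> A i} | A j. j \<in> {K. finite K} \<and> A \<in> Pi j (\<lambda>_. ?E)})"
    by (rule sets_PiM_sigma) (use cover in auto)
  also have "{{f \<in> (\<Pi>\<^sub>E i\<in>(UNIV :: nat set). (UNIV :: real set)). \<forall>i\<in>j. f i \<in> A i} | A j. j \<in> {K. finite K} \<and> A \<in> Pi j (\<lambda>_. ?E)} =
      {{u. \<forall>j\<in>K. u j \<le> a j} | K a. finite (K :: nat set)}" (is "?L = ?R")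
  proof (intro equalityI subsetI)
    fix X assume "X \<in> ?L"
    then obtain A j where X: "X = {f. \<forall>i\<in>j. f i \<in> A i}" and j: "finite j" "A \<in> Pi j (\<lambda>_. ?E)" by auto
    then have "\<forall>i\<in>j. \<exists>x. A i = {..x}" by (auto simp: Pi_iff)
    then obtain a where a: "\<forall>i\<in>j. A i = {..a i}" by metis
    then have "X = {u. \<forall>i\<in>j. u i \<le> a i}" unfolding X by auto
    then show "X \<in> ?R" using j(1) by blast
  next
    fix X assume "X \<in> ?R"
    then obtain K a where X: "X = {u. \<forall>j\<in>K. u j \<le> a j}" "finite K" by blast
    show "X \<in> ?L" unfolding mem_Collect_eq
      by (rule exI[of _ "\<lambda>i. {..a i}"], rule exI[of _ K]) (use X in auto)
  qed
  finally show ?thesis by simp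
qed

lemma Int_stable_seq_atMost:
  "Int_stable {{u :: nat \<Rightarrow> real. \<forall>j\<in>K. u j \<le> a j} | K a. finite (K :: nat set)}"
proof (rule Int_stableI)
  fix G H :: "(nat \<Rightarrow> real) set"
  assume "G \<in> {{u. \<forall>j\<in>K. u j \<le> a j} | K a. finite K}" "H \<in> {{u. \<forall>j\<in>K. u j \<le> a j} | K a. finite K}"
  then obtain K K' a a' where G: "G = {u. \<forall>j\<in>K. u j \<le> a j}" "finite K"
    and H: "H = {u. \<forall>j\<in>K'. u j \<le> a' j}" "finite K'" by blast
  let ?b = "\<lambda>j. if j \<in> K then if j \<in> K' then min (a j) (a' j) else a j else a' j"
  have b: "(j \<in> K \<union> K' \<longrightarrow> x \<le> ?b j) \<longleftrightarrow> (j \<in> K \<longrightarrow> x \<le> a j) \<and> (j \<in> K' \<longrightarrow> x \<le> a' j)" for j x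
    by simp
  have "G \<inter> H = {u. \<forall>j\<in>K \<union> K'. u j \<le> ?b j}"
    unfolding G(1) H(1) Ball_def b by blast
  with finite_UnI[OF G(2) H(2)]
  have "G \<inter> H = {u. \<forall>j\<in>K \<union> K'. u j \<le> ?b j} \<and> finite (K \<union> K')" by (rule conjI[rotated])
  then show "G \<inter> H \<in> {{u. \<forall>j\<in>K. u j \<le> a j} | K a. finite K}"
    unfolding mem_Collect_eq by - (rule exI[of _ "K \<union> K'"], rule exI[of _ ?b], assumption)
qed

text \<open>As functions of \<open>C\<close>, both sides are finite measures, so it suffices to
  compare them on boxes, a generator closed under intersection. The law is given for thresholds in
  the unit interval only; it implies that on the event \<open>Z \<omega> \<in> A\<close> almost
  surely all \<open>Y j\<close> are positive and at most 1, so that arbitrary thresholds can be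
  clipped.\<close>

lemma (in prob_space) prob_seq_mem:
  assumes Y: "\<And>j. Y j \<in> borel_measurable M" and Z: "Z \<in> borel_measurable M"
    and law: "\<And>k a. (\<And>j. 0 \<le> a j) \<Longrightarrow> (\<And>j. a j \<le> 1) \<Longrightarrow>
      prob {\<omega> \<in> space M. (\<forall>j<k. Y j \<omega> \<le> a j) \<and> Z \<omega> \<in> A} = (\<Prod>j<k. a j) * prob {\<omega> \<in> space M. Z \<omega> \<in> A}"
    and A: "A \<in> sets borel" and C: "C \<in> sets U.S"
  shows "prob {\<omega> \<in> space M. (\<lambda>j. Y j \<omega>) \<in> C \<and> Z \<omega> \<in> A} = measure U.S C * prob {\<omega> \<in> space M. Z \<omega> \<in> A}"
proof -
  let ?p = "prob {\<omega> \<in> space M. Z \<omega> \<in> A}"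
  note [measurable] = Y Z A
  have ZA: "{\<omega> \<in> space M. Z \<omega> \<in> A} \<in> sets M" by measurable
  have Yb: "{\<omega> \<in> space M. (\<forall>j<k. Y j \<omega> \<le> b j) \<and> Z \<omega> \<in> A} \<in> sets M" for k :: nat and b by measurable
  have Ym: "(\<lambda>\<omega> j. Y j \<omega>) \<in> measurable M U.S" by (rule measurable_seqI) (rule Y)
  \<comment> \<open>Restriction to the event rather than conditioning on it, so that an event of
    probability 0 is no exception.\<close>
  define P where "P = distr (density M (indicator {\<omega> \<in> space M. Z \<omega> \<in> A})) U.S (\<lambda>\<omega> j. Y j \<omega>)"
  have P: "emeasure P D = ennreal (prob {\<omega> \<in> space M. (\<lambda>j. Y j \<omega>) \<in> D \<and> Z \<omega> \<in> A})" if "D \<in> sets U.S" for D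
  proof -
    have "{\<omega> \<in> space M. Z \<omega> \<in> A} \<inter> ((\<lambda>\<omega> j. Y j \<omega>) -` D \<inter> space M) = {\<omega> \<in> space M. (\<lambda>j. Y j \<omega>) \<in> D \<and> Z \<omega> \<in> A}"
      by auto
    then show ?thesis
      using emeasure_restricted[OF ZA measurable_sets[OF Ym that]]
      by (simp add: P_def emeasure_distr Ym that emeasure_eq_measure)
  qed
  have sub: "prob (G \<union> H) \<le> prob G + prob H" if "G \<in> events" "H \<in> events" for G H
    by (rule measure_subadditive[OF that]) simp_all
  have in01: "prob {\<omega> \<in> space M. 0 < Y i \<omega> \<and> Y i \<omega> \<le> 1 \<and> Z \<omega> \<in> A} = ?p" for i
  proof -
    \<comment> \<open>Thresholds 1 throughout show that the coordinates are at most 1; lowering the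
      one at \<open>i\<close> to 0 shows that \<open>Y i\<close> is positive, almost surely on the
      event.\<close>
    have 1: "prob {\<omega> \<in> space M. (\<forall>j<Suc i. Y j \<omega> \<le> 1) \<and> Z \<omega> \<in> A} = ?p"
      using law[of "\<lambda>_. 1" "Suc i"] by simp
    have "(\<Prod>j<Suc i. if j = i then 0 else 1 :: real) = 0" by simp
    with law[of "\<lambda>j. if j = i then 0 else 1" "Suc i"]
    have 0: "prob {\<omega> \<in> space M. (\<forall>j<Suc i. Y j \<omega> \<le> (if j = i then 0 else 1)) \<and> Z \<omega> \<in> A} = 0" by simp
    have "prob {\<omega> \<in> space M. (\<forall>j<Suc i. Y j \<omega> \<le> 1) \<and> Z \<omega> \<in> A} \<le>
        prob ({\<omega> \<in> space M. 0 < Y i \<omega> \<and> Y i \<omega> \<le> 1 \<and> Z \<omega> \<in> A} \<union>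
          {\<omega> \<in> space M. (\<forall>j<Suc i. Y j \<omega> \<le> (if j = i then 0 else 1)) \<and> Z \<omega> \<in> A})"
      by (rule finite_measure_mono) (auto simp: not_less intro!: Yb)
    also have "\<dots> \<le> prob {\<omega> \<in> space M. 0 < Y i \<omega> \<and> Y i \<omega> \<le> 1 \<and> Z \<omega> \<in> A} +
        prob {\<omega> \<in> space M. (\<forall>j<Suc i. Y j \<omega> \<le> (if j = i then 0 else 1)) \<and> Z \<omega> \<in> A}"
      by (rule sub[OF _ Yb]) measurable
    finally have "?p \<le> prob {\<omega> \<in> space M. 0 < Y i \<omega> \<and> Y i \<omega> \<le> 1 \<and> Z \<omega> \<in> A}"
      unfolding 0 1 by simp
    moreover have "prob {\<omega> \<in> space M. 0 < Y i \<omega> \<and> Y i \<omega> \<le> 1 \<and> Z \<omega> \<in> A} \<le> ?p"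
      by (rule finite_measure_mono) auto
    ultimately show ?thesis by simp
  qed
  have AE01: "AE \<omega> in M. Z \<omega> \<in> A \<longrightarrow> (\<forall>i. 0 < Y i \<omega> \<and> Y i \<omega> \<le> 1)"
  proof -
    have "AE \<omega> in M. Z \<omega> \<in> A \<longrightarrow> 0 < Y i \<omega> \<and> Y i \<omega> \<le> 1" for i
    proof -
      have "prob ({\<omega> \<in> space M. Z \<omega> \<in> A} - {\<omega> \<in> space M. 0 < Y i \<omega> \<and> Y i \<omega> \<le> 1 \<and> Z \<omega> \<in> A}) = 0"
        using in01[of i] by (subst finite_measure_Diff) auto
      then show ?thesis
        by (intro AE_I[of _ _ "{\<omega> \<in> space M. Z \<omega> \<in> A} - {\<omega> \<in> space M. 0 < Y i \<omega> \<and> Y i \<omega> \<le> 1 \<and> Z \<omega> \<in> A}"])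
          (auto simp: emeasure_eq_measure)
    qed
    then have "AE \<omega> in M. \<forall>i. Z \<omega> \<in> A \<longrightarrow> 0 < Y i \<omega> \<and> Y i \<omega> \<le> 1" unfolding AE_all_countable by blast
    then show ?thesis by eventually_elim auto
  qed
  have box: "prob {\<omega> \<in> space M. (\<lambda>j. Y j \<omega>) \<in> {u. \<forall>j\<in>K. u j \<le> a j} \<and> Z \<omega> \<in> A} =
      (\<Prod>j\<in>K. max 0 (min 1 (a j))) * ?p" if K: "finite K" for K a
  proof -
    obtain k where k: "K \<subseteq> {..<k}" using finite_nat_iff_bounded K by blast
    \<comment> \<open>Coordinates outside \<open>K\<close> get the threshold 1, which is almost
      surely met.\<close>
    define b where "b j = (if j \<in> K then max 0 (min 1 (a j)) else 1)" for j
    have "prob {\<omega> \<in> space M. (\<lambda>j. Y j \<omega>) \<in> {u. \<forall>j\<in>K. u j \<le> a j} \<and> Z \<omega> \<in> A} =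
        prob {\<omega> \<in> space M. (\<forall>j<k. Y j \<omega> \<le> b j) \<and> Z \<omega> \<in> A}"
    proof (rule finite_measure_eq_AE)
      show "AE \<omega> in M. (\<omega> \<in> {\<omega> \<in> space M. (\<lambda>j. Y j \<omega>) \<in> {u. \<forall>j\<in>K. u j \<le> a j} \<and> Z \<omega> \<in> A}) =
          (\<omega> \<in> {\<omega> \<in> space M. (\<forall>j<k. Y j \<omega> \<le> b j) \<and> Z \<omega> \<in> A})"
        using AE01
      proof eventually_elim
        case (elim \<omega>)
        have "(\<forall>j\<in>K. Y j \<omega> \<le> a j) \<longleftrightarrow> (\<forall>j<k. Y j \<omega> \<le> b j)" if "Z \<omega> \<in> A"
        proof -
          have *: "0 < Y j \<omega>" "Y j \<omega> \<le> 1" for j using elim that by auto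
          have "Y j \<omega> \<le> max 0 (min 1 (a j)) \<longleftrightarrow> Y j \<omega> \<le> a j" for j
            using *[of j] by (auto simp: max_def min_def)
          then show ?thesis using k *(2) unfolding b_def by auto
        qed
        then show ?case by auto
      qed
      have "{u. \<forall>j\<in>K. u j \<le> a j} \<in> sets U.S" using K unfolding sets_seq_atMost by blast
      from sets.Int[OF measurable_sets[OF Ym this] ZA]
      show "{\<omega> \<in> space M. (\<lambda>j. Y j \<omega>) \<in> {u. \<forall>j\<in>K. u j \<le> a j} \<and> Z \<omega> \<in> A} \<in> sets M"
        by (rule back_subst[of "\<lambda>D. D \<in> sets M"]) auto
      show "{\<omega> \<in> space M. (\<forall>j<k. Y j \<omega> \<le> b j) \<and> Z \<omega> \<in> A} \<in> sets M" by (rule Yb)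
    qed
    also have "\<dots> = (\<Prod>j<k. b j) * ?p" by (rule law) (auto simp: b_def)
    also have "(\<Prod>j<k. b j) = (\<Prod>j\<in>K. max 0 (min 1 (a j)))"
      by (rule prod.mono_neutral_cong_right) (use k in \<open>auto simp: b_def\<close>)
    finally show ?thesis .
  qed
  have "P = scale_measure (ennreal ?p) U.S"
  proof (rule measure_eqI_generator_eq[OF Int_stable_seq_atMost, of UNIV])
    fix X :: "(nat \<Rightarrow> real) set" assume "X \<in> {{u. \<forall>j\<in>K. u j \<le> a j} | K a. finite K}"
    then obtain K a where X: "X = {u. \<forall>j\<in>K. u j \<le> a j}" and K: "finite K" by blast
    then have XS: "X \<in> sets U.S" unfolding sets_seq_atMost by blast
    have "emeasure P X = ennreal ((\<Prod>j\<in>K. max 0 (min 1 (a j))) * ?p)"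
      unfolding P[OF XS] unfolding X box[OF K] ..
    then show "emeasure P X = emeasure (scale_measure (ennreal ?p) U.S) X"
      unfolding emeasure_scale_measure X emeasure_seq_atMost[OF K]
      by (simp add: ennreal_mult'' mult.commute prod_nonneg)
  next
    show "range (\<lambda>_ :: nat. UNIV) \<subseteq> {{u :: nat \<Rightarrow> real. \<forall>j\<in>K. u j \<le> a j} | K a. finite K}"
      by (auto intro!: exI[of _ "{}"])
    show "emeasure P UNIV \<noteq> \<infinity>" using P[OF sets.top] by simp
  qed (auto simp: P_def sets_seq_atMost)
  then have "emeasure P C = ennreal ?p * emeasure U.S C" by simp
  then show ?thesis
    unfolding P[OF C] U.P.emeasure_eq_measure by (simp add: ennreal_mult''[symmetric] mult.commute)
qed

context brownian
begin

text \<open>The identity \<open>prob_event\<close> on the product space is carried to the given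
  space: path and sample points have the product of their laws as joint law.\<close>

lemma prob_ratio_le:
  assumes Y: "indep_vars (\<lambda>_. borel) Y UNIV" "\<And>i. distr M borel (Y i) = unif"
    and indep: "indep_rv M (PiM UNIV (\<lambda>_. borel)) (\<lambda>\<omega>. \<lambda>i\<in>UNIV. Y i \<omega>)
      (PiM {0..1} (\<lambda>_. borel)) (\<lambda>\<omega>. \<lambda>t\<in>{0..1}. B t \<omega>)"
    and a: "\<And>j. 0 \<le> a j" "\<And>j. a j \<le> 1" and A: "A \<in> sets borel"
  shows "prob {\<omega> \<in> space M. (\<forall>j<k. ratio \<omega> (\<lambda>i. Y i \<omega>) j \<le> a j) \<and> B 1 \<omega> \<in> A} =
    (\<Prod>j<k. a j) * prob {\<omega> \<in> space M. B 1 \<omega> \<in> A}"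
proof -
  let ?X = "\<lambda>\<omega>. \<lambda>t\<in>{0..1}. B t \<omega>" and ?Y = "\<lambda>\<omega> i. Y i \<omega>"
  let ?\<Pi> = "PiM {0..1} (\<lambda>_. borel) :: (real \<Rightarrow> real) measure"
  have S: "sets (PiM UNIV (\<lambda>_. borel)) = sets U.S" by (rule sets_PiM_cong) simp_all
  have rv: "random_variable borel (Y i)" for i using Y(1) by (simp add: indep_vars_def)
  have Ym: "?Y \<in> measurable M U.S" by (rule measurable_seqI) (rule rv)
  have lawY: "distr M U.S ?Y = U.S"
  proof -
    have "distr M (PiM UNIV (\<lambda>_. borel)) (\<lambda>\<omega>. \<lambda>i\<in>UNIV. Y i \<omega>) = PiM UNIV (\<lambda>i. distr M borel (Y i))"
      using indep_vars_iff_distr_eq_PiM[of UNIV Y "\<lambda>_. borel"] rv Y(1) by simp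
    moreover have "distr M (PiM UNIV (\<lambda>_. borel)) (\<lambda>\<omega>. \<lambda>i\<in>UNIV. Y i \<omega>) = distr M U.S ?Y"
      by (rule distr_cong) (simp_all add: S restrict_def)
    ultimately show ?thesis by (simp add: Y(2))
  qed
  have Xm: "?X \<in> measurable M ?\<Pi>" using indep by (simp add: indep_rv_def)
  \<comment> \<open>\<open>Y\<close> is independent only of the restriction of \<open>B\<close> to \<open>{0..1}\<close>, hence of \<open>N\<close> but perhaps not of \<open>sets M\<close>.\<close>
  define N where "N = vimage_algebra (space M) ?X ?\<Pi>"
  have spN: "space N = space M" by (simp add: N_def)
  have XN: "?X \<in> measurable N ?\<Pi>" unfolding N_def
    by (rule measurable_vimage_algebra1) (use measurable_space[OF Xm] in blast)
  have setsN: "sets N = {?X -` D \<inter> space M | D. D \<in> sets ?\<Pi>}" unfolding N_def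
    by (rule sets_vimage_algebra2) (use measurable_space[OF Xm] in blast)
  have idm: "(\<lambda>\<omega>. \<omega>) \<in> measurable M N"
    unfolding N_def by (rule measurable_vimage_algebra2[OF _ Xm]) simp
  define M1 where "M1 = distr M N (\<lambda>\<omega>. \<omega>)"
  have M1: "sets M1 = sets N" "space M1 = space M" by (simp_all add: M1_def spN)
  interpret M1: prob_space M1 unfolding M1_def by (rule prob_space_distr[OF idm])
  have BM1: "B t \<in> borel_measurable M1" if "t \<in> {0..1}" for t
  proof -
    have "(\<lambda>\<omega>. ?X \<omega> t) \<in> borel_measurable N"
      by (rule measurable_compose[OF XN measurable_component_singleton]) (rule that)
    then have "B t \<in> borel_measurable N" using that by simp
    then show ?thesis using M1(1) by (simp cong: measurable_cong_sets)
  qed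
  interpret R1: random_path M1 "\<lambda>\<omega> t. B t \<omega>"
    by unfold_locales (use B_cont BM1 M1(2) in auto)
  interpret R: random_path "M1 \<Otimes>\<^sub>M U.S" "\<lambda>z t. B t (fst z)" by (rule R1.random_path_compose) simp
  have rm: "(\<lambda>z. ratio (fst z) (snd z) j) \<in> borel_measurable (M1 \<Otimes>\<^sub>M U.S)" for j
    by (rule R.measurable_stick_ratio) (rule measurable_compose[OF measurable_snd measurable_seq_coord])
  have B1m: "(\<lambda>z. B 1 (fst z)) \<in> borel_measurable (M1 \<Otimes>\<^sub>M U.S)"
    by (rule measurable_compose[OF measurable_fst BM1]) simp
  define E where "E = {z \<in> space (M1 \<Otimes>\<^sub>M U.S). (\<forall>j<k. ratio (fst z) (snd z) j \<le> a j) \<and> B 1 (fst z) \<in> A}"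
  have E: "E \<in> sets (M1 \<Otimes>\<^sub>M U.S)"
  proof -
    note [measurable] = rm B1m A
    show ?thesis unfolding E_def by measurable
  qed
  \<comment> \<open>As a set, the event is the same over \<open>M1\<close> and over
    \<open>M\<close>; over \<open>M1\<close> it is moreover measurable with respect to the path and
    the sample points alone.\<close>
  have Eev: "E = event k (\<lambda>_. False) a A"
    unfolding E_def event_def by (simp add: space_pair_measure M1(2))
  have idm1: "(\<lambda>\<omega>. \<omega>) \<in> measurable M M1" using idm by (simp add: M1_def)
  have pm: "(\<lambda>\<omega>. (\<omega>, ?Y \<omega>)) \<in> measurable M (M1 \<Otimes>\<^sub>M U.S)" by (rule measurable_Pair[OF idm1 Ym])
  \<comment> \<open>On rectangles this is the assumed independence, since the sets of
    \<open>M1\<close> are the events determined by the path on the unit interval.\<close>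
  have joint: "M1 \<Otimes>\<^sub>M U.S = distr M (M1 \<Otimes>\<^sub>M U.S) (\<lambda>\<omega>. (\<omega>, ?Y \<omega>))"
  proof (rule pair_measure_eqI)
    fix G C assume G: "G \<in> sets M1" and C: "C \<in> sets U.S"
    obtain D where D: "G = ?X -` D \<inter> space M" "D \<in> sets ?\<Pi>" using G M1(1) setsN by blast
    have "prob ((?Y -` C \<inter> space M) \<inter> (?X -` D \<inter> space M)) = prob (?Y -` C \<inter> space M) * prob (?X -` D \<inter> space M)"
      by (rule indep_setD) (use indep C D S in \<open>auto simp: indep_rv_def restrict_UNIV_eq\<close>)
    then have "prob ((?Y -` C \<inter> space M) \<inter> G) = prob (?Y -` C \<inter> space M) * prob G" unfolding D(1) .
    moreover have "measure U.S C = prob (?Y -` C \<inter> space M)"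
      by (subst lawY[symmetric]) (rule measure_distr[OF Ym C])
    moreover have "(\<lambda>\<omega>. (\<omega>, ?Y \<omega>)) -` (G \<times> C) \<inter> space M = (?Y -` C \<inter> space M) \<inter> G"
      using D(1) by auto
    moreover have "emeasure M1 G = emeasure M G"
      using G M1(1) D(1) by (simp add: M1_def emeasure_distr[OF idm] Int_absorb2)
    moreover have "G \<times> C \<in> sets (M1 \<Otimes>\<^sub>M U.S)" using G C by simp
    ultimately show "emeasure M1 G * emeasure U.S C = emeasure (distr M (M1 \<Otimes>\<^sub>M U.S) (\<lambda>\<omega>. (\<omega>, ?Y \<omega>))) (G \<times> C)"
      by (simp add: emeasure_distr[OF pm] emeasure_eq_measure U.P.emeasure_eq_measure ennreal_mult''[symmetric] mult.commute)
  qed (simp_all add: M1.sigma_finite_measure_axioms U.P.sigma_finite_measure_axioms)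
  have sp: "space (M1 \<Otimes>\<^sub>M U.S) = space M \<times> UNIV" by (simp add: space_pair_measure M1(2))
  have "{\<omega> \<in> space M. (\<forall>j<k. ratio \<omega> (\<lambda>i. Y i \<omega>) j \<le> a j) \<and> B 1 \<omega> \<in> A} =
      (\<lambda>\<omega>. (\<omega>, ?Y \<omega>)) -` E \<inter> space M"
    unfolding E_def sp set_eq_iff vimage_eq Int_iff mem_Collect_eq mem_Times_iff fst_conv snd_conv by blast
  then have "emeasure M {\<omega> \<in> space M. (\<forall>j<k. ratio \<omega> (\<lambda>i. Y i \<omega>) j \<le> a j) \<and> B 1 \<omega> \<in> A} =
      emeasure (distr M (M1 \<Otimes>\<^sub>M U.S) (\<lambda>\<omega>. (\<omega>, ?Y \<omega>))) E"
    unfolding emeasure_distr[OF pm E] by (rule arg_cong)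
  also have "\<dots> = emeasure (M1 \<Otimes>\<^sub>M U.S) E" by (simp only: joint[symmetric])
  also have "\<dots> = (\<integral>\<^sup>+\<omega>. emeasure U.S (Pair \<omega> -` E) \<partial>M1)"
    by (rule U.P.emeasure_pair_measure_alt[OF E])
  \<comment> \<open>The section probabilities are measurable over \<open>N\<close>, so integrating
    them over the image measure \<open>M1\<close> or over \<open>M\<close> gives the same
    value.\<close>
  also have "\<dots> = (\<integral>\<^sup>+\<omega>. emeasure U.S (Pair \<omega> -` E) \<partial>M)"
    unfolding M1_def
    by (rule nn_integral_distr[OF idm])
      (use U.P.measurable_emeasure_Pair[OF E] M1(1) in \<open>simp cong: measurable_cong_sets\<close>)
  also have "\<dots> = emeasure (M \<Otimes>\<^sub>M U.S) E"
    unfolding Eev by (rule U.P.emeasure_pair_measure_alt[OF sets_event[OF A], symmetric])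
  finally have "prob {\<omega> \<in> space M. (\<forall>j<k. ratio \<omega> (\<lambda>i. Y i \<omega>) j \<le> a j) \<and> B 1 \<omega> \<in> A} =
      measure (M \<Otimes>\<^sub>M U.S) (event k (\<lambda>_. False) a A)"
    unfolding Eev by (simp add: measure_def)
  then show ?thesis using prob_event[OF a A, of k "\<lambda>_. False"] by simp
qed

end

theorem corollary2:
  fixes M :: "'a measure"
    and B :: "real \<Rightarrow> 'a \<Rightarrow> real"
    and U :: "nat \<Rightarrow> 'a \<Rightarrow> real"
    and L :: "nat \<Rightarrow> 'a \<Rightarrow> real"
    and W :: "nat \<Rightarrow> 'a \<Rightarrow> real"
  assumes "prob_space M"
    and "standard_brownian_motion M B"
    and "prob_space.indep_vars M (\<lambda>_. borel) U UNIV"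
    and "\<And>i. distr M borel (U i) = uniform_measure lborel {0<..<1}"
    and "indep_rv M
      (PiM UNIV (\<lambda>_. borel)) (\<lambda>\<omega>. \<lambda>i\<in>UNIV. U i \<omega>)
      (PiM {0..1} (\<lambda>_. borel)) (\<lambda>\<omega>. \<lambda>t\<in>{0..1}. B t \<omega>)"
    and L_def: "\<And>n \<omega>. L n \<omega> =
      size_biased_length
        (vertex_times (least_concave_majorant {0..1} (\<lambda>t. B t \<omega>))) (\<lambda>i. U i \<omega>) n"
    and W_def: "\<And>n \<omega>. W n \<omega> = L n \<omega> / (1 - (\<Sum>k<n. L k \<omega>))"
  shows "prob_space.indep_vars M (\<lambda>_. borel) W UNIV \<and>
    (\<forall>n. distr M borel (W n) = uniform_measure lborel {0<..<1}) \<and>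
    indep_rv M
      (PiM UNIV (\<lambda>_. borel)) (\<lambda>\<omega>. \<lambda>n\<in>UNIV. W n \<omega>)
      borel (B 1)"
proof -
  interpret brownian M B
    using assms(1,2) by (simp add: brownian_def brownian_axioms_def)
  have W: "W n \<omega> = ratio \<omega> (\<lambda>i. U i \<omega>) n" for n \<omega>
    by (simp only: W_def L_def stick_ratio_def)
  have Um: "random_variable borel (U i)" for i using assms(3) by (simp add: indep_vars_def)
  have Wm: "random_variable borel (W n)" for n
    unfolding W using measurable_stick_ratio[of "\<lambda>\<omega> i. U i \<omega>" n] Um by simp
  have B1: "random_variable borel (B 1)" by (rule B_meas) simp
  \<comment> \<open>All three claims are read off this joint law: \<open>A = UNIV\<close> gives the
    law of the whole sequence, and the product form is its independence of
    \<open>B 1\<close>.\<close>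
  have law: "prob {\<omega> \<in> space M. (\<lambda>n. W n \<omega>) \<in> C \<and> B 1 \<omega> \<in> A} = measure U.S C * prob {\<omega> \<in> space M. B 1 \<omega> \<in> A}"
    if "C \<in> sets U.S" "A \<in> sets borel" for C A
    by (rule prob_seq_mem[OF Wm B1 _ that(2,1)], unfold W, rule prob_ratio_le)
      (use assms(3-5) that in \<open>simp_all add: unif_def\<close>)
  have S: "sets (PiM UNIV (\<lambda>_. borel)) = sets U.S" by (rule sets_PiM_cong) simp_all
  have Wseq: "(\<lambda>\<omega> n. W n \<omega>) \<in> measurable M U.S" by (rule measurable_seqI) (rule Wm)
  have lawW: "prob ((\<lambda>\<omega> n. W n \<omega>) -` C \<inter> space M) = measure U.S C" if "C \<in> sets U.S" for C
    using law[OF that, of UNIV] by (simp add: prob_space vimage_def Int_def conj_commute)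
  have distW: "distr M U.S (\<lambda>\<omega> n. W n \<omega>) = U.S"
    by (rule measure_eqI) (simp_all add: emeasure_distr[OF Wseq] emeasure_eq_measure U.P.emeasure_eq_measure lawW)
  have unifW: "distr M borel (W n) = unif" for n
  proof -
    have "distr M borel (W n) = distr (distr M U.S (\<lambda>\<omega> n. W n \<omega>)) borel (\<lambda>u. u n)"
      by (subst distr_distr[OF measurable_seq_coord Wseq]) (simp add: o_def)
    also have "\<dots> = distr U.S unif (\<lambda>u. u n)" unfolding distW by (rule distr_cong) simp_all
    also have "\<dots> = unif" by (rule U.PiM_component) simp
    finally show ?thesis .
  qed
  have "indep_vars (\<lambda>_. borel) W UNIV"
  proof -
    have "distr M (PiM UNIV (\<lambda>_. borel)) (\<lambda>\<omega>. \<lambda>n\<in>UNIV. W n \<omega>) = distr M U.S (\<lambda>\<omega> n. W n \<omega>)"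
      by (rule distr_cong) (simp_all add: S restrict_def)
    then show ?thesis
      using indep_vars_iff_distr_eq_PiM[of UNIV W "\<lambda>_. borel"] Wm distW by (simp add: unifW)
  qed
  moreover have "indep_rv M (PiM UNIV (\<lambda>_. borel)) (\<lambda>\<omega>. \<lambda>n\<in>UNIV. W n \<omega>) borel (B 1)"
    unfolding indep_rv_def indep_sets2_eq
  proof (intro conjI ballI)
    show "(\<lambda>\<omega>. \<lambda>n\<in>UNIV. W n \<omega>) \<in> measurable M (PiM UNIV (\<lambda>_. borel))"
      using Wseq by (simp add: measurable_cong_sets[OF refl S])
    then show "{(\<lambda>\<omega>. \<lambda>n\<in>UNIV. W n \<omega>) -` C \<inter> space M | C. C \<in> sets (PiM UNIV (\<lambda>_. borel))} \<subseteq> events"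
      by (auto intro: measurable_sets)
    show "{B 1 -` A \<inter> space M | A. A \<in> sets borel} \<subseteq> events" using B1 by (auto intro: measurable_sets)
    fix G H
    assume "G \<in> {(\<lambda>\<omega>. \<lambda>n\<in>UNIV. W n \<omega>) -` C \<inter> space M | C. C \<in> sets (PiM UNIV (\<lambda>_. borel))}"
      and "H \<in> {B 1 -` A \<inter> space M | A. A \<in> sets borel}"
    then obtain C A where G: "G = (\<lambda>\<omega> n. W n \<omega>) -` C \<inter> space M" "C \<in> sets U.S"
      and H: "H = B 1 -` A \<inter> space M" "A \<in> sets borel" unfolding S restrict_UNIV_eq by blast
    have "G \<inter> H = {\<omega> \<in> space M. (\<lambda>n. W n \<omega>) \<in> C \<and> B 1 \<omega> \<in> A}" "H = {\<omega> \<in> space M. B 1 \<omega> \<in> A}"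
      unfolding G H by auto
    then show "prob (G \<inter> H) = prob G * prob H"
      using law[OF G(2) H(2)] lawW[OF G(2)] G(1) by simp
  qed (rule B1)
  ultimately show ?thesis using unifW by (simp add: unif_def)
qed

end
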